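(* Let $\theta_1,\theta_2\in[0,1]$ with $\theta_1+\theta_2=1$, $N>0$, and $g_1,g_2\in L^\infty(0,\infty;H)$. For every $(v_0^1,v_0^2)\in V\times V$ there exists a unique pair $(v_1,v_2)$ with $v_1,v_2\in C([0,T];V)\cap L^2(0,T;D(A))$ for all $T>0$, satisfying $$\begin{aligned}\partial_tv_1+\nu Av_1+B(v_1,v_1)&=g_1+\theta_1\big(P_NB(v_1,v_1)-P_NB(v_2,v_2)\big),\\ \partial_tv_2+\nu Av_2+B(v_2,v_2)&=g_2+\theta_2\big(P_NB(v_2,v_2)-P_NB(v_1,v_1)\big),\end{aligned}$$ and $v_j(0)=v_0^j$, $j=1,2$.
   Context: Let $\Omega=[0,2\pi]^2$ with periodic boundary conditions. $H$ is the space of $2\pi$-periodic, divergence-free, mean-free vector fields in $L^2(\Omega)^2$, with inner product $(u,v)=\int_\Omega u\cdot v\,dx$ and norm $|u|=(u,u)^{1/2}$; $V$ is the subspace of $H$ consisting of fields in $H^1$, with norm $\|u\|=|\nabla u|$. $\mathbb P$ is the Leray projection, $A=-\mathbb P\Delta$ is the Stokes operator with domain $D(A)$, and $B(u,v)=\mathbb P((u\cdot\nabla)v)$. For real $N>0$, $P_N$ is the orthogonal projection onto the Fourier modes with wavenumbers $k\in\mathbb Z^2\setminus\{0\}$, $|k|\le N$. $\nu>0$ is the viscosity. *)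

theory Defs
  imports "HOL-Analysis.Analysis"
begin

text \<open>Fourier representation on the torus [0,2pi]^2: a (complex-valued) vector field
  u(x) = sum over k in Z^2 of uhat(k) e^{i k.x} is represented by its coefficient map
  uhat :: int x int => complex x complex. Real-valuedness is conjugate symmetry.\<close>

type_synonym cvec = "complex \<times> complex"
type_synonym fld = "int \<times> int \<Rightarrow> cvec"

definition wdot :: "int \<times> int \<Rightarrow> cvec \<Rightarrow> complex" where
  "wdot k a = of_int (fst k) * fst a + of_int (snd k) * snd a"

definition wnorm2 :: "int \<times> int \<Rightarrow> real" where
  "wnorm2 k = (real_of_int (fst k))^2 + (real_of_int (snd k))^2"

definition cnorm2 :: "cvec \<Rightarrow> real" where
  "cnorm2 a = (cmod (fst a))^2 + (cmod (snd a))^2"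

definition cconj :: "cvec \<Rightarrow> cvec" where
  "cconj a = (cnj (fst a), cnj (snd a))"

definition smulc :: "complex \<Rightarrow> cvec \<Rightarrow> cvec" where
  "smulc c a = (c * fst a, c * snd a)"

text \<open>The space H: real, mean-free, divergence-free, square integrable.\<close>
definition inH :: "fld \<Rightarrow> bool" where
  "inH u \<longleftrightarrow> u (0,0) = (0,0) \<and> (\<forall>k. wdot k (u k) = 0)
     \<and> (\<forall>k. u (- fst k, - snd k) = cconj (u k))
     \<and> (\<lambda>k. cnorm2 (u k)) summable_on UNIV"

text \<open>|u|^2 = integral of |u|^2 over [0,2pi]^2 (Parseval).\<close>
definition Hnorm2 :: "fld \<Rightarrow> real" where
  "Hnorm2 u = (2*pi)^2 * infsum (\<lambda>k. cnorm2 (u k)) UNIV"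

definition inV :: "fld \<Rightarrow> bool" where
  "inV u \<longleftrightarrow> inH u \<and> (\<lambda>k. wnorm2 k * cnorm2 (u k)) summable_on UNIV"

text \<open>||u||^2 = |grad u|^2.\<close>
definition Vnorm2 :: "fld \<Rightarrow> real" where
  "Vnorm2 u = (2*pi)^2 * infsum (\<lambda>k. wnorm2 k * cnorm2 (u k)) UNIV"

definition inDA :: "fld \<Rightarrow> bool" where
  "inDA u \<longleftrightarrow> inH u \<and> (\<lambda>k. (wnorm2 k)^2 * cnorm2 (u k)) summable_on UNIV"

definition lap :: "fld \<Rightarrow> fld" where
  "lap u = (\<lambda>k. (- wnorm2 k) *\<^sub>R u k)"

definition leray :: "fld \<Rightarrow> fld" where
  "leray w = (\<lambda>k. if k = (0,0) then (0,0)
      else w k - smulc (wdot k (w k) / of_real (wnorm2 k)) (of_int (fst k), of_int (snd k)))"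

definition stokesA :: "fld \<Rightarrow> fld" where
  "stokesA u = leray (\<lambda>k. - lap u k)"

text \<open>Fourier coefficients of (u . grad) v: sum over p+q=k of (uhat(p) . i q) vhat(q).\<close>
definition conv :: "fld \<Rightarrow> fld \<Rightarrow> fld" where
  "conv u v = (\<lambda>k. infsum (\<lambda>p. smulc (\<i> * wdot (fst k - fst p, snd k - snd p) (u p))
                                    (v (fst k - fst p, snd k - snd p))) UNIV)"

definition Bop :: "fld \<Rightarrow> fld \<Rightarrow> fld" where
  "Bop u v = leray (conv u v)"

definition PN :: "real \<Rightarrow> fld \<Rightarrow> fld" where
  "PN N w = (\<lambda>k. if k \<noteq> (0,0) \<and> sqrt (wnorm2 k) \<le> N then w k else (0,0))"

text \<open>g in L^infinity(0,infinity;H) (weak = strong measurability by Pettis, H separable).\<close>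
definition Linf_H :: "(real \<Rightarrow> fld) \<Rightarrow> bool" where
  "Linf_H g \<longleftrightarrow> (\<forall>k. (\<lambda>t. g t k) \<in> borel_measurable (restrict_space lborel {0..}))
     \<and> (\<exists>M. AE t in lborel. t \<ge> 0 \<longrightarrow> inH (g t) \<and> Hnorm2 (g t) \<le> M)"

definition CV :: "real \<Rightarrow> (real \<Rightarrow> fld) \<Rightarrow> bool" where
  "CV T v \<longleftrightarrow> (\<forall>t\<in>{0..T}. inV (v t)) \<and>
     (\<forall>t\<in>{0..T}. \<forall>\<epsilon>>0. \<exists>\<delta>>0. \<forall>s\<in>{0..T}. \<bar>s - t\<bar> < \<delta> \<longrightarrow> Vnorm2 (\<lambda>k. v s k - v t k) < \<epsilon>)"

definition L2DA :: "real \<Rightarrow> (real \<Rightarrow> fld) \<Rightarrow> bool" where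
  "L2DA T v \<longleftrightarrow> (AE t in lborel. t \<in> {0..T} \<longrightarrow> inDA (v t)) \<and>
     (\<integral>\<^sup>+ t. indicator {0..T} t *
        infsum (\<lambda>k. ennreal ((wnorm2 k)^2 * cnorm2 (v t k))) UNIV \<partial>lborel) < \<infinity>"

definition rhsF :: "real \<Rightarrow> real \<Rightarrow> real \<Rightarrow> (real \<Rightarrow> fld) \<Rightarrow> (real \<Rightarrow> fld) \<Rightarrow> (real \<Rightarrow> fld)
                   \<Rightarrow> real \<Rightarrow> fld" where
  "rhsF \<nu> N \<theta> g v w s = (\<lambda>k. g s k - \<nu> *\<^sub>R stokesA (v s) k - Bop (v s) (v s) k
        + \<theta> *\<^sub>R (PN N (Bop (v s) (v s)) k - PN N (Bop (w s) (w s)) k))"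

definition strong_sol :: "real \<Rightarrow> real \<Rightarrow> real \<Rightarrow> (real \<Rightarrow> fld) \<Rightarrow> (real \<Rightarrow> fld)
                          \<Rightarrow> (real \<Rightarrow> fld) \<Rightarrow> fld \<Rightarrow> bool" where
  "strong_sol \<nu> N \<theta> g v w v0 \<longleftrightarrow> v 0 = v0 \<and>
     (\<forall>T>0. CV T v \<and> L2DA T v) \<and>
     (\<forall>t\<ge>0. \<forall>k. set_integrable lborel {0..t} (\<lambda>s. rhsF \<nu> N \<theta> g v w s k) \<and>
        v t k = v 0 k + (LINT s:{0..t}|lborel. rhsF \<nu> N \<theta> g v w s k))"

definition sync_sol :: "real \<Rightarrow> real \<Rightarrow> real \<Rightarrow> real \<Rightarrow> (real \<Rightarrow> fld) \<Rightarrow> (real \<Rightarrow> fld)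
     \<Rightarrow> fld \<Rightarrow> fld \<Rightarrow> (real \<Rightarrow> fld) \<Rightarrow> (real \<Rightarrow> fld) \<Rightarrow> bool" where
  "sync_sol \<nu> N \<theta>1 \<theta>2 g1 g2 v01 v02 v1 v2 \<longleftrightarrow>
     strong_sol \<nu> N \<theta>1 g1 v1 v2 v01 \<and> strong_sol \<nu> N \<theta>2 g2 v2 v1 v02"

end

theory Submission
  imports Defs
begin

text \<open>The system is solved mode by mode in mild form. Since \<open>\<parallel>B(u,v)\<parallel>\<close> in \<open>H\<^sup>-\<^sup>1\<^sup>/\<^sup>2\<close> is bounded by
  \<open>\<parallel>u\<parallel> \<parallel>v\<parallel>\<close>, a Picard iteration in a time-weighted norm yields a global solution in \<open>L\<^sup>\<infinity>(0,T;V)\<close>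
  once the nonlinear terms are multiplied by a scalar cutoff of the \<open>V\<close>-norm; the smoothing of the Stokes
  semigroup then upgrades this solution to \<open>C([0,T];V) \<inter> L\<^sup>2(0,T;D(A))\<close>.

  The cutoff factor, being a scalar in \<open>[0,1]\<close>, does not disturb the a priori estimates. As
  \<open>\<theta>1 + \<theta>2 = 1\<close>, the low modes of \<open>v1 - v2\<close> solve a linear heat equation and are bounded. In the balance
  of \<open>\<theta>2 |v1|\<^sup>2 + \<theta>1 |v2|\<^sup>2\<close> the coupling contributes only \<open>\<theta>1 \<theta>2 (B1 - B2, P_N (v1 - v2))\<close>, which is at most
  quadratic in \<open>(v1, v2)\<close>, so that Gronwall's inequality applies. If, say, \<open>\<theta>2 \<ge> 1/2\<close>, this controls \<open>v1\<close>, hence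
  the low modes of \<open>v2\<close>, and then the energy of \<open>v2\<close>. Now \<open>P_N (B1 - B2)\<close> is a bounded force, and
  conservation of enstrophy bounds the \<open>V\<close>-norm independently of the cutoff radius. A large radius therefore
  gives a solution of the original system, and uniqueness allows these solutions to be glued.\<close>

section \<open>Sums over index sets as integrals\<close>

text \<open>The a priori bounds are proved for an arbitrary measurable factor \<kappa>(t) in [0,1]
  in front of the nonlinear terms. A bound is therefore available before the radius is chosen, and
  choosing the radius from it is not circular. No Galerkin truncation or compactness is involved.

  The obstacle is the coupling. Tested with one component alone, \<open>P_N (B1 - B2)\<close> yields
  a cubic term, for which Gronwall's inequality does not close. The crossed weights \<theta>2,
  \<theta>1 replace the test field by the low modes of \<open>v1 - v2\<close>, bounded beforehand.
  Since a weight may be 0, this first estimate secures one component only, and the other is reached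
  through the difference.

  Regularity needs two rounds: a bound in V places B in H^(-1/2) only. The energy estimate with
  weight |k| gives H^(3/2) in mean square over time; this puts B into H, and the estimate with
  weight |k|^2 then gives D(A).

  Both components form one family of coefficients in C^2 x C^2 indexed by Z^2. On it the Stokes
  semigroup is diagonal, so evolution in time is a scalar Duhamel formula in each mode.\<close>

abbreviation nsum :: "('a \<Rightarrow> ennreal) \<Rightarrow> ennreal" where
  "nsum f \<equiv> integral\<^sup>N (count_space UNIV) f"

lemma nsum_eq_infsum_real:
  fixes f :: "'a \<Rightarrow> real"
  assumes "\<And>x. 0 \<le> f x" and "f summable_on UNIV"
  shows "nsum (\<lambda>x. ennreal (f x)) = ennreal (infsum f UNIV)"
proof -
  have "Infinite_Set_Sum.abs_summable_on f UNIV"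
    using assms by (simp add: abs_summable_equivalent[symmetric] summable_on_iff_abs_summable_on_real[symmetric])
  then show ?thesis
    by (simp add: Infinite_Set_Sum.abs_summable_on_def infsetsum_infsum[symmetric] infsetsum_def
        nn_integral_eq_integral assms)
qed

lemma sum_le_nsum:
  assumes "finite A" shows "sum f A \<le> nsum f"
proof -
  have "sum f A = (\<integral>\<^sup>+x. f x * indicator A x \<partial>count_space UNIV)"
    using assms by (simp add: nn_integral_count_space_indicator[symmetric] nn_integral_count_space_finite)
  also have "\<dots> \<le> nsum f" by (intro nn_integral_mono) (auto simp: indicator_def)
  finally show ?thesis .
qed

lemma nsum_ge: "f x \<le> nsum f"
  using sum_le_nsum[of "{x}" f] by simp

lemma nsum_finite_summable:
  fixes f :: "'a \<Rightarrow> real"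
  assumes "\<And>x. 0 \<le> f x" and "nsum (\<lambda>x. ennreal (f x)) < \<infinity>"
  shows "f summable_on UNIV"
proof (rule nonneg_bounded_partial_sums_imp_summable_on[where C = "enn2real (nsum (\<lambda>x. ennreal (f x)))"])
  show "\<forall>\<^sub>F X in finite_subsets_at_top UNIV. sum f X \<le> enn2real (nsum (\<lambda>x. ennreal (f x)))"
  proof (rule eventually_finite_subsets_at_top_weakI)
    fix X :: "'a set" assume "finite X"
    then have "ennreal (sum f X) \<le> nsum (\<lambda>x. ennreal (f x))"
      using sum_le_nsum[of X "\<lambda>x. ennreal (f x)"] assms by (simp add: sum_ennreal)
    then show "sum f X \<le> enn2real (nsum (\<lambda>x. ennreal (f x)))"
      using assms by (metis enn2real_mono enn2real_ennreal infinity_ennreal_def sum_nonneg)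
  qed
qed (use assms in auto)

lemma nsum_real_iff:
  fixes f :: "'a \<Rightarrow> real"
  assumes "\<And>x. 0 \<le> f x"
  shows "nsum (\<lambda>x. ennreal (f x)) < \<infinity> \<longleftrightarrow> f summable_on UNIV"
proof
  show "nsum (\<lambda>x. ennreal (f x)) < \<infinity> \<Longrightarrow> f summable_on UNIV"
    by (rule nsum_finite_summable[OF assms])
  show "f summable_on UNIV \<Longrightarrow> nsum (\<lambda>x. ennreal (f x)) < \<infinity>"
    by (simp add: nsum_eq_infsum_real[OF assms])
qed

text \<open>\<open>L2DA\<close> integrates an \<open>ennreal\<close>-valued \<open>infsum\<close>,
  whereas Tonelli and Cauchy-Schwarz are applied to integrals over the counting measure. For a
  family that is not summable both sides are infinite.\<close>

lemma nsum_eq_infsum: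
  fixes f :: "'a \<Rightarrow> real"
  assumes "\<And>x. 0 \<le> f x"
  shows "nsum (\<lambda>x. ennreal (f x)) = infsum (\<lambda>x. ennreal (f x)) UNIV"
proof -
  have S: "infsum (\<lambda>x. ennreal (f x)) UNIV = (SUP F\<in>{F. finite F \<and> F \<subseteq> UNIV}. \<Sum>x\<in>F. ennreal (f x))"
    by (rule nonneg_infsum_complete) auto
  show ?thesis
  proof (cases "f summable_on UNIV")
    case True
    then show ?thesis
      using nsum_eq_infsum_real[OF assms True] infsum_nonneg_is_SUPREMUM_ennreal[OF True assms] S
      by (simp add: sum_ennreal assms)
  next
    case False
    then have "nsum (\<lambda>x. ennreal (f x)) = \<infinity>"
      using nsum_finite_summable[of f] assms by (metis infinity_ennreal_def less_top)
    moreover have "infsum (\<lambda>x. ennreal (f x)) UNIV = \<infinity>"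
    proof (rule ccontr)
      assume "infsum (\<lambda>x. ennreal (f x)) UNIV \<noteq> \<infinity>"
      then obtain c where c: "c \<ge> 0" "infsum (\<lambda>x. ennreal (f x)) UNIV = ennreal c"
        by (metis ennreal_cases infinity_ennreal_def)
      have "f summable_on UNIV"
      proof (rule nonneg_bounded_partial_sums_imp_summable_on[where C = c])
        show "\<forall>\<^sub>F X in finite_subsets_at_top UNIV. sum f X \<le> c"
        proof (rule eventually_finite_subsets_at_top_weakI)
          fix X :: "'a set" assume "finite X"
          then have "(\<Sum>x\<in>X. ennreal (f x)) \<le> ennreal c"
            unfolding c(2)[symmetric] S by (intro SUP_upper) auto
          then show "sum f X \<le> c" using assms c by (simp add: sum_ennreal)
        qed
      qed (use assms in auto)
      with False show False by simp
    qed
    ultimately show ?thesis by simp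
  qed
qed

lemma nsum_fubini:
  fixes f :: "'i::countable \<Rightarrow> 'a \<Rightarrow> ennreal"
  assumes "\<And>i. f i \<in> borel_measurable M"
  shows "(\<integral>\<^sup>+x. nsum (\<lambda>i. f i x) \<partial>M) = nsum (\<lambda>i. \<integral>\<^sup>+x. f i x \<partial>M)"
  using assms by (intro nn_integral_count_space_nn_integral) auto

lemma measurable_nsum[measurable]:
  fixes f :: "'i::countable \<Rightarrow> 'a \<Rightarrow> ennreal"
  assumes [measurable]: "\<And>i. f i \<in> borel_measurable M"
  shows "(\<lambda>x. nsum (\<lambda>i. f i x)) \<in> borel_measurable M"
proof -
  \<comment> \<open>The index type may be finite, so \<open>to_nat_on\<close> need not reach every
    natural number; the indicator of its range fills the series up with zeros.\<close>
  have "(\<lambda>x. nsum (\<lambda>i. f i x)) = (\<lambda>x. \<integral>\<^sup>+n. f (from_nat_into UNIV n) x * indicator (to_nat_on (UNIV::'i set) ` UNIV) n \<partial>count_space UNIV)"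
  proof
    fix x
    have b: "bij_betw (to_nat_on (UNIV::'i set)) UNIV (to_nat_on (UNIV::'i set) ` UNIV)"
      by (rule inj_on_imp_bij_betw) (rule inj_on_to_nat_on, simp)
    have "nsum (\<lambda>i. f i x) = nsum (\<lambda>i::'i. f (from_nat_into UNIV (to_nat_on UNIV i)) x)"
      by (intro nn_integral_cong) (simp add: from_nat_into_to_nat_on)
    also have "\<dots> = (\<integral>\<^sup>+n. f (from_nat_into UNIV n) x \<partial>count_space (to_nat_on (UNIV::'i set) ` UNIV))"
      by (rule nn_integral_bij_count_space[OF b])
    also have "\<dots> = (\<integral>\<^sup>+n. f (from_nat_into UNIV n) x * indicator (to_nat_on (UNIV::'i set) ` UNIV) n \<partial>count_space UNIV)"
      by (simp add: nn_integral_count_space_indicator)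
    finally show "nsum (\<lambda>i. f i x) = \<dots>" .
  qed
  then show ?thesis by (simp add: nn_integral_count_space_nat)
qed

section \<open>Summation in finite-dimensional spaces\<close>

lemma summable_on_sum_family:
  fixes f :: "'b \<Rightarrow> 'i \<Rightarrow> 'e::{topological_comm_monoid_add}"
  assumes "finite B" "\<And>b. b \<in> B \<Longrightarrow> f b summable_on A"
  shows "(\<lambda>i. \<Sum>b\<in>B. f b i) summable_on A"
  using assms by (induction B rule: finite_induct) (auto intro!: summable_on_add)

text \<open>Finite dimension is essential: each coordinate is a summable real family, hence
  absolutely summable, and the norm is at most the sum of the absolute coordinates.\<close>

lemma summable_on_euclidean_abs:
  fixes f :: "'i \<Rightarrow> 'e::euclidean_space"
  assumes "f summable_on A"
  shows "(\<lambda>i. norm (f i)) summable_on A"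
proof -
  have "(\<lambda>i. f i \<bullet> b) summable_on A" for b
    using summable_on_bounded_linear[OF bounded_linear_inner_left assms] .
  then have "(\<lambda>i. \<bar>f i \<bullet> b\<bar>) summable_on A" for b
    using summable_on_iff_abs_summable_on_real[of "\<lambda>i. f i \<bullet> b" A] by auto
  then have "(\<lambda>i. \<Sum>b\<in>Basis. \<bar>f i \<bullet> b\<bar>) summable_on A"
    by (intro summable_on_sum_family) auto
  then show ?thesis
    by (rule summable_on_comparison_test) (auto simp: norm_le_l1)
qed

text \<open>\<open>infsum\<close> returns 0 wherever the family is not summable. Summability is
  equivalent to finiteness of the sum of norms, a measurable condition, and where it holds the sum
  is an ordinary series along an enumeration.\<close>

lemma measurable_infsum:
  fixes f :: "'i::countable \<Rightarrow> 'a \<Rightarrow> 'e::euclidean_space"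
  assumes [measurable]: "\<And>i. f i \<in> borel_measurable M"
  shows "(\<lambda>x. infsum (\<lambda>i. f i x) UNIV) \<in> borel_measurable M"
proof -
  define J where "J = to_nat_on (UNIV::'i set) ` UNIV"
  define h where "h n x = (if n \<in> J then f (from_nat_into UNIV n) x else 0)" for n x
  have hm[measurable]: "h n \<in> borel_measurable M" for n
    unfolding h_def by (cases "n \<in> J") auto
  have b: "bij_betw (from_nat_into (UNIV::'i set)) J UNIV"
    unfolding J_def by (intro bij_betwI[where g="to_nat_on UNIV"]) auto
  have A: "(\<lambda>i. norm (f i x)) summable_on UNIV \<longleftrightarrow> nsum (\<lambda>i. ennreal (norm (f i x))) < \<infinity>" for x
    by (rule nsum_real_iff[symmetric]) auto
  have B: "infsum (\<lambda>i. f i x) UNIV = (\<Sum>n. h n x)" if "(\<lambda>i. norm (f i x)) summable_on UNIV" for x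
  proof -
    have "(\<lambda>i. f i x) summable_on UNIV" using that by (rule abs_summable_summable)
    then have "((\<lambda>i. f i x) has_sum infsum (\<lambda>i. f i x) UNIV) UNIV" by simp
    then have "((\<lambda>n. f (from_nat_into UNIV n) x) has_sum infsum (\<lambda>i. f i x) UNIV) J"
      using has_sum_reindex_bij_betw[OF b, of "\<lambda>i. f i x"] by simp
    then have "((\<lambda>n. h n x) has_sum infsum (\<lambda>i. f i x) UNIV) UNIV"
      by (subst has_sum_cong_neutral[where T=J and g="\<lambda>n. f (from_nat_into UNIV n) x"]) (auto simp: h_def)
    then show ?thesis using has_sum_imp_sums sums_unique by blast
  qed
  have C: "infsum (\<lambda>i. f i x) UNIV = 0" if "\<not> (\<lambda>i. norm (f i x)) summable_on UNIV" for x
    using that summable_on_euclidean_abs[of "\<lambda>i. f i x" UNIV] infsum_not_exists by blast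
  have "(\<lambda>x. infsum (\<lambda>i. f i x) UNIV) =
      (\<lambda>x. if nsum (\<lambda>i. ennreal (norm (f i x))) < \<infinity> then (\<Sum>n. h n x) else 0)"
    using B C A by auto
  moreover have "(\<lambda>x. \<Sum>n. h n x) \<in> borel_measurable M" by measurable
  ultimately show ?thesis by simp
qed

section \<open>Integral equations and Duhamel's formula\<close>


text \<open>Fubini in the plane takes the place of differentiation: the product of the integrals is
  the double integral of \<open>pr (f s) (g r)\<close>, and the two summands are its parts over the
  triangles \<open>r \<le> s\<close> and \<open>s < r\<close>.\<close>

lemma bilinear_integral_product:
  fixes pr :: "'a::euclidean_space \<Rightarrow> 'b::euclidean_space \<Rightarrow> 'c::euclidean_space"
    and f :: "real \<Rightarrow> 'a" and g :: "real \<Rightarrow> 'b"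
  assumes bb: "bounded_bilinear pr"
    and f: "integrable lborel f" and g: "integrable lborel g"
  defines "SF \<equiv> \<lambda>s. LINT r|lborel. indicator {..s} r *\<^sub>R f r"
    and "SG \<equiv> \<lambda>s. LINT r|lborel. indicator {..s} r *\<^sub>R g r"
  shows "integrable lborel (\<lambda>s. pr (f s) (SG s))" "integrable lborel (\<lambda>s. pr (SF s) (g s))"
    "pr (integral\<^sup>L lborel f) (integral\<^sup>L lborel g) =
      (LINT s|lborel. pr (f s) (SG s)) + (LINT s|lborel. pr (SF s) (g s))"
proof -
  interpret pr: bounded_bilinear pr by (rule bb)
  have [measurable]: "f \<in> borel_measurable borel" "g \<in> borel_measurable borel"
    using f g by auto
  have prm: "(\<lambda>x. pr (u x) (v x)) \<in> borel_measurable M"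
    if "u \<in> borel_measurable M" "v \<in> borel_measurable M" for u v and M :: "'m measure"
  proof -
    have "continuous_on UNIV (\<lambda>x. pr (fst x) (snd x))"
      by (intro pr.continuous_on continuous_intros)
    from borel_measurable_continuous_on[OF this, of "\<lambda>x. (u x, v x)" M] that
    show ?thesis by simp
  qed
  define H where "H = (\<lambda>(s, r). pr (f s) (g r))"
  have [measurable]: "H \<in> borel_measurable (lborel \<Otimes>\<^sub>M lborel)"
    unfolding H_def case_prod_beta by (rule prm) measurable
  have iH: "integrable (lborel \<Otimes>\<^sub>M lborel) H"
  proof (rule lborel_pair.Fubini_integrable)
    obtain K where K: "\<And>a b. norm (pr a b) \<le> norm a * norm b * K" using pr.bounded by blast
    have K0: "0 \<le> norm a * norm b * K" for a :: 'a and b :: 'b by (rule order_trans[OF norm_ge_zero K])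
    show "integrable lborel (\<lambda>x. LINT y|lborel. norm (H (x, y)))"
    proof (rule Bochner_Integration.integrable_bound[where f="\<lambda>x. norm (f x) * ((LINT y|lborel. norm (g y)) * K)"])
      show "AE x in lborel. norm (LINT y|lborel. norm (H (x, y))) \<le> norm (norm (f x) * ((LINT y|lborel. norm (g y)) * K))"
      proof (rule AE_I2)
        fix x
        have "(LINT y|lborel. norm (H (x, y))) \<le> (LINT y|lborel. norm (f x) * (norm (g y) * K))"
          using g K K0 by (intro integral_mono') (auto simp: H_def mult.assoc[symmetric])
        also have "\<dots> = norm (f x) * ((LINT y|lborel. norm (g y)) * K)" by simp
        finally show "norm (LINT y|lborel. norm (H (x, y))) \<le> norm (norm (f x) * ((LINT y|lborel. norm (g y)) * K))"
          by (simp add: abs_of_nonneg)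
      qed
    qed (use f in auto)
    show "AE x in lborel. integrable lborel (\<lambda>y. H (x, y))"
      using pr.bounded_linear_right g by (auto simp: H_def intro: integrable_bounded_linear)
  qed simp
  define H1 where "H1 = (\<lambda>(s, r). indicator {..s} r *\<^sub>R H (s, r))"
  define H2 where "H2 = (\<lambda>(s, r). indicator {..<r} s *\<^sub>R H (s, r))"
  have S1: "{x. snd x \<le> fst x} \<in> sets (lborel \<Otimes>\<^sub>M lborel :: (real \<times> real) measure)"
    by (simp only: sets_pair_measure_cong[OF sets_lborel sets_lborel] borel_prod) (intro borel_closed closed_Collect_le continuous_intros)
  have S2: "{x. fst x < snd x} \<in> sets (lborel \<Otimes>\<^sub>M lborel :: (real \<times> real) measure)"
    by (simp only: sets_pair_measure_cong[OF sets_lborel sets_lborel] borel_prod) (intro borel_open open_Collect_less continuous_intros)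
  have H1e: "H1 = (\<lambda>x. indicator {x. snd x \<le> fst x} x *\<^sub>R H x)"
    by (auto simp: H1_def fun_eq_iff indicator_def)
  have H2e: "H2 = (\<lambda>x. indicator {x. fst x < snd x} x *\<^sub>R H x)"
    by (auto simp: H2_def fun_eq_iff indicator_def)
  have iH1: "integrable (lborel \<Otimes>\<^sub>M lborel) H1"
    unfolding H1e by (rule integrable_mult_indicator[OF S1 iH])
  have iH2: "integrable (lborel \<Otimes>\<^sub>M lborel) H2"
    unfolding H2e by (rule integrable_mult_indicator[OF S2 iH])
  have ind: "integrable lborel (\<lambda>r. indicator A r *\<^sub>R g r)" "integrable lborel (\<lambda>r. indicator A r *\<^sub>R f r)"
    if "A \<in> sets borel" for A
    using that f g integrable_mult_indicator[of A lborel] by auto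
  have e1: "(LINT r|lborel. H1 (s, r)) = pr (f s) (SG s)" for s
  proof -
    have "(LINT r|lborel. H1 (s, r)) = (LINT r|lborel. pr (f s) (indicator {..s} r *\<^sub>R g r))"
      by (simp add: H1_def H_def pr.scaleR_right)
    also have "\<dots> = pr (f s) (SG s)"
      unfolding SG_def by (rule integral_bounded_linear[OF pr.bounded_linear_right ind(1)]) simp
    finally show ?thesis .
  qed
  \<comment> \<open>The second triangle is open along the diagonal; a single point does not change
    the inner integral.\<close>
  have SFo: "(LINT s|lborel. indicator {..<r} s *\<^sub>R f s) = SF r" for r
    unfolding SF_def
  proof (rule integral_cong_AE)
    show "AE x in lborel. indicator {..<r} x *\<^sub>R f x = indicator {..r} x *\<^sub>R f x"
      using AE_lborel_singleton[of r] by eventually_elim (auto simp: indicator_def)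
  qed auto
  have e2: "(LINT s|lborel. H2 (s, r)) = pr (SF r) (g r)" for r
  proof -
    have "(LINT s|lborel. H2 (s, r)) = (LINT s|lborel. pr (indicator {..<r} s *\<^sub>R f s) (g r))"
      by (simp add: H2_def H_def pr.scaleR_left)
    also have "\<dots> = pr (LINT s|lborel. indicator {..<r} s *\<^sub>R f s) (g r)"
      by (rule integral_bounded_linear[OF pr.bounded_linear_left ind(2)]) simp
    finally show ?thesis by (simp add: SFo)
  qed
  show "integrable lborel (\<lambda>s. pr (f s) (SG s))"
    using lborel_pair.integrable_fst'[of H1] iH1 by (simp add: e1)
  show "integrable lborel (\<lambda>s. pr (SF s) (g s))"
    using lborel_pair.integrable_snd[of "\<lambda>s r. H2 (s, r)"] iH2 by (simp add: e2)
  have "pr (integral\<^sup>L lborel f) (integral\<^sup>L lborel g) = (LINT s|lborel. LINT r|lborel. H (s, r))"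
    using integral_bounded_linear[OF pr.bounded_linear_right g]
      integral_bounded_linear[OF pr.bounded_linear_left f]
    by (simp add: H_def)
  also have "\<dots> = integral\<^sup>L (lborel \<Otimes>\<^sub>M lborel) H"
    using lborel_pair.integral_fst[of "\<lambda>s r. H (s, r)"] iH by simp
  also have "\<dots> = integral\<^sup>L (lborel \<Otimes>\<^sub>M lborel) (\<lambda>x. H1 x + H2 x)"
    by (rule arg_cong2[where f="integral\<^sup>L"]) (auto simp: H1e H2e fun_eq_iff indicator_def)
  also have "\<dots> = integral\<^sup>L (lborel \<Otimes>\<^sub>M lborel) H1 + integral\<^sup>L (lborel \<Otimes>\<^sub>M lborel) H2"
    by (rule Bochner_Integration.integral_add[OF iH1 iH2])
  also have "integral\<^sup>L (lborel \<Otimes>\<^sub>M lborel) H1 = (LINT s|lborel. LINT r|lborel. H1 (s, r))"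
    using lborel_pair.integral_fst[of "\<lambda>s r. H1 (s, r)"] iH1 by simp
  also have "integral\<^sup>L (lborel \<Otimes>\<^sub>M lborel) H2 = (LINT r|lborel. LINT s|lborel. H2 (s, r))"
    using lborel_pair.integral_snd[of "\<lambda>s r. H2 (s, r)"] iH2 by simp
  finally show "pr (integral\<^sup>L lborel f) (integral\<^sup>L lborel g) =
      (LINT s|lborel. pr (f s) (SG s)) + (LINT s|lborel. pr (SF s) (g s))"
    by (simp add: e1 e2)
qed

text \<open>Integration by parts for functions given as indefinite integrals. The preceding formula
  is applied to \<open>f\<close> and \<open>g\<close> cut off outside \<open>{0..t}\<close>, so it
  concerns \<open>x - x0\<close> and \<open>y - y0\<close>; the terms with the constants
  \<open>x0\<close> and \<open>y0\<close> are restored by linearity.\<close>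

lemma integral_product_rule:
  fixes pr :: "'a::euclidean_space \<Rightarrow> 'b::euclidean_space \<Rightarrow> 'c::euclidean_space" and t :: real
  assumes bb: "bounded_bilinear pr"
    and f: "set_integrable lborel {0..t} f" and g: "set_integrable lborel {0..t} g"
    and x: "\<And>s. s \<in> {0..t} \<Longrightarrow> x s = x0 + (LINT r:{0..s}|lborel. f r)"
    and y: "\<And>s. s \<in> {0..t} \<Longrightarrow> y s = y0 + (LINT r:{0..s}|lborel. g r)"
    and t: "0 \<le> t"
  shows "set_integrable lborel {0..t} (\<lambda>s. pr (f s) (y s) + pr (x s) (g s))"
    "pr (x t) (y t) = pr x0 y0 + (LINT s:{0..t}|lborel. pr (f s) (y s) + pr (x s) (g s))"
proof -
  interpret pr: bounded_bilinear pr by (rule bb)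
  define F where "F r = indicator {0..t} r *\<^sub>R f r" for r
  define G where "G r = indicator {0..t} r *\<^sub>R g r" for r
  have F: "integrable lborel F" and G: "integrable lborel G"
    using f g unfolding set_integrable_def F_def[abs_def] G_def[abs_def] by auto
  note P = bilinear_integral_product[OF bb F G]
  have xe: "(LINT r|lborel. indicator {..s} r *\<^sub>R F r) = x s - x0" if "s \<in> {0..t}" for s
  proof -
    have "(LINT r|lborel. indicator {..s} r *\<^sub>R F r) = (LINT r:{0..s}|lborel. f r)"
      unfolding set_lebesgue_integral_def using that
      by (intro Bochner_Integration.integral_cong) (auto simp: F_def indicator_def)
    then show ?thesis using x that by simp
  qed
  have ye: "(LINT r|lborel. indicator {..s} r *\<^sub>R G r) = y s - y0" if "s \<in> {0..t}" for s
  proof -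
    have "(LINT r|lborel. indicator {..s} r *\<^sub>R G r) = (LINT r:{0..s}|lborel. g r)"
      unfolding set_lebesgue_integral_def using that
      by (intro Bochner_Integration.integral_cong) (auto simp: G_def indicator_def)
    then show ?thesis using y that by simp
  qed
  have ie: "indicator {0..t} s *\<^sub>R (pr (f s) (y s) + pr (x s) (g s)) =
      pr (F s) (LINT r|lborel. indicator {..s} r *\<^sub>R G r) +
      pr (LINT r|lborel. indicator {..s} r *\<^sub>R F r) (G s) + (pr (F s) y0 + pr x0 (G s))" for s
  proof (cases "s \<in> {0..t}")
    case True
    then show ?thesis
      by (simp only: xe[OF True] ye[OF True] F_def[of s] G_def[of s]) (simp add: pr.diff_left pr.diff_right)
  qed (simp add: F_def[of s] G_def[of s] pr.zero_left pr.zero_right)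
  have i3: "integrable lborel (\<lambda>s. pr (F s) y0)" "integrable lborel (\<lambda>s. pr x0 (G s))"
    using F G pr.bounded_linear_left pr.bounded_linear_right by (auto intro: integrable_bounded_linear)
  show "set_integrable lborel {0..t} (\<lambda>s. pr (f s) (y s) + pr (x s) (g s))"
    unfolding set_integrable_def ie using P i3 by (intro Bochner_Integration.integrable_add) auto
  have FI: "integral\<^sup>L lborel F = x t - x0" "integral\<^sup>L lborel G = y t - y0"
    using x[of t] y[of t] t by (auto simp: set_lebesgue_integral_def F_def[abs_def] G_def[abs_def])
  have "(LINT s:{0..t}|lborel. pr (f s) (y s) + pr (x s) (g s)) =
     pr (x t - x0) (y t - y0) + (pr (x t - x0) y0 + pr x0 (y t - y0))"
    unfolding set_lebesgue_integral_def ie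
    using P i3 integral_bounded_linear[OF pr.bounded_linear_left F, of y0]
      integral_bounded_linear[OF pr.bounded_linear_right G, of x0]
    by (simp add: FI)
  then show "pr (x t) (y t) = pr x0 y0 + (LINT s:{0..t}|lborel. pr (f s) (y s) + pr (x s) (g s))"
    by (simp add: pr.diff_left pr.diff_right)
qed

text \<open>Gives the exponential the integral form in which \<open>integral_product_rule\<close>
  takes its arguments.\<close>

lemma exp_integral_equation:
  fixes c :: real assumes "0 \<le> t"
  shows "set_integrable lborel {0..t} (\<lambda>s. c * exp (c * s))"
    "exp (c * t) = 1 + (LINT s:{0..t}|lborel. c * exp (c * s))"
proof -
  have "has_bochner_integral lborel (\<lambda>x. indicator {0..t} x *\<^sub>R (c * exp (c * x))) (exp (c * t) - exp (c * 0))"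
    using assms by (intro has_bochner_integral_FTC_Icc)
      (auto intro!: derivative_eq_intros continuous_intros simp flip: has_real_derivative_iff_has_vector_derivative)
  note H = this[unfolded has_bochner_integral_iff]
  show "set_integrable lborel {0..t} (\<lambda>s. c * exp (c * s))"
    unfolding set_integrable_def using H by blast
  have "(LINT s:{0..t}|lborel. c * exp (c * s)) = exp (c * t) - exp (c * 0)"
    unfolding set_lebesgue_integral_def using H by blast
  then show "exp (c * t) = 1 + (LINT s:{0..t}|lborel. c * exp (c * s))"
    by (simp del: set_integral_mult_right)
qed

lemma set_integrable_exp_scaleR:
  fixes F :: "real \<Rightarrow> 'a::euclidean_space"
  assumes "set_integrable lborel {0..t} F"
  shows "set_integrable lborel {0..t} (\<lambda>s. exp (c * s + d) *\<^sub>R F s)"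
  unfolding set_integrable_def
proof (rule Bochner_Integration.integrable_bound)
  show "integrable lborel (\<lambda>s. exp (\<bar>c\<bar> * \<bar>t\<bar> + d) *\<^sub>R (indicator {0..t} s *\<^sub>R F s))"
    using assms unfolding set_integrable_def by (intro integrable_scaleR_right) simp
  have [measurable]: "(\<lambda>s. indicator {0..t} s *\<^sub>R F s) \<in> borel_measurable lborel"
    using assms by (auto simp: set_integrable_def)
  have "(\<lambda>s. exp (c * s + d) *\<^sub>R (indicator {0..t} s *\<^sub>R F s)) \<in> borel_measurable lborel" by measurable
  then show "(\<lambda>s. indicator {0..t} s *\<^sub>R exp (c * s + d) *\<^sub>R F s) \<in> borel_measurable lborel"
    by (simp add: mult.commute scaleR_scaleR)
  show "AE s in lborel. norm (indicator {0..t} s *\<^sub>R exp (c * s + d) *\<^sub>R F s)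
      \<le> norm (exp (\<bar>c\<bar> * \<bar>t\<bar> + d) *\<^sub>R (indicator {0..t} s *\<^sub>R F s))"
  proof (rule AE_I2)
    fix s
    have "c * s \<le> \<bar>c\<bar> * \<bar>t\<bar>" if "s \<in> {0..t}"
      by (rule order_trans[OF abs_ge_self]) (use that in \<open>auto simp: abs_mult intro!: mult_left_mono\<close>)
    then show "norm (indicator {0..t} s *\<^sub>R exp (c * s + d) *\<^sub>R F s)
      \<le> norm (exp (\<bar>c\<bar> * \<bar>t\<bar> + d) *\<^sub>R (indicator {0..t} s *\<^sub>R F s))"
      by (auto simp: indicator_def intro!: mult_right_mono)
  qed
qed

text \<open>Both directions are the product rule: applied to \<open>exp (- a t)\<close> and
  \<open>z0 + \<integral> exp (a s) F s\<close>, respectively to \<open>exp (a t)\<close> and \<open>z t\<close>.\<close>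

lemma duhamel_imp_integral_equation:
  fixes F z :: "real \<Rightarrow> 'a::euclidean_space"
  assumes F: "set_integrable lborel {0..t} F" and t: "0 \<le> t"
    and z: "\<And>s. s \<in> {0..t} \<Longrightarrow> z s = exp (- a * s) *\<^sub>R z0 + (LINT r:{0..s}|lborel. exp (- a * (s - r)) *\<^sub>R F r)"
  shows "set_integrable lborel {0..t} (\<lambda>s. F s - a *\<^sub>R z s)"
    "z t = z0 + (LINT s:{0..t}|lborel. F s - a *\<^sub>R z s)"
proof -
  define y where "y s = z0 + (LINT r:{0..s}|lborel. exp (a * r + 0) *\<^sub>R F r)" for s
  have zy: "z s = exp (- a * s) *\<^sub>R y s" if "s \<in> {0..t}" for s
  proof -
    have "(LINT r:{0..s}|lborel. exp (- a * (s - r)) *\<^sub>R F r) = (LINT r:{0..s}|lborel. exp (- a * s) *\<^sub>R (exp (a * r + 0) *\<^sub>R F r))"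
      by (intro set_lebesgue_integral_cong) (auto simp: mult_exp_exp right_diff_distrib)
    also have "\<dots> = exp (- a * s) *\<^sub>R (LINT r:{0..s}|lborel. exp (a * r + 0) *\<^sub>R F r)"
      by (rule set_integral_scaleR_right)
    finally show ?thesis unfolding z[OF that] y_def scaleR_right_distrib by (rule arg_cong)
  qed
  have e: "exp (- a * s) = 1 + (LINT r:{0..s}|lborel. - a * exp (- a * r))" if "s \<in> {0..t}" for s
    using exp_integral_equation(2)[of s "- a"] that by simp
  note P = integral_product_rule[where pr="(*\<^sub>R)" and x="\<lambda>s. exp (- a * s)" and y=y and t=t,
      OF bounded_bilinear_scaleR exp_integral_equation(1)[OF t, of "- a"] set_integrable_exp_scaleR[OF F, of a 0] e]
  have eq: "(- a * exp (- a * s)) *\<^sub>R y s + exp (- a * s) *\<^sub>R exp (a * s + 0) *\<^sub>R F s = F s - a *\<^sub>R z s"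
    if "s \<in> {0..t}" for s
    using zy[OF that] by (simp add: mult_exp_exp)
  have "set_integrable lborel {0..t} (\<lambda>s. (- a * exp (- a * s)) *\<^sub>R y s + exp (- a * s) *\<^sub>R exp (a * s + 0) *\<^sub>R F s)"
    by (rule P(1)) (auto simp: y_def t)
  then show "set_integrable lborel {0..t} (\<lambda>s. F s - a *\<^sub>R z s)"
    by (simp only: set_integrable_cong[where f="\<lambda>s. F s - a *\<^sub>R z s", OF refl refl eq[symmetric]])
  have "exp (- a * t) *\<^sub>R y t = 1 *\<^sub>R z0 + (LINT s:{0..t}|lborel. (- a * exp (- a * s)) *\<^sub>R y s + exp (- a * s) *\<^sub>R exp (a * s + 0) *\<^sub>R F s)"
    by (rule P(2)) (auto simp: y_def t)
  also have "(LINT s:{0..t}|lborel. (- a * exp (- a * s)) *\<^sub>R y s + exp (- a * s) *\<^sub>R exp (a * s + 0) *\<^sub>R F s)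
     = (LINT s:{0..t}|lborel. F s - a *\<^sub>R z s)"
    by (rule set_lebesgue_integral_cong) (use eq in auto)
  finally show "z t = z0 + (LINT s:{0..t}|lborel. F s - a *\<^sub>R z s)"
    using zy[of t] t by simp
qed

lemma integral_equation_imp_duhamel:
  fixes F z :: "real \<Rightarrow> 'a::euclidean_space"
  assumes F: "set_integrable lborel {0..t} (\<lambda>s. F s - a *\<^sub>R z s)" and t: "0 \<le> t"
    and z: "\<And>s. s \<in> {0..t} \<Longrightarrow> z s = z0 + (LINT r:{0..s}|lborel. F r - a *\<^sub>R z r)"
  shows "z t = exp (- a * t) *\<^sub>R z0 + (LINT s:{0..t}|lborel. exp (- a * (t - s)) *\<^sub>R F s)"
proof -
  have e: "exp (a * s) = 1 + (LINT r:{0..s}|lborel. a * exp (a * r))" if "s \<in> {0..t}" for s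
    using exp_integral_equation(2)[of s a] that by simp
  have "exp (a * t) *\<^sub>R z t = 1 *\<^sub>R z0 + (LINT s:{0..t}|lborel. (a * exp (a * s)) *\<^sub>R z s + exp (a * s) *\<^sub>R (F s - a *\<^sub>R z s))"
    by (rule integral_product_rule(2)[OF bounded_bilinear_scaleR exp_integral_equation(1)[OF t] F e z t])
  also have "\<dots> = z0 + (LINT s:{0..t}|lborel. exp (a * s) *\<^sub>R F s)"
    by (simp add: algebra_simps)
  finally have "exp (- a * t) *\<^sub>R (exp (a * t) *\<^sub>R z t) = exp (- a * t) *\<^sub>R z0 + exp (- a * t) *\<^sub>R (LINT s:{0..t}|lborel. exp (a * s) *\<^sub>R F s)"
    by (simp add: scaleR_right_distrib)
  also have "exp (- a * t) *\<^sub>R (LINT s:{0..t}|lborel. exp (a * s) *\<^sub>R F s) = (LINT s:{0..t}|lborel. exp (- a * t) *\<^sub>R exp (a * s) *\<^sub>R F s)"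
    by (rule set_integral_scaleR_right[symmetric])
  also have "\<dots> = (LINT s:{0..t}|lborel. exp (- a * (t - s)) *\<^sub>R F s)"
    by (intro set_lebesgue_integral_cong) (auto simp: mult_exp_exp right_diff_distrib)
  finally show ?thesis by (simp add: mult_exp_exp)
qed

text \<open>The supremum \<open>M\<close> of \<open>exp (- 2 C t) E t\<close> is finite because of
  \<open>K\<close>. With this weight the integral contributes at most \<open>|M| / 2\<close>, which
  is absorbed on the left; that is the origin of both factors 2.\<close>

lemma gronwall_bounded:
  fixes E :: "real \<Rightarrow> real"
  assumes C: "0 < C" and T: "0 \<le> T" and int: "set_integrable lborel {0..T} E"
    and bd: "\<And>t. t \<in> {0..T} \<Longrightarrow> E t \<le> K"
    and le: "\<And>t. t \<in> {0..T} \<Longrightarrow> E t \<le> A + C * (LINT s:{0..t}|lborel. E s)"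
    and t: "t \<in> {0..T}"
  shows "E t \<le> 2 * \<bar>A\<bar> * exp (2 * C * t)"
proof -
  define M where "M = (SUP t\<in>{0..T}. exp (- (2 * C * t)) * E t)"
  have bdd: "bdd_above ((\<lambda>t. exp (- (2 * C * t)) * E t) ` {0..T})"
  proof (rule bdd_aboveI2)
    fix s assume s: "s \<in> {0..T}"
    have "exp (- (2 * C * s)) * E s \<le> exp (- (2 * C * s)) * \<bar>K\<bar>"
      using bd[OF s] by (intro mult_left_mono) auto
    also have "\<dots> \<le> 1 * \<bar>K\<bar>" using C s by (intro mult_right_mono) auto
    finally show "exp (- (2 * C * s)) * E s \<le> 1 * \<bar>K\<bar>" .
  qed
  have EM: "E s \<le> M * exp (2 * C * s)" if "s \<in> {0..T}" for s
  proof -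
    have "exp (- (2 * C * s)) * E s \<le> M" unfolding M_def by (rule cSUP_upper[OF that bdd])
    then have "exp (2 * C * s) * (exp (- (2 * C * s)) * E s) \<le> exp (2 * C * s) * M" by (intro mult_left_mono) auto
    moreover have "exp (2 * C * s) * (exp (- (2 * C * s)) * E s) = E s"
      by (simp only: mult.assoc[symmetric] mult_exp_exp) simp
    ultimately show ?thesis by (metis mult.commute)
  qed
  have step: "exp (- (2 * C * s)) * E s \<le> \<bar>A\<bar> + \<bar>M\<bar> / 2" if s: "s \<in> {0..T}" for s
  proof -
    have i1: "set_integrable lborel {0..s} E"
      using int s by (auto intro: set_integrable_subset)
    have i2: "set_integrable lborel {0..s} (\<lambda>r. (2 * C) * exp ((2 * C) * r))"
      using exp_integral_equation(1) s by auto
    have "(LINT r:{0..s}|lborel. E r) \<le> (LINT r:{0..s}|lborel. \<bar>M\<bar> / (2 * C) * ((2 * C) * exp ((2 * C) * r)))"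
    proof (rule set_integral_mono[OF i1])
      show "set_integrable lborel {0..s} (\<lambda>r. \<bar>M\<bar> / (2 * C) * ((2 * C) * exp ((2 * C) * r)))"
        using i2 by (rule set_integrable_mult_right)
      fix r assume "r \<in> {0..s}"
      then have "E r \<le> M * exp (2 * C * r)" using EM s by auto
      also have "\<dots> \<le> \<bar>M\<bar> * exp (2 * C * r)" by (intro mult_right_mono) auto
      finally show "E r \<le> \<bar>M\<bar> / (2 * C) * ((2 * C) * exp ((2 * C) * r))" using C by simp
    qed
    also have "\<dots> = \<bar>M\<bar> / (2 * C) * (exp (2 * C * s) - 1)"
    proof -
      have "(LINT r:{0..s}|lborel. \<bar>M\<bar> / (2 * C) * ((2 * C) * exp ((2 * C) * r))) =
        \<bar>M\<bar> / (2 * C) * (LINT r:{0..s}|lborel. (2 * C) * exp ((2 * C) * r))"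
        by (rule set_integral_mult_right)
      moreover have "exp ((2 * C) * s) = 1 + (LINT r:{0..s}|lborel. (2 * C) * exp ((2 * C) * r))"
        using exp_integral_equation(2) s by auto
      ultimately show ?thesis by simp
    qed
    finally have "E s \<le> A + C * (\<bar>M\<bar> / (2 * C) * (exp (2 * C * s) - 1))"
      using le[OF s] C mult_left_mono[of _ _ C] by fastforce
    also have "\<dots> \<le> \<bar>A\<bar> * exp (2 * C * s) + \<bar>M\<bar> / 2 * exp (2 * C * s)"
    proof -
      have "\<bar>A\<bar> * 1 \<le> \<bar>A\<bar> * exp (2 * C * s)" using C s by (intro mult_left_mono) auto
      moreover have "C * (\<bar>M\<bar> / (2 * C) * (exp (2 * C * s) - 1)) = \<bar>M\<bar> / 2 * exp (2 * C * s) - \<bar>M\<bar> / 2"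
        using C by (simp add: field_simps)
      ultimately show ?thesis by linarith
    qed
    finally have "exp (- (2 * C * s)) * E s \<le> exp (- (2 * C * s)) * ((\<bar>A\<bar> + \<bar>M\<bar> / 2) * exp (2 * C * s))"
      by (intro mult_left_mono) (auto simp: algebra_simps)
    also have "\<dots> = (\<bar>A\<bar> + \<bar>M\<bar> / 2) * (exp (- (2 * C * s)) * exp (2 * C * s))"
      by (simp only: mult_ac)
    also have "\<dots> = \<bar>A\<bar> + \<bar>M\<bar> / 2"
      by (simp only: mult_exp_exp) simp
    finally show ?thesis .
  qed
  have "(SUP t\<in>{0..T}. exp (- (2 * C * t)) * E t) \<le> \<bar>A\<bar> + \<bar>M\<bar> / 2"
    using T step by (intro cSUP_least) auto
  then have "M \<le> \<bar>A\<bar> + \<bar>M\<bar> / 2" by (simp only: M_def[symmetric])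
  then have "M \<le> 2 * \<bar>A\<bar>" by (cases "M \<ge> 0") auto
  then have "M * exp (2 * C * t) \<le> 2 * \<bar>A\<bar> * exp (2 * C * t)" by (intro mult_right_mono) auto
  with EM[OF t] show ?thesis by linarith
qed

lemma integral_equation_continuous:
  fixes f z :: "real \<Rightarrow> 'a::euclidean_space"
  assumes f: "set_integrable lborel {0..T} f"
    and z: "\<And>s. s \<in> {0..T} \<Longrightarrow> z s = z0 + (LINT r:{0..s}|lborel. f r)"
  shows "continuous_on {0..T} z"
proof -
  have "continuous_on {0..T} (\<lambda>s. z0 + integral {0..s} f)"
    by (intro continuous_intros indefinite_integral_continuous_1)
      (use set_borel_integral_eq_integral(1)[OF f] in simp)
  moreover have "z0 + integral {0..s} f = z s" if "s \<in> {0..T}" for s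
  proof -
    have "set_integrable lborel {0..s} f" using f that by (auto intro: set_integrable_subset)
    then show ?thesis using z[OF that] set_borel_integral_eq_integral(2) by force
  qed
  ultimately show ?thesis by (rule continuous_on_eq)
qed

text \<open>Test the equation with \<open>z\<close>. Young's inequality
  \<open>2 (F, z) \<le> |F|^2 / a + a |z|^2\<close> spends half of the dissipation
  \<open>2 a |z|^2\<close> and leaves the other half. Both sides live in \<open>ennreal\<close>, so
  the modes can be added without any summability hypothesis.\<close>

lemma mode_energy:
  fixes F z :: "real \<Rightarrow> 'a::euclidean_space"
  assumes a: "0 < a" and t: "0 \<le> t"
    and F: "set_integrable lborel {0..t} F"
    and int: "set_integrable lborel {0..t} (\<lambda>s. F s - a *\<^sub>R z s)"
    and z: "\<And>s. s \<in> {0..t} \<Longrightarrow> z s = z0 + (LINT r:{0..s}|lborel. F r - a *\<^sub>R z r)"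
  shows "ennreal ((norm (z t))\<^sup>2) + ennreal a * (\<integral>\<^sup>+s\<in>{0..t}. ennreal ((norm (z s))\<^sup>2) \<partial>lborel)
    \<le> ennreal ((norm z0)\<^sup>2) + ennreal (1 / a) * (\<integral>\<^sup>+s\<in>{0..t}. ennreal ((norm (F s))\<^sup>2) \<partial>lborel)"
proof (cases "(\<integral>\<^sup>+s\<in>{0..t}. ennreal ((norm (F s))\<^sup>2) \<partial>lborel) = \<infinity>")
  case True
  then show ?thesis using a by (simp add: ennreal_mult_eq_top_iff)
next
  case False
  have cont: "continuous_on {0..t} z" by (rule integral_equation_continuous[OF int z])
  have z2: "set_integrable lborel {0..t} (\<lambda>s. (norm (z s))\<^sup>2)"
    by (intro borel_integrable_atLeastAtMost' continuous_intros cont)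
  have Fm: "(\<lambda>s. indicator {0..t} s *\<^sub>R F s) \<in> borel_measurable lborel"
    using F by (auto simp: set_integrable_def)
  have F2: "set_integrable lborel {0..t} (\<lambda>s. (norm (F s))\<^sup>2)"
    unfolding set_integrable_def
  proof (rule integrableI_bounded)
    have e: "indicator {0..t} s *\<^sub>R (norm (F s))\<^sup>2 = (norm (indicator {0..t} s *\<^sub>R F s))\<^sup>2" for s
      by (auto simp: indicator_def)
    show "(\<lambda>s. indicator {0..t} s *\<^sub>R (norm (F s))\<^sup>2) \<in> borel_measurable lborel"
      unfolding e using Fm by measurable
    have "(\<integral>\<^sup>+s. ennreal (norm (indicator {0..t} s *\<^sub>R (norm (F s))\<^sup>2)) \<partial>lborel) = (\<integral>\<^sup>+s\<in>{0..t}. ennreal ((norm (F s))\<^sup>2) \<partial>lborel)"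
      by (intro nn_integral_cong) (auto simp: indicator_def)
    then show "(\<integral>\<^sup>+s. ennreal (norm (indicator {0..t} s *\<^sub>R (norm (F s))\<^sup>2)) \<partial>lborel) < \<infinity>"
      using False by (simp add: less_top)
  qed
  have nn: "(\<integral>\<^sup>+s\<in>{0..t}. ennreal (f s) \<partial>lborel) = ennreal (LINT s:{0..t}|lborel. f s)"
    if "set_integrable lborel {0..t} f" "\<And>s. 0 \<le> f s" for f
  proof -
    have "(\<integral>\<^sup>+s\<in>{0..t}. ennreal (f s) \<partial>lborel) = (\<integral>\<^sup>+s. ennreal (indicator {0..t} s *\<^sub>R f s) \<partial>lborel)"
      by (intro nn_integral_cong) (auto simp: indicator_def)
    also have "\<dots> = ennreal (LINT s:{0..t}|lborel. f s)"
      unfolding set_lebesgue_integral_def using that by (intro nn_integral_eq_integral) (auto simp: set_integrable_def)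
    finally show ?thesis .
  qed
  note P = integral_product_rule[OF bounded_bilinear_inner int int z z t]
  have i3: "set_integrable lborel {0..t} (\<lambda>s. (1 / a) * (norm (F s))\<^sup>2 - a * (norm (z s))\<^sup>2)"
    using F2 z2 by (intro set_integral_diff set_integrable_mult_right)
  have "z t \<bullet> z t = z0 \<bullet> z0 + (LINT s:{0..t}|lborel. (F s - a *\<^sub>R z s) \<bullet> z s + z s \<bullet> (F s - a *\<^sub>R z s))"
    by (rule P(2))
  also have "(LINT s:{0..t}|lborel. (F s - a *\<^sub>R z s) \<bullet> z s + z s \<bullet> (F s - a *\<^sub>R z s))
     \<le> (LINT s:{0..t}|lborel. (1 / a) * (norm (F s))\<^sup>2 - a * (norm (z s))\<^sup>2)"
  proof (rule set_integral_mono[OF P(1) i3])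
    fix s assume "s \<in> {0..t}"
    have "0 \<le> (norm ((1 / sqrt a) *\<^sub>R F s - sqrt a *\<^sub>R z s))\<^sup>2" by simp
    also have "\<dots> = (1 / a) * (norm (F s))\<^sup>2 - 2 * (F s \<bullet> z s) + a * (norm (z s))\<^sup>2"
      using a by (simp add: power2_norm_eq_inner inner_diff_left inner_diff_right inner_commute)
    finally show "(F s - a *\<^sub>R z s) \<bullet> z s + z s \<bullet> (F s - a *\<^sub>R z s) \<le> (1 / a) * (norm (F s))\<^sup>2 - a * (norm (z s))\<^sup>2"
      by (simp add: power2_norm_eq_inner inner_diff_left inner_diff_right inner_commute)
  qed
  also have "\<dots> = (1 / a) * (LINT s:{0..t}|lborel. (norm (F s))\<^sup>2) - a * (LINT s:{0..t}|lborel. (norm (z s))\<^sup>2)"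
    using F2 z2 by (subst set_integral_diff(2)) (auto intro: set_integrable_mult_right)
  finally have ineq: "(norm (z t))\<^sup>2 + a * (LINT s:{0..t}|lborel. (norm (z s))\<^sup>2) \<le>
      (norm z0)\<^sup>2 + (1 / a) * (LINT s:{0..t}|lborel. (norm (F s))\<^sup>2)"
    by (simp add: power2_norm_eq_inner)
  have nonneg: "0 \<le> (LINT s:{0..t}|lborel. (norm (z s))\<^sup>2)" "0 \<le> (LINT s:{0..t}|lborel. (norm (F s))\<^sup>2)"
    by (auto simp: set_lebesgue_integral_def)
  show ?thesis
    unfolding nn[OF z2 zero_le_power2] nn[OF F2 zero_le_power2]
    using a nonneg ineq by (simp add: ennreal_mult[symmetric] ennreal_plus[symmetric] del: ennreal_plus)
qed

section \<open>Smoothing estimates for the exponential kernel\<close>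

lemma nn_integral_exp_decay:
  assumes "0 < a" "0 \<le> t"
  shows "(\<integral>\<^sup>+s\<in>{0..t}. ennreal (exp (- a * (t - s))) \<partial>lborel) \<le> ennreal (1 / a)"
proof -
  have i: "set_integrable lborel {0..t} (\<lambda>s. a * exp (a * s))" 
    and e: "exp (a * t) = 1 + (LINT s:{0..t}|lborel. a * exp (a * s))"
    using exp_integral_equation[OF assms(2), of a] by auto
  have "(\<integral>\<^sup>+s\<in>{0..t}. ennreal (exp (- a * (t - s))) \<partial>lborel) =
     (\<integral>\<^sup>+s. ennreal (exp (- a * t) / a) * ennreal (indicator {0..t} s *\<^sub>R (a * exp (a * s))) \<partial>lborel)"
    using assms by (intro nn_integral_cong)
      (auto simp: indicator_def ennreal_mult[symmetric] mult_exp_exp right_diff_distrib)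
  also have "\<dots> = ennreal (exp (- a * t) / a) * ennreal (LINT s:{0..t}|lborel. a * exp (a * s))"
    unfolding set_lebesgue_integral_def using assms i
    by (subst nn_integral_cmult) (auto simp: set_integrable_def nn_integral_eq_integral)
  also have "\<dots> = ennreal (exp (- a * t) / a * (exp (a * t) - 1))"
  proof -
    have "(LINT s:{0..t}|lborel. a * exp (a * s)) = exp (a * t) - 1" using e by linarith
    then show ?thesis using assms by (simp only:) (subst ennreal_mult[symmetric], auto)
  qed
  also have "\<dots> \<le> ennreal (1 / a)"
    using assms by (intro ennreal_leI) (simp add: field_simps mult_exp_exp)
  finally show ?thesis .
qed

text \<open>Split the kernel as the square of \<open>exp (- a (t - s) / 2)\<close> and apply
  Cauchy-Schwarz. One of the two factors integrates to at most \<open>1 / a\<close>, which accounts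
  for the \<open>a\<close> on the left.\<close>

lemma duhamel_sq_le:
  fixes F :: "real \<Rightarrow> 'a::euclidean_space"
  assumes a: "0 < a" and t: "0 \<le> t" and Fm[measurable]: "F \<in> borel_measurable borel"
  shows "ennreal (a * (norm (LINT s:{0..t}|lborel. exp (- a * (t - s)) *\<^sub>R F s))\<^sup>2)
     \<le> (\<integral>\<^sup>+s\<in>{0..t}. ennreal (exp (- a * (t - s)) * (norm (F s))\<^sup>2) \<partial>lborel)"
    (is "ennreal (a * (norm ?I)\<^sup>2) \<le> ?R")
proof -
  define h where "h s = ennreal (exp (- a * (t - s) / 2)) * indicator {0..t} s" for s
  define k where "k s = ennreal (exp (- a * (t - s) / 2) * norm (F s)) * indicator {0..t} s" for s
  have [measurable]: "h \<in> borel_measurable lborel" "k \<in> borel_measurable lborel"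
    unfolding h_def k_def by measurable
  have ee: "exp x * exp x = exp (2 * x)" for x :: real by (simp add: mult_exp_exp)
  have "ennreal (norm ?I) \<le> (\<integral>\<^sup>+s. ennreal (norm (indicator {0..t} s *\<^sub>R exp (- a * (t - s)) *\<^sub>R F s)) \<partial>lborel)"
    unfolding set_lebesgue_integral_def
  proof (cases "integrable lborel (\<lambda>s. indicator {0..t} s *\<^sub>R exp (- a * (t - s)) *\<^sub>R F s)")
    case True
    then show "ennreal (norm (LINT s|lborel. indicator {0..t} s *\<^sub>R exp (- a * (t - s)) *\<^sub>R F s)) \<le>
      (\<integral>\<^sup>+s. ennreal (norm (indicator {0..t} s *\<^sub>R exp (- a * (t - s)) *\<^sub>R F s)) \<partial>lborel)"
      by (rule integral_norm_bound_ennreal)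
  next
    \<comment> \<open>The Bochner integral of a function that is not integrable is 0, so the bound
      is trivial here.\<close>
    case False
    then show "ennreal (norm (LINT s|lborel. indicator {0..t} s *\<^sub>R exp (- a * (t - s)) *\<^sub>R F s)) \<le>
      (\<integral>\<^sup>+s. ennreal (norm (indicator {0..t} s *\<^sub>R exp (- a * (t - s)) *\<^sub>R F s)) \<partial>lborel)"
      by (simp only: not_integrable_integral_eq[OF False] norm_zero ennreal_0 zero_le)
  qed
  also have "\<dots> = (\<integral>\<^sup>+s. h s * k s \<partial>lborel)"
    by (intro nn_integral_cong)
      (auto simp: h_def k_def indicator_def ennreal_mult[symmetric] mult.assoc[symmetric] mult_exp_exp)
  finally have "(ennreal (norm ?I))\<^sup>2 \<le> (\<integral>\<^sup>+s. h s * k s \<partial>lborel)\<^sup>2"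
    by (intro power_mono) auto
  also have "\<dots> \<le> (\<integral>\<^sup>+s. h s ^ 2 \<partial>lborel) * (\<integral>\<^sup>+s. k s ^ 2 \<partial>lborel)"
    by (rule Cauchy_Schwarz_nn_integral) auto
  also have "(\<integral>\<^sup>+s. h s ^ 2 \<partial>lborel) = (\<integral>\<^sup>+s\<in>{0..t}. ennreal (exp (- a * (t - s))) \<partial>lborel)"
    by (intro nn_integral_cong) (auto simp: h_def indicator_def power2_eq_square ennreal_mult[symmetric] ee)
  also have "(\<integral>\<^sup>+s. k s ^ 2 \<partial>lborel) = ?R"
    by (intro nn_integral_cong)
      (auto simp: k_def indicator_def power2_eq_square ennreal_mult[symmetric] mult_ac ee)
  finally have "(ennreal (norm ?I))\<^sup>2 \<le> ennreal (1 / a) * ?R"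
    using nn_integral_exp_decay[OF a t] by (meson mult_right_mono order_trans zero_le)
  then have "ennreal a * (ennreal (norm ?I))\<^sup>2 \<le> ennreal a * (ennreal (1 / a) * ?R)"
    by (intro mult_left_mono) auto
  also have "\<dots> = ?R" using a by (simp add: mult.assoc[symmetric] ennreal_mult[symmetric])
  finally show ?thesis using a by (simp add: ennreal_mult ennreal_power)
qed

text \<open>What matters is the decay \<open>c powr (-1/4)\<close>: a large exponential weight makes
  the Picard map contract on an interval of any length. It is bought with
  \<open>exp (- y) \<le> y powr (-1/4)\<close>, which worsens the singularity from -1/2 to -3/4;
  this is still integrable, with integral \<open>4 t powr (1/4)\<close>.\<close>

lemma singular_kernel_bound:
  fixes c t :: real
  assumes c: "0 < c" and t: "0 \<le> t"
  shows "(\<integral>\<^sup>+s\<in>{0..t}. ennreal ((t - s) powr (-1/2) * exp (c * s)) \<partial>lborel)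
    \<le> ennreal (exp (c * t) * (4 * t powr (1/4) * c powr (-1/4)))"
proof -
  have root: "exp (- y) \<le> y powr (-1/4)" if "0 < y" for y :: real
  proof -
    have "y powr (1/4) \<le> exp y"
    proof (cases "y \<le> 1")
      case True
      then have "y powr (1/4) \<le> 1" using that powr_le1[of "1/4" y] by simp
      also have "1 \<le> exp y" using that by simp
      finally show ?thesis .
    next
      case False
      then have "y powr (1/4) \<le> y powr 1" by (intro powr_mono) auto
      also have "\<dots> \<le> exp y"
      proof -
        have "y \<le> exp y" using exp_ge_add_one_self[of y] by linarith
        then show ?thesis using that by simp
      qed
      finally show ?thesis .
    qed
    then show ?thesis using that by (simp add: powr_minus exp_minus divide_simps)
  qed
  have pw: "(t - s) powr (-1/2) * exp (c * s) \<le> exp (c * t) * c powr (-1/4) * (t - s) powr (-3/4)"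
    if "s \<in> {0..t}" for s
  proof (cases "s = t")
    case False
    then have p: "0 < t - s" using that by auto
    have "exp (c * s) = exp (c * t) * exp (- (c * (t - s)))" by (simp add: mult_exp_exp algebra_simps)
    also have "\<dots> \<le> exp (c * t) * (c * (t - s)) powr (-1/4)"
      using p c by (intro mult_left_mono root) auto
    also have "\<dots> = exp (c * t) * c powr (-1/4) * (t - s) powr (-1/4)"
      using p c by (simp add: powr_mult)
    finally have "(t - s) powr (-1/2) * exp (c * s) \<le> (t - s) powr (-1/2) * (exp (c * t) * c powr (-1/4) * (t - s) powr (-1/4))"
      by (intro mult_left_mono) auto
    also have "\<dots> = exp (c * t) * c powr (-1/4) * ((t - s) powr (-1/2) * (t - s) powr (-1/4))"
      by (simp only: mult_ac)
    also have "(t - s) powr (-1/2) * (t - s) powr (-1/4) = (t - s) powr (-3/4)"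
      by (simp add: powr_add[symmetric])
    finally show ?thesis .
  qed simp
  have "(\<integral>\<^sup>+s\<in>{0..t}. ennreal ((t - s) powr (-1/2) * exp (c * s)) \<partial>lborel) \<le>
     (\<integral>\<^sup>+s. ennreal (exp (c * t) * c powr (-1/4)) * (ennreal ((t - s) powr (-3/4)) * indicator {0..t} s) \<partial>lborel)"
    using pw by (intro nn_integral_mono) (auto simp: indicator_def ennreal_mult[symmetric] intro!: ennreal_leI)
  also have "\<dots> = ennreal (exp (c * t) * c powr (-1/4)) * (\<integral>\<^sup>+s. ennreal ((t - s) powr (-3/4)) * indicator {0..t} s \<partial>lborel)"
    by (subst nn_integral_cmult) auto
  also have "(\<integral>\<^sup>+s. ennreal ((t - s) powr (-3/4)) * indicator {0..t} s \<partial>lborel)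
     = (\<integral>\<^sup>+s. ennreal (s powr (-3/4)) * indicator {0..t} s \<partial>lborel)"
    by (subst nn_integral_real_affine[where c="-1" and t=t]) (auto simp: indicator_def intro!: nn_integral_cong)
  also have "\<dots> = ennreal (t powr (1/4) / (1/4))"
    using has_integral_powr_from_0[of "-3/4" t] t
    by (intro nn_integral_has_integral_lebesgue') auto
  finally show ?thesis
    by (simp add: ennreal_mult[symmetric] mult_ac)
qed

section \<open>Semilinear parabolic systems with a Lipschitz nonlinearity\<close>


text \<open>Square of a weighted l2 norm, with infinity allowed. For Fourier coefficients the
  weights 1, \<open>jn2\<close>, \<open>jn^3\<close>, \<open>jn^4\<close> and \<open>1 / jn\<close>
  stand for H, V, H^(3/2), D(A) and H^(-1/2).\<close>

definition wsum :: "('i \<Rightarrow> real) \<Rightarrow> ('i \<Rightarrow> 'e::real_normed_vector) \<Rightarrow> ennreal" where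
  "wsum w v = nsum (\<lambda>i. ennreal (w i * (norm (v i))\<^sup>2))"

lemma wsum_zero[simp]: "wsum w (\<lambda>_. 0) = 0"
  by (simp add: wsum_def)

lemma wsum_mono:
  assumes "\<And>i. w i * (norm (u i))\<^sup>2 \<le> w' i * (norm (v i))\<^sup>2"
  shows "wsum w u \<le> wsum w' v"
  unfolding wsum_def by (intro nn_integral_mono ennreal_leI assms)

lemma wsum_mode_le:
  assumes "0 \<le> w i" shows "ennreal (w i * (norm (v i))\<^sup>2) \<le> wsum w v"
  unfolding wsum_def by (rule nsum_ge)

lemma two_ennreal:
  assumes "W < \<infinity>" "0 \<le> q"
  shows "2 * W + 2 * ennreal q = ennreal (2 * enn2real W + 2 * q)"
proof -
  have "2 * W = ennreal (2 * enn2real W)" using assms(1) by (simp add: ennreal_mult)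
  moreover have "2 * ennreal q = ennreal (2 * q)" using assms(2) by (simp add: ennreal_mult)
  ultimately show ?thesis using assms(2) by simp
qed

lemma norm_add_sq_le: "(norm (u + v))\<^sup>2 \<le> 2 * (norm u)\<^sup>2 + 2 * (norm v)\<^sup>2"
  for u v :: "'a::real_normed_vector"
proof -
  have "(norm (u + v))\<^sup>2 \<le> (norm u + norm v)\<^sup>2" by (intro power_mono norm_triangle_ineq) auto
  also have "\<dots> \<le> 2 * (norm u)\<^sup>2 + 2 * (norm v)\<^sup>2"
    using sum_squares_ge_zero[of "norm u - norm v" 0] by (simp add: power2_eq_square algebra_simps)
  finally show ?thesis .
qed

lemma wsum_add_le:
  assumes "\<And>i. 0 \<le> w i"
  shows "wsum w (\<lambda>i. u i + v i) \<le> 2 * wsum w u + 2 * wsum w v"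
proof -
  have "wsum w (\<lambda>i. u i + v i) \<le> nsum (\<lambda>i. 2 * ennreal (w i * (norm (u i))\<^sup>2) + 2 * ennreal (w i * (norm (v i))\<^sup>2))"
    unfolding wsum_def
  proof (intro nn_integral_mono)
    fix i
    have "w i * (norm (u i + v i))\<^sup>2 \<le> w i * (2 * (norm (u i))\<^sup>2 + 2 * (norm (v i))\<^sup>2)"
      using assms norm_add_sq_le by (intro mult_left_mono) auto
    also have "\<dots> = 2 * (w i * (norm (u i))\<^sup>2) + 2 * (w i * (norm (v i))\<^sup>2)" by (simp add: algebra_simps)
    finally have "ennreal (w i * (norm (u i + v i))\<^sup>2) \<le> ennreal (2 * (w i * (norm (u i))\<^sup>2) + 2 * (w i * (norm (v i))\<^sup>2))"
      by (rule ennreal_leI)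
    also have "\<dots> = 2 * ennreal (w i * (norm (u i))\<^sup>2) + 2 * ennreal (w i * (norm (v i))\<^sup>2)"
      using assms by (simp add: ennreal_mult)
    finally show "ennreal (w i * (norm (u i + v i))\<^sup>2) \<le> 2 * ennreal (w i * (norm (u i))\<^sup>2) + 2 * ennreal (w i * (norm (v i))\<^sup>2)" .
  qed
  also have "\<dots> = 2 * wsum w u + 2 * wsum w v"
    unfolding wsum_def by (simp add: nn_integral_add nn_integral_cmult)
  finally show ?thesis .
qed

lemma wsum_minus_commute: "wsum w (\<lambda>i. u i - v i) = wsum w (\<lambda>i. v i - u i)"
  by (simp add: wsum_def norm_minus_commute)

lemma measurable_wsum[measurable]:
  fixes u :: "'x \<Rightarrow> 'i::countable \<Rightarrow> 'e::euclidean_space"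
  assumes [measurable]: "\<And>i. (\<lambda>x. u x i) \<in> borel_measurable M"
  shows "(\<lambda>x. wsum w (u x)) \<in> borel_measurable M"
  unfolding wsum_def by measurable

lemma exp_neg_le_inverse_sqrt:
  assumes "0 < (y::real)" shows "exp (- y) \<le> 1 / sqrt y"
proof -
  have "sqrt y \<le> exp y"
  proof (cases "y \<le> 1")
    case True then show ?thesis using assms by (smt (verit) one_le_exp_iff real_sqrt_le_1_iff)
  next
    case False
    then have "sqrt y \<le> y" using real_sqrt_le_mono[of y "y\<^sup>2"] by (simp add: power2_eq_square)
    then show ?thesis using exp_ge_add_one_self[of y] by linarith
  qed
  then show ?thesis using assms by (simp add: exp_minus divide_simps)
qed

text \<open>Passing from the weight \<open>1 / sqrt a\<close> to the weight \<open>a\<close> takes a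
  factor \<open>a powr (3/2)\<close>. Of this \<open>duhamel_sq_le\<close> supplies
  \<open>a\<close>, and \<open>exp (- a (t - s)) \<le> 1 / sqrt (a (t - s))\<close> supplies the
  rest at the price of an integrable singularity in time.\<close>

lemma duhamel_smoothing:
  fixes G :: "real \<Rightarrow> 'i::countable \<Rightarrow> 'e::euclidean_space"
  assumes a: "\<And>i. 0 < a i" and c: "0 < c" and D: "0 \<le> D"
    and Gm: "\<And>i. (\<lambda>s. G s i) \<in> borel_measurable borel"
    and G: "AE s in lborel. s \<in> {0..T} \<longrightarrow> wsum (\<lambda>i. 1 / sqrt (a i)) (G s) \<le> ennreal (D * exp (c * s))"
    and t: "t \<in> {0..T}"
  shows "set_integrable lborel {0..t} (\<lambda>s. G s i)"
    and "wsum a (\<lambda>i. LINT s:{0..t}|lborel. exp (- a i * (t - s)) *\<^sub>R G s i)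
      \<le> ennreal (D * exp (c * t) * (4 * t powr (1/4) * c powr (-1/4)))"
proof -
  note [measurable] = Gm
  show "set_integrable lborel {0..t} (\<lambda>s. G s i)"
    unfolding set_integrable_def
  proof (rule Bochner_Integration.integrable_bound)
    show "integrable lborel (\<lambda>s. indicator {0..t} s *\<^sub>R sqrt (sqrt (a i) * (D * exp (c * T))))"
      using borel_integrable_atLeastAtMost'[of 0 t "\<lambda>_. sqrt (sqrt (a i) * (D * exp (c * T)))"]
      by (simp only: set_integrable_def continuous_on_const simp_thms)
    show "AE s in lborel. norm (indicator {0..t} s *\<^sub>R G s i) \<le> norm (indicator {0..t} s *\<^sub>R sqrt (sqrt (a i) * (D * exp (c * T))))"
      using G
    proof eventually_elim
      case (elim s)
      show ?case
      proof (cases "s \<in> {0..t}")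
        case True
        then have sT: "s \<in> {0..T}" using t by auto
        have "ennreal (1 / sqrt (a i) * (norm (G s i))\<^sup>2) \<le> ennreal (D * exp (c * s))"
          using elim sT wsum_mode_le[of "\<lambda>i. 1 / sqrt (a i)" i "G s"] less_imp_le[OF a] by (auto intro: order_trans)
        then have "1 / sqrt (a i) * (norm (G s i))\<^sup>2 \<le> D * exp (c * s)" using D by simp
        also have "\<dots> \<le> D * exp (c * T)" using D c sT by (intro mult_left_mono) auto
        finally have "(norm (G s i))\<^sup>2 \<le> sqrt (a i) * (D * exp (c * T))"
          using a[of i] by (simp add: field_simps)
        then have "norm (G s i) \<le> sqrt (sqrt (a i) * (D * exp (c * T)))" by (rule real_le_rsqrt)
        then show ?thesis using True by simp
      qed simp
    qed
  qed measurable
  have "wsum a (\<lambda>i. LINT s:{0..t}|lborel. exp (- a i * (t - s)) *\<^sub>R G s i)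
    \<le> nsum (\<lambda>i. \<integral>\<^sup>+s\<in>{0..t}. ennreal (exp (- a i * (t - s)) * (norm (G s i))\<^sup>2) \<partial>lborel)"
    unfolding wsum_def using a t by (intro nn_integral_mono duhamel_sq_le) auto
  also have "\<dots> = (\<integral>\<^sup>+s. nsum (\<lambda>i. ennreal (exp (- a i * (t - s)) * (norm (G s i))\<^sup>2) * indicator {0..t} s) \<partial>lborel)"
    by (rule nsum_fubini[symmetric]) measurable
  also have "\<dots> \<le> (\<integral>\<^sup>+s. ennreal D * (ennreal ((t - s) powr (-1/2) * exp (c * s)) * indicator {0..t} s) \<partial>lborel)"
  proof (rule nn_integral_mono_AE)
    show "AE s in lborel. nsum (\<lambda>i. ennreal (exp (- a i * (t - s)) * (norm (G s i))\<^sup>2) * indicator {0..t} s)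
       \<le> ennreal D * (ennreal ((t - s) powr (-1/2) * exp (c * s)) * indicator {0..t} s)"
      \<comment> \<open>At \<open>s = t\<close> the function \<open>powr\<close> returns 0 instead
        of infinity, and the pointwise estimate would fail there.\<close>
      using G AE_lborel_singleton[of t]
    proof eventually_elim
      case (elim s)
      show ?case
      proof (cases "s \<in> {0..t}")
        case True
        then have p: "0 < t - s" and sT: "s \<in> {0..T}" using elim t by auto
        have pw: "(t - s) powr (-1/2) = 1 / sqrt (t - s)"
          using p by (simp add: powr_minus powr_half_sqrt divide_simps)
        have "nsum (\<lambda>i. ennreal (exp (- a i * (t - s)) * (norm (G s i))\<^sup>2) * indicator {0..t} s) \<le>
          nsum (\<lambda>i. ennreal ((t - s) powr (-1/2)) * ennreal (1 / sqrt (a i) * (norm (G s i))\<^sup>2))"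
        proof (intro nn_integral_mono)
          fix i
          have "exp (- a i * (t - s)) \<le> 1 / sqrt (a i * (t - s))"
            using exp_neg_le_inverse_sqrt[of "a i * (t - s)"] a[of i] p by simp
          also have "\<dots> = (t - s) powr (-1/2) * (1 / sqrt (a i))" by (simp only: pw real_sqrt_mult) simp
          finally have "exp (- a i * (t - s)) * (norm (G s i))\<^sup>2 \<le> (t - s) powr (-1/2) * (1 / sqrt (a i)) * (norm (G s i))\<^sup>2"
            by (intro mult_right_mono) auto
          then have "ennreal (exp (- a i * (t - s)) * (norm (G s i))\<^sup>2) \<le> ennreal ((t - s) powr (-1/2) * (1 / sqrt (a i) * (norm (G s i))\<^sup>2))"
            by (intro ennreal_leI) (simp add: mult.assoc)
          then show "ennreal (exp (- a i * (t - s)) * (norm (G s i))\<^sup>2) * indicator {0..t} s \<le> ennreal ((t - s) powr (-1/2)) * ennreal (1 / sqrt (a i) * (norm (G s i))\<^sup>2)"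
            using True less_imp_le[OF a, of i] by (simp add: ennreal_mult[symmetric])
        qed
        also have "\<dots> = ennreal ((t - s) powr (-1/2)) * wsum (\<lambda>i. 1 / sqrt (a i)) (G s)"
          unfolding wsum_def by (rule nn_integral_cmult) auto
        also have "\<dots> \<le> ennreal ((t - s) powr (-1/2)) * ennreal (D * exp (c * s))"
          using elim sT by (intro mult_left_mono) auto
        also have "\<dots> = ennreal D * (ennreal ((t - s) powr (-1/2) * exp (c * s)) * indicator {0..t} s)"
          using True D by (simp add: ennreal_mult[symmetric] mult_ac)
        finally show ?thesis .
      qed simp
    qed
  qed
  also have "\<dots> = ennreal D * (\<integral>\<^sup>+s\<in>{0..t}. ennreal ((t - s) powr (-1/2) * exp (c * s)) \<partial>lborel)"
    by (rule nn_integral_cmult) measurable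
  also have "\<dots> \<le> ennreal D * ennreal (exp (c * t) * (4 * t powr (1/4) * c powr (-1/4)))"
    using singular_kernel_bound[OF c, of t] t by (intro mult_left_mono) auto
  also have "\<dots> = ennreal (D * exp (c * t) * (4 * t powr (1/4) * c powr (-1/4)))"
    using D by (simp add: ennreal_mult[symmetric] mult_ac)
  finally show "wsum a (\<lambda>i. LINT s:{0..t}|lborel. exp (- a i * (t - s)) *\<^sub>R G s i)
      \<le> ennreal (D * exp (c * t) * (4 * t powr (1/4) * c powr (-1/4)))" .
qed

lemma measurable_duhamel:
  fixes F :: "real \<Rightarrow> 'e::euclidean_space"
  assumes [measurable]: "F \<in> borel_measurable borel"
  shows "(\<lambda>t. LINT s:{0..t}|lborel. exp (- a * (t - s)) *\<^sub>R F s) \<in> borel_measurable borel"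
proof -
  have e: "(LINT s:{0..t}|lborel. exp (- a * (t - s)) *\<^sub>R F s) =
     (LINT s|lborel. (if 0 \<le> s \<and> s \<le> t then exp (- a * (t - s)) *\<^sub>R F s else 0))" for t
    unfolding set_lebesgue_integral_def by (intro Bochner_Integration.integral_cong) (auto simp: indicator_def)
  show ?thesis unfolding e
    by (rule lborel.borel_measurable_lebesgue_integral) (simp add: case_prod_beta)
qed

text \<open>Abstract frame of the cutoff system: the nonlinearity loses exactly as much as
  \<open>duhamel_smoothing\<close> regains. \<open>L\<close> enters squared because
  \<open>wsum\<close> is a squared norm, whereas \<open>M\<close> already bounds a squared
  norm.\<close>

locale semilinear =
  fixes a :: "'i::countable \<Rightarrow> real" and N :: "('i \<Rightarrow> 'e::euclidean_space) \<Rightarrow> 'i \<Rightarrow> 'e"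
    and L :: real and g :: "real \<Rightarrow> 'i \<Rightarrow> 'e" and M :: real and x0 :: "'i \<Rightarrow> 'e"
  assumes a_pos: "\<And>i. 0 < a i"
    and N_zero: "N (\<lambda>_. 0) = (\<lambda>_. 0)"
    and N_measurable: "\<And>x i. (\<And>j. (\<lambda>s. x s j) \<in> borel_measurable borel) \<Longrightarrow> (\<lambda>s::real. N (x s) i) \<in> borel_measurable borel"
    and N_lipschitz: "\<And>x y. wsum a x < \<infinity> \<Longrightarrow> wsum a y < \<infinity> \<Longrightarrow>
      wsum (\<lambda>i. 1 / sqrt (a i)) (\<lambda>i. N x i - N y i) \<le> ennreal (L\<^sup>2) * wsum a (\<lambda>i. x i - y i)"
    and g_measurable: "\<And>i. (\<lambda>s. g s i) \<in> borel_measurable borel"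
    and M_nonneg: "0 \<le> M"
    and g_bound: "AE s in lborel. 0 \<le> s \<longrightarrow> wsum (\<lambda>i. 1 / sqrt (a i)) (g s) \<le> ennreal M"
    and x0_finite: "wsum a x0 < \<infinity>"
begin

definition duh :: "(real \<Rightarrow> 'i \<Rightarrow> 'e) \<Rightarrow> real \<Rightarrow> 'i \<Rightarrow> 'e" where
  "duh x t i = exp (- a i * t) *\<^sub>R x0 i + (LINT s:{0..t}|lborel. exp (- a i * (t - s)) *\<^sub>R (N (x s) i + g s i))"

text \<open>The bound is local in time but the measurability is global, so that one and the same
  path can be admissible for every \<open>T\<close>.\<close>

definition admissible :: "real \<Rightarrow> (real \<Rightarrow> 'i \<Rightarrow> 'e) \<Rightarrow> bool" where
  "admissible T x \<longleftrightarrow> (\<forall>i. (\<lambda>s. x s i) \<in> borel_measurable borel) \<and>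
     (\<exists>K. \<forall>s\<in>{0..T}. wsum a (x s) \<le> ennreal K)"

lemma a_nonneg: "0 \<le> a i" using a_pos[of i] by simp

lemma N_bound:
  assumes "wsum a x < \<infinity>"
  shows "wsum (\<lambda>i. 1 / sqrt (a i)) (N x) \<le> ennreal (L\<^sup>2) * wsum a x"
  using N_lipschitz[OF assms, of "\<lambda>_. 0"] N_zero by (simp add: fun_cong[OF N_zero])

lemma force_bound:
  assumes "admissible T x"
  obtains K where "0 \<le> K" "AE s in lborel. s \<in> {0..T} \<longrightarrow> wsum (\<lambda>i. 1 / sqrt (a i)) (\<lambda>i. N (x s) i + g s i) \<le> ennreal K"
proof -
  obtain K where K: "\<And>s. s \<in> {0..T} \<Longrightarrow> wsum a (x s) \<le> ennreal K"
    using assms unfolding admissible_def by metis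
  have "AE s in lborel. s \<in> {0..T} \<longrightarrow> wsum (\<lambda>i. 1 / sqrt (a i)) (\<lambda>i. N (x s) i + g s i) \<le> ennreal (2 * (L\<^sup>2 * \<bar>K\<bar>) + 2 * M)"
    using g_bound
  proof eventually_elim
    case (elim s)
    show ?case
    proof
      assume s: "s \<in> {0..T}"
      have "wsum (\<lambda>i. 1 / sqrt (a i)) (N (x s)) \<le> ennreal (L\<^sup>2) * wsum a (x s)"
        using K[OF s] by (intro N_bound) (auto simp: less_top[symmetric] top_unique)
      also have "\<dots> \<le> ennreal (L\<^sup>2) * ennreal \<bar>K\<bar>"
        using K[OF s] by (intro mult_left_mono) (auto intro: order_trans ennreal_leI)
      also have "\<dots> = ennreal (L\<^sup>2 * \<bar>K\<bar>)" by (simp add: ennreal_mult)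
      finally have *: "wsum (\<lambda>i. 1 / sqrt (a i)) (N (x s)) \<le> ennreal (L\<^sup>2 * \<bar>K\<bar>)" .
      have "wsum (\<lambda>i. 1 / sqrt (a i)) (\<lambda>i. N (x s) i + g s i) \<le>
          2 * wsum (\<lambda>i. 1 / sqrt (a i)) (N (x s)) + 2 * wsum (\<lambda>i. 1 / sqrt (a i)) (g s)"
        using a_nonneg by (intro wsum_add_le) auto
      also have "\<dots> \<le> 2 * ennreal (L\<^sup>2 * \<bar>K\<bar>) + 2 * ennreal M"
        using * elim s by (intro add_mono mult_left_mono) auto
      also have "\<dots> = ennreal (2 * (L\<^sup>2 * \<bar>K\<bar>) + 2 * M)"
        using M_nonneg by (simp add: ennreal_mult)
      finally show "wsum (\<lambda>i. 1 / sqrt (a i)) (\<lambda>i. N (x s) i + g s i) \<le> ennreal (2 * (L\<^sup>2 * \<bar>K\<bar>) + 2 * M)" .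
    qed
  qed
  then show thesis using that[of "2 * (L\<^sup>2 * \<bar>K\<bar>) + 2 * M"] M_nonneg by simp
qed

lemma force_measurable:
  assumes "admissible T x"
  shows "(\<lambda>s. N (x s) i + g s i) \<in> borel_measurable borel"
  using assms N_measurable[of x i] g_measurable[of i] unfolding admissible_def by auto

lemma force_integrable:
  assumes "admissible T x" "t \<in> {0..T}"
  shows "set_integrable lborel {0..t} (\<lambda>s. N (x s) i + g s i)"
proof -
  obtain K where K: "0 \<le> K" "AE s in lborel. s \<in> {0..T} \<longrightarrow> wsum (\<lambda>i. 1 / sqrt (a i)) (\<lambda>i. N (x s) i + g s i) \<le> ennreal K"
    using force_bound[OF assms(1)] by blast
  have "AE s in lborel. s \<in> {0..T} \<longrightarrow> wsum (\<lambda>i. 1 / sqrt (a i)) (\<lambda>i. N (x s) i + g s i) \<le> ennreal (K * exp (1 * s))"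
    using K(2)
  proof eventually_elim
    case (elim s)
    have "K \<le> K * exp (1 * s)" if "s \<in> {0..T}" using that K(1) by (simp add: mult_le_cancel_left1)
    then show ?case using elim by (auto intro: order_trans ennreal_leI)
  qed
  from duhamel_smoothing(1)[where a=a, OF a_pos zero_less_one K(1) force_measurable[OF assms(1)] this assms(2)]
  show ?thesis .
qed

lemma admissible_duh:
  assumes "admissible T x"
  shows "admissible T (duh x)"
proof -
  have m: "(\<lambda>s. duh x s i) \<in> borel_measurable borel" for i
    unfolding duh_def using measurable_duhamel[OF force_measurable[OF assms]] by (intro borel_measurable_add) auto
  obtain K where K: "0 \<le> K" "AE s in lborel. s \<in> {0..T} \<longrightarrow> wsum (\<lambda>i. 1 / sqrt (a i)) (\<lambda>i. N (x s) i + g s i) \<le> ennreal K"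
    using force_bound[OF assms] by blast
  have K': "AE s in lborel. s \<in> {0..T} \<longrightarrow> wsum (\<lambda>i. 1 / sqrt (a i)) (\<lambda>i. N (x s) i + g s i) \<le> ennreal (K * exp (1 * s))"
    using K(2)
  proof eventually_elim
    case (elim s)
    have "K \<le> K * exp (1 * s)" if "s \<in> {0..T}" using that K(1) by (simp add: mult_le_cancel_left1)
    then show ?case using elim by (auto intro: order_trans ennreal_leI)
  qed
  define Q where "Q = K * exp (1 * T) * (4 * T powr (1/4) * 1 powr (-1/4))"
  have Q0: "0 \<le> Q" unfolding Q_def using K(1) by simp
  define B where "B = 2 * enn2real (wsum a x0) + 2 * Q"
  have "wsum a (duh x t) \<le> ennreal B" if t: "t \<in> {0..T}" for t
  proof -
    have 1: "wsum a (duh x t) \<le> 2 * wsum a (\<lambda>i. exp (- a i * t) *\<^sub>R x0 i) +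
       2 * wsum a (\<lambda>i. LINT s:{0..t}|lborel. exp (- a i * (t - s)) *\<^sub>R (N (x s) i + g s i))"
      unfolding duh_def[abs_def] using a_nonneg by (intro wsum_add_le)
    have 2: "wsum a (\<lambda>i. exp (- a i * t) *\<^sub>R x0 i) \<le> wsum a x0"
      using a_nonneg t by (intro wsum_mono mult_left_mono power_mono) (auto intro!: mult_left_le_one_le)
    have "wsum a (\<lambda>i. LINT s:{0..t}|lborel. exp (- a i * (t - s)) *\<^sub>R (N (x s) i + g s i))
        \<le> ennreal (K * exp (1 * t) * (4 * t powr (1/4) * 1 powr (-1/4)))"
      by (rule duhamel_smoothing(2)[where a=a, OF a_pos zero_less_one K(1) force_measurable[OF assms(1)] K' t])
    also have "\<dots> \<le> ennreal Q"
      unfolding Q_def using t K(1) by (intro ennreal_leI mult_mono) (auto intro!: powr_mono2)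
    finally have 3: "wsum a (\<lambda>i. LINT s:{0..t}|lborel. exp (- a i * (t - s)) *\<^sub>R (N (x s) i + g s i)) \<le> ennreal Q" .
    have "wsum a (duh x t) \<le> 2 * wsum a x0 + 2 * ennreal Q"
      by (rule order_trans[OF 1 add_mono[OF mult_left_mono[OF 2] mult_left_mono[OF 3]]]) auto
    also have "\<dots> = ennreal B"
      unfolding B_def by (rule two_ennreal[OF x0_finite Q0])
    finally show ?thesis .
  qed
  then show ?thesis unfolding admissible_def using m by blast
qed

text \<open>Chosen so that its power -1/4 beats the smoothing constant: the fourth power undoes the
  exponent -1/4, and 16 is the 4 of \<open>singular_kernel_bound\<close> times the 4 needed for the
  contraction factor 1/4. The added ones keep it positive.\<close>

definition rate :: "real \<Rightarrow> real" where
  "rate T = (16 * (L\<^sup>2 + 1) * (T powr (1/4) + 1)) ^ 4"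

lemma rate_pos: "0 < rate T"
  unfolding rate_def by (intro zero_less_power mult_pos_pos add_nonneg_pos) auto

lemma rate_small:
  assumes "t \<in> {0..T}"
  shows "L\<^sup>2 * (4 * t powr (1/4) * rate T powr (-1/4)) \<le> 1/4"
proof -
  define q where "q = 16 * (L\<^sup>2 + 1) * (T powr (1/4) + 1)"
  have q: "0 < q" unfolding q_def by (intro mult_pos_pos add_nonneg_pos) auto
  have "rate T powr (-1/4) = 1 / q"
  proof -
    have "rate T = q powr 4" unfolding rate_def q_def[symmetric] using q by simp
    then have "rate T powr (-1/4) = q powr (4 * (-1/4))" by (simp only: powr_powr)
    also have "\<dots> = 1 / q" using q by (simp add: powr_minus_divide)
    finally show ?thesis .
  qed
  moreover have "16 * (L\<^sup>2 * t powr (1/4)) \<le> q"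
  proof -
    have "t powr (1/4) \<le> T powr (1/4)" using assms by (intro powr_mono2) auto
    then have "L\<^sup>2 * t powr (1/4) \<le> (L\<^sup>2 + 1) * (T powr (1/4) + 1)" by (intro mult_mono) auto
    then show ?thesis unfolding q_def by linarith
  qed
  ultimately show ?thesis using q by (simp only:) (simp add: field_simps)
qed

text \<open>The datum and \<open>g\<close> cancel in the difference, the Lipschitz bound puts
  \<open>N x - N y\<close> into the weaker norm, and the smoothing brings it back with a constant of
  at most 1/4 by \<open>rate_small\<close>. A factor below 1/2 is wanted because
  \<open>wsum_add_le\<close> doubles squared norms whenever iterates are compared.\<close>

lemma contraction:
  assumes x: "admissible T x" and y: "admissible T y" and D: "0 \<le> D"
    and d: "\<And>s. s \<in> {0..T} \<Longrightarrow> wsum a (\<lambda>i. x s i - y s i) \<le> ennreal (D * exp (rate T * s))"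
    and t: "t \<in> {0..T}"
  shows "wsum a (\<lambda>i. duh x t i - duh y t i) \<le> ennreal (D / 4 * exp (rate T * t))"
proof -
  have m: "(\<lambda>s. N (x s) i - N (y s) i) \<in> borel_measurable borel" for i
    using x y N_measurable[of x i] N_measurable[of y i] unfolding admissible_def by auto
  have b: "wsum (\<lambda>i. 1 / sqrt (a i)) (\<lambda>i. N (x s) i - N (y s) i) \<le> ennreal (L\<^sup>2 * D * exp (rate T * s))"
    if s: "s \<in> {0..T}" for s
  proof -
    have "wsum (\<lambda>i. 1 / sqrt (a i)) (\<lambda>i. N (x s) i - N (y s) i) \<le> ennreal (L\<^sup>2) * wsum a (\<lambda>i. x s i - y s i)"
      using x y s unfolding admissible_def by (intro N_lipschitz) (metis ennreal_less_top infinity_ennreal_def le_less_trans)+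
    also have "\<dots> \<le> ennreal (L\<^sup>2) * ennreal (D * exp (rate T * s))" by (intro mult_left_mono d s) auto
    also have "\<dots> = ennreal (L\<^sup>2 * D * exp (rate T * s))" using D by (simp add: ennreal_mult[symmetric] mult.assoc)
    finally show ?thesis .
  qed
  have eq: "duh x t i - duh y t i = (LINT s:{0..t}|lborel. exp (- a i * (t - s)) *\<^sub>R (N (x s) i - N (y s) i))" for i
  proof -
    have I: "set_integrable lborel {0..t} (\<lambda>s. exp (- a i * (t - s)) *\<^sub>R (N (z s) i + g s i))" if "admissible T z" for z
    proof -
      have "set_integrable lborel {0..t} (\<lambda>s. exp (a i * s + (- a i * t)) *\<^sub>R (N (z s) i + g s i))"
        by (rule set_integrable_exp_scaleR[OF force_integrable[OF that t]])
      then show ?thesis by (simp add: algebra_simps)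
    qed
    have "duh x t i - duh y t i = (LINT s:{0..t}|lborel. exp (- a i * (t - s)) *\<^sub>R (N (x s) i + g s i)
        - exp (- a i * (t - s)) *\<^sub>R (N (y s) i + g s i))"
      unfolding duh_def by (subst set_integral_diff(2)[OF I[OF x] I[OF y]]) simp
    also have "\<dots> = (LINT s:{0..t}|lborel. exp (- a i * (t - s)) *\<^sub>R (N (x s) i - N (y s) i))"
      by (simp add: scaleR_right_diff_distrib[symmetric])
    finally show ?thesis .
  qed
  have "wsum a (\<lambda>i. duh x t i - duh y t i) \<le> ennreal (L\<^sup>2 * D * exp (rate T * t) * (4 * t powr (1/4) * rate T powr (-1/4)))"
    unfolding eq using b D
    by (intro duhamel_smoothing(2)[where a=a and T=T, OF a_pos rate_pos _ m _ t] AE_I2) auto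
  also have "\<dots> \<le> ennreal (D / 4 * exp (rate T * t))"
  proof (rule ennreal_leI)
    have "(D * exp (rate T * t)) * (L\<^sup>2 * (4 * t powr (1/4) * rate T powr (-1/4))) \<le> (D * exp (rate T * t)) * (1/4)"
      using rate_small[OF t] D by (intro mult_left_mono) auto
    then show "L\<^sup>2 * D * exp (rate T * t) * (4 * t powr (1/4) * rate T powr (-1/4)) \<le> D / 4 * exp (rate T * t)"
      by (simp add: mult_ac)
  qed
  finally show ?thesis .
qed

text \<open>The bounds of the two paths give a first estimate \<open>D\<close> of their distance. As
  fixed points of \<open>duh\<close> they inherit the contraction, so the exponentially weighted
  distance is at most \<open>D / 4^n\<close> for every \<open>n\<close>.\<close>

theorem uniqueness:
  assumes x: "admissible T x" and y: "admissible T y"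
    and fx: "\<And>t i. t \<in> {0..T} \<Longrightarrow> x t i = duh x t i" and fy: "\<And>t i. t \<in> {0..T} \<Longrightarrow> y t i = duh y t i"
    and t: "t \<in> {0..T}"
  shows "x t i = y t i"
proof -
  obtain K K' where K: "\<And>s. s \<in> {0..T} \<Longrightarrow> wsum a (x s) \<le> ennreal K" and K': "\<And>s. s \<in> {0..T} \<Longrightarrow> wsum a (y s) \<le> ennreal K'"
    using x y unfolding admissible_def by metis
  define D where "D = 2 * \<bar>K\<bar> + 2 * \<bar>K'\<bar>"
  have D: "0 \<le> D" by (simp add: D_def)
  have base: "wsum a (\<lambda>i. x s i - y s i) \<le> ennreal (D * exp (rate T * s))" if s: "s \<in> {0..T}" for s
  proof -
    have "wsum a (\<lambda>i. x s i - y s i) \<le> 2 * wsum a (x s) + 2 * wsum a (\<lambda>i. - y s i)"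
      using wsum_add_le[of a "x s" "\<lambda>i. - y s i"] a_nonneg by simp
    also have "wsum a (\<lambda>i. - y s i) = wsum a (y s)" by (simp add: wsum_def)
    also have "2 * wsum a (x s) + 2 * wsum a (y s) \<le> 2 * ennreal \<bar>K\<bar> + 2 * ennreal \<bar>K'\<bar>"
      using K[OF s] K'[OF s] by (intro add_mono mult_left_mono) (auto intro: order_trans ennreal_leI)
    also have "\<dots> = ennreal D" by (simp add: D_def ennreal_mult)
    also have "\<dots> \<le> ennreal (D * exp (rate T * s))"
      using D s rate_pos[of T] by (intro ennreal_leI) (auto simp: mult_le_cancel_left1)
    finally show ?thesis .
  qed
  have step: "\<forall>s\<in>{0..T}. wsum a (\<lambda>i. x s i - y s i) \<le> ennreal (D / 4 ^ n * exp (rate T * s))" for n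
  proof (induction n)
    case 0 then show ?case using base by simp
  next
    case (Suc n)
    show ?case
    proof
      fix s assume s: "s \<in> {0..T}"
      have "wsum a (\<lambda>i. duh x s i - duh y s i) \<le> ennreal (D / 4 ^ n / 4 * exp (rate T * s))"
        using Suc D by (intro contraction[OF x y _ _ s]) auto
      then show "wsum a (\<lambda>i. x s i - y s i) \<le> ennreal (D / 4 ^ Suc n * exp (rate T * s))"
        using fx[OF s] fy[OF s] by (simp add: mult.commute)
    qed
  qed
  have "a i * (norm (x t i - y t i))\<^sup>2 \<le> D * exp (rate T * t) * (1 / 4) ^ n" for n
  proof -
    have "ennreal (a i * (norm (x t i - y t i))\<^sup>2) \<le> ennreal (D / 4 ^ n * exp (rate T * t))"
      using step[of n] t wsum_mode_le[of a i "\<lambda>i. x t i - y t i"] a_nonneg by (auto intro: order_trans)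
    then show ?thesis using D by (simp add: power_one_over field_simps)
  qed
  moreover have "(\<lambda>n. D * exp (rate T * t) * (1 / 4) ^ n) \<longlonglongrightarrow> D * exp (rate T * t) * 0"
    by (intro tendsto_intros LIMSEQ_power_zero) auto
  ultimately have "a i * (norm (x t i - y t i))\<^sup>2 \<le> D * exp (rate T * t) * 0"
    by (intro LIMSEQ_le_const) auto
  then have "a i * (norm (x t i - y t i))\<^sup>2 \<le> 0" by simp
  then show ?thesis using a_pos[of i] by (simp add: mult_le_0_iff)
qed

end

text \<open>The limit of the Picard iterates is known mode by mode only, while their bounds are in
  the weighted norm; Fatou's lemma over the modes connects the two.\<close>

lemma wsum_Fatou:
  fixes v :: "nat \<Rightarrow> 'i \<Rightarrow> 'e::real_normed_vector"
  assumes lim: "\<And>i. (\<lambda>k. v k i) \<longlonglongrightarrow> v' i" and le: "\<And>k. wsum w (v k) \<le> C"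
  shows "wsum w v' \<le> C"
proof -
  have "ennreal (w i * (norm (v' i))\<^sup>2) = liminf (\<lambda>k. ennreal (w i * (norm (v k i))\<^sup>2))" for i
    by (rule lim_imp_Liminf[symmetric]) (auto intro!: tendsto_intros lim)
  then have "wsum w v' = nsum (\<lambda>i. liminf (\<lambda>k. ennreal (w i * (norm (v k i))\<^sup>2)))"
    by (simp add: wsum_def)
  also have "\<dots> \<le> liminf (\<lambda>k. wsum w (v k))"
    unfolding wsum_def by (rule nn_integral_liminf) auto
  also have "\<dots> \<le> C" using le by (intro Liminf_le) auto
  finally show ?thesis .
qed

lemma two_ennreal_real:
  assumes "0 \<le> p" "0 \<le> q"
  shows "2 * ennreal p + 2 * ennreal q = ennreal (2 * p + 2 * q)"
  using two_ennreal[of "ennreal p" q] assms by simp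

section \<open>Convergence of the Picard iteration\<close>

context semilinear
begin

definition picard :: "nat \<Rightarrow> real \<Rightarrow> 'i \<Rightarrow> 'e" where
  "picard n = (duh ^^ n) (\<lambda>_ _. 0)"

lemma picard_Suc: "picard (Suc n) = duh (picard n)"
  by (simp add: picard_def)

lemma admissible_picard: "admissible T (picard n)"
proof (induction n)
  case 0
  show ?case by (auto simp: picard_def admissible_def)
next
  case (Suc n)
  then show ?case unfolding picard_Suc by (rule admissible_duh)
qed

text \<open>The bound has to be uniform in \<open>k\<close>. The constant \<open>4 D\<close> is the
  one that reproduces itself in the induction:
  \<open>2 * (4 D / 4^(n+1)) + 2 * (D / 4^n) = 4 D / 4^n\<close>.\<close>

lemma picard_close:
  obtains D where "0 \<le> D"
    "\<And>n k s. s \<in> {0..T} \<Longrightarrow> wsum a (\<lambda>i. picard (n + k) s i - picard n s i) \<le> ennreal (4 * D / 4 ^ n * exp (rate T * s))"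
proof -
  obtain K where K: "\<And>s. s \<in> {0..T} \<Longrightarrow> wsum a (picard (Suc 0) s) \<le> ennreal K"
    using admissible_picard[of T "Suc 0"] unfolding admissible_def by metis
  define D where "D = \<bar>K\<bar>"
  have D: "0 \<le> D" by (simp add: D_def)
  have step: "wsum a (\<lambda>i. picard (Suc n) s i - picard n s i) \<le> ennreal (D / 4 ^ n * exp (rate T * s))"
    if "s \<in> {0..T}" for n s
    using that
  proof (induction n arbitrary: s)
    case 0
    have "K \<le> D * exp (rate T * s)"
      using mult_left_mono[of 1 "exp (rate T * s)" D] 0 rate_pos[of T] D by (auto simp: D_def)
    then have "ennreal K \<le> ennreal (D / 4 ^ 0 * exp (rate T * s))" by (intro ennreal_leI) simp
    with K[OF 0] have "wsum a (picard (Suc 0) s) \<le> ennreal (D / 4 ^ 0 * exp (rate T * s))" by (rule order_trans)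
    then show ?case by (simp add: picard_def)
  next
    case (Suc n)
    have "wsum a (\<lambda>i. duh (picard (Suc n)) s i - duh (picard n) s i) \<le> ennreal (D / 4 ^ n / 4 * exp (rate T * s))"
      using Suc D by (intro contraction[OF admissible_picard admissible_picard]) auto
    then show ?case by (simp add: picard_Suc mult.commute)
  qed
  have close: "wsum a (\<lambda>i. picard (n + k) s i - picard n s i) \<le> ennreal (4 * D / 4 ^ n * exp (rate T * s))"
    if s: "s \<in> {0..T}" for n k s
  proof (induction k arbitrary: n)
    case 0 then show ?case by simp
  next
    case (Suc k)
    have "wsum a (\<lambda>i. picard (n + Suc k) s i - picard n s i) =
      wsum a (\<lambda>i. (picard (Suc n + k) s i - picard (Suc n) s i) + (picard (Suc n) s i - picard n s i))" by simp
    also have "\<dots> \<le> 2 * wsum a (\<lambda>i. picard (Suc n + k) s i - picard (Suc n) s i) + 2 * wsum a (\<lambda>i. picard (Suc n) s i - picard n s i)"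
      by (rule wsum_add_le[OF a_nonneg])
    also have "\<dots> \<le> 2 * ennreal (4 * D / 4 ^ Suc n * exp (rate T * s)) + 2 * ennreal (D / 4 ^ n * exp (rate T * s))"
      using Suc.IH[of "Suc n"] step[OF s, of n] by (intro add_mono mult_left_mono) auto
    also have "\<dots> = ennreal (2 * (4 * D / 4 ^ Suc n * exp (rate T * s)) + 2 * (D / 4 ^ n * exp (rate T * s)))"
      using D by (intro two_ennreal_real) auto
    also have "2 * (4 * D / 4 ^ Suc n * exp (rate T * s)) + 2 * (D / 4 ^ n * exp (rate T * s)) = 4 * D / 4 ^ n * exp (rate T * s)"
      by simp
    finally show ?case .
  qed
  show thesis by (rule that[OF D close])
qed

lemma convergent_picard:
  assumes "0 \<le> t" shows "convergent (\<lambda>n. picard n t i)"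
proof -
  obtain D where D: "0 \<le> D" and close:
    "\<And>n k s. s \<in> {0..t} \<Longrightarrow> wsum a (\<lambda>i. picard (n + k) s i - picard n s i) \<le> ennreal (4 * D / 4 ^ n * exp (rate t * s))"
    by (rule picard_close[of t]) blast
  define C where "C = sqrt (4 * D * exp (rate t * t) / a i)"
  have le: "norm (picard (n + k) t i - picard n t i) \<le> C * (1/2) ^ n" for n k
  proof -
    have "ennreal (a i * (norm (picard (n + k) t i - picard n t i))\<^sup>2) \<le> ennreal (4 * D / 4 ^ n * exp (rate t * t))"
      using assms order_trans[OF wsum_mode_le[of a i "\<lambda>i. picard (n + k) t i - picard n t i", OF a_nonneg] close] by auto
    then have "a i * (norm (picard (n + k) t i - picard n t i))\<^sup>2 \<le> 4 * D / 4 ^ n * exp (rate t * t)"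
      using D by simp
    then have "(norm (picard (n + k) t i - picard n t i))\<^sup>2 \<le> (4 * D * exp (rate t * t) / a i) * (1/4) ^ n"
      using a_pos[of i] by (simp add: field_simps)
    then have "norm (picard (n + k) t i - picard n t i) \<le> sqrt ((4 * D * exp (rate t * t) / a i) * (1/4) ^ n)"
      by (rule real_le_rsqrt)
    also have "\<dots> = C * sqrt ((1/4) ^ n)" unfolding C_def by (rule real_sqrt_mult)
    also have "sqrt ((1/4) ^ n) = (1/2 :: real) ^ n"
      by (simp add: real_sqrt_power real_sqrt_divide)
    finally show ?thesis .
  qed
  have lim: "(\<lambda>n. C * (1/2) ^ n) \<longlonglongrightarrow> C * 0" by (intro tendsto_intros LIMSEQ_power_zero) auto
  have "Cauchy (\<lambda>n. picard n t i)"
  proof (rule CauchyI')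
    fix e :: real assume "0 < e"
    then have "\<forall>\<^sub>F n in sequentially. C * (1/2) ^ n < e" using order_tendstoD(2)[OF lim, of e] by simp
    then obtain N where N: "\<And>n. n \<ge> N \<Longrightarrow> C * (1/2) ^ n < e" by (auto simp: eventually_sequentially)
    have "norm (picard m t i - picard n t i) < e" if "N \<le> m" "m < n" for m n
      using order_le_less_trans[OF le[of m "n - m"] N[OF that(1)]] that by (simp add: norm_minus_commute)
    then show "\<exists>M. \<forall>m\<ge>M. \<forall>n>m. dist (picard m t i) (picard n t i) < e" by (auto simp: dist_norm)
  qed
  then show ?thesis by (rule Cauchy_convergent)
qed

text \<open>Only the single modes are shown to converge; \<open>wsum_Fatou\<close> turns the Cauchy
  bounds into convergence in the weighted norm. The fixed point property follows by comparing
  \<open>x\<close> and \<open>duh x\<close> with the same iterate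
  \<open>picard (Suc n)\<close>.\<close>

theorem existence:
  "\<exists>x. (\<forall>T. admissible T x) \<and> (\<forall>t\<ge>0. \<forall>i. x t i = duh x t i)"
proof (intro exI conjI allI impI)
  \<comment> \<open>For negative \<open>t\<close> the iterates may fail to converge;
    \<open>lim\<close> still gives a function that is measurable on the whole line.\<close>
  define x where "x t i = lim (\<lambda>n. picard n t i)" for t i
  have xlim: "(\<lambda>n. picard n t i) \<longlonglongrightarrow> x t i" if "0 \<le> t" for t i
    unfolding x_def using convergent_picard[OF that] by (simp add: convergent_LIMSEQ_iff)
  have xm: "(\<lambda>t. x t i) \<in> borel_measurable borel" for i
  proof -
    have "(\<lambda>t. picard n t i) \<in> borel_measurable borel" for n
      using admissible_picard[of 0 n] unfolding admissible_def by blast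
    then show ?thesis unfolding x_def by (rule borel_measurable_lim_metric)
  qed
  have close: "\<exists>D\<ge>0. \<forall>n. \<forall>s\<in>{0..T}. wsum a (\<lambda>i. x s i - picard n s i) \<le> ennreal (4 * D / 4 ^ n * exp (rate T * s))" for T
  proof -
    obtain D where D: "0 \<le> D" and close:
      "\<And>n k s. s \<in> {0..T} \<Longrightarrow> wsum a (\<lambda>i. picard (n + k) s i - picard n s i) \<le> ennreal (4 * D / 4 ^ n * exp (rate T * s))"
      by (rule picard_close[of T]) blast
    have "wsum a (\<lambda>i. x s i - picard n s i) \<le> ennreal (4 * D / 4 ^ n * exp (rate T * s))" if "s \<in> {0..T}" for n s
    proof (rule wsum_Fatou[where v="\<lambda>k i. picard (n + k) s i - picard n s i"])
      show "(\<lambda>k. picard (n + k) s i - picard n s i) \<longlonglongrightarrow> x s i - picard n s i" for i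
        using that LIMSEQ_ignore_initial_segment[OF xlim[of s i], of n] by (intro tendsto_intros) (simp add: add.commute)
    qed (rule close[OF that])
    with D show ?thesis by blast
  qed
  show adm: "admissible T x" for T
  proof -
    obtain D where D: "D \<ge> 0" "\<And>n s. s\<in>{0..T} \<Longrightarrow> wsum a (\<lambda>i. x s i - picard n s i) \<le> ennreal (4 * D / 4 ^ n * exp (rate T * s))"
      using close[of T] by blast
    have "wsum a (x s) \<le> ennreal (4 * D * exp (rate T * T))" if "s \<in> {0..T}" for s
    proof -
      have "wsum a (x s) \<le> ennreal (4 * D * exp (rate T * s))"
        using D(2)[OF that, of 0] by (simp add: picard_def)
      also have "\<dots> \<le> ennreal (4 * D * exp (rate T * T))"
        using that rate_pos[of T] D(1) by (intro ennreal_leI mult_left_mono) auto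
      finally show ?thesis .
    qed
    then show ?thesis unfolding admissible_def using xm by blast
  qed
  fix t :: real and i assume t: "0 \<le> t"
  obtain D where D: "D \<ge> 0" "\<And>n s. s\<in>{0..t} \<Longrightarrow> wsum a (\<lambda>i. x s i - picard n s i) \<le> ennreal (4 * D / 4 ^ n * exp (rate t * s))"
    using close[of t] by blast
  have bound: "a i * (norm (x t i - duh x t i))\<^sup>2 \<le> (4 * D * exp (rate t * t)) * (1/4) ^ n" for n
  proof -
    have tt: "t \<in> {0..t}" using t by auto
    have 1: "wsum a (\<lambda>i. x t i - picard (Suc n) t i) \<le> ennreal (4 * D / 4 ^ Suc n * exp (rate t * t))" by (rule D(2)[OF tt])
    have 2: "wsum a (\<lambda>i. duh x t i - duh (picard n) t i) \<le> ennreal (4 * D / 4 ^ n / 4 * exp (rate t * t))"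
      using D by (intro contraction[OF adm admissible_picard _ _ tt]) auto
    have "ennreal (a i * (norm (x t i - duh x t i))\<^sup>2) \<le> wsum a (\<lambda>i. x t i - duh x t i)"
      by (rule wsum_mode_le[of a i "\<lambda>i. x t i - duh x t i", OF a_nonneg])
    also have "\<dots> = wsum a (\<lambda>i. (x t i - picard (Suc n) t i) + (duh (picard n) t i - duh x t i))"
      by (simp add: picard_Suc)
    also have "\<dots> \<le> 2 * wsum a (\<lambda>i. x t i - picard (Suc n) t i) + 2 * wsum a (\<lambda>i. duh (picard n) t i - duh x t i)"
      by (rule wsum_add_le[OF a_nonneg])
    also have "\<dots> \<le> 2 * ennreal (4 * D / 4 ^ Suc n * exp (rate t * t)) + 2 * ennreal (4 * D / 4 ^ n / 4 * exp (rate t * t))"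
      using 1 2 by (intro add_mono mult_left_mono) (auto simp: wsum_minus_commute)
    also have "\<dots> = ennreal (2 * (4 * D / 4 ^ Suc n * exp (rate t * t)) + 2 * (4 * D / 4 ^ n / 4 * exp (rate t * t)))"
      using D(1) by (intro two_ennreal_real) auto
    finally have "a i * (norm (x t i - duh x t i))\<^sup>2 \<le> 2 * (4 * D / 4 ^ Suc n * exp (rate t * t)) + 2 * (4 * D / 4 ^ n / 4 * exp (rate t * t))"
      using D(1) by (subst (asm) ennreal_le_iff) auto
    then show ?thesis by (simp add: power_one_over field_simps)
  qed
  have "(\<lambda>n. (4 * D * exp (rate t * t)) * (1/4) ^ n) \<longlonglongrightarrow> (4 * D * exp (rate t * t)) * 0"
    by (intro tendsto_intros LIMSEQ_power_zero) auto
  then have "a i * (norm (x t i - duh x t i))\<^sup>2 \<le> (4 * D * exp (rate t * t)) * 0"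
    by (rule LIMSEQ_le_const) (use bound in auto)
  then show "x t i = duh x t i" using a_pos[of i] by (simp add: mult_le_0_iff)
qed

end

section \<open>Convolution estimates on the lattice\<close>


text \<open>The value \<open>1\<close> at \<open>k = 0\<close> keeps all weights positive; it is immaterial for mean-free fields.\<close>

definition jn :: "int \<times> int \<Rightarrow> real" where
  "jn k = max 1 (sqrt (wnorm2 k))"

lemma jn_ge_1: "1 \<le> jn k" by (simp add: jn_def)
lemma jn_pos: "0 < jn k" using jn_ge_1[of k] by linarith
lemma jn_nonneg: "0 \<le> jn k" using jn_pos[of k] by linarith
lemma jn_uminus[simp]: "jn (- k) = jn k" by (simp add: jn_def wnorm2_def)
lemma wnorm2_nonneg: "0 \<le> wnorm2 k" by (simp add: wnorm2_def)

lemma sqrt_wnorm2_le_jn: "sqrt (wnorm2 k) \<le> jn k" by (simp add: jn_def)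

lemma wnorm2_ge_1: assumes "k \<noteq> 0" shows "1 \<le> wnorm2 k"
proof -
  have "1 \<le> (fst k)\<^sup>2 + (snd k)\<^sup>2"
  proof (cases "fst k = 0")
    case True
    then have "snd k \<noteq> 0" using assms by (auto simp: prod_eq_iff)
    then have "0 < (snd k)\<^sup>2" by simp
    then show ?thesis by (smt (verit) zero_le_power2)
  next
    case False
    then have "0 < (fst k)\<^sup>2" by simp
    then show ?thesis by (smt (verit) zero_le_power2)
  qed
  then have "real_of_int 1 \<le> real_of_int ((fst k)\<^sup>2 + (snd k)\<^sup>2)" by (simp only: of_int_le_iff)
  then show ?thesis by (simp add: wnorm2_def)
qed

lemma jn_sq: assumes "k \<noteq> 0" shows "(jn k)\<^sup>2 = wnorm2 k"
  using wnorm2_ge_1[OF assms] by (simp add: jn_def max_def)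

lemma abs_fst_snd_le_jn: "max 1 \<bar>real_of_int (fst k)\<bar> \<le> jn k" "max 1 \<bar>real_of_int (snd k)\<bar> \<le> jn k"
  unfolding jn_def wnorm2_def by (auto intro!: max.coboundedI2 real_le_rsqrt)

lemma nsum_int_weight_finite: "nsum (\<lambda>i::int. ennreal (max 1 \<bar>real_of_int i\<bar> powr (-3/2))) < \<infinity>"
proof -
  let ?f = "\<lambda>i::int. ennreal (max 1 \<bar>real_of_int i\<bar> powr (-3/2))"
  have nat: "nsum (\<lambda>n::nat. ennreal (max 1 \<bar>real n\<bar> powr (-3/2))) < \<infinity>"
  proof -
    have "summable (\<lambda>n. real n powr (-3/2))" by (subst summable_real_powr_iff) simp
    then have s: "summable (\<lambda>n. real (Suc n) powr (-3/2))" by (subst summable_Suc_iff)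
    have "summable (\<lambda>n. max 1 \<bar>real (Suc n)\<bar> powr (-3/2))"
      using s by (simp add: max_def)
    then have "summable (\<lambda>n. max 1 \<bar>real n\<bar> powr (-3/2))" by (subst (asm) summable_Suc_iff)
    then have "(\<lambda>n. max 1 \<bar>real n\<bar> powr (-3/2)) summable_on UNIV"
      by (subst summable_on_UNIV_nonneg_real_iff) auto
    then show ?thesis by (subst nsum_real_iff) auto
  qed
  have A: "(\<integral>\<^sup>+i. ?f i * indicator (range int) i \<partial>count_space UNIV) = nsum (\<lambda>n::nat. ennreal (max 1 \<bar>real n\<bar> powr (-3/2)))"
  proof -
    have "nsum (\<lambda>n::nat. ?f (int n)) = (\<integral>\<^sup>+i. ?f i \<partial>count_space (range int))"
      by (rule nn_integral_bij_count_space) (simp add: bij_betw_def inj_on_def)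
    then show ?thesis by (simp add: nn_integral_count_space_indicator)
  qed
  have B: "(\<integral>\<^sup>+i. ?f i * indicator (range (\<lambda>n. - int n)) i \<partial>count_space UNIV) = nsum (\<lambda>n::nat. ennreal (max 1 \<bar>real n\<bar> powr (-3/2)))"
  proof -
    have "nsum (\<lambda>n::nat. ?f (- int n)) = (\<integral>\<^sup>+i. ?f i \<partial>count_space (range (\<lambda>n. - int n)))"
      by (rule nn_integral_bij_count_space[where g="\<lambda>n::nat. - int n"]) (simp add: bij_betw_def inj_on_def)
    then show ?thesis by (simp add: nn_integral_count_space_indicator)
  qed
  have "nsum ?f \<le> (\<integral>\<^sup>+i. ?f i * indicator (range int) i + ?f i * indicator (range (\<lambda>n. - int n)) i \<partial>count_space UNIV)"
  proof (intro nn_integral_mono)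
    fix i :: int
    have "i \<in> range int \<or> i \<in> range (\<lambda>n. - int n)"
      by (cases i rule: int_cases2) auto
    then show "?f i \<le> ?f i * indicator (range int) i + ?f i * indicator (range (\<lambda>n. - int n)) i"
      by (auto simp: indicator_def)
  qed
  also have "\<dots> = nsum (\<lambda>n::nat. ennreal (max 1 \<bar>real n\<bar> powr (-3/2))) + nsum (\<lambda>n::nat. ennreal (max 1 \<bar>real n\<bar> powr (-3/2)))"
    unfolding A[symmetric] by (subst nn_integral_add) (simp_all only: A B, auto)
  also have "\<dots> < \<infinity>" using nat by (simp add: ennreal_add_less_top)
  finally show ?thesis .
qed

definition inv_cube_sum :: ennreal where "inv_cube_sum = nsum (\<lambda>k. ennreal (1 / jn k ^ 3))"

text \<open>\<open>jn\<close> dominates both \<open>max 1 |i|\<close> and \<open>max 1 |j|\<close>.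
  Its inverse cube, written as a product of two powers -3/2, is therefore bounded by the terms of a
  product of two convergent one-dimensional sums.\<close>

lemma inv_cube_sum_finite: "inv_cube_sum < \<infinity>"
proof -
  let ?f = "\<lambda>i::int. max 1 \<bar>real_of_int i\<bar> powr (-3/2)"
  have "inv_cube_sum \<le> nsum (\<lambda>(i, j). ennreal (?f i) * ennreal (?f j))"
    unfolding inv_cube_sum_def
  proof (intro nn_integral_mono, clarify)
    fix i j :: int
    have "jn (i, j) powr (-3/2) \<le> ?f i" "jn (i, j) powr (-3/2) \<le> ?f j"
      using abs_fst_snd_le_jn[of "(i, j)"] by (auto intro!: powr_mono2')
    then have "jn (i, j) powr (-3/2) * jn (i, j) powr (-3/2) \<le> ?f i * ?f j"
      by (intro mult_mono) auto
    moreover have "jn (i, j) powr (-3/2) * jn (i, j) powr (-3/2) = 1 / jn (i, j) ^ 3"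
    proof -
      have "jn (i, j) powr (-3/2) * jn (i, j) powr (-3/2) = jn (i, j) powr (- 3)"
        by (simp add: powr_add[symmetric])
      also have "\<dots> = 1 / jn (i, j) ^ 3" using jn_pos[of "(i, j)"] by (simp add: powr_minus_divide)
      finally show ?thesis .
    qed
    ultimately show "ennreal (1 / jn (i, j) ^ 3) \<le> ennreal (?f i) * ennreal (?f j)"
      by (subst ennreal_mult[symmetric]) (auto intro!: ennreal_leI)
  qed
  also have "\<dots> = nsum (\<lambda>i. nsum (\<lambda>j. ennreal (?f i) * ennreal (?f j)))"
    by (subst nn_integral_fst_count_space[symmetric]) simp
  also have "\<dots> = nsum (\<lambda>i. ennreal (?f i)) * nsum (\<lambda>j. ennreal (?f j))"
    by (simp add: nn_integral_cmult nn_integral_multc)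
  also have "\<dots> < \<infinity>" using nsum_int_weight_finite by (simp add: ennreal_mult_less_top)
  finally show ?thesis .
qed

lemma nsum_reindex:
  assumes "bij \<phi>" shows "nsum (\<lambda>p. f (\<phi> p)) = nsum f"
  using assms by (rule nn_integral_bij_count_space)

lemma bij_minus_right: "bij (\<lambda>p. k - p)" for k :: "int \<times> int"
  by (rule bij_betw_byWitness[where f'="\<lambda>p. k - p"]) auto
lemma bij_minus_left: "bij (\<lambda>p. p - k)" for k :: "int \<times> int"
  by (rule bij_betw_byWitness[where f'="\<lambda>p. p + k"]) auto
lemma bij_plus_left: "bij (\<lambda>p. p + k)" for k :: "int \<times> int"
  by (rule bij_betw_byWitness[where f'="\<lambda>p. p - k"]) auto
lemma bij_uminus_pair: "bij (\<lambda>p :: int \<times> int. - p)"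
  by (rule bij_betw_byWitness[where f'="\<lambda>p. - p"]) auto

text \<open>\<open>1 / (x^2 y) \<le> 1 / x^3 + 1 / y^3\<close>, according to which of
  \<open>x\<close> and \<open>y\<close> is smaller. The bijection stands for the translations and
  reflections of the lattice that occur in convolutions; the bound does not depend on it.\<close>

lemma kernel_bound:
  assumes "bij \<phi>"
  shows "nsum (\<lambda>p. ennreal (1 / ((jn p)\<^sup>2 * jn (\<phi> p)))) \<le> 2 * inv_cube_sum"
proof -
  have "1 / (x\<^sup>2 * y) \<le> 1 / x ^ 3 + 1 / y ^ 3" if "0 < x" "0 < y" for x y :: real
  proof (cases "x \<le> y")
    case True
    then have "x ^ 3 \<le> x\<^sup>2 * y" using that by (simp add: power2_eq_square power3_eq_cube)
    then have "1 / (x\<^sup>2 * y) \<le> 1 / x ^ 3" using that by (intro divide_left_mono) auto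
    then show ?thesis using that by (smt (verit) zero_le_divide_1_iff zero_less_power)
  next
    case False
    then have "y ^ 3 \<le> x\<^sup>2 * y" using that by (simp add: power2_eq_square power3_eq_cube mult_mono)
    then have "1 / (x\<^sup>2 * y) \<le> 1 / y ^ 3" using that by (intro divide_left_mono) auto
    then show ?thesis using that by (smt (verit) zero_le_divide_1_iff zero_less_power)
  qed
  then have "nsum (\<lambda>p. ennreal (1 / ((jn p)\<^sup>2 * jn (\<phi> p)))) \<le> nsum (\<lambda>p. ennreal (1 / jn p ^ 3) + ennreal (1 / jn (\<phi> p) ^ 3))"
    using jn_pos by (intro nn_integral_mono) (auto simp: ennreal_plus[symmetric] jn_nonneg simp del: ennreal_plus intro!: ennreal_leI)
  also have "\<dots> = inv_cube_sum + nsum (\<lambda>p. ennreal (1 / jn (\<phi> p) ^ 3))"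
    unfolding inv_cube_sum_def by (rule nn_integral_add) auto
  also have "nsum (\<lambda>p. ennreal (1 / jn (\<phi> p) ^ 3)) = inv_cube_sum"
    unfolding inv_cube_sum_def by (rule nsum_reindex[OF assms, of "\<lambda>p. ennreal (1 / jn p ^ 3)"])
  finally show ?thesis by (simp add: mult_2)
qed

definition cv :: "(int \<times> int \<Rightarrow> ennreal) \<Rightarrow> (int \<times> int \<Rightarrow> ennreal) \<Rightarrow> int \<times> int \<Rightarrow> ennreal" where
  "cv A B k = nsum (\<lambda>p. A p * B (k - p))"

lemma nsum_swap:
  fixes f :: "'a::countable \<Rightarrow> 'b::countable \<Rightarrow> ennreal"
  shows "nsum (\<lambda>x. nsum (\<lambda>y. f x y)) = nsum (\<lambda>y. nsum (\<lambda>x. f x y))"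
  by (rule nsum_fubini) simp

lemma jn_cancel: "ennreal (jn p) * ennreal (1 / jn p) = 1"
  using jn_pos[of p] by (simp add: ennreal_mult[symmetric])

text \<open>With \<open>A\<close> the modulus of \<open>u\<close> and \<open>B\<close> that of \<open>\<nabla>v\<close>, the next two bounds control \<open>B(u,v)\<close> in
  \<open>H\<^sup>-\<^sup>1\<^sup>/\<^sup>2\<close> by \<open>\<parallel>u\<parallel> \<parallel>v\<parallel>\<close> and in \<open>H\<close> by \<open>\<parallel>u\<parallel>\<close> and the \<open>H\<^sup>3\<^sup>/\<^sup>2\<close>-norm of \<open>v\<close>.\<close>

lemma cv_bound_negative:
  "nsum (\<lambda>k. ennreal (1 / jn k) * (cv A B k)\<^sup>2) \<le>
     2 * inv_cube_sum * nsum (\<lambda>p. ennreal ((jn p)\<^sup>2) * (A p)\<^sup>2) * nsum (\<lambda>q. (B q)\<^sup>2)"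
proof -
  let ?X = "nsum (\<lambda>p. ennreal ((jn p)\<^sup>2) * (A p)\<^sup>2)"
  \<comment> \<open>Giving the weight \<open>jn p\<close> to \<open>A\<close> leaves
    \<open>1 / jn p\<close> with \<open>B\<close>. After the sums are exchanged,
    \<open>kernel_bound\<close> adds up \<open>1 / (jn p^2 jn (p + q))\<close> over
    \<open>p\<close>.\<close>
  have cs: "(cv A B k)\<^sup>2 \<le> ?X * nsum (\<lambda>p. ennreal (1 / (jn p)\<^sup>2) * (B (k - p))\<^sup>2)" for k
  proof -
    have "cv A B k = nsum (\<lambda>p. (ennreal (jn p) * A p) * (ennreal (1 / jn p) * B (k - p)))"
      unfolding cv_def
    proof (intro nn_integral_cong)
      fix p
      have "(ennreal (jn p) * A p) * (ennreal (1 / jn p) * B (k - p)) = (ennreal (jn p) * ennreal (1 / jn p)) * (A p * B (k - p))"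
        by (simp only: mult_ac)
      then show "A p * B (k - p) = (ennreal (jn p) * A p) * (ennreal (1 / jn p) * B (k - p))" by (simp only: jn_cancel mult_1)
    qed
    then have "(cv A B k)\<^sup>2 \<le> nsum (\<lambda>p. (ennreal (jn p) * A p)\<^sup>2) * nsum (\<lambda>p. (ennreal (1 / jn p) * B (k - p))\<^sup>2)"
      using Cauchy_Schwarz_nn_integral[of "\<lambda>p. ennreal (jn p) * A p" "count_space UNIV" "\<lambda>p. ennreal (1 / jn p) * B (k - p)"] by simp
    then show ?thesis using jn_nonneg by (simp add: power_mult_distrib ennreal_power power_one_over)
  qed
  have "nsum (\<lambda>k. ennreal (1 / jn k) * (cv A B k)\<^sup>2) \<le>
      nsum (\<lambda>k. ennreal (1 / jn k) * (?X * nsum (\<lambda>p. ennreal (1 / (jn p)\<^sup>2) * (B (k - p))\<^sup>2)))"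
    by (intro nn_integral_mono mult_left_mono cs) auto
  also have "\<dots> = nsum (\<lambda>k. ?X * nsum (\<lambda>p. ennreal (1 / ((jn p)\<^sup>2 * jn k)) * (B (k - p))\<^sup>2))"
  proof (intro nn_integral_cong)
    fix k
    have "ennreal (1 / jn k) * (?X * nsum (\<lambda>p. ennreal (1 / (jn p)\<^sup>2) * (B (k - p))\<^sup>2)) =
      ?X * (ennreal (1 / jn k) * nsum (\<lambda>p. ennreal (1 / (jn p)\<^sup>2) * (B (k - p))\<^sup>2))" by (simp only: mult_ac)
    also have "ennreal (1 / jn k) * nsum (\<lambda>p. ennreal (1 / (jn p)\<^sup>2) * (B (k - p))\<^sup>2) =
      nsum (\<lambda>p. ennreal (1 / jn k) * (ennreal (1 / (jn p)\<^sup>2) * (B (k - p))\<^sup>2))"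
      by (rule nn_integral_cmult[symmetric]) simp
    also have "\<dots> = nsum (\<lambda>p. ennreal (1 / ((jn p)\<^sup>2 * jn k)) * (B (k - p))\<^sup>2)"
      using jn_nonneg by (intro nn_integral_cong) (simp add: mult.assoc[symmetric] ennreal_mult[symmetric] mult.commute)
    finally show "ennreal (1 / jn k) * (?X * nsum (\<lambda>p. ennreal (1 / (jn p)\<^sup>2) * (B (k - p))\<^sup>2)) =
      ?X * nsum (\<lambda>p. ennreal (1 / ((jn p)\<^sup>2 * jn k)) * (B (k - p))\<^sup>2)" .
  qed
  also have "\<dots> = ?X * nsum (\<lambda>k. nsum (\<lambda>p. ennreal (1 / ((jn p)\<^sup>2 * jn k)) * (B (k - p))\<^sup>2))"
    by (rule nn_integral_cmult) simp
  finally have 1: "nsum (\<lambda>k. ennreal (1 / jn k) * (cv A B k)\<^sup>2) \<le> ?X * nsum (\<lambda>k. nsum (\<lambda>p. ennreal (1 / ((jn p)\<^sup>2 * jn k)) * (B (k - p))\<^sup>2))" .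
  have "nsum (\<lambda>k. nsum (\<lambda>p. ennreal (1 / ((jn p)\<^sup>2 * jn k)) * (B (k - p))\<^sup>2)) =
      nsum (\<lambda>p. nsum (\<lambda>k. ennreal (1 / ((jn p)\<^sup>2 * jn k)) * (B (k - p))\<^sup>2))" by (rule nsum_swap)
  also have "\<dots> = nsum (\<lambda>p. nsum (\<lambda>q. ennreal (1 / ((jn p)\<^sup>2 * jn (q + p))) * (B q)\<^sup>2))"
  proof (rule nn_integral_cong)
    fix p :: "int \<times> int"
    show "nsum (\<lambda>k. ennreal (1 / ((jn p)\<^sup>2 * jn k)) * (B (k - p))\<^sup>2) = nsum (\<lambda>q. ennreal (1 / ((jn p)\<^sup>2 * jn (q + p))) * (B q)\<^sup>2)"
      using nsum_reindex[OF bij_minus_left, of "\<lambda>q. ennreal (1 / ((jn p)\<^sup>2 * jn (q + p))) * (B q)\<^sup>2" p] by simp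
  qed
  also have "\<dots> = nsum (\<lambda>q. nsum (\<lambda>p. ennreal (1 / ((jn p)\<^sup>2 * jn (q + p))) * (B q)\<^sup>2))" by (rule nsum_swap)
  also have "\<dots> = nsum (\<lambda>q. nsum (\<lambda>p. ennreal (1 / ((jn p)\<^sup>2 * jn (p + q)))) * (B q)\<^sup>2)"
    by (intro nn_integral_cong) (simp add: nn_integral_multc add.commute)
  also have "\<dots> \<le> nsum (\<lambda>q. 2 * inv_cube_sum * (B q)\<^sup>2)"
    by (intro nn_integral_mono mult_right_mono kernel_bound bij_plus_left) auto
  also have "\<dots> = 2 * inv_cube_sum * nsum (\<lambda>q. (B q)\<^sup>2)" by (rule nn_integral_cmult) simp
  finally have "?X * nsum (\<lambda>k. nsum (\<lambda>p. ennreal (1 / ((jn p)\<^sup>2 * jn k)) * (B (k - p))\<^sup>2)) \<le> ?X * (2 * inv_cube_sum * nsum (\<lambda>q. (B q)\<^sup>2))"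
    by (rule mult_left_mono) simp
  with 1 show ?thesis by (simp add: mult_ac)
qed

lemma cv_bound_positive:
  "nsum (\<lambda>k. (cv A B k)\<^sup>2) \<le>
     2 * inv_cube_sum * nsum (\<lambda>p. ennreal ((jn p)\<^sup>2) * (A p)\<^sup>2) * nsum (\<lambda>q. ennreal (jn q) * (B q)\<^sup>2)"
proof -
  \<comment> \<open>Here both factors receive a weight; what remains is the kernel
    \<open>1 / (jn p^2 jn (k - p))\<close>, whose sum over \<open>p\<close> is bounded uniformly in
    \<open>k\<close>.\<close>
  define w where "w p q = jn p * sqrt (jn q)" for p q
  have w: "0 < w p q" for p q using jn_pos by (simp add: w_def)
  have w2: "(w p q)\<^sup>2 = (jn p)\<^sup>2 * jn q" for p q using jn_nonneg by (simp add: w_def power_mult_distrib)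
  have cs: "(cv A B k)\<^sup>2 \<le> nsum (\<lambda>p. (ennreal ((jn p)\<^sup>2) * (A p)\<^sup>2) * (ennreal (jn (k - p)) * (B (k - p))\<^sup>2)) * (2 * inv_cube_sum)" for k
  proof -
    have "cv A B k = nsum (\<lambda>p. (ennreal (w p (k - p)) * (A p * B (k - p))) * ennreal (1 / w p (k - p)))"
      unfolding cv_def
    proof (intro nn_integral_cong)
      fix p
      have "(ennreal (w p (k - p)) * (A p * B (k - p))) * ennreal (1 / w p (k - p)) = (ennreal (w p (k - p)) * ennreal (1 / w p (k - p))) * (A p * B (k - p))"
        by (simp only: mult_ac)
      moreover have "ennreal (w p (k - p)) * ennreal (1 / w p (k - p)) = 1"
        using w[of p "k - p"] by (simp add: ennreal_mult[symmetric])
      ultimately show "A p * B (k - p) = (ennreal (w p (k - p)) * (A p * B (k - p))) * ennreal (1 / w p (k - p))" by simp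
    qed
    then have "(cv A B k)\<^sup>2 \<le> nsum (\<lambda>p. (ennreal (w p (k - p)) * (A p * B (k - p)))\<^sup>2) * nsum (\<lambda>p. (ennreal (1 / w p (k - p)))\<^sup>2)"
      using Cauchy_Schwarz_nn_integral[of "\<lambda>p. ennreal (w p (k - p)) * (A p * B (k - p))" "count_space UNIV" "\<lambda>p. ennreal (1 / w p (k - p))"] by simp
    also have "(\<lambda>p. (ennreal (w p (k - p)) * (A p * B (k - p)))\<^sup>2) = (\<lambda>p. (ennreal ((jn p)\<^sup>2) * (A p)\<^sup>2) * (ennreal (jn (k - p)) * (B (k - p))\<^sup>2))"
    proof
      fix p
      have "(ennreal (w p (k - p)))\<^sup>2 = ennreal ((jn p)\<^sup>2) * ennreal (jn (k - p))"
        using less_imp_le[OF w, of p "k - p"] jn_nonneg by (simp add: ennreal_power w2 ennreal_mult)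
      then show "(ennreal (w p (k - p)) * (A p * B (k - p)))\<^sup>2 = (ennreal ((jn p)\<^sup>2) * (A p)\<^sup>2) * (ennreal (jn (k - p)) * (B (k - p))\<^sup>2)"
        by (simp only: power_mult_distrib mult_ac)
    qed
    also have "(\<lambda>p. (ennreal (1 / w p (k - p)))\<^sup>2) = (\<lambda>p. ennreal (1 / ((jn p)\<^sup>2 * jn (k - p))))"
      using less_imp_le[OF w] by (simp add: ennreal_power power_one_over[symmetric] w2 power_divide)
    also have "nsum (\<lambda>p. (ennreal ((jn p)\<^sup>2) * (A p)\<^sup>2) * (ennreal (jn (k - p)) * (B (k - p))\<^sup>2)) * nsum (\<lambda>p. ennreal (1 / ((jn p)\<^sup>2 * jn (k - p))))
      \<le> nsum (\<lambda>p. (ennreal ((jn p)\<^sup>2) * (A p)\<^sup>2) * (ennreal (jn (k - p)) * (B (k - p))\<^sup>2)) * (2 * inv_cube_sum)"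
      by (intro mult_left_mono kernel_bound bij_minus_right) auto
    finally show ?thesis .
  qed
  have "nsum (\<lambda>k. (cv A B k)\<^sup>2) \<le> nsum (\<lambda>k. nsum (\<lambda>p. (ennreal ((jn p)\<^sup>2) * (A p)\<^sup>2) * (ennreal (jn (k - p)) * (B (k - p))\<^sup>2)) * (2 * inv_cube_sum))"
    by (intro nn_integral_mono cs)
  also have "\<dots> = nsum (\<lambda>k. nsum (\<lambda>p. (ennreal ((jn p)\<^sup>2) * (A p)\<^sup>2) * (ennreal (jn (k - p)) * (B (k - p))\<^sup>2))) * (2 * inv_cube_sum)"
    by (rule nn_integral_multc) simp
  also have "nsum (\<lambda>k. nsum (\<lambda>p. (ennreal ((jn p)\<^sup>2) * (A p)\<^sup>2) * (ennreal (jn (k - p)) * (B (k - p))\<^sup>2))) =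
     nsum (\<lambda>p. nsum (\<lambda>k. (ennreal ((jn p)\<^sup>2) * (A p)\<^sup>2) * (ennreal (jn (k - p)) * (B (k - p))\<^sup>2)))" by (rule nsum_swap)
  also have "\<dots> = nsum (\<lambda>p. (ennreal ((jn p)\<^sup>2) * (A p)\<^sup>2) * nsum (\<lambda>q. ennreal (jn q) * (B q)\<^sup>2))"
  proof (intro nn_integral_cong)
    fix p
    show "nsum (\<lambda>k. (ennreal ((jn p)\<^sup>2) * (A p)\<^sup>2) * (ennreal (jn (k - p)) * (B (k - p))\<^sup>2)) = (ennreal ((jn p)\<^sup>2) * (A p)\<^sup>2) * nsum (\<lambda>q. ennreal (jn q) * (B q)\<^sup>2)"
      using nsum_reindex[OF bij_minus_left, of "\<lambda>q. ennreal (jn q) * (B q)\<^sup>2" p] by (subst nn_integral_cmult) auto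
  qed
  also have "\<dots> = nsum (\<lambda>p. ennreal ((jn p)\<^sup>2) * (A p)\<^sup>2) * nsum (\<lambda>q. ennreal (jn q) * (B q)\<^sup>2)"
    by (rule nn_integral_multc) simp
  finally show ?thesis by (simp add: mult_ac)
qed

section \<open>The bilinear operator\<close>


lemma norm_cvec_sq: "(norm (v :: cvec))\<^sup>2 = cnorm2 v"
  by (simp add: norm_prod_def cnorm2_def)

lemma norm_smulc: "norm (smulc c v) = cmod c * norm v"
  by (simp add: smulc_def norm_prod_def norm_mult power_mult_distrib distrib_left[symmetric] real_sqrt_mult)

lemma smulc_diff: "smulc c (u - v) = smulc c u - smulc c v" "smulc (c - d) u = smulc c u - smulc d u"
  by (simp_all add: smulc_def algebra_simps)
lemma smulc_scaleR: "smulc c (r *\<^sub>R u) = r *\<^sub>R smulc c u" "smulc (r *\<^sub>R c) u = r *\<^sub>R smulc c u"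
  by (simp_all add: smulc_def)
lemma wdot_diff: "wdot k (u - v) = wdot k u - wdot k v" by (simp add: wdot_def algebra_simps)
lemma wdot_add: "wdot k (u + v) = wdot k u + wdot k v" by (simp add: wdot_def algebra_simps)
lemma wdot_scaleR: "wdot k (r *\<^sub>R u) = r *\<^sub>R wdot k u" by (simp add: wdot_def algebra_simps)
lemma wdot_zero[simp]: "wdot k 0 = 0" by (simp add: wdot_def)
lemma wdot_smulc: "wdot k (smulc c u) = c * wdot k u" by (simp add: wdot_def smulc_def algebra_simps)
lemma wdot_diff_left: "wdot (k - p) u = wdot k u - wdot p u" by (simp add: wdot_def algebra_simps)

lemma norm_wdot_le: "cmod (wdot k u) \<le> sqrt (wnorm2 k) * norm u"
proof -
  define x y where "x = real_of_int (fst k)" and "y = real_of_int (snd k)"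
  define p q where "p = cmod (fst u)" and "q = cmod (snd u)"
  have "cmod (wdot k u) \<le> cmod (of_int (fst k) * fst u) + cmod (of_int (snd k) * snd u)"
    unfolding wdot_def by (rule norm_triangle_ineq)
  also have "\<dots> = \<bar>x\<bar> * p + \<bar>y\<bar> * q" by (simp add: norm_mult x_def y_def p_def q_def)
  also have "\<dots> \<le> sqrt ((x\<^sup>2 + y\<^sup>2) * (p\<^sup>2 + q\<^sup>2))"
  proof (rule real_le_rsqrt)
    have "0 \<le> (\<bar>x\<bar> * q - \<bar>y\<bar> * p)\<^sup>2" by simp
    also have "(\<bar>x\<bar> * q - \<bar>y\<bar> * p)\<^sup>2 = (x\<^sup>2 + y\<^sup>2) * (p\<^sup>2 + q\<^sup>2) - (\<bar>x\<bar> * p + \<bar>y\<bar> * q)\<^sup>2"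
    proof -
      have "(a * q - b * p)\<^sup>2 = (a\<^sup>2 + b\<^sup>2) * (p\<^sup>2 + q\<^sup>2) - (a * p + b * q)\<^sup>2" for a b :: real by algebra
      from this[of "\<bar>x\<bar>" "\<bar>y\<bar>"] show ?thesis by simp
    qed
    finally show "(\<bar>x\<bar> * p + \<bar>y\<bar> * q)\<^sup>2 \<le> (x\<^sup>2 + y\<^sup>2) * (p\<^sup>2 + q\<^sup>2)" by simp
  qed
  also have "\<dots> = sqrt (wnorm2 k) * norm u"
    by (simp add: real_sqrt_mult wnorm2_def norm_prod_def x_def y_def p_def q_def)
  finally show ?thesis .
qed

text \<open>An orthogonal projection has norm at most 1; the triangle inequality yields 2, which
  affects constants only.\<close>

lemma norm_leray_le: "norm (leray w k) \<le> 2 * norm (w k)"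
proof (cases "k = 0")
  case True
  then show ?thesis by (simp add: leray_def zero_prod_def)
next
  case False
  let ?K = "(of_int (fst k), of_int (snd k)) :: cvec"
  have K: "norm ?K = sqrt (wnorm2 k)" by (simp add: norm_prod_def wnorm2_def)
  have w: "1 \<le> wnorm2 k" by (rule wnorm2_ge_1[OF False])
  have "norm (leray w k) \<le> norm (w k) + cmod (wdot k (w k) / of_real (wnorm2 k)) * sqrt (wnorm2 k)"
    using False norm_triangle_ineq4[of "w k" "smulc (wdot k (w k) / of_real (wnorm2 k)) ?K"]
    by (simp add: leray_def norm_smulc K zero_prod_def)
  also have "cmod (wdot k (w k) / of_real (wnorm2 k)) * sqrt (wnorm2 k) \<le> (sqrt (wnorm2 k) * norm (w k) / wnorm2 k) * sqrt (wnorm2 k)"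
    using norm_wdot_le[of k "w k"] w by (intro mult_right_mono) (auto simp: norm_divide divide_right_mono)
  also have "\<dots> = norm (w k)" using w by (simp add: field_simps)
  finally show ?thesis by simp
qed

lemma leray_zero_mode[simp]: "leray w 0 = 0" by (simp add: leray_def zero_prod_def)

lemma leray_diff: "leray (\<lambda>k. u k - v k) k = leray u k - leray v k"
  by (simp add: leray_def wdot_diff diff_divide_distrib smulc_diff zero_prod_def)

lemma leray_scaleR: "leray (\<lambda>k. r *\<^sub>R u k) k = r *\<^sub>R leray u k"
proof -
  have "(r *\<^sub>R c) / d = r *\<^sub>R (c / d)" for c d :: complex by (simp add: scaleR_conv_of_real)
  then show ?thesis by (simp add: leray_def wdot_scaleR smulc_scaleR scaleR_right_diff_distrib zero_prod_def)
qed

lemma wdot_leray: "wdot k (leray w k) = 0"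
proof (cases "k = 0")
  case False
  have "wdot k (of_int (fst k), of_int (snd k)) = of_real (wnorm2 k)"
    by (simp add: wdot_def wnorm2_def power2_eq_square)
  then show ?thesis using False wnorm2_ge_1[OF False]
    by (simp add: leray_def wdot_diff wdot_smulc zero_prod_def)
qed simp

lemma leray_divfree: "wdot k (w k) = 0 \<Longrightarrow> w 0 = 0 \<Longrightarrow> leray w k = w k"
  by (auto simp: leray_def zero_prod_def smulc_def)

section \<open>The convolution series and its norm bounds\<close>

definition Vfin :: "fld \<Rightarrow> bool" where "Vfin u \<longleftrightarrow> wsum (\<lambda>k. (jn k)\<^sup>2) u < \<infinity>"

abbreviation nm :: "('a \<Rightarrow> 'b::real_normed_vector) \<Rightarrow> 'a \<Rightarrow> ennreal" where
  "nm u \<equiv> \<lambda>p. ennreal (norm (u p))"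
abbreviation jnm :: "(int \<times> int \<Rightarrow> 'b::real_normed_vector) \<Rightarrow> int \<times> int \<Rightarrow> ennreal" where
  "jnm u \<equiv> \<lambda>p. ennreal (jn p * norm (u p))"

lemma nsum_jn_nm: "nsum (\<lambda>p. ennreal ((jn p)\<^sup>2) * (nm u p)\<^sup>2) = wsum (\<lambda>k. (jn k)\<^sup>2) u"
  by (simp add: wsum_def ennreal_mult ennreal_power)

lemma nsum_jnm: "nsum (\<lambda>q. (jnm v q)\<^sup>2) = wsum (\<lambda>k. (jn k)\<^sup>2) v"
  by (simp add: wsum_def ennreal_power power_mult_distrib jn_nonneg)

lemma ennreal_sq_finite: "(x :: ennreal)\<^sup>2 < \<infinity> \<Longrightarrow> x < \<infinity>"
  by (cases x) (auto simp: power2_eq_square ennreal_top_mult)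

lemma cv_finite:
  assumes "wsum (\<lambda>k. (jn k)\<^sup>2) u < \<infinity>" "wsum (\<lambda>k. (jn k)\<^sup>2) v < \<infinity>"
  shows "cv (nm u) (jnm v) k < \<infinity>"
proof -
  have "ennreal (1 / jn k) * (cv (nm u) (jnm v) k)\<^sup>2 \<le> nsum (\<lambda>k. ennreal (1 / jn k) * (cv (nm u) (jnm v) k)\<^sup>2)"
    by (rule nsum_ge)
  also have "\<dots> \<le> 2 * inv_cube_sum * wsum (\<lambda>k. (jn k)\<^sup>2) u * wsum (\<lambda>k. (jn k)\<^sup>2) v"
    using cv_bound_negative[of "nm u" "jnm v"] by (simp only: nsum_jn_nm nsum_jnm)
  also have "\<dots> < \<infinity>" using assms inv_cube_sum_finite by (simp add: ennreal_mult_less_top)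
  finally have "(cv (nm u) (jnm v) k)\<^sup>2 < \<infinity>"
    using jn_pos[of k] by (auto simp: ennreal_mult_less_top)
  then show ?thesis by (rule ennreal_sq_finite)
qed

lemma has_sum_diff_euclidean:
  fixes f g :: "'i \<Rightarrow> 'e::euclidean_space"
  assumes "(f has_sum x) A" "(g has_sum y) A"
  shows "((\<lambda>i. f i - g i) has_sum (x - y)) A"
  using has_sum_add[OF assms(1) has_sum_bounded_linear[OF bounded_linear_minus[OF bounded_linear_ident] assms(2)]] by simp

definition cterm :: "fld \<Rightarrow> fld \<Rightarrow> int \<times> int \<Rightarrow> int \<times> int \<Rightarrow> cvec" where
  "cterm u v k p = smulc (\<i> * wdot (k - p) (u p)) (v (k - p))"

lemma conv_eq: "conv u v k = infsum (cterm u v k) UNIV"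
  by (simp add: conv_def cterm_def[abs_def] minus_prod_def)

lemma norm_cterm_le: "norm (cterm u v k p) \<le> norm (u p) * (jn (k - p) * norm (v (k - p)))"
proof -
  have "norm (cterm u v k p) = cmod (wdot (k - p) (u p)) * norm (v (k - p))"
    by (simp add: cterm_def norm_smulc norm_mult)
  also have "\<dots> \<le> (jn (k - p) * norm (u p)) * norm (v (k - p))"
    using order_trans[OF norm_wdot_le[of "k - p" "u p"] mult_right_mono[OF sqrt_wnorm2_le_jn]]
    by (intro mult_right_mono) auto
  finally show ?thesis by (simp add: mult_ac)
qed

lemma nsum_cterm_le: "nsum (\<lambda>p. ennreal (norm (cterm u v k p))) \<le> cv (nm u) (jnm v) k"
  unfolding cv_def
  by (intro nn_integral_mono) (auto simp: ennreal_mult[symmetric] jn_nonneg intro!: ennreal_leI norm_cterm_le)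

lemma cterm_abs_summable:
  assumes "Vfin u" "Vfin v" shows "(\<lambda>p. norm (cterm u v k p)) summable_on UNIV"
  using nsum_cterm_le[of u v k] cv_finite[of u v k] assms
  by (intro nsum_finite_summable) (auto simp: Vfin_def)

lemma cterm_summable:
  assumes "Vfin u" "Vfin v" shows "cterm u v k summable_on UNIV"
  using cterm_abs_summable[OF assms] by (rule abs_summable_summable)

text \<open>Without summability \<open>infsum\<close> is 0 and the bound is trivial. The norm
  estimates of \<open>Bop\<close> derived from it therefore hold for arbitrary coefficient
  families.\<close>

lemma norm_infsum_le_nsum: "ennreal (norm (infsum f UNIV)) \<le> nsum (\<lambda>p. ennreal (norm (f p)))"
  for f :: "'i \<Rightarrow> 'e::euclidean_space"
proof (cases "(\<lambda>p. norm (f p)) summable_on UNIV")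
  case True
  then show ?thesis
    using norm_infsum_bound[OF True] by (simp add: nsum_eq_infsum_real[of "\<lambda>p. norm (f p)"] ennreal_leI)
next
  case False
  then have "\<not> f summable_on UNIV" using summable_on_euclidean_abs by blast
  then show ?thesis by (simp add: infsum_not_exists)
qed

lemma norm_Bop_le: "ennreal (norm (Bop u v k)) \<le> 2 * cv (nm u) (jnm v) k"
proof -
  have "ennreal (norm (Bop u v k)) \<le> ennreal (2 * norm (conv u v k))"
    unfolding Bop_def by (intro ennreal_leI norm_leray_le)
  also have "\<dots> = 2 * ennreal (norm (conv u v k))" by (simp add: ennreal_mult)
  also have "\<dots> \<le> 2 * nsum (\<lambda>p. ennreal (norm (cterm u v k p)))"
    unfolding conv_eq by (intro mult_left_mono norm_infsum_le_nsum) auto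
  also have "\<dots> \<le> 2 * cv (nm u) (jnm v) k" by (intro mult_left_mono nsum_cterm_le) auto
  finally show ?thesis .
qed

text \<open>The 8 is the square of the factor 2 of \<open>norm_leray_le\<close> times the factor 2
  of \<open>kernel_bound\<close>.\<close>

definition Bop_const :: real where "Bop_const = enn2real (8 * inv_cube_sum)"
lemma Bop_const: "ennreal Bop_const = 8 * inv_cube_sum" "0 \<le> Bop_const"
  using inv_cube_sum_finite by (simp_all add: Bop_const_def ennreal_mult_less_top)

lemma Bop_bound_negative:
  "wsum (\<lambda>k. 1 / jn k) (Bop u v) \<le> ennreal Bop_const * wsum (\<lambda>k. (jn k)\<^sup>2) u * wsum (\<lambda>k. (jn k)\<^sup>2) v"
proof -
  have "wsum (\<lambda>k. 1 / jn k) (Bop u v) \<le> nsum (\<lambda>k. 4 * (ennreal (1 / jn k) * (cv (nm u) (jnm v) k)\<^sup>2))"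
    unfolding wsum_def
  proof (intro nn_integral_mono)
    fix k
    have "ennreal (1 / jn k * (norm (Bop u v k))\<^sup>2) = ennreal (1 / jn k) * (ennreal (norm (Bop u v k)))\<^sup>2"
      using jn_nonneg by (simp add: ennreal_power ennreal_mult[symmetric])
    also have "\<dots> \<le> ennreal (1 / jn k) * (2 * cv (nm u) (jnm v) k)\<^sup>2"
      by (intro mult_left_mono power_mono norm_Bop_le) auto
    finally show "ennreal (1 / jn k * (norm (Bop u v k))\<^sup>2) \<le> 4 * (ennreal (1 / jn k) * (cv (nm u) (jnm v) k)\<^sup>2)"
      by (simp add: power_mult_distrib mult_ac)
  qed
  also have "\<dots> = 4 * nsum (\<lambda>k. ennreal (1 / jn k) * (cv (nm u) (jnm v) k)\<^sup>2)" by (rule nn_integral_cmult) simp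
  also have "\<dots> \<le> 4 * (2 * inv_cube_sum * wsum (\<lambda>k. (jn k)\<^sup>2) u * wsum (\<lambda>k. (jn k)\<^sup>2) v)"
    using cv_bound_negative[of "nm u" "jnm v"] by (intro mult_left_mono) (simp_all only: nsum_jn_nm nsum_jnm, simp)
  finally show ?thesis by (simp add: Bop_const mult.assoc[symmetric])
qed

lemma Bop_bound_positive:
  "wsum (\<lambda>k. 1) (Bop u v) \<le> ennreal Bop_const * wsum (\<lambda>k. (jn k)\<^sup>2) u * wsum (\<lambda>k. (jn k) ^ 3) v"
proof -
  have "wsum (\<lambda>k. 1) (Bop u v) \<le> nsum (\<lambda>k. 4 * (cv (nm u) (jnm v) k)\<^sup>2)"
    unfolding wsum_def
  proof (intro nn_integral_mono)
    fix k
    have "ennreal (1 * (norm (Bop u v k))\<^sup>2) = (ennreal (norm (Bop u v k)))\<^sup>2"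
      by (simp add: ennreal_power)
    also have "\<dots> \<le> (2 * cv (nm u) (jnm v) k)\<^sup>2"
      by (intro power_mono norm_Bop_le) auto
    finally show "ennreal (1 * (norm (Bop u v k))\<^sup>2) \<le> 4 * (cv (nm u) (jnm v) k)\<^sup>2"
      by (simp add: power_mult_distrib mult_ac)
  qed
  also have "\<dots> = 4 * nsum (\<lambda>k. (cv (nm u) (jnm v) k)\<^sup>2)" by (rule nn_integral_cmult) simp
  also have "\<dots> \<le> 4 * (2 * inv_cube_sum * wsum (\<lambda>k. (jn k)\<^sup>2) u * wsum (\<lambda>k. (jn k) ^ 3) v)"
  proof -
    have "nsum (\<lambda>q. ennreal (jn q) * (jnm v q)\<^sup>2) = wsum (\<lambda>k. (jn k) ^ 3) v"
      unfolding wsum_def using jn_nonneg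
      by (intro nn_integral_cong) (simp add: ennreal_power ennreal_mult[symmetric] power_mult_distrib power2_eq_square power3_eq_cube mult_ac)
    then show ?thesis
      using cv_bound_positive[of "nm u" "jnm v"] by (intro mult_left_mono) (simp_all only: nsum_jn_nm, simp)
  qed
  finally show ?thesis by (simp add: Bop_const mult.assoc[symmetric])
qed

lemma Bop_diff_left:
  assumes "Vfin u" "Vfin u'" "Vfin v" shows "Bop (\<lambda>k. u k - u' k) v k = Bop u v k - Bop u' v k"
proof -
  have "conv (\<lambda>k. u k - u' k) v = (\<lambda>k. conv u v k - conv u' v k)"
  proof
    fix k
    have "cterm (\<lambda>k. u k - u' k) v k = (\<lambda>p. cterm u v k p - cterm u' v k p)"
      by (simp add: fun_eq_iff cterm_def wdot_diff right_diff_distrib smulc_diff)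
    then show "conv (\<lambda>k. u k - u' k) v k = conv u v k - conv u' v k"
      using has_sum_diff_euclidean[OF has_sum_infsum[OF cterm_summable[OF assms(1,3), of k]] has_sum_infsum[OF cterm_summable[OF assms(2,3), of k]]]
      unfolding conv_eq by (simp add: infsumI)
  qed
  then show ?thesis unfolding Bop_def by (simp add: leray_diff)
qed

lemma Bop_diff_right:
  assumes "Vfin u" "Vfin v" "Vfin v'" shows "Bop u (\<lambda>k. v k - v' k) k = Bop u v k - Bop u v' k"
proof -
  have "conv u (\<lambda>k. v k - v' k) = (\<lambda>k. conv u v k - conv u v' k)"
  proof
    fix k
    have "cterm u (\<lambda>k. v k - v' k) k = (\<lambda>p. cterm u v k p - cterm u v' k p)"
      by (simp add: fun_eq_iff cterm_def smulc_diff)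
    then show "conv u (\<lambda>k. v k - v' k) k = conv u v k - conv u v' k"
      using has_sum_diff_euclidean[OF has_sum_infsum[OF cterm_summable[OF assms(1,2), of k]] has_sum_infsum[OF cterm_summable[OF assms(1,3), of k]]]
      unfolding conv_eq by (simp add: infsumI)
  qed
  then show ?thesis unfolding Bop_def by (simp add: leray_diff)
qed

lemma Bop_scaleR: "Bop (\<lambda>k. r *\<^sub>R u k) (\<lambda>k. r *\<^sub>R v k) k = r\<^sup>2 *\<^sub>R Bop u v k"
proof -
  have "cterm (\<lambda>k. r *\<^sub>R u k) (\<lambda>k. r *\<^sub>R v k) k = (\<lambda>p. r\<^sup>2 *\<^sub>R cterm u v k p)" for k
    by (simp add: fun_eq_iff cterm_def wdot_scaleR smulc_scaleR power2_eq_square)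
  then have "conv (\<lambda>k. r *\<^sub>R u k) (\<lambda>k. r *\<^sub>R v k) = (\<lambda>k. r\<^sup>2 *\<^sub>R conv u v k)"
    unfolding conv_eq by (simp add: infsum_scaleR_right)
  then show ?thesis unfolding Bop_def by (simp add: leray_scaleR)
qed

lemma wdot_Bop: "wdot k (Bop u v k) = 0" unfolding Bop_def by (rule wdot_leray)
lemma Bop_zero_mode[simp]: "Bop u v 0 = 0" by (simp add: Bop_def)

section \<open>Complex conjugation, measurability, and the low modes of B\<close>

lemma bounded_linear_cconj: "bounded_linear cconj"
  unfolding cconj_def
  by (intro bounded_linear_Pair bounded_linear_compose[OF bounded_linear_cnj] bounded_linear_fst bounded_linear_snd)

lemma norm_cconj[simp]: "norm (cconj v) = norm v" by (simp add: cconj_def norm_prod_def)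

lemma wdot_uminus_cconj: "wdot (- k) (cconj v) = - cnj (wdot k v)" by (simp add: wdot_def cconj_def)
lemma cconj_smulc: "cconj (smulc c v) = smulc (cnj c) (cconj v)" by (simp add: cconj_def smulc_def)
lemma cconj_diff: "cconj (u - v) = cconj u - cconj v" by (simp add: cconj_def)
lemma cconj_scaleR: "cconj (r *\<^sub>R v) = r *\<^sub>R cconj v" by (simp add: cconj_def)
lemma cconj_zero[simp]: "cconj 0 = 0" by (simp add: cconj_def zero_prod_def)
lemma cconj_cconj[simp]: "cconj (cconj v) = v" by (simp add: cconj_def)
lemma wnorm2_uminus[simp]: "wnorm2 (- k) = wnorm2 k" by (simp add: wnorm2_def)

text \<open>Complex conjugation of the field in physical space; the real fields are its fixed
  points.\<close>

definition refl_fld :: "fld \<Rightarrow> fld" where "refl_fld u k = cconj (u (- k))"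

text \<open>In physical space B is a real operator, so it commutes with conjugation. This is the
  input for showing, by uniqueness, that solutions with real data are real.\<close>

lemma Bop_refl_fld:
  assumes "Vfin u" "Vfin v" shows "Bop (refl_fld u) (refl_fld v) k = refl_fld (Bop u v) k"
proof -
  have "conv (refl_fld u) (refl_fld v) k = cconj (conv u v (- k))" for k
  proof -
    have "cterm (refl_fld u) (refl_fld v) k p = cconj (cterm u v (- k) (- p))" for p
      using wdot_uminus_cconj[of "- (k - p)" "u (- p)"]
      by (simp add: cterm_def refl_fld_def cconj_smulc)
    then have "conv (refl_fld u) (refl_fld v) k = infsum (\<lambda>p. cconj (cterm u v (- k) (- p))) UNIV"
      unfolding conv_eq by (intro infsum_cong)
    also have "\<dots> = infsum (\<lambda>p. cconj (cterm u v (- k) p)) UNIV"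
      by (rule infsum_reindex_bij_betw[OF bij_uminus_pair])
    also have "\<dots> = cconj (conv u v (- k))"
      unfolding conv_eq
      using has_sum_bounded_linear[OF bounded_linear_cconj has_sum_infsum[OF cterm_summable[OF assms, of "- k"]]]
      by (simp add: infsumI)
    finally show ?thesis .
  qed
  then have "conv (refl_fld u) (refl_fld v) = (\<lambda>k. cconj (conv u v (- k)))" by blast
  moreover have "leray (\<lambda>k. cconj (w (- k))) k = cconj (leray w (- k))" for w k
  proof (cases "k = 0")
    case False
    have "wdot k (cconj (w (- k))) = - cnj (wdot (- k) (w (- k)))"
      using wdot_uminus_cconj[of "- k" "w (- k)"] by simp
    then show ?thesis using False
      by (auto simp: leray_def cconj_diff cconj_smulc smulc_def cconj_def zero_prod_def prod_eq_iff)
  qed simp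
  ultimately show ?thesis by (simp add: Bop_def refl_fld_def)
qed

lemma borel_measurable_fst_prod[measurable (raw)]:
  fixes f :: "'x \<Rightarrow> 'a::{second_countable_topology, t2_space} \<times> 'b::{second_countable_topology, t2_space}"
  assumes "f \<in> borel_measurable M"
  shows "(\<lambda>x. fst (f x)) \<in> borel_measurable M" "(\<lambda>x. snd (f x)) \<in> borel_measurable M"
  using borel_measurable_continuous_on[OF continuous_on_fst[OF continuous_on_id] assms]
    borel_measurable_continuous_on[OF continuous_on_snd[OF continuous_on_id] assms] by simp_all

lemma measurable_wdot[measurable (raw)]:
  assumes [measurable]: "f \<in> borel_measurable M" shows "(\<lambda>x. wdot k (f x)) \<in> borel_measurable M"
  unfolding wdot_def by measurable

lemma measurable_smulc[measurable (raw)]: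
  assumes [measurable]: "f \<in> borel_measurable M" "c \<in> borel_measurable M"
  shows "(\<lambda>x. smulc (c x) (f x)) \<in> borel_measurable M"
  unfolding smulc_def by measurable

lemma measurable_Bop:
  assumes [measurable]: "\<And>k. (\<lambda>s. u s k) \<in> borel_measurable M" "\<And>k. (\<lambda>s. v s k) \<in> borel_measurable M"
  shows "(\<lambda>s. Bop (u s) (v s) k) \<in> borel_measurable M"
proof -
  have [measurable]: "(\<lambda>s. conv (u s) (v s) k) \<in> borel_measurable M" for k
    unfolding conv_eq by (intro measurable_infsum) (simp add: cterm_def)
  show ?thesis unfolding Bop_def leray_def by (cases "k = (0, 0)") simp_all
qed

text \<open>Since \<open>u p\<close> is orthogonal to \<open>p\<close>, the factor
  \<open>(k - p) . u p\<close> equals \<open>k . u p\<close>: the derivative moves to the output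
  mode \<open>k\<close>. A low mode of B is thus bounded by the energy alone, which is what makes
  the coupling tractable.\<close>

lemma norm_Bop_low_mode:
  assumes div: "\<And>k. wdot k (u k) = 0"
  shows "ennreal (norm (Bop u u k)) \<le> ennreal (2 * jn k) * wsum (\<lambda>_. 1) u"
proof -
  have t: "norm (cterm u u k p) \<le> jn k * ((norm (u p))\<^sup>2 / 2 + (norm (u (k - p)))\<^sup>2 / 2)" for p
  proof -
    have "norm (cterm u u k p) = cmod (wdot k (u p)) * norm (u (k - p))"
      by (simp add: cterm_def norm_smulc norm_mult wdot_diff_left div)
    also have "\<dots> \<le> (jn k * norm (u p)) * norm (u (k - p))"
      using order_trans[OF norm_wdot_le[of k "u p"] mult_right_mono[OF sqrt_wnorm2_le_jn]] by (intro mult_right_mono) auto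
    also have "\<dots> = jn k * (norm (u p) * norm (u (k - p)))" by simp
    also have "\<dots> \<le> jn k * ((norm (u p))\<^sup>2 / 2 + (norm (u (k - p)))\<^sup>2 / 2)"
      using sum_squares_bound[of "norm (u p)" "norm (u (k - p))"] jn_nonneg by (intro mult_left_mono) auto
    finally show ?thesis .
  qed
  have "ennreal (norm (Bop u u k)) \<le> ennreal (2 * norm (conv u u k))"
    unfolding Bop_def by (intro ennreal_leI norm_leray_le)
  also have "\<dots> = 2 * ennreal (norm (conv u u k))" by (simp add: ennreal_mult)
  also have "\<dots> \<le> 2 * nsum (\<lambda>p. ennreal (norm (cterm u u k p)))"
    unfolding conv_eq by (intro mult_left_mono norm_infsum_le_nsum) auto
  also have "\<dots> \<le> 2 * nsum (\<lambda>p. ennreal (jn k / 2) * (ennreal ((norm (u p))\<^sup>2) + ennreal ((norm (u (k - p)))\<^sup>2)))"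
  proof (intro mult_left_mono nn_integral_mono)
    fix p
    have "ennreal (norm (cterm u u k p)) \<le> ennreal (jn k / 2 * ((norm (u p))\<^sup>2 + (norm (u (k - p)))\<^sup>2))"
      using t[of p] by (intro ennreal_leI) (simp add: algebra_simps)
    then show "ennreal (norm (cterm u u k p)) \<le> ennreal (jn k / 2) * (ennreal ((norm (u p))\<^sup>2) + ennreal ((norm (u (k - p)))\<^sup>2))"
      using jn_nonneg[of k] by (simp add: ennreal_mult[symmetric] ennreal_plus[symmetric] del: ennreal_plus)
  qed simp
  also have "\<dots> = 2 * (ennreal (jn k / 2) * (nsum (\<lambda>p. ennreal ((norm (u p))\<^sup>2)) + nsum (\<lambda>p. ennreal ((norm (u (k - p)))\<^sup>2))))"
    by (simp add: nn_integral_cmult nn_integral_add)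
  also have "nsum (\<lambda>p. ennreal ((norm (u (k - p)))\<^sup>2)) = nsum (\<lambda>p. ennreal ((norm (u p))\<^sup>2))"
    by (rule nsum_reindex[OF bij_minus_right, of "\<lambda>p. ennreal ((norm (u p))\<^sup>2)"])
  also have "2 * (ennreal (jn k / 2) * (nsum (\<lambda>p. ennreal ((norm (u p))\<^sup>2)) + nsum (\<lambda>p. ennreal ((norm (u p))\<^sup>2)))) =
      (2 * ennreal (jn k / 2) * 2) * wsum (\<lambda>_. 1) u"
    by (simp add: wsum_def mult_2[symmetric] mult_ac)
  also have "2 * ennreal (jn k / 2) * 2 = ennreal (2 * jn k)"
    using jn_nonneg[of k] by (simp add: ennreal_mult[symmetric] ennreal_numeral[symmetric] del: ennreal_numeral)
  finally show ?thesis .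
qed

section \<open>Conservation of energy and enstrophy\<close>


definition cross2 :: "int \<times> int \<Rightarrow> int \<times> int \<Rightarrow> real" where
  "cross2 p q = real_of_int (fst p) * real_of_int (snd q) - real_of_int (snd p) * real_of_int (fst q)"
definition dot2 :: "int \<times> int \<Rightarrow> int \<times> int \<Rightarrow> real" where
  "dot2 p q = real_of_int (fst p) * real_of_int (fst q) + real_of_int (snd p) * real_of_int (snd q)"
text \<open>Bilinear and not Hermitian: for a real field the conjugate is supplied by
  \<open>u (- k)\<close>, so the three modes of a triad enter in the same way.\<close>

definition cdot :: "cvec \<Rightarrow> cvec \<Rightarrow> complex" where
  "cdot v w = fst v * fst w + snd v * snd w"

lemma inner_eq_Re_cdot: "v \<bullet> w = Re (cdot v (cconj w))"
  by (simp add: inner_prod_def cdot_def cconj_def inner_complex_def)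

text \<open>A divergence-free mode is a multiple of the rotated wave vector; the factor is (up to \<open>\<i>\<close>)
  the Fourier coefficient of the stream function.\<close>

definition stream :: "fld \<Rightarrow> int \<times> int \<Rightarrow> complex" where
  "stream u p = (of_int (fst p) * snd (u p) - of_int (snd p) * fst (u p)) / of_real (wnorm2 p)"

lemma divfree_stream:
  assumes "u 0 = 0" "wdot p (u p) = 0"
  shows "u p = (- of_int (snd p) * stream u p, of_int (fst p) * stream u p)"
proof (cases "p = 0")
  case False
  let ?a = "of_int (fst p) :: complex" and ?b = "of_int (snd p) :: complex"
  have w: "of_real (wnorm2 p) = ?a\<^sup>2 + ?b\<^sup>2" by (simp add: wnorm2_def)
  have nz: "?a\<^sup>2 + ?b\<^sup>2 \<noteq> 0" using wnorm2_ge_1[OF False] unfolding w[symmetric] by auto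
  have d: "?a * fst (u p) + ?b * snd (u p) = 0" using assms(2) by (simp add: wdot_def)
  have e1: "fst (u p) * (?a\<^sup>2 + ?b\<^sup>2) = - ?b * (?a * snd (u p) - ?b * fst (u p))" using d by algebra
  have e2: "snd (u p) * (?a\<^sup>2 + ?b\<^sup>2) = ?a * (?a * snd (u p) - ?b * fst (u p))" using d by algebra
  have "fst (u p) = - ?b * stream u p"
    using e1[folded nonzero_eq_divide_eq[OF nz]] unfolding stream_def w by simp
  moreover have "snd (u p) = ?a * stream u p"
    using e2[folded nonzero_eq_divide_eq[OF nz]] unfolding stream_def w by simp
  ultimately show ?thesis by (simp add: prod_eq_iff)
qed (use assms in \<open>simp add: zero_prod_def\<close>)

text \<open>With \<open>r = - p - q\<close>, the factor \<open>cross2 p q\<close> comes from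
  \<open>q . u p\<close> and \<open>dot2 q r\<close> from \<open>u q . u r\<close>, once the modes
  are expressed through the stream function.\<close>

definition triad :: "fld \<Rightarrow> (int \<times> int \<Rightarrow> real) \<Rightarrow> int \<times> int \<Rightarrow> int \<times> int \<Rightarrow> complex" where
  "triad u h p q = \<i> * (stream u p * stream u q * stream u (- p - q)) *
     of_real (cross2 p q * dot2 q (- p - q) * h (- p - q))"

lemma triad_eq:
  assumes u0: "u 0 = 0" and div: "\<And>k. wdot k (u k) = 0" and h: "h (- k) = h k"
  shows "of_real (h k) * cdot (cterm u u k p) (u (- k)) = triad u h p (k - p)"
proof -
  let ?q = "k - p"
  have r: "- p - ?q = - k" by simp
  have up: "wdot ?q (u p) = stream u p * of_real (cross2 p ?q)"
    by (subst divfree_stream[where u=u and p=p, OF u0 div]) (simp add: wdot_def cross2_def algebra_simps)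
  have uq: "cdot (u ?q) (u (- k)) = stream u ?q * stream u (- k) * of_real (dot2 ?q (- k))"
    by (subst divfree_stream[where u=u and p="?q", OF u0 div], subst divfree_stream[where u=u and p="- k", OF u0 div])
      (simp add: cdot_def dot2_def algebra_simps)
  have "cdot (cterm u u k p) (u (- k)) = \<i> * wdot ?q (u p) * cdot (u ?q) (u (- k))"
    by (simp add: cterm_def cdot_def smulc_def algebra_simps)
  then show ?thesis unfolding triad_def r up uq h by (simp add: mult_ac)
qed

lemma triad_symmetrization:
  assumes h: "h = (\<lambda>_. 1) \<or> h = wnorm2"
  defines "r \<equiv> \<lambda>p q :: int \<times> int. - p - q"
  shows "triad u h p q + triad u h q (r p q) + triad u h (r p q) p + triad u h q p + triad u h (r p q) q + triad u h p (r p q) = 0"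
proof -
  \<comment> \<open>The product of the three stream coefficients is invariant under permutations.
    Once it is factored out, a polynomial identity in the coordinates of \<open>p\<close> and
    \<open>q\<close> remains.\<close>
  define C where "C = \<i> * (stream u p * stream u q * stream u (r p q))"
  have rr: "- q - r p q = p" "- r p q - p = q" "- r p q - q = p" "- p - r p q = q" "- q - p = r p q"
    by (simp_all add: r_def)
  have t: "triad u h p q = C * of_real (cross2 p q * dot2 q (r p q) * h (r p q))"
    "triad u h q (r p q) = C * of_real (cross2 q (r p q) * dot2 (r p q) p * h p)"
    "triad u h (r p q) p = C * of_real (cross2 (r p q) p * dot2 p q * h q)"
    "triad u h q p = C * of_real (cross2 q p * dot2 p (r p q) * h (r p q))"
    "triad u h (r p q) q = C * of_real (cross2 (r p q) q * dot2 q p * h p)"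
    "triad u h p (r p q) = C * of_real (cross2 p (r p q) * dot2 (r p q) q * h q)"
    unfolding triad_def rr C_def by (simp_all add: r_def mult_ac)
  have "cross2 p q * dot2 q (r p q) * h (r p q) + cross2 q (r p q) * dot2 (r p q) p * h p
     + cross2 (r p q) p * dot2 p q * h q + cross2 q p * dot2 p (r p q) * h (r p q)
     + cross2 (r p q) q * dot2 q p * h p + cross2 p (r p q) * dot2 (r p q) q * h q = 0"
  proof -
    obtain p1 p2 q1 q2 where pq: "p = (p1, p2)" "q = (q1, q2)" by (cases p, cases q)
    show ?thesis using h
    proof (rule disjE)
      assume "h = (\<lambda>_. 1)"
      then show ?thesis unfolding pq r_def cross2_def dot2_def by (simp only: fst_conv snd_conv fst_diff snd_diff fst_uminus snd_uminus of_int_diff of_int_minus) (simp add: algebra_simps power2_eq_square)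
    next
      assume "h = wnorm2"
      then show ?thesis unfolding pq r_def cross2_def dot2_def by (simp only: wnorm2_def fst_conv snd_conv fst_diff snd_diff fst_uminus snd_uminus of_int_diff of_int_minus) (simp add: algebra_simps power2_eq_square)
    qed
  qed
  then have "C * of_real (cross2 p q * dot2 q (r p q) * h (r p q) + cross2 q (r p q) * dot2 (r p q) p * h p
     + cross2 (r p q) p * dot2 p q * h q + cross2 q p * dot2 p (r p q) * h (r p q)
     + cross2 (r p q) q * dot2 q p * h p + cross2 p (r p q) * dot2 (r p q) q * h q) = 0" by simp
  then show ?thesis unfolding t by (simp add: distrib_left)
qed

lemma norm_cdot_le: "cmod (cdot v w) \<le> norm v * norm w"
proof -
  have "cmod (cdot v w) \<le> cmod (fst v) * cmod (fst w) + cmod (snd v) * cmod (snd w)"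
    unfolding cdot_def using norm_triangle_ineq[of "fst v * fst w" "snd v * snd w"] by (simp add: norm_mult)
  also have "\<dots> = (cmod (fst v), cmod (snd v)) \<bullet> (cmod (fst w), cmod (snd w))" by simp
  also have "\<dots> \<le> norm (cmod (fst v), cmod (snd v)) * norm (cmod (fst w), cmod (snd w))"
    by (rule norm_cauchy_schwarz)
  also have "\<dots> = norm v * norm w" by (simp add: norm_prod_def)
  finally show ?thesis .
qed

text \<open>\<open>leray\<close> removes a multiple of \<open>k\<close>, and \<open>u k\<close> is
  orthogonal to \<open>k\<close>.\<close>

lemma inner_Bop_eq:
  assumes u0: "u 0 = 0" and div: "wdot k (u k) = 0"
  shows "Bop u v k \<bullet> u k = conv u v k \<bullet> u k"
proof (cases "k = 0")
  case False
  let ?s = "wdot k (conv u v k) / of_real (wnorm2 k)"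
  have "smulc s (of_int (fst k), of_int (snd k)) \<bullet> u k = Re (s * cnj (wdot k (u k)))" for s
    unfolding inner_eq_Re_cdot by (simp add: cdot_def smulc_def cconj_def wdot_def algebra_simps)
  then show ?thesis using False div
    by (simp add: Bop_def leray_def inner_diff_left zero_prod_def)
qed (use u0 in simp)

lemma wsum_pow_mono: "m \<le> n \<Longrightarrow> wsum (\<lambda>k. jn k ^ m) u \<le> wsum (\<lambda>k. jn k ^ n) u"
  using jn_ge_1 by (intro wsum_mono mult_right_mono power_increasing) auto

text \<open>With \<open>h = 1\<close> this is conservation of energy and with \<open>h = |k|\<^sup>2\<close> conservation of
  enstrophy by the nonlinearity. For each triad \<open>p + q + r = 0\<close> the six permuted contributions
  cancel, because \<open>p \<times> q\<close> is invariant under cyclic permutations and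
  \<open>h(r)(|p|\<^sup>2 - |q|\<^sup>2) + h(p)(|q|\<^sup>2 - |r|\<^sup>2) + h(q)(|r|\<^sup>2 - |p|\<^sup>2) = 0\<close>.\<close>

lemma Bop_cancellation:
  assumes u0: "u 0 = 0" and div: "\<And>k. wdot k (u k) = 0" and real: "\<And>k. u (- k) = cconj (u k)"
    and DA: "wsum (\<lambda>k. jn k ^ 4) u < \<infinity>" and h: "h = (\<lambda>_. 1) \<or> h = wnorm2"
  shows "((\<lambda>k. h k * (Bop u u k \<bullet> u k)) has_sum 0) UNIV"
proof -
  have hs: "h (- k) = h k" and h0: "0 \<le> h k" and hle: "h k \<le> (jn k)\<^sup>2" for k
  proof -
    have "1 \<le> (jn k)\<^sup>2" "wnorm2 k \<le> (jn k)\<^sup>2"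
      using jn_ge_1[of k] power_mono[OF sqrt_wnorm2_le_jn[of k], of 2] wnorm2_nonneg[of k]
      by (auto simp: one_le_power)
    then show "h (- k) = h k" "0 \<le> h k" "h k \<le> (jn k)\<^sup>2" using h wnorm2_nonneg[of k] by auto
  qed
  have fin2: "wsum (\<lambda>k. (jn k)\<^sup>2) u < \<infinity>" and fin3: "wsum (\<lambda>k. jn k ^ 3) u < \<infinity>"
    using wsum_pow_mono[of 2 4 u] wsum_pow_mono[of 3 4 u] DA by (auto intro: le_less_trans)
  have Vf: "Vfin u" using fin2 by (simp add: Vfin_def)
  let ?F = "\<lambda>(k, p). triad u h p (k - p)"
  have cvf: "nsum (\<lambda>k. (cv (nm u) (jnm u) k)\<^sup>2) < \<infinity>"
  proof -
    have "nsum (\<lambda>q. ennreal (jn q) * (jnm u q)\<^sup>2) = wsum (\<lambda>k. (jn k) ^ 3) u"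
      unfolding wsum_def using jn_nonneg
      by (intro nn_integral_cong) (simp add: ennreal_power ennreal_mult[symmetric] power_mult_distrib power2_eq_square power3_eq_cube mult_ac)
    then have "nsum (\<lambda>k. (cv (nm u) (jnm u) k)\<^sup>2) \<le> 2 * inv_cube_sum * wsum (\<lambda>k. (jn k)\<^sup>2) u * wsum (\<lambda>k. jn k ^ 3) u"
      using cv_bound_positive[of "nm u" "jnm u"] by (simp only: nsum_jn_nm)
    also have "\<dots> < \<infinity>" using fin2 fin3 inv_cube_sum_finite by (simp add: ennreal_mult_less_top)
    finally show ?thesis .
  qed
  \<comment> \<open>Reindexing and iterated summation require absolute convergence over both
    indices. This is where D(A) enters: \<open>|k|^2 |u k|\<close> is square summable, and so is the
    convolution by \<open>cv_bound_positive\<close>.\<close>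
  have abs: "(\<lambda>x. norm (?F x)) summable_on UNIV"
  proof (rule nsum_finite_summable)
    have "nsum (\<lambda>x. ennreal (norm (?F x))) = nsum (\<lambda>k. nsum (\<lambda>p. ennreal (norm (triad u h p (k - p)))))"
      by (subst nn_integral_fst_count_space[symmetric]) simp
    also have "\<dots> \<le> nsum (\<lambda>k. ennreal ((jn k)\<^sup>2 * norm (u k)) * cv (nm u) (jnm u) k)"
    proof (intro nn_integral_mono)
      fix k
      have "nsum (\<lambda>p. ennreal (norm (triad u h p (k - p)))) \<le> nsum (\<lambda>p. ennreal ((jn k)\<^sup>2 * norm (u k)) * ennreal (norm (cterm u u k p)))"
      proof (intro nn_integral_mono)
        fix p
        have "norm (triad u h p (k - p)) = h k * cmod (cdot (cterm u u k p) (u (- k)))"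
          using h0 unfolding triad_eq[where h=h, OF u0 div hs, symmetric] by (simp add: norm_mult)
        also have "\<dots> \<le> (jn k)\<^sup>2 * (norm (cterm u u k p) * norm (u (- k)))"
          by (intro mult_mono hle norm_cdot_le) auto
        finally have "norm (triad u h p (k - p)) \<le> ((jn k)\<^sup>2 * norm (u k)) * norm (cterm u u k p)"
          by (simp add: real mult_ac)
        then show "ennreal (norm (triad u h p (k - p))) \<le> ennreal ((jn k)\<^sup>2 * norm (u k)) * ennreal (norm (cterm u u k p))"
          by (simp add: ennreal_mult[symmetric] ennreal_leI)
      qed
      also have "\<dots> = ennreal ((jn k)\<^sup>2 * norm (u k)) * nsum (\<lambda>p. ennreal (norm (cterm u u k p)))"
        by (rule nn_integral_cmult) simp
      also have "\<dots> \<le> ennreal ((jn k)\<^sup>2 * norm (u k)) * cv (nm u) (jnm u) k"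
        by (intro mult_left_mono nsum_cterm_le) simp
      finally show "nsum (\<lambda>p. ennreal (norm (triad u h p (k - p)))) \<le> ennreal ((jn k)\<^sup>2 * norm (u k)) * cv (nm u) (jnm u) k" .
    qed
    also have "\<dots> < \<infinity>"
    proof -
      have "(nsum (\<lambda>k. ennreal ((jn k)\<^sup>2 * norm (u k)) * cv (nm u) (jnm u) k))\<^sup>2 \<le>
        nsum (\<lambda>k. (ennreal ((jn k)\<^sup>2 * norm (u k)))\<^sup>2) * nsum (\<lambda>k. (cv (nm u) (jnm u) k)\<^sup>2)"
        by (rule Cauchy_Schwarz_nn_integral) auto
      also have "nsum (\<lambda>k. (ennreal ((jn k)\<^sup>2 * norm (u k)))\<^sup>2) = wsum (\<lambda>k. jn k ^ 4) u"
        by (simp add: wsum_def ennreal_power power_mult_distrib power_mult[symmetric])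
      also have "wsum (\<lambda>k. jn k ^ 4) u * nsum (\<lambda>k. (cv (nm u) (jnm u) k)\<^sup>2) < \<infinity>"
        using DA cvf by (simp add: ennreal_mult_less_top)
      finally show ?thesis by (rule ennreal_sq_finite)
    qed
    finally show "nsum (\<lambda>x. ennreal (norm (?F x))) < \<infinity>" .
  qed simp
  then have "?F summable_on UNIV" by (rule abs_summable_summable)
  then obtain S where S: "(?F has_sum S) UNIV" by (auto simp: summable_on_def)
  let ?G = "\<lambda>(p, q). triad u h p q"
  have reindex: "((\<lambda>x. f (\<phi> x)) has_sum s) UNIV \<longleftrightarrow> (f has_sum s) UNIV" if "\<And>x. \<psi> (\<phi> x) = x" "\<And>x. \<phi> (\<psi> x) = x"
    for f :: "(int \<times> int) \<times> (int \<times> int) \<Rightarrow> complex" and \<phi> \<psi> s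
  proof (rule has_sum_reindex_bij_betw)
    show "bij \<phi>" using that by (intro bij_betw_byWitness[where f'=\<psi>]) auto
  qed
  have G: "(?G has_sum S) UNIV"
    using S reindex[of "\<lambda>(p, q). (p + q, p)" "\<lambda>(k, p). (p, k - p)" ?G S] by (simp add: case_prod_unfold)
  have perm: "((\<lambda>(p, q). triad u h q (- p - q)) has_sum S) UNIV" "((\<lambda>(p, q). triad u h (- p - q) p) has_sum S) UNIV"
    "((\<lambda>(p, q). triad u h q p) has_sum S) UNIV" "((\<lambda>(p, q). triad u h (- p - q) q) has_sum S) UNIV"
    "((\<lambda>(p, q). triad u h p (- p - q)) has_sum S) UNIV"
    using G reindex[of "\<lambda>(p, q). (- p - q, p)" "\<lambda>(p, q). (q, - p - q)" ?G S]
      reindex[of "\<lambda>(p, q). (q, - p - q)" "\<lambda>(p, q). (- p - q, p)" ?G S]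
      reindex[of "\<lambda>(p, q). (q, p)" "\<lambda>(p, q). (q, p)" ?G S]
      reindex[of "\<lambda>(p, q). (- p - q, q)" "\<lambda>(p, q). (- p - q, q)" ?G S]
      reindex[of "\<lambda>(p, q). (p, - p - q)" "\<lambda>(p, q). (p, - p - q)" ?G S]
    by (simp_all add: case_prod_unfold)
  \<comment> \<open>The six permuted families all have the sum \<open>S\<close>, while their terms
    cancel, so \<open>6 S = 0\<close>.\<close>
  have "((\<lambda>x. ?G x + (\<lambda>(p, q). triad u h q (- p - q)) x + (\<lambda>(p, q). triad u h (- p - q) p) x + (\<lambda>(p, q). triad u h q p) x
     + (\<lambda>(p, q). triad u h (- p - q) q) x + (\<lambda>(p, q). triad u h p (- p - q)) x) has_sum (S + S + S + S + S + S)) UNIV"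
    by (intro has_sum_add G perm)
  moreover have "(\<lambda>x. ?G x + (\<lambda>(p, q). triad u h q (- p - q)) x + (\<lambda>(p, q). triad u h (- p - q) p) x + (\<lambda>(p, q). triad u h q p) x
     + (\<lambda>(p, q). triad u h (- p - q) q) x + (\<lambda>(p, q). triad u h p (- p - q)) x) = (\<lambda>_. 0)"
    using triad_symmetrization[OF h, of u] by (auto simp: fun_eq_iff)
  ultimately have "S + S + S + S + S + S = 0" using has_sum_unique[OF _ has_sum_0] by (metis (full_types))
  then have S0: "S = 0" by simp
  have inner: "((\<lambda>p. triad u h p (k - p)) has_sum (of_real (h k) * cdot (conv u u k) (u (- k)))) UNIV" for k
  proof -
    have bl: "bounded_linear (\<lambda>v. of_real (h k) * cdot v (u (- k)))"
      unfolding cdot_def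
      by (intro bounded_linear_mult_right[THEN bounded_linear_compose] bounded_linear_add
          bounded_linear_mult_left[THEN bounded_linear_compose] bounded_linear_fst bounded_linear_snd)
    show ?thesis
      using has_sum_bounded_linear[OF bl has_sum_infsum[OF cterm_summable[OF Vf Vf, of k]]]
      unfolding conv_eq triad_eq[where h=h, OF u0 div hs] by simp
  qed
  have "((\<lambda>k. of_real (h k) * cdot (conv u u k) (u (- k))) has_sum 0) UNIV"
    by (rule has_sum_SigmaD[where f="?F" and B="\<lambda>_. UNIV"]) (use S S0 inner in simp_all)
  then have "((\<lambda>k. Re (of_real (h k) * cdot (conv u u k) (u (- k)))) has_sum Re 0) UNIV" by (rule has_sum_Re)
  moreover have "Re (of_real (h k) * cdot (conv u u k) (u (- k))) = h k * (Bop u u k \<bullet> u k)" for k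
    by (simp only: inner_Bop_eq[where u=u and v=u and k=k, OF u0 div] inner_eq_Re_cdot[of "conv u u k"] real) simp
  ultimately show ?thesis by (simp only: zero_complex.sel)
qed

section \<open>The cutoff nonlinearity\<close>


lemma wsum_scaleR: "wsum w (\<lambda>i. c *\<^sub>R u i) = ennreal (c\<^sup>2) * wsum w u"
  if "\<And>i. 0 \<le> w i"
proof -
  have "wsum w (\<lambda>i. c *\<^sub>R u i) = nsum (\<lambda>i. ennreal (c\<^sup>2) * ennreal (w i * (norm (u i))\<^sup>2))"
    unfolding wsum_def by (intro nn_integral_cong) (simp add: ennreal_mult[symmetric] that power_mult_distrib mult_ac)
  then show ?thesis unfolding wsum_def by (simp add: nn_integral_cmult)
qed

lemma wsum_weight_mult:
  assumes "0 \<le> c" "\<And>i. 0 \<le> w i" shows "wsum (\<lambda>i. c * w i) u = ennreal c * wsum w u"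
proof -
  have "wsum (\<lambda>i. c * w i) u = nsum (\<lambda>i. ennreal c * ennreal (w i * (norm (u i))\<^sup>2))"
    unfolding wsum_def using assms by (intro nn_integral_cong) (simp add: ennreal_mult[symmetric] mult_ac)
  then show ?thesis unfolding wsum_def by (simp add: nn_integral_cmult)
qed

lemma wsum_pair:
  assumes "\<And>i. 0 \<le> w i"
  shows "wsum w (\<lambda>k. (u k, v k)) = wsum w u + wsum w v"
proof -
  have "wsum w (\<lambda>k. (u k, v k)) = nsum (\<lambda>k. ennreal (w k * (norm (u k))\<^sup>2) + ennreal (w k * (norm (v k))\<^sup>2))"
    unfolding wsum_def using assms
    by (intro nn_integral_cong) (simp add: ennreal_plus[symmetric] norm_Pair distrib_left del: ennreal_plus)
  then show ?thesis unfolding wsum_def by (simp add: nn_integral_add)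
qed

lemma wsum_fst_snd:
  assumes "\<And>i. 0 \<le> w i"
  shows "wsum w x = wsum w (\<lambda>k. fst (x k)) + wsum w (\<lambda>k. snd (x k))"
  using wsum_pair[where w=w, OF assms, of "\<lambda>k. fst (x k)" "\<lambda>k. snd (x k)"] by simp

section \<open>Weighted norms and the radial cutoff\<close>

definition wnrm :: "('i \<Rightarrow> real) \<Rightarrow> ('i \<Rightarrow> 'e::real_normed_vector) \<Rightarrow> real" where
  "wnrm w x = sqrt (enn2real (wsum w x))"

lemma wnrm_nonneg: "0 \<le> wnrm w x" by (simp add: wnrm_def)

lemma wsum_eq_wnrm: "wsum w x < \<infinity> \<Longrightarrow> wsum w x = ennreal ((wnrm w x)\<^sup>2)"
  by (simp add: wnrm_def)

lemma wnrm_le: "wsum w x \<le> ennreal (c\<^sup>2) \<Longrightarrow> 0 \<le> c \<Longrightarrow> wnrm w x \<le> c"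
  unfolding wnrm_def by (intro real_le_lsqrt enn2real_leI) auto

lemma ennreal_sq_le_imp_le:
  assumes "(x :: ennreal)\<^sup>2 \<le> (ennreal c)\<^sup>2" "0 \<le> c" shows "x \<le> ennreal c"
proof (cases x)
  case (real r)
  then have "r\<^sup>2 \<le> c\<^sup>2" using assms by (simp add: ennreal_power)
  then show ?thesis using real assms(2) by (auto intro!: ennreal_leI power2_le_imp_le)
next
  case top
  then show ?thesis using assms by (simp add: ennreal_power power2_eq_square[of top] ennreal_top_mult top_unique)
qed

text \<open>The constant has to be 1 here, unlike in \<open>wsum_add_le\<close>: the reverse
  triangle inequality derived from it is what makes the cutoff Lipschitz.\<close>

lemma wnrm_triangle:
  assumes w: "\<And>i. 0 \<le> w i" and x: "wsum w x < \<infinity>" and y: "wsum w y < \<infinity>"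
  shows "wnrm w (\<lambda>i. x i + y i) \<le> wnrm w x + wnrm w y"
proof (rule wnrm_le)
  let ?P = "nsum (\<lambda>i. ennreal (sqrt (w i) * norm (x i)) * ennreal (sqrt (w i) * norm (y i)))"
  have "?P\<^sup>2 \<le> nsum (\<lambda>i. (ennreal (sqrt (w i) * norm (x i)))\<^sup>2) * nsum (\<lambda>i. (ennreal (sqrt (w i) * norm (y i)))\<^sup>2)"
    by (rule Cauchy_Schwarz_nn_integral) auto
  also have "\<dots> = wsum w x * wsum w y"
    using w by (simp add: wsum_def ennreal_power power_mult_distrib)
  also have "\<dots> = (ennreal (wnrm w x * wnrm w y))\<^sup>2"
    using x y by (simp add: wsum_eq_wnrm ennreal_power ennreal_mult[symmetric] power_mult_distrib wnrm_nonneg)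
  finally have P: "?P \<le> ennreal (wnrm w x * wnrm w y)"
    by (rule ennreal_sq_le_imp_le) (simp add: wnrm_nonneg)
  have "wsum w (\<lambda>i. x i + y i) \<le> nsum (\<lambda>i. ennreal (w i * (norm (x i))\<^sup>2) + ennreal (w i * (norm (y i))\<^sup>2)
      + 2 * (ennreal (sqrt (w i) * norm (x i)) * ennreal (sqrt (w i) * norm (y i))))"
    unfolding wsum_def
  proof (intro nn_integral_mono)
    fix i
    have "w i * (norm (x i + y i))\<^sup>2 \<le> w i * (norm (x i) + norm (y i))\<^sup>2"
      using w by (intro mult_left_mono power_mono norm_triangle_ineq) auto
    also have "\<dots> = w i * (norm (x i))\<^sup>2 + w i * (norm (y i))\<^sup>2 + 2 * ((sqrt (w i) * norm (x i)) * (sqrt (w i) * norm (y i)))"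
    proof -
      have "sqrt (w i) * norm (x i) * (sqrt (w i) * norm (y i)) = (sqrt (w i))\<^sup>2 * (norm (x i) * norm (y i))"
        by (simp add: power2_eq_square mult_ac)
      then show ?thesis using w[of i] by (simp add: power2_sum algebra_simps)
    qed
    finally have "ennreal (w i * (norm (x i + y i))\<^sup>2) \<le> ennreal \<dots>" by (rule ennreal_leI)
    also have "\<dots> = ennreal (w i * (norm (x i))\<^sup>2) + ennreal (w i * (norm (y i))\<^sup>2)
      + 2 * (ennreal (sqrt (w i) * norm (x i)) * ennreal (sqrt (w i) * norm (y i)))"
      using w[of i] by (simp add: ennreal_mult)
    finally show "ennreal (w i * (norm (x i + y i))\<^sup>2) \<le> \<dots>" .
  qed
  also have "\<dots> = wsum w x + wsum w y + 2 * ?P"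
    unfolding wsum_def by (simp add: nn_integral_add nn_integral_cmult)
  also have "\<dots> \<le> ennreal ((wnrm w x)\<^sup>2) + ennreal ((wnrm w y)\<^sup>2) + 2 * ennreal (wnrm w x * wnrm w y)"
    using x y P by (intro add_mono mult_left_mono) (auto simp: wsum_eq_wnrm)
  also have "\<dots> = ennreal ((wnrm w x + wnrm w y)\<^sup>2)"
    using wnrm_nonneg[of w x] wnrm_nonneg[of w y] by (simp add: power2_sum ennreal_mult mult.assoc)
  finally show "wsum w (\<lambda>i. x i + y i) \<le> ennreal ((wnrm w x + wnrm w y)\<^sup>2)" .
qed (simp add: wnrm_nonneg)

lemma wsum_diff_finite:
  assumes w: "\<And>i. 0 \<le> w i" and "wsum w x < \<infinity>" "wsum w y < \<infinity>"
  shows "wsum w (\<lambda>i. x i - y i) < \<infinity>"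
proof -
  have "wsum w (\<lambda>i. x i - y i) \<le> 2 * wsum w x + 2 * wsum w (\<lambda>i. - y i)"
    using wsum_add_le[where w=w, OF w, of x "\<lambda>i. - y i"] by simp
  also have "wsum w (\<lambda>i. - y i) = wsum w y" by (simp add: wsum_def)
  also have "2 * wsum w x + 2 * wsum w y < \<infinity>" using assms by (simp add: ennreal_mult_less_top)
  finally show ?thesis .
qed

lemma wnrm_diff_abs_le:
  assumes w: "\<And>i. 0 \<le> w i" and x: "wsum w x < \<infinity>" and y: "wsum w y < \<infinity>"
  shows "\<bar>wnrm w x - wnrm w y\<bar> \<le> wnrm w (\<lambda>i. x i - y i)"
proof -
  have 1: "wnrm w (\<lambda>i. (x i - y i) + y i) \<le> wnrm w (\<lambda>i. x i - y i) + wnrm w y"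
    by (intro wnrm_triangle w y wsum_diff_finite x)
  have 2: "wnrm w (\<lambda>i. (y i - x i) + x i) \<le> wnrm w (\<lambda>i. y i - x i) + wnrm w x"
    by (intro wnrm_triangle w y wsum_diff_finite x)
  have "wnrm w (\<lambda>i. y i - x i) = wnrm w (\<lambda>i. x i - y i)" by (simp only: wnrm_def wsum_minus_commute[of w y x])
  then show ?thesis using 1 2 by simp
qed

definition cut :: "('i \<Rightarrow> real) \<Rightarrow> real \<Rightarrow> ('i \<Rightarrow> 'e::real_normed_vector) \<Rightarrow> real" where
  "cut w R x = R / max R (wnrm w x)"

lemma cut_bounds: assumes "0 < R" shows "0 \<le> cut w R x" "cut w R x \<le> 1" "cut w R x * wnrm w x \<le> R"
proof -
  have m: "0 < max R (wnrm w x)" using assms by simp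
  show "0 \<le> cut w R x" "cut w R x \<le> 1" using assms m by (auto simp: cut_def)
  have "R * wnrm w x \<le> R * max R (wnrm w x)" using assms by (intro mult_left_mono) auto
  then show "cut w R x * wnrm w x \<le> R" using m by (simp add: cut_def divide_le_eq)
qed

lemma cut_eq_1: "0 < R \<Longrightarrow> wnrm w x \<le> R \<Longrightarrow> cut w R x = 1"
  by (simp add: cut_def max_def)

text \<open>Write \<open>a x - b y = b (x - y) + (a - b) x\<close> with the cutoff values
  \<open>a\<close>, \<open>b\<close>. For \<open>p = max R |x|\<close> and
  \<open>q = max R |y|\<close> one has \<open>|a - b| |x| = (R / q) (|x| / p) |q - p|\<close>, so
  both terms are bounded by \<open>|x - y|\<close>. The constant is 2 for norms and 4 for squared
  norms.\<close>

lemma cut_lipschitz: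
  assumes R: "0 < R" and w: "\<And>i. 0 \<le> w i" and x: "wsum w x < \<infinity>" and y: "wsum w y < \<infinity>"
  shows "wsum w (\<lambda>i. cut w R x *\<^sub>R x i - cut w R y *\<^sub>R y i) \<le> 4 * wsum w (\<lambda>i. x i - y i)"
proof -
  let ?X = "wnrm w x" and ?Y = "wnrm w y" and ?D = "wnrm w (\<lambda>i. x i - y i)"
  let ?a = "cut w R x" and ?b = "cut w R y"
  have D: "\<bar>?X - ?Y\<bar> \<le> ?D" by (rule wnrm_diff_abs_le[where w=w, OF w x y])
  have d: "wsum w (\<lambda>i. x i - y i) < \<infinity>" by (rule wsum_diff_finite[where w=w, OF w x y])
  have ab: "\<bar>?a - ?b\<bar> * ?X \<le> ?D"
  proof -
    define p q where "p = max R ?X" and "q = max R ?Y"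
    have pq: "0 < p" "0 < q" "R \<le> q" "?X \<le> p" using R by (auto simp: p_def q_def)
    have "\<bar>?a - ?b\<bar> * ?X = (R / q) * (?X / p) * \<bar>q - p\<bar>"
    proof -
      have "?a - ?b = R * (q - p) / (p * q)" using pq by (simp add: cut_def p_def[symmetric] q_def[symmetric] diff_frac_eq algebra_simps)
      then show ?thesis using pq R by (simp add: abs_mult mult_ac)
    qed
    also have "\<dots> \<le> 1 * \<bar>q - p\<bar>"
      using pq R wnrm_nonneg[of w x] by (intro mult_right_mono mult_le_one) auto
    also have "\<bar>q - p\<bar> \<le> \<bar>?X - ?Y\<bar>" by (auto simp: p_def q_def max_def)
    finally show ?thesis using D by simp
  qed
  have "wsum w (\<lambda>i. ?a *\<^sub>R x i - ?b *\<^sub>R y i) = wsum w (\<lambda>i. ?b *\<^sub>R (x i - y i) + (?a - ?b) *\<^sub>R x i)"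
    by (simp add: algebra_simps)
  also have "\<dots> \<le> 2 * wsum w (\<lambda>i. ?b *\<^sub>R (x i - y i)) + 2 * wsum w (\<lambda>i. (?a - ?b) *\<^sub>R x i)"
    by (rule wsum_add_le[where w=w, OF w])
  also have "wsum w (\<lambda>i. ?b *\<^sub>R (x i - y i)) \<le> wsum w (\<lambda>i. x i - y i)"
  proof -
    have "?b\<^sup>2 \<le> 1" using cut_bounds[OF R, of w y] by (simp add: power_le_one)
    then have "ennreal (?b\<^sup>2) \<le> 1" by (simp add: ennreal_le_1)
    then show ?thesis unfolding wsum_scaleR[where w=w, OF w] using mult_right_mono[of "ennreal (?b\<^sup>2)" 1] by simp
  qed
  also have "wsum w (\<lambda>i. (?a - ?b) *\<^sub>R x i) \<le> wsum w (\<lambda>i. x i - y i)"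
  proof -
    have "wsum w (\<lambda>i. (?a - ?b) *\<^sub>R x i) = ennreal ((\<bar>?a - ?b\<bar> * ?X)\<^sup>2)"
      unfolding wsum_scaleR[where w=w, OF w] wsum_eq_wnrm[OF x] by (simp add: ennreal_mult[symmetric] power_mult_distrib)
    also have "\<dots> \<le> ennreal (?D\<^sup>2)" using ab wnrm_nonneg[of w x] by (intro ennreal_leI power_mono) auto
    finally show ?thesis using wsum_eq_wnrm[OF d] by simp
  qed
  finally show ?thesis by (simp add: mult_left_mono add_mono distrib_right[symmetric])
qed

section \<open>The nonlinear part of the coupled system\<close>

definition jn2 :: "int \<times> int \<Rightarrow> real" where "jn2 k = (jn k)\<^sup>2"
lemma jn2_nonneg: "0 \<le> jn2 k" by (simp add: jn2_def)

definition low :: "real \<Rightarrow> int \<times> int \<Rightarrow> real" where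
  "low N k = (if k \<noteq> (0, 0) \<and> sqrt (wnorm2 k) \<le> N then 1 else 0)"

text \<open>Turns the pair of \<open>B (v1, v1)\<close> and \<open>B (v2, v2)\<close> into the
  nonlinear parts of both right-hand sides. Being linear, it commutes with scalar cutoff
  factors.\<close>

definition mix :: "real \<Rightarrow> real \<Rightarrow> real \<Rightarrow> int \<times> int \<Rightarrow> cvec \<times> cvec \<Rightarrow> cvec \<times> cvec" where
  "mix N \<theta>1 \<theta>2 k b = ((\<theta>1 * low N k) *\<^sub>R (fst b - snd b) - fst b, (\<theta>2 * low N k) *\<^sub>R (snd b - fst b) - snd b)"

definition PB :: "(int \<times> int \<Rightarrow> cvec \<times> cvec) \<Rightarrow> (int \<times> int \<Rightarrow> cvec \<times> cvec) \<Rightarrow> int \<times> int \<Rightarrow> cvec \<times> cvec" where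
  "PB x y k = (Bop (\<lambda>k. fst (x k)) (\<lambda>k. fst (y k)) k, Bop (\<lambda>k. snd (x k)) (\<lambda>k. snd (y k)) k)"

lemma mix_diff: "mix N \<theta>1 \<theta>2 k (b - c) = mix N \<theta>1 \<theta>2 k b - mix N \<theta>1 \<theta>2 k c"
  by (simp add: mix_def algebra_simps)
lemma mix_scaleR: "mix N \<theta>1 \<theta>2 k (r *\<^sub>R b) = r *\<^sub>R mix N \<theta>1 \<theta>2 k b"
  by (simp add: mix_def algebra_simps)

lemma norm_mix_le:
  assumes "0 \<le> \<theta>1" "\<theta>1 \<le> 1" "0 \<le> \<theta>2" "\<theta>2 \<le> 1"
  shows "norm (mix N \<theta>1 \<theta>2 k b) \<le> 6 * norm b"
proof -
  have c: "0 \<le> low N k" "low N k \<le> 1" by (auto simp: low_def)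
  have f: "norm (fst b) \<le> norm b" "norm (snd b) \<le> norm b" by (cases b; simp add: norm_fst_le norm_snd_le)+
  have g: "norm ((\<theta> * low N k) *\<^sub>R (u - v) - u) \<le> 3 * norm b" if "0 \<le> \<theta>" "\<theta> \<le> 1" "norm u \<le> norm b" "norm v \<le> norm b"
    for \<theta> and u v :: cvec
  proof -
    have "norm ((\<theta> * low N k) *\<^sub>R (u - v) - u) \<le> norm ((\<theta> * low N k) *\<^sub>R (u - v)) + norm u" by (rule norm_triangle_ineq4)
    also have "norm ((\<theta> * low N k) *\<^sub>R (u - v)) \<le> 1 * norm (u - v)"
      unfolding norm_scaleR using that c by (intro mult_right_mono) (auto simp: abs_mult mult_le_one)
    also have "1 * norm (u - v) \<le> norm u + norm v" using norm_triangle_ineq4[of u v] by simp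
    finally show ?thesis using that by simp
  qed
  have "norm (mix N \<theta>1 \<theta>2 k b) \<le> norm ((\<theta>1 * low N k) *\<^sub>R (fst b - snd b) - fst b) + norm ((\<theta>2 * low N k) *\<^sub>R (snd b - fst b) - snd b)"
    unfolding mix_def by (rule norm_Pair_le)
  also have "\<dots> \<le> 3 * norm b + 3 * norm b" using assms f by (intro add_mono g) auto
  finally show ?thesis by simp
qed

lemma wsum_mix_le:
  assumes "0 \<le> \<theta>1" "\<theta>1 \<le> 1" "0 \<le> \<theta>2" "\<theta>2 \<le> 1" and w: "\<And>k. 0 \<le> w k"
  shows "wsum w (\<lambda>k. mix N \<theta>1 \<theta>2 k (b k)) \<le> 36 * wsum w b"
proof -
  have "wsum w (\<lambda>k. mix N \<theta>1 \<theta>2 k (b k)) \<le> wsum w (\<lambda>k. 6 *\<^sub>R b k)"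
    using norm_mix_le[OF assms(1-4)] w by (intro wsum_mono mult_left_mono power_mono) auto
  also have "\<dots> = 36 * wsum w b" unfolding wsum_scaleR[where w=w, OF w] by simp
  finally show ?thesis .
qed

lemma Vfin_components:
  assumes "wsum jn2 x < \<infinity>" shows "Vfin (\<lambda>k. fst (x k))" "Vfin (\<lambda>k. snd (x k))"
  using assms wsum_fst_snd[where w=jn2, OF jn2_nonneg, of x] by (auto simp: Vfin_def jn2_def[abs_def])

lemma PB_bound_negative:
  "wsum (\<lambda>k. 1 / jn k) (PB x y) \<le> ennreal Bop_const * wsum jn2 x * wsum jn2 y"
proof -
  have "wsum (\<lambda>k. 1 / jn k) (PB x y) = wsum (\<lambda>k. 1 / jn k) (Bop (\<lambda>k. fst (x k)) (\<lambda>k. fst (y k)))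
     + wsum (\<lambda>k. 1 / jn k) (Bop (\<lambda>k. snd (x k)) (\<lambda>k. snd (y k)))"
    unfolding PB_def[abs_def] using jn_nonneg by (intro wsum_pair) auto
  also have "\<dots> \<le> ennreal Bop_const * wsum jn2 (\<lambda>k. fst (x k)) * wsum jn2 (\<lambda>k. fst (y k))
     + ennreal Bop_const * wsum jn2 (\<lambda>k. snd (x k)) * wsum jn2 (\<lambda>k. snd (y k))"
    unfolding jn2_def[abs_def] by (intro add_mono Bop_bound_negative)
  also have "\<dots> \<le> ennreal Bop_const * (wsum jn2 (\<lambda>k. fst (x k)) + wsum jn2 (\<lambda>k. snd (x k))) * (wsum jn2 (\<lambda>k. fst (y k)) + wsum jn2 (\<lambda>k. snd (y k)))"
    by (simp add: distrib_left distrib_right add.assoc add_increasing add_left_mono add_increasing2)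
  finally show ?thesis by (simp only: wsum_fst_snd[where w=jn2, OF jn2_nonneg, symmetric])
qed

lemma PB_bound_positive:
  "wsum (\<lambda>k. 1) (PB x y) \<le> ennreal Bop_const * wsum jn2 x * wsum (\<lambda>k. jn k ^ 3) y"
proof -
  have "wsum (\<lambda>k. 1) (PB x y) = wsum (\<lambda>k. 1) (Bop (\<lambda>k. fst (x k)) (\<lambda>k. fst (y k)))
     + wsum (\<lambda>k. 1) (Bop (\<lambda>k. snd (x k)) (\<lambda>k. snd (y k)))"
    unfolding PB_def[abs_def] by (intro wsum_pair) auto
  also have "\<dots> \<le> ennreal Bop_const * wsum jn2 (\<lambda>k. fst (x k)) * wsum (\<lambda>k. jn k ^ 3) (\<lambda>k. fst (y k))
     + ennreal Bop_const * wsum jn2 (\<lambda>k. snd (x k)) * wsum (\<lambda>k. jn k ^ 3) (\<lambda>k. snd (y k))"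
    unfolding jn2_def[abs_def] by (intro add_mono Bop_bound_positive)
  also have "\<dots> \<le> ennreal Bop_const * (wsum jn2 (\<lambda>k. fst (x k)) + wsum jn2 (\<lambda>k. snd (x k))) * (wsum (\<lambda>k. jn k ^ 3) (\<lambda>k. fst (y k)) + wsum (\<lambda>k. jn k ^ 3) (\<lambda>k. snd (y k)))"
    by (simp add: distrib_left distrib_right add.assoc add_increasing add_left_mono add_increasing2)
  finally show ?thesis
    using wsum_fst_snd[where w=jn2, OF jn2_nonneg, of x] wsum_fst_snd[where w="\<lambda>k. jn k ^ 3" and x=y] jn_nonneg by simp
qed

lemma PB_scaleR: "PB (\<lambda>k. r *\<^sub>R x k) (\<lambda>k. r *\<^sub>R y k) k = r\<^sup>2 *\<^sub>R PB x y k"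
  using Bop_scaleR[of r "\<lambda>k. fst (x k)" "\<lambda>k. fst (y k)" k] Bop_scaleR[of r "\<lambda>k. snd (x k)" "\<lambda>k. snd (y k)" k]
  by (simp add: PB_def)

lemma PB_diff_square:
  assumes "wsum jn2 x < \<infinity>" "wsum jn2 y < \<infinity>"
  shows "PB x x k - PB y y k = PB (\<lambda>k. x k - y k) x k + PB y (\<lambda>k. x k - y k) k"
  using Vfin_components[OF assms(1)] Vfin_components[OF assms(2)]
  by (simp add: PB_def Bop_diff_left Bop_diff_right)

text \<open>Multiplying by the square of the cutoff amounts to evaluating the quadratic nonlinearity at the
  radial retraction of \<open>x\<close> to the ball of radius \<open>R\<close>, which is Lipschitz continuous.\<close>

definition cut_nonlin :: "real \<Rightarrow> real \<Rightarrow> real \<Rightarrow> real \<Rightarrow> (int \<times> int \<Rightarrow> cvec \<times> cvec) \<Rightarrow> int \<times> int \<Rightarrow> cvec \<times> cvec" where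
  "cut_nonlin N \<theta>1 \<theta>2 R x k = (if wsum jn2 x < \<infinity> then (cut jn2 R x)\<^sup>2 *\<^sub>R mix N \<theta>1 \<theta>2 k (PB x x k) else 0)"

lemma cut_nonlin_lipschitz:
  assumes th: "0 \<le> \<theta>1" "\<theta>1 \<le> 1" "0 \<le> \<theta>2" "\<theta>2 \<le> 1" and R: "0 < R"
    and x: "wsum jn2 x < \<infinity>" and y: "wsum jn2 y < \<infinity>"
  shows "wsum (\<lambda>k. 1 / jn k) (\<lambda>k. cut_nonlin N \<theta>1 \<theta>2 R x k - cut_nonlin N \<theta>1 \<theta>2 R y k)
    \<le> ennreal (576 * Bop_const * R\<^sup>2) * wsum jn2 (\<lambda>k. x k - y k)"
proof -
  let ?x = "\<lambda>k. cut jn2 R x *\<^sub>R x k" and ?y = "\<lambda>k. cut jn2 R y *\<^sub>R y k"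
  let ?z = "\<lambda>k. ?x k - ?y k" and ?w = "\<lambda>k. 1 / jn k"
  have w: "0 \<le> ?w k" for k using jn_nonneg by simp
  have bd: "wsum jn2 (\<lambda>k. cut jn2 R u *\<^sub>R u k) \<le> ennreal (R\<^sup>2)" if "wsum jn2 u < \<infinity>" for u :: "int \<times> int \<Rightarrow> cvec \<times> cvec"
  proof -
    have "wsum jn2 (\<lambda>k. cut jn2 R u *\<^sub>R u k) = ennreal ((cut jn2 R u * wnrm jn2 u)\<^sup>2)"
      unfolding wsum_scaleR[where w=jn2, OF jn2_nonneg] wsum_eq_wnrm[OF that] by (simp add: ennreal_mult[symmetric] power_mult_distrib)
    also have "\<dots> \<le> ennreal (R\<^sup>2)"
      using cut_bounds[OF R, of jn2 u] wnrm_nonneg[of jn2 u] by (intro ennreal_leI power_mono) auto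
    finally show ?thesis .
  qed
  have fin: "wsum jn2 ?x < \<infinity>" "wsum jn2 ?y < \<infinity>"
    using bd[OF x] bd[OF y] by (auto intro: le_less_trans)
  \<comment> \<open>\<open>PB\<close> is homogeneous of degree 2, so the squared cutoff moves into
    its arguments; the difference of the two quadratic terms is then polarized.\<close>
  have "wsum ?w (\<lambda>k. cut_nonlin N \<theta>1 \<theta>2 R x k - cut_nonlin N \<theta>1 \<theta>2 R y k) = wsum ?w (\<lambda>k. mix N \<theta>1 \<theta>2 k (PB ?z ?x k + PB ?y ?z k))"
    using x y by (simp add: cut_nonlin_def mix_scaleR[symmetric] PB_scaleR[symmetric] mix_diff[symmetric] PB_diff_square[OF fin])
  also have "\<dots> \<le> 36 * wsum ?w (\<lambda>k. PB ?z ?x k + PB ?y ?z k)" by (rule wsum_mix_le[where w="?w", OF th w])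
  also have "\<dots> \<le> 36 * (2 * wsum ?w (PB ?z ?x) + 2 * wsum ?w (PB ?y ?z))"
    by (intro mult_left_mono wsum_add_le w) auto
  also have "\<dots> \<le> 36 * (2 * (ennreal Bop_const * wsum jn2 ?z * wsum jn2 ?x) + 2 * (ennreal Bop_const * wsum jn2 ?y * wsum jn2 ?z))"
    by (intro mult_left_mono add_mono PB_bound_negative) auto
  also have "\<dots> \<le> 36 * (2 * (ennreal Bop_const * (4 * wsum jn2 (\<lambda>k. x k - y k)) * ennreal (R\<^sup>2)) + 2 * (ennreal Bop_const * ennreal (R\<^sup>2) * (4 * wsum jn2 (\<lambda>k. x k - y k))))"
    by (intro mult_left_mono add_mono mult_mono order_refl cut_lipschitz[where w=jn2, OF R jn2_nonneg x y] bd x y) auto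
  \<comment> \<open>\<open>576 = 36 * (2 * 4 + 2 * 4)\<close>: 36 from \<open>mix\<close>, 2 from
    \<open>wsum_add_le\<close>, 4 from the Lipschitz bound of the retraction.\<close>
  also have "\<dots> = 576 * (ennreal Bop_const * ennreal (R\<^sup>2)) * wsum jn2 (\<lambda>k. x k - y k)"
    by (simp add: mult_ac mult_2[symmetric] distrib_left[symmetric])
  also have "576 * (ennreal Bop_const * ennreal (R\<^sup>2)) = ennreal (576 * Bop_const * R\<^sup>2)"
    using Bop_const(2) by (simp add: ennreal_mult mult.assoc)
  finally show ?thesis .
qed

lemma cut_nonlin_measurable:
  assumes [measurable]: "\<And>k. (\<lambda>s::real. x s k) \<in> borel_measurable borel"
  shows "(\<lambda>s. cut_nonlin N \<theta>1 \<theta>2 R (x s) k) \<in> borel_measurable borel"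
proof -
  have [measurable]: "(\<lambda>s. PB (x s) (x s) k) \<in> borel_measurable borel"
    unfolding PB_def by (intro borel_measurable_Pair measurable_Bop) measurable
  show ?thesis unfolding cut_nonlin_def cut_def wnrm_def mix_def by measurable
qed

section \<open>Energy estimates and the energy identity\<close>


text \<open>Tonelli's theorem. It serves both sides of \<open>energy_sum\<close>, with
  \<open>c = a\<close> for the dissipation and \<open>c = 1 / a\<close> for the force.\<close>

lemma nsum_energy:
  fixes F :: "real \<Rightarrow> 'i::countable \<Rightarrow> 'e::euclidean_space"
  assumes Fm: "\<And>k. (\<lambda>s. F s k) \<in> borel_measurable borel" and w: "\<And>k. 0 \<le> w k" and c: "\<And>k. 0 \<le> c k"
  shows "nsum (\<lambda>k. ennreal (w k) * (ennreal ((norm (u k))\<^sup>2) + ennreal (c k) * (\<integral>\<^sup>+s\<in>{0..t}. ennreal ((norm (F s k))\<^sup>2) \<partial>lborel)))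
    = wsum w u + (\<integral>\<^sup>+s\<in>{0..t}. wsum (\<lambda>k. w k * c k) (F s) \<partial>lborel)"
proof -
  note [measurable] = Fm
  have "(\<integral>\<^sup>+s\<in>{0..t}. wsum (\<lambda>k. w k * c k) (F s) \<partial>lborel) = (\<integral>\<^sup>+s. nsum (\<lambda>k. ennreal (w k * c k) * (ennreal ((norm (F s k))\<^sup>2) * indicator {0..t} s)) \<partial>lborel)"
    unfolding wsum_def using w c
    by (intro nn_integral_cong) (simp add: nn_integral_multc[symmetric] ennreal_mult[symmetric] mult.assoc[symmetric])
  also have "\<dots> = nsum (\<lambda>k. \<integral>\<^sup>+s. ennreal (w k * c k) * (ennreal ((norm (F s k))\<^sup>2) * indicator {0..t} s) \<partial>lborel)"
    by (rule nsum_fubini) measurable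
  also have "\<dots> = nsum (\<lambda>k. ennreal (w k * c k) * (\<integral>\<^sup>+s\<in>{0..t}. ennreal ((norm (F s k))\<^sup>2) \<partial>lborel))"
    by (intro nn_integral_cong nn_integral_cmult) measurable
  finally show ?thesis
    using w c by (simp add: wsum_def nn_integral_add[symmetric] ennreal_mult distrib_left mult.assoc)
qed

lemma energy_sum:
  fixes x F :: "real \<Rightarrow> 'i::countable \<Rightarrow> 'e::euclidean_space"
  assumes a: "\<And>k. 0 < a k" and w: "\<And>k. 0 \<le> w k" and t: "0 \<le> t"
    and Fm: "\<And>k. (\<lambda>s. F s k) \<in> borel_measurable borel" and xm: "\<And>k. (\<lambda>s. x s k) \<in> borel_measurable borel"
    and F: "\<And>k. set_integrable lborel {0..t} (\<lambda>s. F s k)"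
    and int: "\<And>k. set_integrable lborel {0..t} (\<lambda>s. F s k - a k *\<^sub>R x s k)"
    and eq: "\<And>s k. s \<in> {0..t} \<Longrightarrow> x s k = x0 k + (LINT r:{0..s}|lborel. F r k - a k *\<^sub>R x r k)"
  shows "wsum w (x t) + (\<integral>\<^sup>+s\<in>{0..t}. wsum (\<lambda>k. w k * a k) (x s) \<partial>lborel)
    \<le> wsum w x0 + (\<integral>\<^sup>+s\<in>{0..t}. wsum (\<lambda>k. w k * (1 / a k)) (F s) \<partial>lborel)"
  unfolding nsum_energy[where c=a, OF xm w less_imp_le[OF a], symmetric]
    nsum_energy[where w=w and c="\<lambda>k. 1 / a k", OF Fm w divide_nonneg_nonneg[OF zero_le_one less_imp_le[OF a]], symmetric]
  by (intro nn_integral_mono mult_left_mono mode_energy[OF a t F int eq]) auto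

text \<open>Continuity in the weighted norm follows from continuity of each mode by dominated convergence,
  since the energy estimate bounds each mode uniformly in time by a summable sequence.\<close>

lemma energy_continuity:
  fixes x F :: "real \<Rightarrow> 'i::countable \<Rightarrow> 'e::euclidean_space"
  assumes a: "\<And>k. 0 < a k" and w: "\<And>k. 0 \<le> w k" and T: "0 \<le> T"
    and Fm: "\<And>k. (\<lambda>s. F s k) \<in> borel_measurable borel"
    and F: "\<And>k. set_integrable lborel {0..T} (\<lambda>s. F s k)"
    and int: "\<And>k. set_integrable lborel {0..T} (\<lambda>s. F s k - a k *\<^sub>R x s k)"
    and eq: "\<And>s k. s \<in> {0..T} \<Longrightarrow> x s k = x0 k + (LINT r:{0..s}|lborel. F r k - a k *\<^sub>R x r k)"
    and x0: "wsum w x0 < \<infinity>" and fin: "(\<integral>\<^sup>+s\<in>{0..T}. wsum (\<lambda>k. w k * (1 / a k)) (F s) \<partial>lborel) < \<infinity>"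
    and t: "t \<in> {0..T}" and e: "0 < e"
  shows "\<exists>d>0. \<forall>s\<in>{0..T}. \<bar>s - t\<bar> < d \<longrightarrow> wsum w (\<lambda>k. x s k - x t k) < ennreal e"
proof (rule ccontr)
  assume "\<not> ?thesis"
  then have "\<forall>d>0. \<exists>s\<in>{0..T}. \<bar>s - t\<bar> < d \<and> ennreal e \<le> wsum w (\<lambda>k. x s k - x t k)" by (simp only: not_less[symmetric]) blast
  then have "\<forall>n. \<exists>s\<in>{0..T}. \<bar>s - t\<bar> < 1 / real (Suc n) \<and> ennreal e \<le> wsum w (\<lambda>k. x s k - x t k)" by simp
  then obtain \<sigma> where \<sigma>: "\<And>n. \<sigma> n \<in> {0..T}" "\<And>n. \<bar>\<sigma> n - t\<bar> < 1 / real (Suc n)" "\<And>n. ennreal e \<le> wsum w (\<lambda>k. x (\<sigma> n) k - x t k)"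
    by metis
  have \<sigma>lim: "\<sigma> \<longlonglongrightarrow> t"
  proof -
    have "(\<lambda>n. \<sigma> n - t) \<longlonglongrightarrow> 0"
      by (rule tendsto_rabs_zero_cancel, rule tendsto_sandwich[OF _ _ tendsto_const LIMSEQ_inverse_real_of_nat])
        (use \<sigma>(2) in \<open>auto intro!: always_eventually simp: less_imp_le inverse_eq_divide\<close>)
    then show ?thesis using LIM_zero_iff by blast
  qed
  define b where "b k = ennreal (w k) * (ennreal ((norm (x0 k))\<^sup>2) + ennreal (1 / a k) * (\<integral>\<^sup>+s\<in>{0..T}. ennreal ((norm (F s k))\<^sup>2) \<partial>lborel))" for k
  have b: "nsum b < \<infinity>"
    unfolding b_def nsum_energy[where w=w and c="\<lambda>k. 1 / a k", OF Fm w divide_nonneg_nonneg[OF zero_le_one less_imp_le[OF a]]] using x0 fin by simp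
  have xb: "ennreal (w k * (norm (x s k))\<^sup>2) \<le> b k" if s: "s \<in> {0..T}" for s k
  proof -
    have sub: "set_integrable lborel {0..s} f" if "set_integrable lborel {0..T} f" for f :: "real \<Rightarrow> 'e"
      using that s by (auto intro: set_integrable_subset)
    have "ennreal ((norm (x s k))\<^sup>2) \<le> ennreal ((norm (x s k))\<^sup>2) + ennreal (a k) * (\<integral>\<^sup>+r\<in>{0..s}. ennreal ((norm (x r k))\<^sup>2) \<partial>lborel)" by simp
    also have "\<dots> \<le> ennreal ((norm (x0 k))\<^sup>2) + ennreal (1 / a k) * (\<integral>\<^sup>+r\<in>{0..s}. ennreal ((norm (F r k))\<^sup>2) \<partial>lborel)"
      by (rule mode_energy[OF a _ sub[OF F] sub[OF int]]) (use s eq in auto)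
    also have "\<dots> \<le> ennreal ((norm (x0 k))\<^sup>2) + ennreal (1 / a k) * (\<integral>\<^sup>+r\<in>{0..T}. ennreal ((norm (F r k))\<^sup>2) \<partial>lborel)"
      using s by (intro add_left_mono mult_left_mono nn_integral_mono) (auto simp: indicator_def)
    finally show ?thesis unfolding b_def using w[of k] by (simp add: ennreal_mult mult_left_mono)
  qed
  have "(\<lambda>n. wsum w (\<lambda>k. x (\<sigma> n) k - x t k)) \<longlonglongrightarrow> nsum (\<lambda>k::'i. 0)"
    unfolding wsum_def
  proof (rule nn_integral_dominated_convergence[where w="\<lambda>k. 4 * b k"])
    show "nsum (\<lambda>k. 4 * b k) < \<infinity>" using b by (simp add: nn_integral_cmult ennreal_mult_less_top)
    show "AE k in count_space UNIV. ennreal (w k * (norm (x (\<sigma> n) k - x t k))\<^sup>2) \<le> 4 * b k" for n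
    proof (rule AE_I2)
      fix k
      have "w k * (norm (x (\<sigma> n) k - x t k))\<^sup>2 \<le> w k * (2 * (norm (x (\<sigma> n) k))\<^sup>2 + 2 * (norm (x t k))\<^sup>2)"
        using norm_add_sq_le[of "x (\<sigma> n) k" "- x t k"] w by (intro mult_left_mono) auto
      then have "ennreal (w k * (norm (x (\<sigma> n) k - x t k))\<^sup>2) \<le> ennreal (2 * (w k * (norm (x (\<sigma> n) k))\<^sup>2) + 2 * (w k * (norm (x t k))\<^sup>2))"
        by (intro ennreal_leI) (simp add: algebra_simps)
      also have "\<dots> = 2 * ennreal (w k * (norm (x (\<sigma> n) k))\<^sup>2) + 2 * ennreal (w k * (norm (x t k))\<^sup>2)"
        using w[of k] by (subst two_ennreal_real) auto
      also have "\<dots> \<le> 2 * b k + 2 * b k" by (intro add_mono mult_left_mono xb \<sigma> t) auto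
      finally show "ennreal (w k * (norm (x (\<sigma> n) k - x t k))\<^sup>2) \<le> 4 * b k" by (simp add: distrib_right[symmetric])
    qed
    show "AE k in count_space UNIV. (\<lambda>n. ennreal (w k * (norm (x (\<sigma> n) k - x t k))\<^sup>2)) \<longlonglongrightarrow> 0"
    proof (rule AE_I2)
      fix k
      have "continuous_on {0..T} (\<lambda>s. x s k)" by (rule integral_equation_continuous[OF int eq])
      then have "(\<lambda>n. x (\<sigma> n) k) \<longlonglongrightarrow> x t k"
        by (rule continuous_on_tendsto_compose[OF _ \<sigma>lim t]) (use \<sigma>(1) in \<open>auto intro: always_eventually\<close>)
      then have "(\<lambda>n. ennreal (w k * (norm (x (\<sigma> n) k - x t k))\<^sup>2)) \<longlonglongrightarrow> ennreal (w k * (norm (x t k - x t k))\<^sup>2)"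
        by (intro tendsto_intros)
      then show "(\<lambda>n. ennreal (w k * (norm (x (\<sigma> n) k - x t k))\<^sup>2)) \<longlonglongrightarrow> 0" by simp
    qed
  qed auto
  then have "(\<lambda>n. wsum w (\<lambda>k. x (\<sigma> n) k - x t k)) \<longlonglongrightarrow> 0" by simp
  then have "ennreal e \<le> 0" by (rule LIMSEQ_le_const) (use \<sigma>(3) in auto)
  then show False using e by simp
qed

text \<open>A cofinal sequence of finite sets. It replaces the filter of finite subsets by a
  sequence, as dominated convergence requires.\<close>

definition box :: "nat \<Rightarrow> (int \<times> int) set" where
  "box n = {- int n..int n} \<times> {- int n..int n}"

lemma finite_box: "finite (box n)" by (simp add: box_def)

lemma filterlim_box: "filterlim box (finite_subsets_at_top UNIV) sequentially"
  unfolding filterlim_finite_subsets_at_top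
proof (intro allI impI)
  fix X :: "(int \<times> int) set" assume X: "finite X \<and> X \<subseteq> UNIV"
  have "\<exists>m. \<forall>k\<in>X. k \<in> box m"
    using conjunct1[OF X]
  proof (induction X rule: finite_induct)
    case (insert k X)
    then obtain m where m: "\<forall>k\<in>X. k \<in> box m" by blast
    define m' where "m' = max m (nat (max \<bar>fst k\<bar> \<bar>snd k\<bar>))"
    have "box m \<subseteq> box m'" by (auto simp: box_def m'_def)
    moreover have "k \<in> box m'" by (cases k) (auto simp: box_def m'_def)
    ultimately show ?case using m by blast
  qed simp
  then obtain m where m: "X \<subseteq> box m" by blast
  have "box m \<subseteq> box n" if "m \<le> n" for n using that by (auto simp: box_def)
  then show "\<forall>\<^sub>F n in sequentially. finite (box n) \<and> X \<subseteq> box n \<and> box n \<subseteq> UNIV"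
    using m finite_box unfolding eventually_sequentially by blast
qed

lemma has_sum_box: "(f has_sum S) UNIV \<Longrightarrow> (\<lambda>n. sum f (box n)) \<longlonglongrightarrow> S"
  unfolding has_sum_def using filterlim_compose[OF _ filterlim_box] by blast

text \<open>Provides a majorant that can be integrated in time: the weight \<open>h \<le> q\<close>
  costs one factor \<open>q\<close>, and \<open>q |u| |f|\<close> splits into contributions to the
  D(A) norm of \<open>u\<close> and the H norm of \<open>f\<close>.\<close>

lemma energy_term_bound:
  fixes u f :: "'e::euclidean_space"
  assumes h: "0 \<le> h" "h \<le> q" and q: "1 \<le> q" and nu: "0 \<le> \<nu>"
  shows "\<bar>h * (2 * (u \<bullet> f) - 2 * (\<nu> * q) * (norm u)\<^sup>2)\<bar> \<le> (1 + 2 * \<nu>) * (q\<^sup>2 * (norm u)\<^sup>2) + (norm f)\<^sup>2"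
proof -
  have "\<bar>h * (2 * (u \<bullet> f) - 2 * (\<nu> * q) * (norm u)\<^sup>2)\<bar> = h * \<bar>2 * (u \<bullet> f) - 2 * (\<nu> * q) * (norm u)\<^sup>2\<bar>"
    using h by (simp add: abs_mult)
  also have "\<dots> \<le> q * \<bar>2 * (u \<bullet> f) - 2 * (\<nu> * q) * (norm u)\<^sup>2\<bar>" using h by (intro mult_right_mono) auto
  also have "\<dots> \<le> q * (2 * (norm u * norm f) + 2 * (\<nu> * q) * (norm u)\<^sup>2)"
  proof (intro mult_left_mono)
    have "0 \<le> 2 * (\<nu> * q) * (norm u)\<^sup>2" using q nu by simp
    then show "\<bar>2 * (u \<bullet> f) - 2 * (\<nu> * q) * (norm u)\<^sup>2\<bar> \<le> 2 * (norm u * norm f) + 2 * (\<nu> * q) * (norm u)\<^sup>2"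
      using Cauchy_Schwarz_ineq2[of u f] by linarith
  qed (use q in simp)
  also have "\<dots> = 2 * ((q * norm u) * norm f) + 2 * \<nu> * (q\<^sup>2 * (norm u)\<^sup>2)"
    by (simp add: power2_eq_square algebra_simps)
  also have "2 * ((q * norm u) * norm f) \<le> (q * norm u)\<^sup>2 + (norm f)\<^sup>2"
    using sum_squares_bound[of "q * norm u" "norm f"] by simp
  finally show ?thesis by (simp add: power_mult_distrib algebra_simps)
qed

lemma jn4: "(jn k) ^ 4 = (jn2 k)\<^sup>2" by (simp add: jn2_def power_mult[symmetric])
lemma jn2_ge_1: "1 \<le> jn2 k" unfolding jn2_def using jn_ge_1 by (simp add: one_le_power)

lemma set_integral_at_0:
  fixes f :: "real \<Rightarrow> 'e::euclidean_space"
  shows "(LINT r:{0..0}|lborel. f r) = 0"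
  unfolding set_lebesgue_integral_def
proof (rule integral_eq_zero_AE)
  show "AE r in lborel. indicator {0..0} r *\<^sub>R f r = 0"
    using AE_lborel_singleton[of 0] by eventually_elim auto
qed

lemma ennreal_enn2real_le: "ennreal (enn2real x) \<le> x"
  by (cases x) auto

text \<open>For each mode this is the product rule. The sum over the modes is exchanged with the
  time integral by dominated convergence along \<open>box n\<close>, with the majorant
  \<open>d\<close>. The weight \<open>h\<close> stays general so as to cover both energy
  (\<open>h = 1\<close>) and enstrophy (\<open>h = wnorm2\<close>).\<close>

lemma energy_identity:
  fixes x F :: "real \<Rightarrow> int \<times> int \<Rightarrow> 'e::euclidean_space"
  assumes nu: "0 < \<nu>" and T: "0 \<le> T" and h: "\<And>k. 0 \<le> h k" "\<And>k. h k \<le> jn2 k"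
    and Fm: "\<And>k. (\<lambda>s. F s k) \<in> borel_measurable borel" and xm: "\<And>k. (\<lambda>s. x s k) \<in> borel_measurable borel"
    and int: "\<And>k. set_integrable lborel {0..T} (\<lambda>s. F s k - (\<nu> * jn2 k) *\<^sub>R x s k)"
    and eq: "\<And>s k. s \<in> {0..T} \<Longrightarrow> x s k = x0 k + (LINT r:{0..s}|lborel. F r k - (\<nu> * jn2 k) *\<^sub>R x r k)"
    and x4: "(\<integral>\<^sup>+s\<in>{0..T}. wsum (\<lambda>k. jn k ^ 4) (x s) \<partial>lborel) < \<infinity>"
    and F2: "(\<integral>\<^sup>+s\<in>{0..T}. wsum (\<lambda>k. 1) (F s) \<partial>lborel) < \<infinity>"
    and xV: "\<And>s. s \<in> {0..T} \<Longrightarrow> wsum jn2 (x s) < \<infinity>"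
    and t: "t \<in> {0..T}"
  defines "\<phi> \<equiv> \<lambda>s. infsum (\<lambda>k. h k * (2 * (x s k \<bullet> F s k) - 2 * (\<nu> * jn2 k) * (norm (x s k))\<^sup>2)) UNIV"
  shows "set_integrable lborel {0..t} \<phi>"
    and "infsum (\<lambda>k. h k * (norm (x t k))\<^sup>2) UNIV = infsum (\<lambda>k. h k * (norm (x0 k))\<^sup>2) UNIV + (LINT s:{0..t}|lborel. \<phi> s)"
    and "AE s in lborel. s \<in> {0..T} \<longrightarrow> (\<lambda>k. h k * (2 * (x s k \<bullet> F s k) - 2 * (\<nu> * jn2 k) * (norm (x s k))\<^sup>2)) summable_on UNIV"
    and "AE s in lborel. s \<in> {0..T} \<longrightarrow> wsum (\<lambda>k. jn k ^ 4) (x s) < \<infinity> \<and> wsum (\<lambda>k. 1) (F s) < \<infinity>"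
proof -
  note [measurable] = Fm xm
  define \<psi> where "\<psi> k s = h k * (2 * (x s k \<bullet> F s k) - 2 * (\<nu> * jn2 k) * (norm (x s k))\<^sup>2)" for k s
  define d where "d s = ennreal (1 + 2 * \<nu>) * wsum (\<lambda>k. jn k ^ 4) (x s) + wsum (\<lambda>k. 1) (F s)" for s
  have [measurable]: "d \<in> borel_measurable borel" "\<psi> k \<in> borel_measurable borel" for k
    unfolding d_def \<psi>_def by measurable
  have dfin: "(\<integral>\<^sup>+s\<in>{0..T}. d s \<partial>lborel) < \<infinity>"
  proof -
    have "(\<integral>\<^sup>+s\<in>{0..T}. d s \<partial>lborel) = ennreal (1 + 2 * \<nu>) * (\<integral>\<^sup>+s\<in>{0..T}. wsum (\<lambda>k. jn k ^ 4) (x s) \<partial>lborel) + (\<integral>\<^sup>+s\<in>{0..T}. wsum (\<lambda>k. 1) (F s) \<partial>lborel)"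
      unfolding d_def by (simp add: distrib_right nn_integral_add nn_integral_cmult mult.assoc)
    then show ?thesis using x4 F2 by (simp add: ennreal_mult_less_top)
  qed
  have AEd: "AE s in lborel. s \<in> {0..T} \<longrightarrow> d s < \<infinity>"
  proof -
    have "AE s in lborel. d s * indicator {0..T} s \<noteq> \<infinity>"
      using dfin by (intro nn_integral_PInf_AE) auto
    then show ?thesis by eventually_elim (auto simp: less_top)
  qed
  show AE4: "AE s in lborel. s \<in> {0..T} \<longrightarrow> wsum (\<lambda>k. jn k ^ 4) (x s) < \<infinity> \<and> wsum (\<lambda>k. 1) (F s) < \<infinity>"
    using AEd
  proof eventually_elim
    case (elim s)
    have "ennreal (1 + 2 * \<nu>) \<noteq> 0" using nu by (simp add: ennreal_eq_0_iff)
    then show ?case using elim unfolding d_def by (auto simp: ennreal_mult_less_top)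
  qed
  have \<psi>d: "nsum (\<lambda>k. ennreal \<bar>\<psi> k s\<bar>) \<le> d s" for s
  proof -
    have "nsum (\<lambda>k. ennreal \<bar>\<psi> k s\<bar>) \<le> nsum (\<lambda>k. ennreal (1 + 2 * \<nu>) * ennreal (jn k ^ 4 * (norm (x s k))\<^sup>2) + ennreal (1 * (norm (F s k))\<^sup>2))"
    proof (intro nn_integral_mono)
      fix k
      have "\<bar>\<psi> k s\<bar> \<le> (1 + 2 * \<nu>) * ((jn2 k)\<^sup>2 * (norm (x s k))\<^sup>2) + (norm (F s k))\<^sup>2"
        unfolding \<psi>_def using h nu jn2_ge_1 by (intro energy_term_bound) auto
      then have "ennreal \<bar>\<psi> k s\<bar> \<le> ennreal ((1 + 2 * \<nu>) * (jn k ^ 4 * (norm (x s k))\<^sup>2) + 1 * (norm (F s k))\<^sup>2)"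
        by (intro ennreal_leI) (simp add: jn4)
      also have "\<dots> = ennreal (1 + 2 * \<nu>) * ennreal (jn k ^ 4 * (norm (x s k))\<^sup>2) + ennreal (1 * (norm (F s k))\<^sup>2)"
        using nu jn_nonneg[of k] by (subst ennreal_plus) (auto simp: ennreal_mult[of "1 + 2 * \<nu>"] simp del: ennreal_plus)
      finally show "ennreal \<bar>\<psi> k s\<bar> \<le> \<dots>" .
    qed
    then show ?thesis unfolding d_def wsum_def by (simp add: nn_integral_add nn_integral_cmult)
  qed
  have abs: "(\<lambda>k. \<bar>\<psi> k s\<bar>) summable_on UNIV" if "d s < \<infinity>" for s
    by (rule nsum_finite_summable[OF abs_ge_zero le_less_trans[OF \<psi>d that]])
  have summ: "(\<lambda>k. \<psi> k s) summable_on UNIV" if "d s < \<infinity>" for s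
    by (rule abs_summable_summable) (use abs[OF that] in simp)
  show "AE s in lborel. s \<in> {0..T} \<longrightarrow> (\<lambda>k. h k * (2 * (x s k \<bullet> F s k) - 2 * (\<nu> * jn2 k) * (norm (x s k))\<^sup>2)) summable_on UNIV"
    using AEd
  proof eventually_elim
    case (elim s)
    then show ?case using summ[of s] unfolding \<psi>_def by blast
  qed
  have \<phi>_eq: "\<phi> s = infsum (\<lambda>k. \<psi> k s) UNIV" for s by (simp add: \<phi>_def \<psi>_def)
  have [measurable]: "\<phi> \<in> borel_measurable borel"
    unfolding \<phi>_eq[abs_def] by (intro measurable_infsum) measurable
  let ?D = "\<lambda>s. enn2real (d s * indicator {0..t} s)"
  have sT: "{0..t} \<subseteq> {0..T}" using t by auto
  have Dint: "integrable lborel ?D"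
  proof (rule integrableI_bounded)
    have "(\<integral>\<^sup>+s. ennreal (norm (?D s)) \<partial>lborel) \<le> (\<integral>\<^sup>+s\<in>{0..T}. d s \<partial>lborel)"
      using sT ennreal_enn2real_le by (intro nn_integral_mono) (auto simp: indicator_def)
    then show "(\<integral>\<^sup>+s. ennreal (norm (?D s)) \<partial>lborel) < \<infinity>" using dfin by (rule le_less_trans)
  qed measurable
  have sumbd: "\<bar>\<Sum>k\<in>A. \<psi> k s\<bar> \<le> enn2real (d s)" if "d s < \<infinity>" "finite A" for A s
  proof -
    have "ennreal \<bar>\<Sum>k\<in>A. \<psi> k s\<bar> \<le> ennreal (\<Sum>k\<in>A. \<bar>\<psi> k s\<bar>)" by (intro ennreal_leI sum_abs)
    also have "\<dots> = (\<Sum>k\<in>A. ennreal \<bar>\<psi> k s\<bar>)" by (simp add: sum_ennreal)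
    also have "\<dots> \<le> d s" using sum_le_nsum[OF that(2)] \<psi>d[of s] by (rule order_trans)
    finally show ?thesis using that(1) by (metis enn2real_ennreal enn2real_mono abs_ge_zero infinity_ennreal_def)
  qed
  define P where "P n s = indicator {0..t} s *\<^sub>R (\<Sum>k\<in>box n. \<psi> k s)" for n s
  have lim: "AE s in lborel. (\<lambda>n. P n s) \<longlonglongrightarrow> indicator {0..t} s *\<^sub>R \<phi> s"
    using AEd
  proof eventually_elim
    case (elim s)
    show ?case
    proof (cases "s \<in> {0..t}")
      case True
      then have "d s < \<infinity>" using elim sT by auto
      then have "((\<lambda>k. \<psi> k s) has_sum \<phi> s) UNIV" unfolding \<phi>_eq using summ by simp
      then show ?thesis unfolding P_def by (intro tendsto_intros has_sum_box)
    qed (simp add: P_def)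
  qed
  have bound: "AE s in lborel. norm (P n s) \<le> ?D s" for n
    using AEd
  proof eventually_elim
    case (elim s)
    show ?case using elim sT sumbd[OF _ finite_box, of s n] by (auto simp: P_def indicator_def)
  qed
  have Pm: "P n \<in> borel_measurable lborel" for n unfolding P_def by measurable
  have \<phi>m: "(\<lambda>s. indicator {0..t} s *\<^sub>R \<phi> s) \<in> borel_measurable lborel" by measurable
  note DCT = \<phi>m Pm Dint lim bound
  show "set_integrable lborel {0..t} \<phi>"
    unfolding set_integrable_def by (rule integrable_dominated_convergence[OF DCT])
  have L: "(\<lambda>n. integral\<^sup>L lborel (P n)) \<longlonglongrightarrow> (LINT s:{0..t}|lborel. \<phi> s)"
    unfolding set_lebesgue_integral_def by (rule integral_dominated_convergence[OF DCT])
  have mode: "set_integrable lborel {0..t} (\<psi> k)" "h k * (norm (x t k))\<^sup>2 = h k * (norm (x0 k))\<^sup>2 + (LINT s:{0..t}|lborel. \<psi> k s)" for k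
  proof -
    have it: "set_integrable lborel {0..t} (\<lambda>s. F s k - (\<nu> * jn2 k) *\<^sub>R x s k)"
      using int[of k] sT by (auto intro: set_integrable_subset)
    note R = integral_product_rule[OF bounded_bilinear_inner it it, of "\<lambda>s. x s k" "x0 k" "\<lambda>s. x s k" "x0 k"]
    have pe: "\<psi> k s = h k * ((F s k - (\<nu> * jn2 k) *\<^sub>R x s k) \<bullet> x s k + x s k \<bullet> (F s k - (\<nu> * jn2 k) *\<^sub>R x s k))" for s
      by (simp add: \<psi>_def inner_diff_left inner_diff_right inner_commute power2_norm_eq_inner algebra_simps)
    have R1: "set_integrable lborel {0..t} (\<lambda>s. (F s k - (\<nu> * jn2 k) *\<^sub>R x s k) \<bullet> x s k + x s k \<bullet> (F s k - (\<nu> * jn2 k) *\<^sub>R x s k))"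
      by (rule R(1)) (use eq sT t in auto)
    have R2: "x t k \<bullet> x t k = x0 k \<bullet> x0 k + (LINT s:{0..t}|lborel. (F s k - (\<nu> * jn2 k) *\<^sub>R x s k) \<bullet> x s k + x s k \<bullet> (F s k - (\<nu> * jn2 k) *\<^sub>R x s k))"
      by (rule R(2)) (use eq sT t in auto)
    show "set_integrable lborel {0..t} (\<psi> k)"
      unfolding pe[abs_def] by (rule set_integrable_mult_right) (rule R1)
    have "(LINT s:{0..t}|lborel. \<psi> k s) = h k * (LINT s:{0..t}|lborel. (F s k - (\<nu> * jn2 k) *\<^sub>R x s k) \<bullet> x s k + x s k \<bullet> (F s k - (\<nu> * jn2 k) *\<^sub>R x s k))"
      unfolding pe by (rule set_integral_mult_right)
    then show "h k * (norm (x t k))\<^sup>2 = h k * (norm (x0 k))\<^sup>2 + (LINT s:{0..t}|lborel. \<psi> k s)"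
      unfolding power2_norm_eq_inner R2 by (simp add: distrib_left)
  qed
  have PI: "integral\<^sup>L lborel (P n) = (\<Sum>k\<in>box n. h k * (norm (x t k))\<^sup>2) - (\<Sum>k\<in>box n. h k * (norm (x0 k))\<^sup>2)" for n
  proof -
    have "integral\<^sup>L lborel (P n) = (\<Sum>k\<in>box n. LINT s:{0..t}|lborel. \<psi> k s)"
      unfolding P_def[abs_def] scaleR_sum_right set_lebesgue_integral_def
      using mode(1) by (intro Bochner_Integration.integral_sum) (simp add: set_integrable_def)
    also have "\<dots> = (\<Sum>k\<in>box n. h k * (norm (x t k))\<^sup>2 - h k * (norm (x0 k))\<^sup>2)"
      using mode(2) by (intro sum.cong) auto
    finally show ?thesis by (simp add: sum_subtractf)
  qed
  have sx: "((\<lambda>k. h k * (norm (x s k))\<^sup>2) has_sum infsum (\<lambda>k. h k * (norm (x s k))\<^sup>2) UNIV) UNIV" if "s \<in> {0..T}" for s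
  proof -
    have "wsum h (x s) \<le> wsum jn2 (x s)" using h by (intro wsum_mono mult_right_mono) auto
    then have "wsum h (x s) < \<infinity>" using xV[OF that] by (rule le_less_trans)
    then show ?thesis unfolding wsum_def using h by (intro has_sum_infsum nsum_finite_summable) auto
  qed
  have x00: "x 0 k = x0 k" for k
    using eq[of 0 k, unfolded set_integral_at_0] T by simp
  have "(\<lambda>n. integral\<^sup>L lborel (P n)) \<longlonglongrightarrow> infsum (\<lambda>k. h k * (norm (x t k))\<^sup>2) UNIV - infsum (\<lambda>k. h k * (norm (x0 k))\<^sup>2) UNIV"
    unfolding PI using has_sum_box[OF sx[OF t]] has_sum_box[OF sx[of 0]] T by (intro tendsto_diff) (auto simp: x00)
  with L have "(LINT s:{0..t}|lborel. \<phi> s) = infsum (\<lambda>k. h k * (norm (x t k))\<^sup>2) UNIV - infsum (\<lambda>k. h k * (norm (x0 k))\<^sup>2) UNIV"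
    by (rule LIMSEQ_unique)
  then show "infsum (\<lambda>k. h k * (norm (x t k))\<^sup>2) UNIV = infsum (\<lambda>k. h k * (norm (x0 k))\<^sup>2) UNIV + (LINT s:{0..t}|lborel. \<phi> s)" by simp
qed

section \<open>Production of energy and enstrophy\<close>


definition solenoidal :: "fld \<Rightarrow> bool" where
  "solenoidal u \<longleftrightarrow> u 0 = 0 \<and> (\<forall>k. wdot k (u k) = 0) \<and> (\<forall>k. u (- k) = cconj (u k))"

definition sqsum :: "('i \<Rightarrow> 'e::real_normed_vector) \<Rightarrow> real" where
  "sqsum u = infsum (\<lambda>k. (norm (u k))\<^sup>2) UNIV"

lemma sqsum_nonneg: "0 \<le> sqsum u" unfolding sqsum_def by (intro infsum_nonneg) auto

lemma sqsum_has_sum: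
  assumes "wsum (\<lambda>_. 1) u < \<infinity>" shows "((\<lambda>k. (norm (u k))\<^sup>2) has_sum sqsum u) UNIV"
  unfolding sqsum_def using assms by (intro has_sum_infsum nsum_finite_summable) (auto simp: wsum_def)

lemma wsum_eq_sqsum: "wsum (\<lambda>_. 1) u < \<infinity> \<Longrightarrow> wsum (\<lambda>_. 1) u = ennreal (sqsum u)"
  using nsum_eq_infsum_real[of "\<lambda>k. (norm (u k))\<^sup>2"] has_sum_imp_summable[OF sqsum_has_sum, of u]
  by (simp add: wsum_def sqsum_def)

lemma sqsum_le: "wsum (\<lambda>_. 1) u \<le> ennreal M \<Longrightarrow> 0 \<le> M \<Longrightarrow> sqsum u \<le> M"
  using wsum_eq_sqsum[of u] by (metis ennreal_le_iff ennreal_less_top infinity_ennreal_def le_less_trans)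

lemma norm_sq_le_sqsum: assumes "wsum (\<lambda>_. 1) u < \<infinity>" shows "(norm (u k))\<^sup>2 \<le> sqsum u"
proof -
  have "ennreal (1 * (norm (u k))\<^sup>2) \<le> ennreal (sqsum u)"
    using wsum_mode_le[of "\<lambda>_. 1" k u] wsum_eq_sqsum[OF assms] by simp
  then show ?thesis using sqsum_nonneg[of u] by simp
qed

definition lowset :: "real \<Rightarrow> (int \<times> int) set" where
  "lowset N = {k. k \<noteq> (0, 0) \<and> sqrt (wnorm2 k) \<le> N}"

lemma finite_lowset: "finite (lowset N)"
proof (rule finite_subset)
  show "lowset N \<subseteq> box (nat \<lceil>\<bar>N\<bar>\<rceil>)"
  proof
    fix k assume k: "k \<in> lowset N"
    have "\<bar>real_of_int (fst k)\<bar> \<le> \<bar>N\<bar>" "\<bar>real_of_int (snd k)\<bar> \<le> \<bar>N\<bar>"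
    proof -
      have "\<bar>real_of_int (fst k)\<bar> \<le> sqrt (wnorm2 k)" "\<bar>real_of_int (snd k)\<bar> \<le> sqrt (wnorm2 k)"
        unfolding wnorm2_def by (auto intro!: real_le_rsqrt)
      then show "\<bar>real_of_int (fst k)\<bar> \<le> \<bar>N\<bar>" "\<bar>real_of_int (snd k)\<bar> \<le> \<bar>N\<bar>"
        using k by (auto simp: lowset_def)
    qed
    then have "\<bar>fst k\<bar> \<le> \<lceil>\<bar>N\<bar>\<rceil>" "\<bar>snd k\<bar> \<le> \<lceil>\<bar>N\<bar>\<rceil>" by linarith+
    then show "k \<in> box (nat \<lceil>\<bar>N\<bar>\<rceil>)" by (cases k) (auto simp: box_def)
  qed
qed (rule finite_box)

lemma jn_lowset: "k \<in> lowset N \<Longrightarrow> jn k \<le> max 1 N"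
  by (auto simp: lowset_def jn_def)

lemma low_eq: "low N k = (if k \<in> lowset N then 1 else 0)" by (auto simp: low_def lowset_def)

lemma wnorm2_le_jn2: "wnorm2 k \<le> jn2 k"
  using power_mono[OF sqrt_wnorm2_le_jn[of k], of 2] wnorm2_nonneg[of k] by (simp add: jn2_def)

lemma has_sum_low:
  fixes f :: "int \<times> int \<Rightarrow> real"
  shows "((\<lambda>k. low N k * f k) has_sum (\<Sum>k\<in>lowset N. f k)) UNIV"
  by (rule has_sum_finite_neutralI[OF finite_lowset]) (auto simp: low_eq)

lemma wsum_one_le_jn2: "wsum (\<lambda>_. 1) u \<le> wsum jn2 u"
  by (intro wsum_mono mult_right_mono) (auto simp: jn2_ge_1)

lemma wsum_one_le_jn4: "wsum (\<lambda>_. 1) u \<le> wsum (\<lambda>k. jn k ^ 4) u"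
  by (intro wsum_mono mult_right_mono) (auto intro: one_le_power jn_ge_1)

text \<open>The cancellation removes the inner product of B(u,u) with u, and the dissipation is
  dropped. The coupling is kept as an exact sum because it is estimated only after the balances of
  the two components have been combined. \<open>b'\<close> stands for the nonlinear term of the
  other component.\<close>

lemma energy_production:
  fixes u g b' :: fld
  assumes u: "solenoidal u" and u4: "wsum (\<lambda>k. jn k ^ 4) u < \<infinity>" and g: "wsum (\<lambda>_. 1) g < \<infinity>" and nu: "0 \<le> \<nu>"
    and f: "\<And>k. f k = \<kappa> *\<^sub>R ((\<theta> * low N k) *\<^sub>R (Bop u u k - b' k) - Bop u u k) + g k"
    and s: "(\<lambda>k. 1 * (2 * (u k \<bullet> f k) - 2 * (\<nu> * jn2 k) * (norm (u k))\<^sup>2)) summable_on UNIV"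
  shows "infsum (\<lambda>k. 1 * (2 * (u k \<bullet> f k) - 2 * (\<nu> * jn2 k) * (norm (u k))\<^sup>2)) UNIV
    \<le> 2 * \<kappa> * \<theta> * (\<Sum>k\<in>lowset N. (Bop u u k - b' k) \<bullet> u k) + sqsum u + sqsum g"
proof -
  let ?R = "\<lambda>k. (- 2 * \<kappa>) * (1 * (Bop u u k \<bullet> u k)) + (2 * \<kappa> * \<theta>) * (low N k * ((Bop u u k - b' k) \<bullet> u k)) + (norm (u k))\<^sup>2 + (norm (g k))\<^sup>2"
  have c: "((\<lambda>k. 1 * (Bop u u k \<bullet> u k)) has_sum 0) UNIV"
    using Bop_cancellation[where h="\<lambda>_. 1", OF _ _ _ u4] u unfolding solenoidal_def by simp
  have u1: "wsum (\<lambda>_. 1) u < \<infinity>" using wsum_one_le_jn4 u4 by (rule le_less_trans)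
  have R: "(?R has_sum ((- 2 * \<kappa>) * 0 + (2 * \<kappa> * \<theta>) * (\<Sum>k\<in>lowset N. (Bop u u k - b' k) \<bullet> u k) + sqsum u + sqsum g)) UNIV"
    by (intro has_sum_add has_sum_cmult_right c has_sum_low sqsum_has_sum u1 g)
  have le: "1 * (2 * (u k \<bullet> f k) - 2 * (\<nu> * jn2 k) * (norm (u k))\<^sup>2) \<le> ?R k" for k
  proof -
    have "u k \<bullet> f k = - \<kappa> * (Bop u u k \<bullet> u k) + (\<kappa> * \<theta>) * (low N k * ((Bop u u k - b' k) \<bullet> u k)) + u k \<bullet> g k"
      unfolding f by (simp add: inner_add_right inner_diff_right inner_diff_left inner_commute algebra_simps)
    moreover have "2 * (u k \<bullet> g k) \<le> (norm (u k))\<^sup>2 + (norm (g k))\<^sup>2"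
      using Cauchy_Schwarz_ineq2[of "u k" "g k"] sum_squares_bound[of "norm (u k)" "norm (g k)"] by linarith
    moreover have "0 \<le> 2 * (\<nu> * jn2 k) * (norm (u k))\<^sup>2" using nu jn2_nonneg by simp
    ultimately show ?thesis by (simp add: algebra_simps)
  qed
  have "infsum (\<lambda>k. 1 * (2 * (u k \<bullet> f k) - 2 * (\<nu> * jn2 k) * (norm (u k))\<^sup>2)) UNIV \<le> infsum ?R UNIV"
    by (rule infsum_mono[OF s has_sum_imp_summable[OF R] le])
  also have "infsum ?R UNIV = (- 2 * \<kappa>) * 0 + (2 * \<kappa> * \<theta>) * (\<Sum>k\<in>lowset N. (Bop u u k - b' k) \<bullet> u k) + sqsum u + sqsum g"
    by (rule infsumI[OF R])
  finally show ?thesis by simp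
qed

text \<open>The cancellation removes B, and the low-mode coupling together with \<open>g\<close>
  acts as a force \<open>h\<close> in H. Young's inequality
  \<open>2 |k|^2 (u, h) \<le> 2 \<nu> |k|^4 |u|^2 + |h|^2 / (2 \<nu>)\<close> is paid for by the
  dissipation; splitting \<open>h\<close> into its two parts costs the factor 2 that turns
  \<open>1 / (2 \<nu>)\<close> into \<open>1 / \<nu>\<close>.\<close>

lemma enstrophy_production:
  fixes u g b' :: fld
  assumes u: "solenoidal u" and u4: "wsum (\<lambda>k. jn k ^ 4) u < \<infinity>" and g: "wsum (\<lambda>_. 1) g < \<infinity>" and nu: "0 < \<nu>"
    and chi: "0 \<le> \<kappa>" "\<kappa> \<le> 1" and th: "0 \<le> \<theta>" "\<theta> \<le> 1"
    and f: "\<And>k. f k = \<kappa> *\<^sub>R ((\<theta> * low N k) *\<^sub>R (Bop u u k - b' k) - Bop u u k) + g k"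
    and s: "(\<lambda>k. wnorm2 k * (2 * (u k \<bullet> f k) - 2 * (\<nu> * jn2 k) * (norm (u k))\<^sup>2)) summable_on UNIV"
  shows "infsum (\<lambda>k. wnorm2 k * (2 * (u k \<bullet> f k) - 2 * (\<nu> * jn2 k) * (norm (u k))\<^sup>2)) UNIV
    \<le> (1 / \<nu>) * ((\<Sum>k\<in>lowset N. (norm (Bop u u k - b' k))\<^sup>2) + sqsum g)"
proof -
  let ?R = "\<lambda>k. (- 2 * \<kappa>) * (wnorm2 k * (Bop u u k \<bullet> u k)) + (1 / \<nu>) * (low N k * (norm (Bop u u k - b' k))\<^sup>2 + (norm (g k))\<^sup>2)"
  have c: "((\<lambda>k. wnorm2 k * (Bop u u k \<bullet> u k)) has_sum 0) UNIV"
    using Bop_cancellation[where h=wnorm2, OF _ _ _ u4] u unfolding solenoidal_def by simp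
  have R: "(?R has_sum ((- 2 * \<kappa>) * 0 + (1 / \<nu>) * ((\<Sum>k\<in>lowset N. (norm (Bop u u k - b' k))\<^sup>2) + sqsum g))) UNIV"
    by (intro has_sum_add has_sum_cmult_right c has_sum_low sqsum_has_sum g)
  have le: "wnorm2 k * (2 * (u k \<bullet> f k) - 2 * (\<nu> * jn2 k) * (norm (u k))\<^sup>2) \<le> ?R k" for k
  proof -
    let ?h = "(\<kappa> * \<theta> * low N k) *\<^sub>R (Bop u u k - b' k) + g k"
    have uf: "u k \<bullet> f k = - \<kappa> * (Bop u u k \<bullet> u k) + u k \<bullet> ?h"
      unfolding f by (simp add: inner_add_right inner_diff_right inner_diff_left inner_commute algebra_simps)
    have h: "(norm ?h)\<^sup>2 \<le> 2 * (low N k * (norm (Bop u u k - b' k))\<^sup>2 + (norm (g k))\<^sup>2)"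
    proof -
      have "(norm ?h)\<^sup>2 \<le> 2 * (norm ((\<kappa> * \<theta> * low N k) *\<^sub>R (Bop u u k - b' k)))\<^sup>2 + 2 * (norm (g k))\<^sup>2"
        by (rule norm_add_sq_le)
      also have "(norm ((\<kappa> * \<theta> * low N k) *\<^sub>R (Bop u u k - b' k)))\<^sup>2 \<le> low N k * (norm (Bop u u k - b' k))\<^sup>2"
      proof -
        have "(\<kappa> * \<theta>)\<^sup>2 \<le> 1" using chi th by (intro power_le_one mult_le_one) auto
        then show ?thesis by (auto simp: low_eq power_mult_distrib intro: mult_left_le_one_le)
      qed
      finally show ?thesis by simp
    qed
    have y: "2 * (u k \<bullet> ?h) \<le> 2 * \<nu> * wnorm2 k * (norm (u k))\<^sup>2 + (1 / (2 * \<nu> * wnorm2 k)) * (norm ?h)\<^sup>2" if "0 < wnorm2 k"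
    proof -
      define q where "q = sqrt (2 * \<nu> * wnorm2 k)"
      have q: "0 < q" "q\<^sup>2 = 2 * \<nu> * wnorm2 k" using that nu by (auto simp: q_def)
      have "2 * (u k \<bullet> ?h) \<le> 2 * (norm (u k) * norm ?h)" using Cauchy_Schwarz_ineq2[of "u k" ?h] by linarith
      also have "\<dots> = 2 * ((q * norm (u k)) * (norm ?h / q))" using q by simp
      also have "\<dots> \<le> (q * norm (u k))\<^sup>2 + (norm ?h / q)\<^sup>2"
        using sum_squares_bound[of "q * norm (u k)" "norm ?h / q"] by (simp only: mult.assoc)
      finally show ?thesis by (simp add: power_mult_distrib power_divide q(2))
    qed
    have "wnorm2 k * (2 * (u k \<bullet> ?h)) \<le> wnorm2 k * (2 * (\<nu> * jn2 k) * (norm (u k))\<^sup>2) + (1 / (2 * \<nu>)) * (norm ?h)\<^sup>2"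
    proof (cases "wnorm2 k = 0")
      case True
      then show ?thesis using nu by simp
    next
      case False
      then have w: "0 < wnorm2 k" using wnorm2_nonneg[of k] by simp
      have "wnorm2 k * (2 * (u k \<bullet> ?h)) \<le> wnorm2 k * (2 * \<nu> * wnorm2 k * (norm (u k))\<^sup>2 + (1 / (2 * \<nu> * wnorm2 k)) * (norm ?h)\<^sup>2)"
        using y[OF w] w by (intro mult_left_mono) auto
      also have "\<dots> = wnorm2 k * (2 * \<nu> * wnorm2 k * (norm (u k))\<^sup>2) + (1 / (2 * \<nu>)) * (norm ?h)\<^sup>2"
        using w nu by (simp add: field_simps)
      also have "wnorm2 k * (2 * \<nu> * wnorm2 k * (norm (u k))\<^sup>2) \<le> wnorm2 k * (2 * (\<nu> * jn2 k) * (norm (u k))\<^sup>2)"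
      proof -
        have "2 * \<nu> * wnorm2 k \<le> 2 * (\<nu> * jn2 k)" using wnorm2_le_jn2[of k] nu by simp
        then show ?thesis using w by (intro mult_left_mono mult_right_mono) auto
      qed
      finally show ?thesis by simp
    qed
    also have "(1 / (2 * \<nu>)) * (norm ?h)\<^sup>2 \<le> (1 / (2 * \<nu>)) * (2 * (low N k * (norm (Bop u u k - b' k))\<^sup>2 + (norm (g k))\<^sup>2))"
      using h nu by (intro mult_left_mono) auto
    also have "\<dots> = (1 / \<nu>) * (low N k * (norm (Bop u u k - b' k))\<^sup>2 + (norm (g k))\<^sup>2)" using nu by (simp add: field_simps)
    finally have "wnorm2 k * (2 * (u k \<bullet> ?h)) - wnorm2 k * (2 * (\<nu> * jn2 k) * (norm (u k))\<^sup>2)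
       \<le> (1 / \<nu>) * (low N k * (norm (Bop u u k - b' k))\<^sup>2 + (norm (g k))\<^sup>2)" by simp
    moreover have "wnorm2 k * (2 * (u k \<bullet> f k) - 2 * (\<nu> * jn2 k) * (norm (u k))\<^sup>2) =
      (- 2 * \<kappa>) * (wnorm2 k * (Bop u u k \<bullet> u k)) + (wnorm2 k * (2 * (u k \<bullet> ?h)) - wnorm2 k * (2 * (\<nu> * jn2 k) * (norm (u k))\<^sup>2))"
      unfolding uf by (simp only: distrib_left right_diff_distrib) (simp add: mult_ac)
    ultimately show ?thesis by linarith
  qed
  have "infsum (\<lambda>k. wnorm2 k * (2 * (u k \<bullet> f k) - 2 * (\<nu> * jn2 k) * (norm (u k))\<^sup>2)) UNIV \<le> infsum ?R UNIV"
    by (rule infsum_mono[OF s has_sum_imp_summable[OF R] le])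
  also have "infsum ?R UNIV = (- 2 * \<kappa>) * 0 + (1 / \<nu>) * ((\<Sum>k\<in>lowset N. (norm (Bop u u k - b' k))\<^sup>2) + sqsum g)"
    by (rule infsumI[OF R])
  finally show ?thesis by simp
qed

lemma norm_Bop_lowset:
  assumes "solenoidal u" "wsum (\<lambda>_. 1) u < \<infinity>" "k \<in> lowset N"
  shows "norm (Bop u u k) \<le> 2 * max 1 N * sqsum u"
proof -
  have "ennreal (norm (Bop u u k)) \<le> ennreal (2 * jn k) * wsum (\<lambda>_. 1) u"
    using assms(1) unfolding solenoidal_def by (intro norm_Bop_low_mode) blast
  also have "\<dots> = ennreal (2 * jn k * sqsum u)"
    using wsum_eq_sqsum[OF assms(2)] jn_nonneg[of k] sqsum_nonneg[of u] by (simp add: ennreal_mult[symmetric])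
  finally have "norm (Bop u u k) \<le> 2 * jn k * sqsum u"
    using jn_nonneg[of k] sqsum_nonneg[of u] by simp
  also have "\<dots> \<le> 2 * max 1 N * sqsum u"
    using jn_lowset[OF assms(3)] sqsum_nonneg[of u] by (intro mult_right_mono) auto
  finally show ?thesis .
qed

section \<open>Regularity of mild solutions\<close>


locale sync_data =
  fixes \<nu> N \<theta>1 \<theta>2 :: real and G :: "real \<Rightarrow> int \<times> int \<Rightarrow> cvec \<times> cvec" and M :: real
    and x0 :: "int \<times> int \<Rightarrow> cvec \<times> cvec"
  assumes nu: "0 < \<nu>" and th: "0 \<le> \<theta>1" "\<theta>1 \<le> 1" "0 \<le> \<theta>2" "\<theta>2 \<le> 1" and th_sum: "\<theta>1 + \<theta>2 = 1"
    and G_measurable: "\<And>k. (\<lambda>s. G s k) \<in> borel_measurable borel"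
    and M_nonneg: "0 \<le> M"
    and G_bound: "AE s in lborel. 0 \<le> s \<longrightarrow> wsum (\<lambda>_. 1) (G s) \<le> ennreal M"
    and x0_V: "wsum jn2 x0 < \<infinity>"
begin

definition force :: "(real \<Rightarrow> real) \<Rightarrow> (real \<Rightarrow> int \<times> int \<Rightarrow> cvec \<times> cvec) \<Rightarrow> real \<Rightarrow> int \<times> int \<Rightarrow> cvec \<times> cvec" where
  "force \<kappa> x s k = \<kappa> s *\<^sub>R mix N \<theta>1 \<theta>2 k (PB (x s) (x s) k) + G s k"

text \<open>The factor \<open>\<kappa>\<close> is the value of the cutoff along the solution; \<open>\<kappa> = 1\<close> is the original system.\<close>

definition solves :: "real \<Rightarrow> (real \<Rightarrow> real) \<Rightarrow> (real \<Rightarrow> int \<times> int \<Rightarrow> cvec \<times> cvec) \<Rightarrow> bool" where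
  "solves T \<kappa> x \<longleftrightarrow> \<kappa> \<in> borel_measurable borel \<and> (\<forall>s. 0 \<le> \<kappa> s \<and> \<kappa> s \<le> 1) \<and>
     (\<forall>k. (\<lambda>s. x s k) \<in> borel_measurable borel) \<and> (\<exists>K. \<forall>s\<in>{0..T}. wsum jn2 (x s) \<le> ennreal K) \<and>
     (\<forall>t\<in>{0..T}. \<forall>k. x t k = exp (- (\<nu> * jn2 k) * t) *\<^sub>R x0 k +
        (LINT s:{0..t}|lborel. exp (- (\<nu> * jn2 k) * (t - s)) *\<^sub>R force \<kappa> x s k))"

lemma diffusion_pos: "0 < \<nu> * jn2 k" using nu jn2_ge_1[of k] by simp

lemma wsum_G_weighted: "wsum (\<lambda>k. 1 / jn k) (G s) \<le> wsum (\<lambda>_. 1) (G s)"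
  using jn_ge_1 by (intro wsum_mono mult_right_mono) (auto simp: divide_le_eq_1 jn_pos)

lemma wsum_inverse_sqrt:
  "wsum (\<lambda>k. 1 / sqrt (\<nu> * jn2 k)) f = ennreal (1 / sqrt \<nu>) * wsum (\<lambda>k. 1 / jn k) f"
proof -
  have "(\<lambda>k. 1 / sqrt (\<nu> * jn2 k)) = (\<lambda>k. 1 / sqrt \<nu> * (1 / jn k))"
    using jn_nonneg by (simp add: real_sqrt_mult jn2_def)
  then show ?thesis using nu jn_nonneg by (simp only:) (rule wsum_weight_mult, auto)
qed

context
  fixes T :: real and \<kappa> and x
  assumes sol: "solves T \<kappa> x" and T: "0 \<le> T"
begin

lemma kappa: "0 \<le> \<kappa> s" "\<kappa> s \<le> 1" using sol by (auto simp: solves_def)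

lemma x_measurable: "(\<lambda>s. x s k) \<in> borel_measurable borel" using sol unfolding solves_def by blast

lemma x_V: "s \<in> {0..T} \<Longrightarrow> wsum jn2 (x s) < \<infinity>"
  using sol unfolding solves_def by (metis ennreal_less_top infinity_ennreal_def le_less_trans)

lemma force_measurable: "(\<lambda>s. force \<kappa> x s k) \<in> borel_measurable borel"
proof -
  have [measurable]: "\<kappa> \<in> borel_measurable borel" using sol by (simp add: solves_def)
  note [measurable] = x_measurable G_measurable
  have [measurable]: "(\<lambda>s. PB (x s) (x s) k) \<in> borel_measurable borel"
    unfolding PB_def by (intro borel_measurable_Pair measurable_Bop) measurable
  show ?thesis unfolding force_def mix_def by measurable
qed

lemma wsum_force_le:
  assumes w: "\<And>k. 0 \<le> w k"
  shows "wsum w (force \<kappa> x s) \<le> 72 * wsum w (PB (x s) (x s)) + 2 * wsum w (G s)"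
proof -
  have "wsum w (force \<kappa> x s) \<le> 2 * wsum w (\<lambda>k. \<kappa> s *\<^sub>R mix N \<theta>1 \<theta>2 k (PB (x s) (x s) k)) + 2 * wsum w (G s)"
    unfolding force_def[abs_def] by (rule wsum_add_le[where w=w, OF w])
  also have "wsum w (\<lambda>k. \<kappa> s *\<^sub>R mix N \<theta>1 \<theta>2 k (PB (x s) (x s) k)) \<le> wsum w (\<lambda>k. mix N \<theta>1 \<theta>2 k (PB (x s) (x s) k))"
    using kappa[of s] w by (intro wsum_mono mult_left_mono power_mono) (auto intro: mult_left_le_one_le)
  also have "\<dots> \<le> 36 * wsum w (PB (x s) (x s))" by (rule wsum_mix_le[where w=w, OF th w])
  finally show ?thesis by (simp add: mult_left_mono mult.assoc[symmetric])
qed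

lemma force_negative_bound:
  "\<exists>K\<ge>0. AE s in lborel. s \<in> {0..T} \<longrightarrow> wsum (\<lambda>k. 1 / jn k) (force \<kappa> x s) \<le> ennreal K"
proof -
  obtain K where K: "\<And>s. s \<in> {0..T} \<Longrightarrow> wsum jn2 (x s) \<le> ennreal K"
    using sol unfolding solves_def by blast
  have "AE s in lborel. s \<in> {0..T} \<longrightarrow> wsum (\<lambda>k. 1 / jn k) (force \<kappa> x s) \<le> ennreal (72 * (Bop_const * \<bar>K\<bar> * \<bar>K\<bar>) + 2 * M)"
    using G_bound
  proof eventually_elim
    case (elim s)
    show ?case
    proof
      assume s: "s \<in> {0..T}"
      have K': "wsum jn2 (x s) \<le> ennreal \<bar>K\<bar>" by (rule order_trans[OF K[OF s] ennreal_leI]) simp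
      have "wsum (\<lambda>k. 1 / jn k) (force \<kappa> x s) \<le> 72 * wsum (\<lambda>k. 1 / jn k) (PB (x s) (x s)) + 2 * wsum (\<lambda>k. 1 / jn k) (G s)"
        using jn_nonneg by (intro wsum_force_le) auto
      also have "\<dots> \<le> 72 * (ennreal Bop_const * ennreal \<bar>K\<bar> * ennreal \<bar>K\<bar>) + 2 * ennreal M"
        using elim s by (intro add_mono mult_left_mono order_trans[OF PB_bound_negative] mult_mono K' order_trans[OF wsum_G_weighted]) auto
      also have "\<dots> = ennreal (72 * (Bop_const * \<bar>K\<bar> * \<bar>K\<bar>) + 2 * M)"
        using Bop_const(2) M_nonneg by (simp add: ennreal_mult)
      finally show "wsum (\<lambda>k. 1 / jn k) (force \<kappa> x s) \<le> ennreal (72 * (Bop_const * \<bar>K\<bar> * \<bar>K\<bar>) + 2 * M)" .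
    qed
  qed
  moreover have "0 \<le> 72 * (Bop_const * \<bar>K\<bar> * \<bar>K\<bar>) + 2 * M" using Bop_const(2) M_nonneg by simp
  ultimately show ?thesis by blast
qed

lemma force_integrable:
  assumes t: "t \<in> {0..T}" shows "set_integrable lborel {0..t} (\<lambda>s. force \<kappa> x s k)"
proof -
  obtain K where K: "0 \<le> K" "AE s in lborel. s \<in> {0..T} \<longrightarrow> wsum (\<lambda>k. 1 / jn k) (force \<kappa> x s) \<le> ennreal K"
    using force_negative_bound by blast
  \<comment> \<open>\<open>duhamel_smoothing\<close> asks for an exponential majorant; the exponent
    1 will do, as \<open>exp s \<ge> 1\<close> on \<open>{0..T}\<close>.\<close>
  have "AE s in lborel. s \<in> {0..T} \<longrightarrow> wsum (\<lambda>k. 1 / sqrt (\<nu> * jn2 k)) (force \<kappa> x s) \<le> ennreal ((1 / sqrt \<nu> * K) * exp (1 * s))"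
    using K(2)
  proof eventually_elim
    case (elim s)
    show ?case
    proof
      assume s: "s \<in> {0..T}"
      have "wsum (\<lambda>k. 1 / sqrt (\<nu> * jn2 k)) (force \<kappa> x s) \<le> ennreal (1 / sqrt \<nu>) * ennreal K"
        unfolding wsum_inverse_sqrt using elim s by (intro mult_left_mono) auto
      also have "\<dots> = ennreal ((1 / sqrt \<nu> * K) * 1)" using K(1) nu by (simp add: ennreal_mult[symmetric])
      also have "\<dots> \<le> ennreal ((1 / sqrt \<nu> * K) * exp (1 * s))"
        using K(1) nu s by (intro ennreal_leI mult_left_mono) auto
      finally show "wsum (\<lambda>k. 1 / sqrt (\<nu> * jn2 k)) (force \<kappa> x s) \<le> ennreal ((1 / sqrt \<nu> * K) * exp (1 * s))" .
    qed
  qed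
  then show ?thesis
    using K(1) nu
    by (intro duhamel_smoothing(1)[where a="\<lambda>k. \<nu> * jn2 k" and G="force \<kappa> x" and c=1 and T=T and D="1 / sqrt \<nu> * K"]
        diffusion_pos force_measurable t) auto
qed

lemma integral_equation:
  assumes t: "t \<in> {0..T}"
  shows "set_integrable lborel {0..t} (\<lambda>s. force \<kappa> x s k - (\<nu> * jn2 k) *\<^sub>R x s k)"
    and "x t k = x0 k + (LINT s:{0..t}|lborel. force \<kappa> x s k - (\<nu> * jn2 k) *\<^sub>R x s k)"
proof -
  have d: "x s k = exp (- (\<nu> * jn2 k) * s) *\<^sub>R x0 k + (LINT r:{0..s}|lborel. exp (- (\<nu> * jn2 k) * (s - r)) *\<^sub>R force \<kappa> x r k)"
    if "s \<in> {0..t}" for s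
  proof -
    have "s \<in> {0..T}" using that t by auto
    then show ?thesis using sol unfolding solves_def by blast
  qed
  have t0: "0 \<le> t" using t by simp
  show "set_integrable lborel {0..t} (\<lambda>s. force \<kappa> x s k - (\<nu> * jn2 k) *\<^sub>R x s k)"
    by (rule duhamel_imp_integral_equation(1)[OF force_integrable[OF t] t0 d])
  show "x t k = x0 k + (LINT s:{0..t}|lborel. force \<kappa> x s k - (\<nu> * jn2 k) *\<^sub>R x s k)"
    by (rule duhamel_imp_integral_equation(2)[OF force_integrable[OF t] t0 d])
qed

lemma T_in: "T \<in> {0..T}" using T by simp

lemmas energy_sum_x = energy_sum[where a="\<lambda>k. \<nu> * jn2 k" and F="force \<kappa> x" and x=x and ?x0.0=x0 and t=T,
    OF diffusion_pos _ T force_measurable x_measurable force_integrable[OF T_in] integral_equation(1)[OF T_in] integral_equation(2)]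

lemma nn_integral_G: "(\<integral>\<^sup>+s\<in>{0..T}. wsum (\<lambda>k. 1) (G s) \<partial>lborel) < \<infinity>"
proof -
  have "(\<integral>\<^sup>+s\<in>{0..T}. wsum (\<lambda>k. 1) (G s) \<partial>lborel) \<le> (\<integral>\<^sup>+s. ennreal M * indicator {0..T} s \<partial>lborel)"
    by (rule nn_integral_mono_AE) (use G_bound in \<open>eventually_elim, auto simp: indicator_def\<close>)
  also have "\<dots> = ennreal M * ennreal T" using T by (simp add: nn_integral_cmult)
  also have "\<dots> < \<infinity>" by (simp add: ennreal_mult_less_top)
  finally show ?thesis .
qed

text \<open>First gain of half a derivative. With the weight \<open>jn\<close> the dissipation is
  \<open>\<nu> jn^3\<close>, and the force enters with \<open>1 / (\<nu> jn)\<close>, exactly the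
  norm in which \<open>force_negative_bound\<close> controls it.\<close>

lemma x_H32: "(\<integral>\<^sup>+s\<in>{0..T}. wsum (\<lambda>k. jn k ^ 3) (x s) \<partial>lborel) < \<infinity>"
proof -
  obtain K where K: "0 \<le> K" "AE s in lborel. s \<in> {0..T} \<longrightarrow> wsum (\<lambda>k. 1 / jn k) (force \<kappa> x s) \<le> ennreal K"
    using force_negative_bound by blast
  have e1: "(\<lambda>k. jn k * (\<nu> * jn2 k)) = (\<lambda>k. \<nu> * jn k ^ 3)"
    by (simp add: jn2_def fun_eq_iff power2_eq_square power3_eq_cube mult_ac)
  have e2: "(\<lambda>k. jn k * (1 / (\<nu> * jn2 k))) = (\<lambda>k. (1 / \<nu>) * (1 / jn k))"
    using jn_pos nu by (simp add: jn2_def fun_eq_iff power2_eq_square field_simps)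
  note [measurable] = x_measurable force_measurable
  have "ennreal \<nu> * (\<integral>\<^sup>+s\<in>{0..T}. wsum (\<lambda>k. jn k ^ 3) (x s) \<partial>lborel) = (\<integral>\<^sup>+s\<in>{0..T}. wsum (\<lambda>k. jn k * (\<nu> * jn2 k)) (x s) \<partial>lborel)"
    unfolding e1 using nu jn_nonneg by (subst wsum_weight_mult) (auto simp: nn_integral_cmult mult.assoc)
  also have "\<dots> \<le> wsum jn (x T) + (\<integral>\<^sup>+s\<in>{0..T}. wsum (\<lambda>k. jn k * (\<nu> * jn2 k)) (x s) \<partial>lborel)" by simp
  also have "\<dots> \<le> wsum jn x0 + (\<integral>\<^sup>+s\<in>{0..T}. wsum (\<lambda>k. jn k * (1 / (\<nu> * jn2 k))) (force \<kappa> x s) \<partial>lborel)"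
    by (rule energy_sum_x[where w=jn, OF jn_nonneg])
  also have "\<dots> \<le> wsum jn2 x0 + ennreal (1 / \<nu>) * (ennreal K * ennreal T)"
  proof (intro add_mono)
    show "wsum jn x0 \<le> wsum jn2 x0"
      using jn_ge_1 jn_nonneg by (intro wsum_mono mult_right_mono) (auto simp: jn2_def power2_eq_square mult_le_cancel_left1)
    have "(\<integral>\<^sup>+s\<in>{0..T}. wsum (\<lambda>k. jn k * (1 / (\<nu> * jn2 k))) (force \<kappa> x s) \<partial>lborel) = ennreal (1 / \<nu>) * (\<integral>\<^sup>+s\<in>{0..T}. wsum (\<lambda>k. 1 / jn k) (force \<kappa> x s) \<partial>lborel)"
      unfolding e2 using nu jn_nonneg by (subst wsum_weight_mult) (auto simp: nn_integral_cmult mult.assoc)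
    also have "\<dots> \<le> ennreal (1 / \<nu>) * (\<integral>\<^sup>+s. ennreal K * indicator {0..T} s \<partial>lborel)"
      by (intro mult_left_mono nn_integral_mono_AE) (use K(2) in \<open>eventually_elim, auto simp: indicator_def\<close>)
    also have "(\<integral>\<^sup>+s. ennreal K * indicator {0..T} s \<partial>lborel) = ennreal K * ennreal T" using T by (simp add: nn_integral_cmult)
    finally show "(\<integral>\<^sup>+s\<in>{0..T}. wsum (\<lambda>k. jn k * (1 / (\<nu> * jn2 k))) (force \<kappa> x s) \<partial>lborel) \<le> ennreal (1 / \<nu>) * (ennreal K * ennreal T)" .
  qed
  also have "\<dots> < \<infinity>" using x0_V by (simp add: ennreal_mult_less_top)
  finally show ?thesis using nu by (auto simp: ennreal_mult_less_top)
qed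

text \<open>The bound in V together with H^(3/2) in mean square over time puts B into H by
  \<open>PB_bound_positive\<close>. The force is then regular enough for the energy estimate with
  weight \<open>jn2\<close>.\<close>

lemma force_L2H: "(\<integral>\<^sup>+s\<in>{0..T}. wsum (\<lambda>k. 1) (force \<kappa> x s) \<partial>lborel) < \<infinity>"
proof -
  note [measurable] = x_measurable force_measurable G_measurable
  obtain K where K: "\<And>s. s \<in> {0..T} \<Longrightarrow> wsum jn2 (x s) \<le> ennreal K"
    using sol unfolding solves_def by blast
  have "(\<integral>\<^sup>+s\<in>{0..T}. wsum (\<lambda>k. 1) (force \<kappa> x s) \<partial>lborel) \<le>
    (\<integral>\<^sup>+s. (72 * ennreal Bop_const * ennreal K) * (wsum (\<lambda>k. jn k ^ 3) (x s) * indicator {0..T} s) + 2 * (wsum (\<lambda>k. 1) (G s) * indicator {0..T} s) \<partial>lborel)"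
  proof (intro nn_integral_mono)
    fix s
    show "wsum (\<lambda>k. 1) (force \<kappa> x s) * indicator {0..T} s \<le>
      (72 * ennreal Bop_const * ennreal K) * (wsum (\<lambda>k. jn k ^ 3) (x s) * indicator {0..T} s) + 2 * (wsum (\<lambda>k. 1) (G s) * indicator {0..T} s)"
    proof (cases "s \<in> {0..T}")
      case True
      have "wsum (\<lambda>k. 1) (force \<kappa> x s) \<le> 72 * wsum (\<lambda>k. 1) (PB (x s) (x s)) + 2 * wsum (\<lambda>k. 1) (G s)"
        by (rule wsum_force_le) simp
      also have "\<dots> \<le> 72 * (ennreal Bop_const * ennreal K * wsum (\<lambda>k. jn k ^ 3) (x s)) + 2 * wsum (\<lambda>k. 1) (G s)"
        by (intro add_mono mult_left_mono order_trans[OF PB_bound_positive] mult_mono K True order_refl) auto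
      finally show ?thesis using True by (simp add: mult.assoc)
    qed simp
  qed
  also have "\<dots> = (72 * ennreal Bop_const * ennreal K) * (\<integral>\<^sup>+s\<in>{0..T}. wsum (\<lambda>k. jn k ^ 3) (x s) \<partial>lborel) + 2 * (\<integral>\<^sup>+s\<in>{0..T}. wsum (\<lambda>k. 1) (G s) \<partial>lborel)"
    by (simp add: nn_integral_add nn_integral_cmult)
  also have "\<dots> < \<infinity>" using x_H32 nn_integral_G by (simp add: ennreal_mult_less_top)
  finally show ?thesis .
qed

lemma weight_jn4: "(\<lambda>k. jn2 k * (\<nu> * jn2 k)) = (\<lambda>k. \<nu> * jn k ^ 4)"
  by (simp add: jn4 fun_eq_iff power2_eq_square mult_ac)

lemma weight_one: "(\<lambda>k. jn2 k * (1 / (\<nu> * jn2 k))) = (\<lambda>k. (1 / \<nu>) * 1)"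
  using jn2_ge_1 nu by (auto simp: fun_eq_iff) (smt (verit) jn2_ge_1)

lemma force_weighted_finite: "(\<integral>\<^sup>+s\<in>{0..T}. wsum (\<lambda>k. jn2 k * (1 / (\<nu> * jn2 k))) (force \<kappa> x s) \<partial>lborel) < \<infinity>"
proof -
  note [measurable] = force_measurable
  have "(\<integral>\<^sup>+s\<in>{0..T}. wsum (\<lambda>k. jn2 k * (1 / (\<nu> * jn2 k))) (force \<kappa> x s) \<partial>lborel) = ennreal (1 / \<nu>) * (\<integral>\<^sup>+s\<in>{0..T}. wsum (\<lambda>k. 1) (force \<kappa> x s) \<partial>lborel)"
    unfolding weight_one using nu by (subst wsum_weight_mult) (auto simp: nn_integral_cmult mult.assoc)
  then show ?thesis using force_L2H by (simp add: ennreal_mult_less_top)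
qed

text \<open>Second gain of half a derivative: the same estimate with the weight \<open>jn2\<close>,
  for which the force is measured in H.\<close>

lemma x_L2DA: "(\<integral>\<^sup>+s\<in>{0..T}. wsum (\<lambda>k. jn k ^ 4) (x s) \<partial>lborel) < \<infinity>"
proof -
  note [measurable] = x_measurable
  have "ennreal \<nu> * (\<integral>\<^sup>+s\<in>{0..T}. wsum (\<lambda>k. jn k ^ 4) (x s) \<partial>lborel) = (\<integral>\<^sup>+s\<in>{0..T}. wsum (\<lambda>k. jn2 k * (\<nu> * jn2 k)) (x s) \<partial>lborel)"
    unfolding weight_jn4 using nu jn_nonneg by (subst wsum_weight_mult) (auto simp: nn_integral_cmult mult.assoc)
  also have "\<dots> \<le> wsum jn2 (x T) + (\<integral>\<^sup>+s\<in>{0..T}. wsum (\<lambda>k. jn2 k * (\<nu> * jn2 k)) (x s) \<partial>lborel)" by simp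
  also have "\<dots> \<le> wsum jn2 x0 + (\<integral>\<^sup>+s\<in>{0..T}. wsum (\<lambda>k. jn2 k * (1 / (\<nu> * jn2 k))) (force \<kappa> x s) \<partial>lborel)"
    by (rule energy_sum_x[where w=jn2, OF jn2_nonneg])
  also have "\<dots> < \<infinity>" using x0_V force_weighted_finite by simp
  finally show ?thesis using nu by (auto simp: ennreal_mult_less_top)
qed

lemma x_continuous_V:
  assumes "t \<in> {0..T}" "0 < e"
  shows "\<exists>d>0. \<forall>s\<in>{0..T}. \<bar>s - t\<bar> < d \<longrightarrow> wsum jn2 (\<lambda>k. x s k - x t k) < ennreal e"
  by (rule energy_continuity[where a="\<lambda>k. \<nu> * jn2 k" and F="force \<kappa> x" and x=x and ?x0.0=x0 and T=T,
    OF diffusion_pos jn2_nonneg T force_measurable force_integrable[OF T_in] integral_equation(1)[OF T_in] integral_equation(2)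
      x0_V force_weighted_finite assms])

end

end

section \<open>A priori bounds\<close>


text \<open>Adapts \<open>gronwall_bounded\<close> to a rate inequality that holds almost
  everywhere; the constant \<open>D\<close> is moved into the initial value as
  \<open>D T\<close>.\<close>

lemma gronwall_rate:
  fixes E \<phi> :: "real \<Rightarrow> real"
  assumes C: "0 < C" and D: "0 \<le> D" and T: "0 \<le> T" and E0: "0 \<le> E0"
    and int: "set_integrable lborel {0..T} E" and bd: "\<And>t. t \<in> {0..T} \<Longrightarrow> E t \<le> K"
    and phi: "\<And>t. t \<in> {0..T} \<Longrightarrow> set_integrable lborel {0..t} \<phi>"
    and eq: "\<And>t. t \<in> {0..T} \<Longrightarrow> E t = E0 + (LINT s:{0..t}|lborel. \<phi> s)"
    and le: "AE s in lborel. s \<in> {0..T} \<longrightarrow> \<phi> s \<le> C * E s + D"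
    and t: "t \<in> {0..T}"
  shows "E t \<le> 2 * (E0 + D * T) * exp (2 * C * T)"
proof -
  have "E s \<le> (E0 + D * T) + C * (LINT r:{0..s}|lborel. E r)" if s: "s \<in> {0..T}" for s
  proof -
    have sub: "set_integrable lborel {0..s} E" using int s by (auto intro: set_integrable_subset)
    have c: "set_integrable lborel {0..s} (\<lambda>r. D)" by (intro borel_integrable_atLeastAtMost' continuous_intros)
    have m: "set_integrable lborel {0..s} (\<lambda>r. C * E r)" using sub by (rule set_integrable_mult_right)
    have "(LINT r:{0..s}|lborel. \<phi> r) \<le> (LINT r:{0..s}|lborel. C * E r + D)"
      unfolding set_lebesgue_integral_def
    proof (rule integral_mono_AE)
      show "integrable lborel (\<lambda>r. indicator {0..s} r *\<^sub>R \<phi> r)" using phi[OF s] by (simp add: set_integrable_def)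
      show "integrable lborel (\<lambda>r. indicator {0..s} r *\<^sub>R (C * E r + D))"
        using set_integral_add(1)[OF m c] by (simp add: set_integrable_def)
      show "AE r in lborel. indicator {0..s} r *\<^sub>R \<phi> r \<le> indicator {0..s} r *\<^sub>R (C * E r + D)"
        using le by eventually_elim (use s in \<open>auto simp: indicator_def\<close>)
    qed
    also have "\<dots> = C * (LINT r:{0..s}|lborel. E r) + (LINT r:{0..s}|lborel. D)"
      by (simp add: set_integral_add(2)[OF m c])
    also have "(LINT r:{0..s}|lborel. D) = s * D" using s by (simp add: set_lebesgue_integral_def)
    also have "s * D \<le> D * T" using s D by (simp add: mult.commute mult_left_mono)
    finally show ?thesis using eq[OF s] by simp
  qed
  from gronwall_bounded[OF C T int bd this t]
  have "E t \<le> 2 * \<bar>E0 + D * T\<bar> * exp (2 * C * t)" .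
  also have "\<dots> \<le> 2 * \<bar>E0 + D * T\<bar> * exp (2 * C * T)" using C t by (intro mult_left_mono) auto
  finally show ?thesis using E0 D T by simp
qed

lemma wsum_component_le:
  fixes p :: "'e::euclidean_space \<Rightarrow> 'f::euclidean_space"
  assumes "\<And>z. norm (p z) \<le> norm z" "\<And>k. 0 \<le> w k"
  shows "wsum w (\<lambda>k. p (z k)) \<le> wsum w z"
  using assms by (intro wsum_mono mult_left_mono power_mono) auto

lemma norm_fst_snd_le: "norm (fst z) \<le> norm z" "norm (snd z) \<le> norm z"
  for z :: "'a::real_normed_vector \<times> 'b::real_normed_vector"
  by (cases z; simp add: norm_fst_le norm_snd_le)+

context sync_data
begin

abbreviation Bp :: "(cvec \<times> cvec \<Rightarrow> cvec) \<Rightarrow> (int \<times> int \<Rightarrow> cvec \<times> cvec) \<Rightarrow> fld" where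
  "Bp p z \<equiv> Bop (\<lambda>k. p (z k)) (\<lambda>k. p (z k))"

definition solenoidal_pair :: "real \<Rightarrow> (real \<Rightarrow> int \<times> int \<Rightarrow> cvec \<times> cvec) \<Rightarrow> bool" where
  "solenoidal_pair T x \<longleftrightarrow> (\<forall>t\<in>{0..T}. solenoidal (\<lambda>k. fst (x t k)) \<and> solenoidal (\<lambda>k. snd (x t k)))"

context
  fixes T :: real and \<kappa> and x
  assumes sol: "solves T \<kappa> x" and T: "0 \<le> T"
begin

text \<open>A general linear map \<open>p\<close> allows the estimates that follow to be proved once
  for both components.\<close>

lemma component_integral_equation:
  fixes p :: "cvec \<times> cvec \<Rightarrow> 'f::euclidean_space"
  assumes p: "bounded_linear p" and t: "t \<in> {0..T}"
  shows "set_integrable lborel {0..t} (\<lambda>s. p (force \<kappa> x s k) - (\<nu> * jn2 k) *\<^sub>R p (x s k))"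
    and "p (x t k) = p (x0 k) + (LINT s:{0..t}|lborel. p (force \<kappa> x s k) - (\<nu> * jn2 k) *\<^sub>R p (x s k))"
proof -
  interpret p: bounded_linear p by (rule p)
  note I = integral_equation[OF sol T t, of k]
  have e: "indicator {0..t} s *\<^sub>R (p (force \<kappa> x s k) - (\<nu> * jn2 k) *\<^sub>R p (x s k)) =
     p (indicator {0..t} s *\<^sub>R (force \<kappa> x s k - (\<nu> * jn2 k) *\<^sub>R x s k))" for s
    by (simp add: p.scaleR p.diff)
  have i: "integrable lborel (\<lambda>s. indicator {0..t} s *\<^sub>R (force \<kappa> x s k - (\<nu> * jn2 k) *\<^sub>R x s k))"
    using I(1) by (simp add: set_integrable_def)
  show "set_integrable lborel {0..t} (\<lambda>s. p (force \<kappa> x s k) - (\<nu> * jn2 k) *\<^sub>R p (x s k))"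
    unfolding set_integrable_def e by (rule integrable_bounded_linear[OF p i])
  have "p (x t k) = p (x0 k) + p (LINT s:{0..t}|lborel. force \<kappa> x s k - (\<nu> * jn2 k) *\<^sub>R x s k)"
    by (subst I(2)) (rule p.add)
  then show "p (x t k) = p (x0 k) + (LINT s:{0..t}|lborel. p (force \<kappa> x s k) - (\<nu> * jn2 k) *\<^sub>R p (x s k))"
    unfolding set_lebesgue_integral_def e integral_bounded_linear[OF p i] .
qed

lemma component_measurable:
  fixes p :: "cvec \<times> cvec \<Rightarrow> 'f::euclidean_space"
  assumes "bounded_linear p"
  shows "(\<lambda>s. p (x s k)) \<in> borel_measurable borel" "(\<lambda>s. p (force \<kappa> x s k)) \<in> borel_measurable borel"
  using borel_measurable_continuous_on[OF linear_continuous_on[OF assms] x_measurable[OF sol T]]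
    borel_measurable_continuous_on[OF linear_continuous_on[OF assms] force_measurable[OF sol T]] by blast+

lemma component_energy_identity:
  fixes p :: "cvec \<times> cvec \<Rightarrow> 'f::euclidean_space"
  assumes p: "bounded_linear p" and pn: "\<And>z. norm (p z) \<le> norm z"
    and h: "\<And>k. 0 \<le> h k" "\<And>k. h k \<le> jn2 k" and t: "t \<in> {0..T}"
  defines "\<phi> \<equiv> \<lambda>s. infsum (\<lambda>k. h k * (2 * (p (x s k) \<bullet> p (force \<kappa> x s k)) - 2 * (\<nu> * jn2 k) * (norm (p (x s k)))\<^sup>2)) UNIV"
  shows "set_integrable lborel {0..t} \<phi>"
    and "infsum (\<lambda>k. h k * (norm (p (x t k)))\<^sup>2) UNIV = infsum (\<lambda>k. h k * (norm (p (x0 k)))\<^sup>2) UNIV + (LINT s:{0..t}|lborel. \<phi> s)"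
    and "AE s in lborel. s \<in> {0..T} \<longrightarrow> (\<lambda>k. h k * (2 * (p (x s k) \<bullet> p (force \<kappa> x s k)) - 2 * (\<nu> * jn2 k) * (norm (p (x s k)))\<^sup>2)) summable_on UNIV"
    and "AE s in lborel. s \<in> {0..T} \<longrightarrow> wsum (\<lambda>k. jn k ^ 4) (\<lambda>k. p (x s k)) < \<infinity> \<and> wsum (\<lambda>k. 1) (\<lambda>k. p (force \<kappa> x s k)) < \<infinity>"
proof -
  have x4: "(\<integral>\<^sup>+s\<in>{0..T}. wsum (\<lambda>k. jn k ^ 4) (\<lambda>k. p (x s k)) \<partial>lborel) < \<infinity>"
    by (rule le_less_trans[OF nn_integral_mono x_L2DA[OF sol T]]) (intro mult_right_mono wsum_component_le pn, auto simp: jn_nonneg)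
  have F2: "(\<integral>\<^sup>+s\<in>{0..T}. wsum (\<lambda>k. 1) (\<lambda>k. p (force \<kappa> x s k)) \<partial>lborel) < \<infinity>"
    by (rule le_less_trans[OF nn_integral_mono force_L2H[OF sol T]]) (intro mult_right_mono wsum_component_le pn, auto)
  have xV: "wsum jn2 (\<lambda>k. p (x s k)) < \<infinity>" if "s \<in> {0..T}" for s
    by (rule le_less_trans[OF wsum_component_le[OF pn jn2_nonneg] x_V[OF sol T that]])
  have T_in: "T \<in> {0..T}" using T by simp
  note E = energy_identity[where x="\<lambda>s k. p (x s k)" and F="\<lambda>s k. p (force \<kappa> x s k)" and ?x0.0="\<lambda>k. p (x0 k)" and h=h and T=T and t=t,
      OF nu T h component_measurable(2)[OF p] component_measurable(1)[OF p] component_integral_equation(1)[OF p T_in]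
        component_integral_equation(2)[OF p] x4 F2 xV t]
  show "set_integrable lborel {0..t} \<phi>" unfolding \<phi>_def by (rule E(1))
  show "infsum (\<lambda>k. h k * (norm (p (x t k)))\<^sup>2) UNIV = infsum (\<lambda>k. h k * (norm (p (x0 k)))\<^sup>2) UNIV + (LINT s:{0..t}|lborel. \<phi> s)"
    unfolding \<phi>_def by (rule E(2))
  show "AE s in lborel. s \<in> {0..T} \<longrightarrow> (\<lambda>k. h k * (2 * (p (x s k) \<bullet> p (force \<kappa> x s k)) - 2 * (\<nu> * jn2 k) * (norm (p (x s k)))\<^sup>2)) summable_on UNIV"
    by (rule E(3))
  show "AE s in lborel. s \<in> {0..T} \<longrightarrow> wsum (\<lambda>k. jn k ^ 4) (\<lambda>k. p (x s k)) < \<infinity> \<and> wsum (\<lambda>k. 1) (\<lambda>k. p (force \<kappa> x s k)) < \<infinity>"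
    by (rule E(4))
qed

lemma fst_force: "fst (force \<kappa> x s k) = \<kappa> s *\<^sub>R ((\<theta>1 * low N k) *\<^sub>R (Bp fst (x s) k - Bp snd (x s) k) - Bp fst (x s) k) + fst (G s k)"
  and snd_force: "snd (force \<kappa> x s k) = \<kappa> s *\<^sub>R ((\<theta>2 * low N k) *\<^sub>R (Bp snd (x s) k - Bp fst (x s) k) - Bp snd (x s) k) + snd (G s k)"
  by (simp_all add: force_def mix_def PB_def)

text \<open>In a low mode the difference of the two forces contains \<open>B1 - B2\<close> with the
  factor \<open>\<kappa> (\<theta>1 + \<theta>2 - 1) = 0\<close>, whatever \<open>\<kappa>\<close>
  is. Datum and \<open>g1 - g2\<close> remain, damped by the exponential kernel; the factors 2 bound
  \<open>fst - snd\<close>.\<close>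

lemma low_difference_bound:
  assumes k: "k \<in> lowset N" and t: "t \<in> {0..T}"
  shows "norm (fst (x t k) - snd (x t k)) \<le> 2 * wnrm jn2 x0 + 2 * sqrt M * T"
proof -
  define p :: "cvec \<times> cvec \<Rightarrow> cvec" where "p z = fst z - snd z" for z
  have p: "bounded_linear p" unfolding p_def by (intro bounded_linear_sub bounded_linear_fst bounded_linear_snd)
  interpret p: bounded_linear p by (rule p)
  have pn: "norm (p z) \<le> 2 * norm z" for z
    using norm_triangle_ineq4[of "fst z" "snd z"] norm_fst_snd_le[of z] by (simp add: p_def)
  have pf: "p (force \<kappa> x s k) = p (G s k)" for s
  proof -
    have "low N k = 1" using k by (simp add: low_eq)
    moreover have "c *\<^sub>R ((\<theta>1 * 1) *\<^sub>R (u - v) - u) + g - (c *\<^sub>R ((\<theta>2 * 1) *\<^sub>R (v - u) - v) + h) =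
      (c * (\<theta>1 + \<theta>2 - 1)) *\<^sub>R (u - v) + (g - h)" for c and u v g h :: cvec by (simp add: algebra_simps)
    ultimately show ?thesis unfolding p_def fst_force snd_force using th_sum by simp
  qed
  let ?a = "\<nu> * jn2 k"
  have i: "set_integrable lborel {0..t} (\<lambda>s. exp (- ?a * (t - s)) *\<^sub>R force \<kappa> x s k)"
  proof -
    have "set_integrable lborel {0..t} (\<lambda>s. exp (?a * s + (- ?a * t)) *\<^sub>R force \<kappa> x s k)"
      by (rule set_integrable_exp_scaleR[OF force_integrable[OF sol T t]])
    then show ?thesis by (simp add: algebra_simps)
  qed
  have "x t k = exp (- ?a * t) *\<^sub>R x0 k + (LINT s:{0..t}|lborel. exp (- ?a * (t - s)) *\<^sub>R force \<kappa> x s k)"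
    using sol t unfolding solves_def by blast
  then have "p (x t k) = exp (- ?a * t) *\<^sub>R p (x0 k) + p (LINT s:{0..t}|lborel. exp (- ?a * (t - s)) *\<^sub>R force \<kappa> x s k)"
    by (simp only: p.add p.scaleR)
  also have "p (LINT s:{0..t}|lborel. exp (- ?a * (t - s)) *\<^sub>R force \<kappa> x s k) =
     (LINT s|lborel. p (indicator {0..t} s *\<^sub>R (exp (- ?a * (t - s)) *\<^sub>R force \<kappa> x s k)))"
    unfolding set_lebesgue_integral_def using i by (intro integral_bounded_linear[OF p, symmetric]) (simp only: set_integrable_def)
  finally have "norm (p (x t k)) \<le> norm (exp (- ?a * t) *\<^sub>R p (x0 k)) + norm (LINT s|lborel. p (indicator {0..t} s *\<^sub>R (exp (- ?a * (t - s)) *\<^sub>R force \<kappa> x s k)))"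
    by (simp only: norm_triangle_ineq)
  moreover have "norm (exp (- ?a * t) *\<^sub>R p (x0 k)) \<le> 2 * wnrm jn2 x0"
  proof -
    have "norm (exp (- ?a * t) *\<^sub>R p (x0 k)) \<le> norm (p (x0 k))"
      using less_imp_le[OF diffusion_pos, of k] t by (auto intro!: mult_left_le_one_le)
    also have "\<dots> \<le> 2 * norm (x0 k)" by (rule pn)
    also have "norm (x0 k) \<le> wnrm jn2 x0"
    proof -
      have "ennreal (jn2 k * (norm (x0 k))\<^sup>2) \<le> ennreal ((wnrm jn2 x0)\<^sup>2)"
        using wsum_mode_le[of jn2 k x0, OF jn2_nonneg] wsum_eq_wnrm[OF x0_V] by simp
      then have "jn2 k * (norm (x0 k))\<^sup>2 \<le> (wnrm jn2 x0)\<^sup>2" by simp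
      then have "(norm (x0 k))\<^sup>2 \<le> (wnrm jn2 x0)\<^sup>2"
        using mult_right_mono[OF jn2_ge_1, of "(norm (x0 k))\<^sup>2" k] by simp
      then show ?thesis using wnrm_nonneg by (rule power2_le_imp_le)
    qed
    finally show ?thesis by simp
  qed
  moreover have "norm (LINT s|lborel. p (indicator {0..t} s *\<^sub>R (exp (- ?a * (t - s)) *\<^sub>R force \<kappa> x s k))) \<le> 2 * sqrt M * T"
  proof -
    have "ennreal (norm (LINT s|lborel. p (indicator {0..t} s *\<^sub>R (exp (- ?a * (t - s)) *\<^sub>R force \<kappa> x s k)))) \<le>
       (\<integral>\<^sup>+s. ennreal (norm (p (indicator {0..t} s *\<^sub>R (exp (- ?a * (t - s)) *\<^sub>R force \<kappa> x s k)))) \<partial>lborel)"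
      using i by (intro integral_norm_bound_ennreal integrable_bounded_linear[OF p]) (simp only: set_integrable_def)
    also have "\<dots> \<le> (\<integral>\<^sup>+s. ennreal (2 * sqrt M) * indicator {0..t} s \<partial>lborel)"
    proof (rule nn_integral_mono_AE)
      show "AE s in lborel. ennreal (norm (p (indicator {0..t} s *\<^sub>R (exp (- ?a * (t - s)) *\<^sub>R force \<kappa> x s k)))) \<le> ennreal (2 * sqrt M) * indicator {0..t} s"
        using G_bound
      proof eventually_elim
        case (elim s)
        show ?case
        proof (cases "s \<in> {0..t}")
          case True
          then have Gs: "wsum (\<lambda>_. 1) (G s) \<le> ennreal M" using elim by simp
          then have fin: "wsum (\<lambda>_. 1) (G s) < \<infinity>" by (rule le_less_trans) simp
          have "(norm (G s k))\<^sup>2 \<le> M" using norm_sq_le_sqsum[OF fin, of k] sqsum_le[OF Gs M_nonneg] by simp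
          then have "norm (G s k) \<le> sqrt M" by (rule real_le_rsqrt)
          then have "norm (p (G s k)) \<le> 2 * sqrt M" using pn[of "G s k"] by simp
          moreover have "norm (p (indicator {0..t} s *\<^sub>R (exp (- ?a * (t - s)) *\<^sub>R force \<kappa> x s k))) \<le> norm (p (G s k))"
            unfolding p.scaleR pf using True less_imp_le[OF diffusion_pos, of k] by (auto intro!: mult_left_le_one_le)
          ultimately show ?thesis using True by (auto intro!: ennreal_leI)
        qed (simp add: p.zero)
      qed
    qed
    also have "\<dots> = ennreal (2 * sqrt M) * ennreal t" using t by (simp add: nn_integral_cmult)
    also have "\<dots> = ennreal (2 * sqrt M * t)" using M_nonneg t by (simp add: ennreal_mult[symmetric])
    finally have "norm (LINT s|lborel. p (indicator {0..t} s *\<^sub>R (exp (- ?a * (t - s)) *\<^sub>R force \<kappa> x s k))) \<le> 2 * sqrt M * t"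
      using M_nonneg t by simp
    also have "\<dots> \<le> 2 * sqrt M * T" using M_nonneg t by (intro mult_left_mono) auto
    finally show ?thesis .
  qed
  ultimately show ?thesis unfolding p_def by linarith
qed

end

end

context sync_data
begin

definition low_diff :: "real \<Rightarrow> real" where "low_diff T = 2 * wnrm jn2 x0 + 2 * sqrt M * T"
definition low_jn :: real where "low_jn = max 1 N"
definition low_card :: real where "low_card = real (card (lowset N))"

lemma low_jn_ge: "1 \<le> low_jn" by (simp add: low_jn_def)
lemma low_card_nonneg: "0 \<le> low_card" by (simp add: low_card_def)
lemma low_diff_nonneg: "0 \<le> T \<Longrightarrow> 0 \<le> low_diff T" using M_nonneg wnrm_nonneg[of jn2 x0] by (simp add: low_diff_def)

lemma sqsum_x0: assumes "\<And>z. norm (p z) \<le> norm z" shows "sqsum (\<lambda>k. p (x0 k)) \<le> (wnrm jn2 x0)\<^sup>2"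
proof (rule sqsum_le)
  have "wsum (\<lambda>_. 1) (\<lambda>k. p (x0 k)) \<le> wsum (\<lambda>_. 1) x0" using assms by (intro wsum_mono mult_left_mono power_mono) auto
  also have "\<dots> \<le> wsum jn2 x0" by (rule wsum_one_le_jn2)
  finally show "wsum (\<lambda>_. 1) (\<lambda>k. p (x0 k)) \<le> ennreal ((wnrm jn2 x0)\<^sup>2)" using wsum_eq_wnrm[OF x0_V] by simp
qed simp

context
  fixes T :: real and \<kappa> and x
  assumes sol: "solves T \<kappa> x" and T: "0 \<le> T" and gx: "solenoidal_pair T x"
begin

lemma sqsum_component_bound:
  fixes p :: "cvec \<times> cvec \<Rightarrow> cvec"
  assumes pn: "\<And>z. norm (p z) \<le> norm z"
  obtains K where "0 \<le> K" "\<And>t. t \<in> {0..T} \<Longrightarrow> sqsum (\<lambda>k. p (x t k)) \<le> K"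
proof -
  obtain K where K: "\<And>s. s \<in> {0..T} \<Longrightarrow> wsum jn2 (x s) \<le> ennreal K"
    using sol unfolding solves_def by blast
  have "sqsum (\<lambda>k. p (x t k)) \<le> \<bar>K\<bar>" if "t \<in> {0..T}" for t
  proof (rule sqsum_le)
    show "wsum (\<lambda>_. 1) (\<lambda>k. p (x t k)) \<le> ennreal \<bar>K\<bar>"
      by (rule order_trans[OF order_trans[OF wsum_one_le_jn2 wsum_component_le[OF pn jn2_nonneg]] order_trans[OF K[OF that] ennreal_leI]]) simp
  qed simp
  then show thesis using that[of "\<bar>K\<bar>"] by simp
qed

lemma sqsum_integrable:
  fixes p :: "cvec \<times> cvec \<Rightarrow> cvec"
  assumes p: "bounded_linear p" and pn: "\<And>z. norm (p z) \<le> norm z"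
  shows "set_integrable lborel {0..T} (\<lambda>s. sqsum (\<lambda>k. p (x s k)))"
proof -
  obtain K where K: "0 \<le> K" "\<And>t. t \<in> {0..T} \<Longrightarrow> sqsum (\<lambda>k. p (x t k)) \<le> K"
    using sqsum_component_bound[OF pn] by blast
  note [measurable] = component_measurable(1)[OF sol T p]
  have [measurable]: "(\<lambda>s. sqsum (\<lambda>k. p (x s k))) \<in> borel_measurable borel"
    unfolding sqsum_def by (intro measurable_infsum) measurable
  have c: "set_integrable lborel {0..T} (\<lambda>s. K)" by (intro borel_integrable_atLeastAtMost' continuous_intros)
  show ?thesis
    unfolding set_integrable_def
    by (rule Bochner_Integration.integrable_bound[OF c[unfolded set_integrable_def]])
      (use K sqsum_nonneg in \<open>auto simp: indicator_def abs_of_nonneg[OF sqsum_nonneg] intro!: AE_I2\<close>)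
qed

lemma x_H: assumes "\<And>z. norm (p z) \<le> norm z" "t \<in> {0..T}" shows "wsum (\<lambda>_. 1) (\<lambda>k. p (x t k)) < \<infinity>"
proof -
  have "wsum (\<lambda>_. 1) (\<lambda>k. p (x t k)) \<le> wsum (\<lambda>_. 1) (x t)" using assms by (intro wsum_mono mult_left_mono power_mono) auto
  also have "\<dots> \<le> wsum jn2 (x t)" by (rule wsum_one_le_jn2)
  also have "\<dots> < \<infinity>" by (rule x_V[OF sol T assms(2)])
  finally show ?thesis .
qed

lemma G_component:
  assumes "\<And>z. norm (p z) \<le> norm z"
  shows "AE s in lborel. s \<in> {0..T} \<longrightarrow> wsum (\<lambda>_. 1) (\<lambda>k. p (G s k)) < \<infinity> \<and> sqsum (\<lambda>k. p (G s k)) \<le> M"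
  using G_bound
proof eventually_elim
  case (elim s)
  have le: "wsum (\<lambda>_. 1) (\<lambda>k. p (G s k)) \<le> wsum (\<lambda>_. 1) (G s)" using assms by (intro wsum_mono mult_left_mono power_mono) auto
  show ?case
  proof
    assume "s \<in> {0..T}"
    then have "wsum (\<lambda>_. 1) (\<lambda>k. p (G s k)) \<le> ennreal M" using elim le by auto
    then show "wsum (\<lambda>_. 1) (\<lambda>k. p (G s k)) < \<infinity> \<and> sqsum (\<lambda>k. p (G s k)) \<le> M"
      using sqsum_le[OF _ M_nonneg] by (auto intro: le_less_trans)
  qed
qed

text \<open>The following two lemmas are stated for \<open>p\<close> one of the two components and \<open>q\<close> the other one.\<close>

lemma component_energy_rate:
  fixes p q :: "cvec \<times> cvec \<Rightarrow> cvec"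
  assumes p: "bounded_linear p" and pn: "\<And>z. norm (p z) \<le> norm z"
    and gp: "\<And>t. t \<in> {0..T} \<Longrightarrow> solenoidal (\<lambda>k. p (x t k))"
    and f: "\<And>s k. p (force \<kappa> x s k) = \<kappa> s *\<^sub>R ((\<theta> * low N k) *\<^sub>R (Bp p (x s) k - Bp q (x s) k) - Bp p (x s) k) + p (G s k)"
  shows "\<exists>\<phi>. (\<forall>t\<in>{0..T}. set_integrable lborel {0..t} \<phi> \<and> sqsum (\<lambda>k. p (x t k)) = sqsum (\<lambda>k. p (x0 k)) + (LINT s:{0..t}|lborel. \<phi> s)) \<and>
     (AE s in lborel. s \<in> {0..T} \<longrightarrow> \<phi> s \<le> 2 * \<kappa> s * \<theta> * (\<Sum>k\<in>lowset N. (Bp p (x s) k - Bp q (x s) k) \<bullet> p (x s k)) + sqsum (\<lambda>k. p (x s k)) + M)"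
proof -
  have h: "0 \<le> (1::real)" "1 \<le> jn2 k" for k by (auto simp: jn2_ge_1)
  note E = component_energy_identity[OF sol T p pn, where h="\<lambda>_. 1", OF h]
  define \<phi> where "\<phi> s = infsum (\<lambda>k. 1 * (2 * (p (x s k) \<bullet> p (force \<kappa> x s k)) - 2 * (\<nu> * jn2 k) * (norm (p (x s k)))\<^sup>2)) UNIV" for s
  show ?thesis
  proof (intro exI conjI ballI)
    fix t assume t: "t \<in> {0..T}"
    show "set_integrable lborel {0..t} \<phi>" unfolding \<phi>_def[abs_def] by (rule E(1)[OF t])
    show "sqsum (\<lambda>k. p (x t k)) = sqsum (\<lambda>k. p (x0 k)) + (LINT s:{0..t}|lborel. \<phi> s)"
      using E(2)[OF t] unfolding \<phi>_def[abs_def] sqsum_def by simp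
  next
    have T_in: "T \<in> {0..T}" using T by simp
    show "AE s in lborel. s \<in> {0..T} \<longrightarrow> \<phi> s \<le> 2 * \<kappa> s * \<theta> * (\<Sum>k\<in>lowset N. (Bp p (x s) k - Bp q (x s) k) \<bullet> p (x s k)) + sqsum (\<lambda>k. p (x s k)) + M"
      using E(3)[OF T_in] E(4)[OF T_in] G_component[OF pn]
    proof eventually_elim
      case (elim s)
      show ?case
      proof
        assume s: "s \<in> {0..T}"
        have "\<phi> s \<le> 2 * \<kappa> s * \<theta> * (\<Sum>k\<in>lowset N. (Bp p (x s) k - Bp q (x s) k) \<bullet> p (x s k)) + sqsum (\<lambda>k. p (x s k)) + sqsum (\<lambda>k. p (G s k))"
          unfolding \<phi>_def
          by (rule energy_production[OF gp[OF s]]) (use elim s f nu in auto)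
        also have "\<dots> \<le> 2 * \<kappa> s * \<theta> * (\<Sum>k\<in>lowset N. (Bp p (x s) k - Bp q (x s) k) \<bullet> p (x s k)) + sqsum (\<lambda>k. p (x s k)) + M"
          using elim s by simp
        finally show "\<phi> s \<le> 2 * \<kappa> s * \<theta> * (\<Sum>k\<in>lowset N. (Bp p (x s) k - Bp q (x s) k) \<bullet> p (x s k)) + sqsum (\<lambda>k. p (x s k)) + M" .
      qed
    qed
  qed
qed

lemma component_V_bound:
  fixes p q :: "cvec \<times> cvec \<Rightarrow> cvec"
  assumes p: "bounded_linear p" and pn: "\<And>z. norm (p z) \<le> norm z" and qn: "\<And>z. norm (q z) \<le> norm z"
    and gp: "\<And>t. t \<in> {0..T} \<Longrightarrow> solenoidal (\<lambda>k. p (x t k))" and gq: "\<And>t. t \<in> {0..T} \<Longrightarrow> solenoidal (\<lambda>k. q (x t k))"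
    and f: "\<And>s k. p (force \<kappa> x s k) = \<kappa> s *\<^sub>R ((\<theta> * low N k) *\<^sub>R (Bp p (x s) k - Bp q (x s) k) - Bp p (x s) k) + p (G s k)"
    and th: "0 \<le> \<theta>" "\<theta> \<le> 1"
    and K: "0 \<le> K" "\<And>t. t \<in> {0..T} \<Longrightarrow> sqsum (\<lambda>k. p (x t k)) \<le> K" "\<And>t. t \<in> {0..T} \<Longrightarrow> sqsum (\<lambda>k. q (x t k)) \<le> K"
    and t: "t \<in> {0..T}"
  shows "wsum jn2 (\<lambda>k. p (x t k)) \<le> ennreal ((wnrm jn2 x0)\<^sup>2 + 1 / \<nu> * (low_card * (4 * low_jn * K)\<^sup>2 + M) * T)"
proof -
  note E = component_energy_identity[OF sol T p pn, where h=wnorm2, OF wnorm2_nonneg wnorm2_le_jn2]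
  define \<phi> where "\<phi> s = infsum (\<lambda>k. wnorm2 k * (2 * (p (x s k) \<bullet> p (force \<kappa> x s k)) - 2 * (\<nu> * jn2 k) * (norm (p (x s k)))\<^sup>2)) UNIV" for s
  have T_in: "T \<in> {0..T}" using T by simp
  have V: "wsum jn2 (\<lambda>k. p (x s k)) = ennreal (infsum (\<lambda>k. wnorm2 k * (norm (p (x s k)))\<^sup>2) UNIV)" if s: "s \<in> {0..T}" for s
  proof -
    \<comment> \<open>The weights \<open>jn2\<close> and \<open>wnorm2\<close> differ only at
      \<open>k = 0\<close>, where the field vanishes.\<close>
    have e: "jn2 k * (norm (p (x s k)))\<^sup>2 = wnorm2 k * (norm (p (x s k)))\<^sup>2" for k
      using gp[OF s] jn_sq[of k] by (cases "k = 0") (auto simp: solenoidal_def jn2_def)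
    have "(\<lambda>k. wnorm2 k * (norm (p (x s k)))\<^sup>2) summable_on UNIV"
      using le_less_trans[OF wsum_component_le[where w=jn2, OF pn jn2_nonneg] x_V[OF sol T s]]
      by (intro nsum_finite_summable) (auto simp: wsum_def e wnorm2_nonneg)
    then show ?thesis unfolding wsum_def e by (intro nsum_eq_infsum_real) (simp add: wnorm2_nonneg)
  qed
  let ?C = "1 / \<nu> * (low_card * (4 * low_jn * K)\<^sup>2 + M)"
  have C: "0 \<le> ?C" using nu low_card_nonneg M_nonneg by simp
  have AE: "AE s in lborel. s \<in> {0..T} \<longrightarrow> \<phi> s \<le> ?C"
    using E(3)[OF T_in] E(4)[OF T_in] G_component[OF pn]
  proof eventually_elim
    case (elim s)
    show ?case
    proof
      assume s: "s \<in> {0..T}"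
      have "\<phi> s \<le> (1 / \<nu>) * ((\<Sum>k\<in>lowset N. (norm (Bp p (x s) k - Bp q (x s) k))\<^sup>2) + sqsum (\<lambda>k. p (G s k)))"
        unfolding \<phi>_def
        by (rule enstrophy_production[where \<kappa>="\<kappa> s" and \<theta>=\<theta>, OF gp[OF s]]) (use elim s f nu th kappa[OF sol T] in auto)
      \<comment> \<open>Each of the two low-mode terms is at most \<open>2 * low_jn * K\<close> by
        \<open>norm_Bop_lowset\<close>: once the energies are bounded, the coupling is a bounded
        force.\<close>
      also have "\<dots> \<le> (1 / \<nu>) * ((\<Sum>k\<in>lowset N. (4 * low_jn * K)\<^sup>2) + M)"
      proof (intro mult_left_mono add_mono sum_mono power_mono)
        fix k assume k: "k \<in> lowset N"
        have "norm (Bp p (x s) k - Bp q (x s) k) \<le> norm (Bp p (x s) k) + norm (Bp q (x s) k)" by (rule norm_triangle_ineq4)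
        also have "\<dots> \<le> 2 * low_jn * sqsum (\<lambda>k. p (x s k)) + 2 * low_jn * sqsum (\<lambda>k. q (x s k))"
          unfolding low_jn_def by (intro add_mono norm_Bop_lowset gp gq s k x_H pn qn)
        also have "\<dots> \<le> 2 * low_jn * K + 2 * low_jn * K" using K s low_jn_ge by (intro add_mono mult_left_mono) auto
        finally show "norm (Bp p (x s) k - Bp q (x s) k) \<le> 4 * low_jn * K" by (simp add: mult_ac)
      qed (use elim s nu in auto)
      finally show "\<phi> s \<le> ?C" by (simp add: low_card_def)
    qed
  qed
  have "(LINT s:{0..t}|lborel. \<phi> s) \<le> (LINT s:{0..t}|lborel. ?C)"
    unfolding set_lebesgue_integral_def
  proof (rule integral_mono_AE)
    show "integrable lborel (\<lambda>r. indicator {0..t} r *\<^sub>R \<phi> r)" using E(1)[OF t] unfolding \<phi>_def[abs_def] by (simp add: set_integrable_def)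
    show "integrable lborel (\<lambda>r. indicator {0..t} r *\<^sub>R ?C)"
      using borel_integrable_atLeastAtMost'[of 0 t "\<lambda>_. ?C"] by (simp only: set_integrable_def continuous_on_const simp_thms)
    show "AE r in lborel. indicator {0..t} r *\<^sub>R \<phi> r \<le> indicator {0..t} r *\<^sub>R ?C"
      using AE by eventually_elim (use t in \<open>auto simp: indicator_def\<close>)
  qed
  also have "\<dots> = t * ?C" using t by (simp add: set_lebesgue_integral_def)
  also have "\<dots> \<le> ?C * T" using t mult_left_mono[OF _ C, of t T] by (simp only: mult.commute[of t] atLeastAtMost_iff)
  finally have 1: "(LINT s:{0..t}|lborel. \<phi> s) \<le> ?C * T" .
  have 2: "infsum (\<lambda>k. wnorm2 k * (norm (p (x0 k)))\<^sup>2) UNIV \<le> (wnrm jn2 x0)\<^sup>2"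
  proof -
    have le: "wsum wnorm2 (\<lambda>k. p (x0 k)) \<le> ennreal ((wnrm jn2 x0)\<^sup>2)"
      unfolding wsum_eq_wnrm[OF x0_V, symmetric]
      using pn wnorm2_le_jn2 wnorm2_nonneg jn2_nonneg by (intro wsum_mono mult_mono power_mono) auto
    then have "(\<lambda>k. wnorm2 k * (norm (p (x0 k)))\<^sup>2) summable_on UNIV"
      by (intro nsum_finite_summable) (auto simp: wsum_def wnorm2_nonneg intro: le_less_trans)
    then have e: "ennreal (infsum (\<lambda>k. wnorm2 k * (norm (p (x0 k)))\<^sup>2) UNIV) = wsum wnorm2 (\<lambda>k. p (x0 k))"
      unfolding wsum_def by (intro nsum_eq_infsum_real[symmetric]) (simp add: wnorm2_nonneg)
    show ?thesis by (rule ennreal_le_iff[THEN iffD1, OF zero_le_power2 le[folded e]])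
  qed
  have "infsum (\<lambda>k. wnorm2 k * (norm (p (x t k)))\<^sup>2) UNIV \<le> (wnrm jn2 x0)\<^sup>2 + ?C * T"
    using E(2)[OF t] 1 2 unfolding \<phi>_def[abs_def] by linarith
  then show ?thesis unfolding V[OF t] by (intro ennreal_leI)
qed

text \<open>In low modes B is bounded by the energy, and the test field \<open>z\<close> has a known
  bound; the coupling is thus linear in the energies, as Gronwall's inequality requires.\<close>

lemma low_sum_bound:
  assumes s: "s \<in> {0..T}" and z: "\<And>k. k \<in> lowset N \<Longrightarrow> norm (z k) \<le> W"
  shows "\<bar>\<Sum>k\<in>lowset N. (Bp fst (x s) k - Bp snd (x s) k) \<bullet> z k\<bar>
    \<le> low_card * (2 * low_jn * (sqsum (\<lambda>k. fst (x s k)) + sqsum (\<lambda>k. snd (x s k))) * W)"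
proof -
  have "\<bar>\<Sum>k\<in>lowset N. (Bp fst (x s) k - Bp snd (x s) k) \<bullet> z k\<bar> \<le> (\<Sum>k\<in>lowset N. \<bar>(Bp fst (x s) k - Bp snd (x s) k) \<bullet> z k\<bar>)"
    by (rule sum_abs)
  also have "\<dots> \<le> (\<Sum>k\<in>lowset N. 2 * low_jn * (sqsum (\<lambda>k. fst (x s k)) + sqsum (\<lambda>k. snd (x s k))) * W)"
  proof (rule sum_mono)
    fix k assume k: "k \<in> lowset N"
    have gf: "solenoidal (\<lambda>k. fst (x s k))" "solenoidal (\<lambda>k. snd (x s k))" using gx s by (auto simp: solenoidal_pair_def)
    have "\<bar>(Bp fst (x s) k - Bp snd (x s) k) \<bullet> z k\<bar> \<le> norm (Bp fst (x s) k - Bp snd (x s) k) * norm (z k)"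
      by (rule Cauchy_Schwarz_ineq2)
    also have "\<dots> \<le> (2 * low_jn * (sqsum (\<lambda>k. fst (x s k)) + sqsum (\<lambda>k. snd (x s k)))) * W"
    proof (rule mult_mono)
      have "norm (Bp fst (x s) k - Bp snd (x s) k) \<le> norm (Bp fst (x s) k) + norm (Bp snd (x s) k)" by (rule norm_triangle_ineq4)
      also have "\<dots> \<le> 2 * low_jn * sqsum (\<lambda>k. fst (x s k)) + 2 * low_jn * sqsum (\<lambda>k. snd (x s k))"
        unfolding low_jn_def by (intro add_mono norm_Bop_lowset gf k x_H s norm_fst_snd_le)
      finally show "norm (Bp fst (x s) k - Bp snd (x s) k) \<le> 2 * low_jn * (sqsum (\<lambda>k. fst (x s k)) + sqsum (\<lambda>k. snd (x s k)))"
        by (simp add: distrib_left)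
      show "0 \<le> 2 * low_jn * (sqsum (\<lambda>k. fst (x s k)) + sqsum (\<lambda>k. snd (x s k)))"
        using low_jn_ge sqsum_nonneg[of "\<lambda>k. fst (x s k)"] sqsum_nonneg[of "\<lambda>k. snd (x s k)"] by simp
    qed (use z k in auto)
    finally show "\<bar>(Bp fst (x s) k - Bp snd (x s) k) \<bullet> z k\<bar> \<le> 2 * low_jn * (sqsum (\<lambda>k. fst (x s k)) + sqsum (\<lambda>k. snd (x s k))) * W" .
  qed
  also have "\<dots> = low_card * (2 * low_jn * (sqsum (\<lambda>k. fst (x s k)) + sqsum (\<lambda>k. snd (x s k))) * W)" by (simp add: low_card_def)
  finally show ?thesis .
qed

end

text \<open>The bound that \<open>gronwall_rate\<close> gives for the weighted energy. In the rate,
  4 is the 2 of the energy balance times the 2 of \<open>low_sum_bound\<close>, and the summand 1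
  comes from separating \<open>g\<close> by Young's inequality.\<close>

definition energy_bound :: "real \<Rightarrow> real" where
  "energy_bound T = 2 * ((wnrm jn2 x0)\<^sup>2 + M * T) * exp (2 * (4 * low_card * low_jn * low_diff T + 1) * T)"

text \<open>Bounds the low modes of the second component, reached from the first one through the
  difference; for \<open>\<theta>2 \<ge> 1/2\<close> the energy of the first is at most
  \<open>2 * energy_bound T\<close>.\<close>

definition low_second :: "real \<Rightarrow> real" where "low_second T = sqrt (2 * energy_bound T) + low_diff T"

text \<open>\<open>gronwall_rate\<close> once more, now with \<open>low_second\<close> as the bound
  of the test field. The energy of the first component is already bounded by
  \<open>2 * energy_bound T\<close> and goes into the constant term, whence the 8.\<close>

definition second_energy_const :: "real \<Rightarrow> real" where
  "second_energy_const T = 2 * ((wnrm jn2 x0)\<^sup>2 + (M + 8 * low_card * low_jn * low_second T * energy_bound T) * T) * exp (2 * (4 * low_card * low_jn * low_second T + 1) * T)"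

definition max_energy_bound :: "real \<Rightarrow> real" where "max_energy_bound T = max (2 * energy_bound T) (second_energy_const T)"

lemma energy_bound_nonneg: "0 \<le> T \<Longrightarrow> 0 \<le> energy_bound T" using M_nonneg by (simp add: energy_bound_def)

text \<open>In the weighted energy \<open>\<theta>2 |v1|\<^sup>2 + \<theta>1 |v2|\<^sup>2\<close> the coupling only enters through
  \<open>\<theta>1 \<theta>2 (P_N (B1 - B2), P_N (v1 - v2))\<close>, where \<open>P_N (v1 - v2)\<close> solves a linear heat equation.\<close>

lemma weighted_energy_bound:
  assumes sol: "solves T \<kappa> x" and T: "0 \<le> T" and gx: "solenoidal_pair T x" and t: "t \<in> {0..T}"
  shows "\<theta>2 * sqsum (\<lambda>k. fst (x t k)) + \<theta>1 * sqsum (\<lambda>k. snd (x t k)) \<le> energy_bound T"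
proof -
  let ?E1 = "\<lambda>s. sqsum (\<lambda>k. fst (x s k))" and ?E2 = "\<lambda>s. sqsum (\<lambda>k. snd (x s k))"
  let ?E = "\<lambda>s. \<theta>2 * ?E1 s + \<theta>1 * ?E2 s"
  let ?S = "\<lambda>s z. \<Sum>k\<in>lowset N. (Bp fst (x s) k - Bp snd (x s) k) \<bullet> z k"
  have gf: "solenoidal (\<lambda>k. fst (x s k))" "solenoidal (\<lambda>k. snd (x s k))" if "s \<in> {0..T}" for s using gx that by (auto simp: solenoidal_pair_def)
  obtain \<phi>1 where \<phi>1: "\<forall>t\<in>{0..T}. set_integrable lborel {0..t} \<phi>1 \<and> ?E1 t = sqsum (\<lambda>k. fst (x0 k)) + (LINT s:{0..t}|lborel. \<phi>1 s)"
    "AE s in lborel. s \<in> {0..T} \<longrightarrow> \<phi>1 s \<le> 2 * \<kappa> s * \<theta>1 * (\<Sum>k\<in>lowset N. (Bp fst (x s) k - Bp snd (x s) k) \<bullet> fst (x s k)) + ?E1 s + M"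
    using component_energy_rate[OF sol T gx bounded_linear_fst norm_fst_snd_le(1) gf(1) fst_force[OF sol T]] by blast
  obtain \<phi>2 where \<phi>2: "\<forall>t\<in>{0..T}. set_integrable lborel {0..t} \<phi>2 \<and> ?E2 t = sqsum (\<lambda>k. snd (x0 k)) + (LINT s:{0..t}|lborel. \<phi>2 s)"
    "AE s in lborel. s \<in> {0..T} \<longrightarrow> \<phi>2 s \<le> 2 * \<kappa> s * \<theta>2 * (\<Sum>k\<in>lowset N. (Bp snd (x s) k - Bp fst (x s) k) \<bullet> snd (x s k)) + ?E2 s + M"
    using component_energy_rate[OF sol T gx bounded_linear_snd norm_fst_snd_le(2) gf(2) snd_force[OF sol T]] by blast
  let ?\<phi> = "\<lambda>s. \<theta>2 * \<phi>1 s + \<theta>1 * \<phi>2 s"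
  let ?C = "4 * low_card * low_jn * low_diff T + 1"
  have C: "0 < ?C" using low_card_nonneg low_jn_ge low_diff_nonneg[OF T] by (intro add_nonneg_pos mult_nonneg_nonneg) auto
  have int1: "set_integrable lborel {0..t} (\<lambda>s. \<theta>2 * \<phi>1 s)" "set_integrable lborel {0..t} (\<lambda>s. \<theta>1 * \<phi>2 s)" if "t \<in> {0..T}" for t
    using \<phi>1(1) \<phi>2(1) that by (auto intro: set_integrable_mult_right)
  have eq: "?E t = (\<theta>2 * sqsum (\<lambda>k. fst (x0 k)) + \<theta>1 * sqsum (\<lambda>k. snd (x0 k))) + (LINT s:{0..t}|lborel. ?\<phi> s)" if "t \<in> {0..T}" for t
    using \<phi>1(1) \<phi>2(1) that by (simp add: set_integral_add(2)[OF int1[OF that]] algebra_simps)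
  obtain Ka where Ka: "\<And>t. t \<in> {0..T} \<Longrightarrow> ?E1 t \<le> Ka" using sqsum_component_bound[OF sol T gx, of fst] norm_fst_snd_le(1) by blast
  obtain Kb where Kb: "\<And>t. t \<in> {0..T} \<Longrightarrow> ?E2 t \<le> Kb" using sqsum_component_bound[OF sol T gx, of snd] norm_fst_snd_le(2) by blast
  have rate: "AE s in lborel. s \<in> {0..T} \<longrightarrow> ?\<phi> s \<le> ?C * ?E s + M"
    using \<phi>1(2) \<phi>2(2)
  proof eventually_elim
    case (elim s)
    show ?case
    proof
      assume s: "s \<in> {0..T}"
      have S: "\<bar>?S s (\<lambda>k. fst (x s k) - snd (x s k))\<bar> \<le> low_card * (2 * low_jn * (?E1 s + ?E2 s) * low_diff T)"
        by (rule low_sum_bound[OF sol T gx s]) (auto simp: low_diff_def intro: low_difference_bound[OF sol T _ s])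
      have "(\<Sum>k\<in>lowset N. (Bp snd (x s) k - Bp fst (x s) k) \<bullet> snd (x s k)) = - ?S s (\<lambda>k. snd (x s k))"
        by (simp add: sum_negf[symmetric] inner_diff_left)
      then have "?\<phi> s \<le> \<theta>2 * (2 * \<kappa> s * \<theta>1 * ?S s (\<lambda>k. fst (x s k)) + ?E1 s + M) + \<theta>1 * (2 * \<kappa> s * \<theta>2 * (- ?S s (\<lambda>k. snd (x s k))) + ?E2 s + M)"
        using elim s th by (intro add_mono mult_left_mono) auto
      also have "\<dots> = 2 * (\<kappa> s * (\<theta>1 * \<theta>2)) * (?S s (\<lambda>k. fst (x s k)) - ?S s (\<lambda>k. snd (x s k))) + ?E s + (\<theta>1 + \<theta>2) * M"
        by (simp add: algebra_simps)
      also have "?S s (\<lambda>k. fst (x s k)) - ?S s (\<lambda>k. snd (x s k)) = ?S s (\<lambda>k. fst (x s k) - snd (x s k))"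
        by (simp add: sum_subtractf[symmetric] inner_diff_right)
      also have "2 * (\<kappa> s * (\<theta>1 * \<theta>2)) * ?S s (\<lambda>k. fst (x s k) - snd (x s k)) \<le> (4 * low_card * low_jn * low_diff T) * ?E s"
      proof -
        have "2 * (\<kappa> s * (\<theta>1 * \<theta>2)) * ?S s (\<lambda>k. fst (x s k) - snd (x s k)) \<le> 2 * (\<kappa> s * (\<theta>1 * \<theta>2)) * \<bar>?S s (\<lambda>k. fst (x s k) - snd (x s k))\<bar>"
          using kappa[OF sol T] th by (intro mult_left_mono) auto
        also have "\<dots> \<le> 2 * (1 * (\<theta>1 * \<theta>2)) * (low_card * (2 * low_jn * (?E1 s + ?E2 s) * low_diff T))"
          using kappa[OF sol T, of s] th S by (intro mult_mono) (auto simp: mult_le_cancel_right1 intro: mult_left_le_one_le)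
        \<comment> \<open>The product \<open>\<theta>1 \<theta>2\<close> is what converts the
          unweighted energies into weighted ones, even if one of the weights is 0.\<close>
        also have "\<dots> = (4 * low_card * low_jn * low_diff T) * (\<theta>1 * (\<theta>2 * ?E1 s) + \<theta>2 * (\<theta>1 * ?E2 s))" by (simp add: algebra_simps)
        also have "\<dots> \<le> (4 * low_card * low_jn * low_diff T) * (1 * (\<theta>2 * ?E1 s) + 1 * (\<theta>1 * ?E2 s))"
          using th low_card_nonneg low_jn_ge low_diff_nonneg[OF T] sqsum_nonneg[of "\<lambda>k. fst (x s k)"] sqsum_nonneg[of "\<lambda>k. snd (x s k)"]
          by (intro mult_left_mono add_mono mult_right_mono) auto
        finally show ?thesis by simp
      qed
      finally show "?\<phi> s \<le> ?C * ?E s + M" using th_sum by (simp add: algebra_simps)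
    qed
  qed
  let ?F0 = "\<theta>2 * sqsum (\<lambda>k. fst (x0 k)) + \<theta>1 * sqsum (\<lambda>k. snd (x0 k))"
  have F0: "0 \<le> ?F0" "?F0 \<le> (wnrm jn2 x0)\<^sup>2"
  proof -
    show "0 \<le> ?F0" by (intro add_nonneg_nonneg mult_nonneg_nonneg th sqsum_nonneg)
    have "?F0 \<le> \<theta>2 * (wnrm jn2 x0)\<^sup>2 + \<theta>1 * (wnrm jn2 x0)\<^sup>2"
      using th by (intro add_mono mult_left_mono sqsum_x0 norm_fst_snd_le) auto
    also have "\<dots> = (\<theta>1 + \<theta>2) * (wnrm jn2 x0)\<^sup>2" by (simp add: algebra_simps)
    finally show "?F0 \<le> (wnrm jn2 x0)\<^sup>2" using th_sum by simp
  qed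
  have "?E t \<le> 2 * (?F0 + M * T) * exp (2 * ?C * T)"
  proof (rule gronwall_rate[OF C M_nonneg T F0(1) _ _ _ _ rate t])
    show "set_integrable lborel {0..T} ?E"
      by (intro set_integral_add(1) set_integrable_mult_right sqsum_integrable[OF sol T gx] bounded_linear_fst bounded_linear_snd norm_fst_snd_le)
    show "?E t \<le> \<theta>2 * Ka + \<theta>1 * Kb" if "t \<in> {0..T}" for t using Ka[OF that] Kb[OF that] th by (intro add_mono mult_left_mono) auto
    show "set_integrable lborel {0..t} ?\<phi>" if "t \<in> {0..T}" for t using int1[OF that] by (rule set_integral_add(1))
  qed (use eq in auto)
  also have "\<dots> \<le> energy_bound T" unfolding energy_bound_def using F0 by (intro mult_right_mono) auto
  finally show ?thesis .
qed

lemma second_energy_bound: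
  assumes sol: "solves T \<kappa> x" and T: "0 \<le> T" and gx: "solenoidal_pair T x" and half: "1/2 \<le> \<theta>2"
  shows "\<And>t. t \<in> {0..T} \<Longrightarrow> sqsum (\<lambda>k. fst (x t k)) \<le> 2 * energy_bound T" and "\<And>t. t \<in> {0..T} \<Longrightarrow> sqsum (\<lambda>k. snd (x t k)) \<le> second_energy_const T"
proof -
  let ?E1 = "\<lambda>s. sqsum (\<lambda>k. fst (x s k))" and ?E2 = "\<lambda>s. sqsum (\<lambda>k. snd (x s k))"
  let ?S = "\<lambda>s z. \<Sum>k\<in>lowset N. (Bp fst (x s) k - Bp snd (x s) k) \<bullet> z k"
  have gf: "solenoidal (\<lambda>k. fst (x s k))" "solenoidal (\<lambda>k. snd (x s k))" if "s \<in> {0..T}" for s using gx that by (auto simp: solenoidal_pair_def)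
  show E1: "?E1 t \<le> 2 * energy_bound T" if t: "t \<in> {0..T}" for t
  proof -
    \<comment> \<open>The second term is only bounded below by 0, since its weight
      \<open>\<theta>1\<close> may vanish; that component needs the separate estimate below.\<close>
    have "1/2 * ?E1 t + 0 \<le> \<theta>2 * ?E1 t + \<theta>1 * ?E2 t"
      using half th sqsum_nonneg by (intro add_mono mult_right_mono mult_nonneg_nonneg) auto
    then show ?thesis using weighted_energy_bound[OF sol T gx t] by linarith
  qed
  have W: "norm (snd (x s k)) \<le> low_second T" if s: "s \<in> {0..T}" and k: "k \<in> lowset N" for s k
  proof -
    have "(norm (fst (x s k)))\<^sup>2 \<le> 2 * energy_bound T"
      using norm_sq_le_sqsum[OF x_H[OF sol T gx norm_fst_snd_le(1) s], of k] E1[OF s] by linarith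
    then have "norm (fst (x s k)) \<le> sqrt (2 * energy_bound T)" by (rule real_le_rsqrt)
    moreover have "norm (snd (x s k)) \<le> norm (fst (x s k)) + norm (fst (x s k) - snd (x s k))"
      by (metis norm_minus_commute norm_triangle_sub)
    ultimately show ?thesis using low_difference_bound[OF sol T k s] unfolding low_second_def low_diff_def by linarith
  qed
  have W0: "0 \<le> low_second T" unfolding low_second_def using low_diff_nonneg[OF T] energy_bound_nonneg[OF T] by simp
  obtain \<phi>2 where \<phi>2: "\<forall>t\<in>{0..T}. set_integrable lborel {0..t} \<phi>2 \<and> ?E2 t = sqsum (\<lambda>k. snd (x0 k)) + (LINT s:{0..t}|lborel. \<phi>2 s)"
    "AE s in lborel. s \<in> {0..T} \<longrightarrow> \<phi>2 s \<le> 2 * \<kappa> s * \<theta>2 * (\<Sum>k\<in>lowset N. (Bp snd (x s) k - Bp fst (x s) k) \<bullet> snd (x s k)) + ?E2 s + M"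
    using component_energy_rate[OF sol T gx bounded_linear_snd norm_fst_snd_le(2) gf(2) snd_force[OF sol T]] by blast
  let ?C = "4 * low_card * low_jn * low_second T + 1" and ?D = "M + 8 * low_card * low_jn * low_second T * energy_bound T"
  have C: "0 < ?C" using low_card_nonneg low_jn_ge W0 by (intro add_nonneg_pos mult_nonneg_nonneg) auto
  have D: "0 \<le> ?D" using low_card_nonneg low_jn_ge W0 energy_bound_nonneg[OF T] M_nonneg by (intro add_nonneg_nonneg mult_nonneg_nonneg) auto
  have rate: "AE s in lborel. s \<in> {0..T} \<longrightarrow> \<phi>2 s \<le> ?C * ?E2 s + ?D"
    using \<phi>2(2)
  proof eventually_elim
    case (elim s)
    show ?case
    proof
      assume s: "s \<in> {0..T}"
      have S: "\<bar>?S s (\<lambda>k. snd (x s k))\<bar> \<le> low_card * (2 * low_jn * (?E1 s + ?E2 s) * low_second T)"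
        by (rule low_sum_bound[OF sol T gx s]) (rule W[OF s])
      have "(\<Sum>k\<in>lowset N. (Bp snd (x s) k - Bp fst (x s) k) \<bullet> snd (x s k)) = - ?S s (\<lambda>k. snd (x s k))"
        by (simp add: sum_negf[symmetric] inner_diff_left)
      then have "\<phi>2 s \<le> 2 * (\<kappa> s * \<theta>2) * (- ?S s (\<lambda>k. snd (x s k))) + ?E2 s + M"
        using elim s by (simp add: mult_ac)
      also have "2 * (\<kappa> s * \<theta>2) * (- ?S s (\<lambda>k. snd (x s k))) \<le> 2 * (\<kappa> s * \<theta>2) * \<bar>?S s (\<lambda>k. snd (x s k))\<bar>"
        using kappa[OF sol T, of s] th by (intro mult_left_mono) auto
      also have "2 * (\<kappa> s * \<theta>2) * \<bar>?S s (\<lambda>k. snd (x s k))\<bar> \<le> 2 * 1 * (low_card * (2 * low_jn * (?E1 s + ?E2 s) * low_second T))"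
        using kappa[OF sol T, of s] th S by (intro mult_mono) (auto intro: mult_le_one)
      also have "\<dots> = 4 * low_card * low_jn * low_second T * ?E2 s + 4 * low_card * low_jn * low_second T * ?E1 s" by (simp add: algebra_simps)
      also have "4 * low_card * low_jn * low_second T * ?E1 s \<le> 4 * low_card * low_jn * low_second T * (2 * energy_bound T)"
        using low_card_nonneg low_jn_ge W0 E1[OF s] by (intro mult_left_mono mult_nonneg_nonneg) auto
      finally show "\<phi>2 s \<le> ?C * ?E2 s + ?D" by (simp add: algebra_simps)
    qed
  qed
  obtain Kb where Kb: "\<And>t. t \<in> {0..T} \<Longrightarrow> ?E2 t \<le> Kb" using sqsum_component_bound[OF sol T gx, of snd] norm_fst_snd_le(2) by blast
  show "?E2 t \<le> second_energy_const T" if t: "t \<in> {0..T}" for t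
  proof -
    have "?E2 t \<le> 2 * (sqsum (\<lambda>k. snd (x0 k)) + ?D * T) * exp (2 * ?C * T)"
      by (rule gronwall_rate[OF C D T sqsum_nonneg sqsum_integrable[OF sol T gx bounded_linear_snd norm_fst_snd_le(2)] Kb _ _ rate t])
        (use \<phi>2(1) in auto)
    also have "\<dots> \<le> second_energy_const T"
      unfolding second_energy_const_def using sqsum_x0[OF norm_fst_snd_le(2)] by (intro mult_right_mono) auto
    finally show ?thesis .
  qed
qed

text \<open>Bounded energies make the low-mode coupling a bounded force, and
  \<open>component_V_bound\<close> then applies to each component in turn. \<open>K\<close> is fixed
  before \<open>\<kappa>\<close> and \<open>x\<close>, which is what allows the cutoff radius to be
  chosen afterwards.\<close>

lemma a_priori_half:
  assumes half: "1/2 \<le> \<theta>2" and T: "0 \<le> T"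
  shows "\<exists>K. \<forall>\<kappa> x. solves T \<kappa> x \<longrightarrow> solenoidal_pair T x \<longrightarrow> (\<forall>t\<in>{0..T}. wsum jn2 (x t) \<le> ennreal K)"
proof (intro exI allI impI ballI)
  fix \<kappa> x t assume sol: "solves T \<kappa> x" and gx: "solenoidal_pair T x" and t: "t \<in> {0..T}"
  have gf: "solenoidal (\<lambda>k. fst (x s k))" "solenoidal (\<lambda>k. snd (x s k))" if "s \<in> {0..T}" for s using gx that by (auto simp: solenoidal_pair_def)
  have K: "0 \<le> max_energy_bound T" "\<And>t. t \<in> {0..T} \<Longrightarrow> sqsum (\<lambda>k. fst (x t k)) \<le> max_energy_bound T" "\<And>t. t \<in> {0..T} \<Longrightarrow> sqsum (\<lambda>k. snd (x t k)) \<le> max_energy_bound T"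
    using second_energy_bound[OF sol T gx half] energy_bound_nonneg[OF T] by (auto simp: max_energy_bound_def le_max_iff_disj)
  let ?Q = "(wnrm jn2 x0)\<^sup>2 + 1 / \<nu> * (low_card * (4 * low_jn * max_energy_bound T)\<^sup>2 + M) * T"
  have Q: "0 \<le> ?Q" using nu low_card_nonneg M_nonneg T by simp
  have 1: "wsum jn2 (\<lambda>k. fst (x t k)) \<le> ennreal ?Q"
    by (rule component_V_bound[OF sol T gx bounded_linear_fst norm_fst_snd_le gf fst_force[OF sol T] th(1,2) K t])
  have 2: "wsum jn2 (\<lambda>k. snd (x t k)) \<le> ennreal ?Q"
    by (rule component_V_bound[OF sol T gx bounded_linear_snd norm_fst_snd_le(2,1) gf(2,1) snd_force[OF sol T] th(3,4) K(1,3,2) t])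
  have "wsum jn2 (x t) = wsum jn2 (\<lambda>k. fst (x t k)) + wsum jn2 (\<lambda>k. snd (x t k))"
    by (rule wsum_fst_snd[where w=jn2, OF jn2_nonneg])
  also have "\<dots> \<le> ennreal ?Q + ennreal ?Q" by (rule add_mono[OF 1 2])
  also have "\<dots> = ennreal (?Q + ?Q)" by (rule ennreal_plus[OF Q Q, symmetric])
  finally show "wsum jn2 (x t) \<le> ennreal (?Q + ?Q)" .
qed

end

section \<open>Global solutions\<close>


lemma bounded_linear_swap: "bounded_linear (prod.swap :: 'a::real_normed_vector \<times> 'b::real_normed_vector \<Rightarrow> 'b \<times> 'a)"
proof -
  have "bounded_linear (\<lambda>z :: 'a \<times> 'b. (snd z, fst z))"
    by (intro bounded_linear_Pair bounded_linear_fst bounded_linear_snd)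
  then show ?thesis unfolding prod.swap_def[abs_def] .
qed

lemma norm_swap[simp]: "norm (prod.swap z) = norm z"
  by (cases z) (simp add: norm_Pair add.commute)

lemma wsum_swap[simp]: "wsum w (\<lambda>k. prod.swap (z k)) = wsum w z"
  by (simp add: wsum_def)

lemma set_integral_bounded_linear:
  fixes f :: "real \<Rightarrow> 'a::euclidean_space" and p :: "'a \<Rightarrow> 'b::euclidean_space"
  assumes "bounded_linear p" "set_integrable lborel A f"
  shows "set_integrable lborel A (\<lambda>s. p (f s))" "(LINT s:A|lborel. p (f s)) = p (LINT s:A|lborel. f s)"
proof -
  interpret p: bounded_linear p by (rule assms(1))
  have e: "indicator A s *\<^sub>R p (f s) = p (indicator A s *\<^sub>R f s)" for s by (simp add: p.scaleR)
  show "set_integrable lborel A (\<lambda>s. p (f s))"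
    using assms(2) unfolding set_integrable_def e by (rule integrable_bounded_linear[OF assms(1)])
  show "(LINT s:A|lborel. p (f s)) = p (LINT s:A|lborel. f s)"
    using assms(2) unfolding set_integrable_def set_lebesgue_integral_def e by (rule integral_bounded_linear[OF assms(1)])
qed

lemma set_integrable_duhamel:
  fixes F :: "real \<Rightarrow> 'a::euclidean_space"
  assumes "set_integrable lborel {0..t} F"
  shows "set_integrable lborel {0..t} (\<lambda>s. exp (- a * (t - s)) *\<^sub>R F s)"
proof -
  have "set_integrable lborel {0..t} (\<lambda>s. exp (a * s + (- a * t)) *\<^sub>R F s)"
    by (rule set_integrable_exp_scaleR[OF assms])
  then show ?thesis by (simp add: algebra_simps)
qed

context sync_data
begin

lemma sync_data_swap: "sync_data \<nu> \<theta>2 \<theta>1 (\<lambda>s k. prod.swap (G s k)) M (\<lambda>k. prod.swap (x0 k))"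
proof
  show "(\<lambda>s. prod.swap (G s k)) \<in> borel_measurable borel" for k
    using borel_measurable_continuous_on[OF linear_continuous_on[OF bounded_linear_swap] G_measurable] .
qed (use nu th th_sum M_nonneg G_bound x0_V in simp_all)

text \<open>One of the weights is at least 1/2, and exchanging the components together with their
  weights turns one case into the other.\<close>

lemma a_priori:
  assumes T: "0 \<le> T"
  shows "\<exists>K. \<forall>\<kappa> x. solves T \<kappa> x \<longrightarrow> solenoidal_pair T x \<longrightarrow> (\<forall>t\<in>{0..T}. wsum jn2 (x t) \<le> ennreal K)"
proof (cases "1/2 \<le> \<theta>2")
  case True
  then show ?thesis by (rule a_priori_half[OF _ T])
next
  case False
  then have half: "1/2 \<le> \<theta>1" using th_sum by simp
  interpret sw: sync_data \<nu> N \<theta>2 \<theta>1 "\<lambda>s k. prod.swap (G s k)" M "\<lambda>k. prod.swap (x0 k)"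
    by (rule sync_data_swap)
  obtain K where K: "\<And>\<kappa> x t. sw.solves T \<kappa> x \<Longrightarrow> sw.solenoidal_pair T x \<Longrightarrow> t \<in> {0..T} \<Longrightarrow> wsum jn2 (x t) \<le> ennreal K"
    using sw.a_priori_half[OF half T] by blast
  show ?thesis
  proof (intro exI allI impI ballI)
    fix \<kappa> x t assume sol: "solves T \<kappa> x" and gx: "solenoidal_pair T x" and t: "t \<in> {0..T}"
    let ?y = "\<lambda>s k. prod.swap (x s k)"
    have f: "sw.force \<kappa> ?y s k = prod.swap (force \<kappa> x s k)" for s k
      unfolding sw.force_def force_def mix_def PB_def by (simp add: prod_eq_iff)
    have "sw.solves T \<kappa> ?y"
      unfolding sw.solves_def
    proof (intro conjI allI ballI)
      show "\<kappa> \<in> borel_measurable borel" "0 \<le> \<kappa> s" "\<kappa> s \<le> 1" for s using sol by (simp_all add: solves_def)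
      show "(\<lambda>s. prod.swap (x s k)) \<in> borel_measurable borel" for k
        by (rule component_measurable(1)[OF sol T bounded_linear_swap])
      show "\<exists>K. \<forall>s\<in>{0..T}. wsum jn2 (\<lambda>k. prod.swap (x s k)) \<le> ennreal K" using sol by (simp add: solves_def)
      fix t k assume t: "t \<in> {0..T}"
      have "x t k = exp (- (\<nu> * jn2 k) * t) *\<^sub>R x0 k + (LINT s:{0..t}|lborel. exp (- (\<nu> * jn2 k) * (t - s)) *\<^sub>R force \<kappa> x s k)"
        using sol t unfolding solves_def by blast
      then have "prod.swap (x t k) = exp (- (\<nu> * jn2 k) * t) *\<^sub>R prod.swap (x0 k) + prod.swap (LINT s:{0..t}|lborel. exp (- (\<nu> * jn2 k) * (t - s)) *\<^sub>R force \<kappa> x s k)"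
        by (simp add: prod.swap_def)
      also have "prod.swap (LINT s:{0..t}|lborel. exp (- (\<nu> * jn2 k) * (t - s)) *\<^sub>R force \<kappa> x s k) =
         (LINT s:{0..t}|lborel. prod.swap (exp (- (\<nu> * jn2 k) * (t - s)) *\<^sub>R force \<kappa> x s k))"
        by (rule set_integral_bounded_linear(2)[OF bounded_linear_swap set_integrable_duhamel[OF force_integrable[OF sol T t]], symmetric])
      also have "\<dots> = (LINT s:{0..t}|lborel. exp (- (\<nu> * jn2 k) * (t - s)) *\<^sub>R sw.force \<kappa> ?y s k)"
        unfolding f by (simp add: prod.swap_def)
      finally show "prod.swap (x t k) = exp (- (\<nu> * jn2 k) * t) *\<^sub>R prod.swap (x0 k) + \<dots>" .
    qed
    moreover have "sw.solenoidal_pair T ?y" using gx by (simp add: sw.solenoidal_pair_def solenoidal_pair_def)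
    ultimately have "wsum jn2 (?y t) \<le> ennreal K" using t by (rule K)
    then show "wsum jn2 (x t) \<le> ennreal K" by simp
  qed
qed

lemma wsum_diffusion: "wsum (\<lambda>k. \<nu> * jn2 k) z = ennreal \<nu> * wsum jn2 z"
  using nu jn2_nonneg by (intro wsum_weight_mult) auto

lemma wsum_diffusion_finite: "wsum (\<lambda>k. \<nu> * jn2 k) z < \<infinity> \<longleftrightarrow> wsum jn2 z < \<infinity>"
  unfolding wsum_diffusion using nu by (auto simp: ennreal_mult_less_top)

text \<open>In the Lipschitz constant, \<open>1 / sqrt \<nu>\<close> comes from the weight
  \<open>1 / sqrt (\<nu> jn2)\<close> of the weaker norm and \<open>1 / \<nu>\<close> from the
  weight \<open>\<nu> jn2\<close> of the stronger one.\<close>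

lemma semilinear_cut_nonlin:
  assumes R: "0 < R"
  shows "semilinear (\<lambda>k. \<nu> * jn2 k) (cut_nonlin N \<theta>1 \<theta>2 R) (sqrt (576 * Bop_const * R\<^sup>2 / (\<nu> * sqrt \<nu>))) G (1 / sqrt \<nu> * M) x0"
proof
  show "cut_nonlin N \<theta>1 \<theta>2 R (\<lambda>_. 0) = (\<lambda>_. 0)"
  proof
    fix k
    have "Bop (\<lambda>_. 0) (\<lambda>_. 0) k = 0" using Bop_scaleR[of 0 "\<lambda>_. 0" "\<lambda>_. 0" k] by simp
    then show "cut_nonlin N \<theta>1 \<theta>2 R (\<lambda>_. 0) k = 0" by (simp add: cut_nonlin_def PB_def mix_def zero_prod_def)
  qed
  show "(\<lambda>s. cut_nonlin N \<theta>1 \<theta>2 R (x s) k) \<in> borel_measurable borel"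
    if "\<And>j. (\<lambda>s. x s j) \<in> borel_measurable borel" for x :: "real \<Rightarrow> int \<times> int \<Rightarrow> cvec \<times> cvec" and k
    by (rule cut_nonlin_measurable) (rule that)
  show "wsum (\<lambda>i. 1 / sqrt (\<nu> * jn2 i)) (\<lambda>i. cut_nonlin N \<theta>1 \<theta>2 R x i - cut_nonlin N \<theta>1 \<theta>2 R y i)
       \<le> ennreal ((sqrt (576 * Bop_const * R\<^sup>2 / (\<nu> * sqrt \<nu>)))\<^sup>2) * wsum (\<lambda>k. \<nu> * jn2 k) (\<lambda>i. x i - y i)"
    if "wsum (\<lambda>k. \<nu> * jn2 k) x < \<infinity>" "wsum (\<lambda>k. \<nu> * jn2 k) y < \<infinity>" for x y
  proof -
    have "wsum (\<lambda>i. 1 / sqrt (\<nu> * jn2 i)) (\<lambda>i. cut_nonlin N \<theta>1 \<theta>2 R x i - cut_nonlin N \<theta>1 \<theta>2 R y i)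
      \<le> ennreal (1 / sqrt \<nu>) * (ennreal (576 * Bop_const * R\<^sup>2) * wsum jn2 (\<lambda>k. x k - y k))"
      unfolding wsum_inverse_sqrt using that unfolding wsum_diffusion_finite
      by (intro mult_left_mono cut_nonlin_lipschitz th R) auto
    also have "\<dots> = (ennreal (1 / sqrt \<nu>) * ennreal (576 * Bop_const * R\<^sup>2)) * wsum jn2 (\<lambda>k. x k - y k)" by (simp only: mult.assoc)
    also have "ennreal (1 / sqrt \<nu>) * ennreal (576 * Bop_const * R\<^sup>2) = ennreal ((sqrt (576 * Bop_const * R\<^sup>2 / (\<nu> * sqrt \<nu>)))\<^sup>2) * ennreal \<nu>"
    proof -
      have "0 \<le> 576 * Bop_const * R\<^sup>2 / (\<nu> * sqrt \<nu>)" using nu Bop_const(2) by simp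
      then show ?thesis using nu Bop_const(2) by (simp add: ennreal_mult[symmetric])
    qed
    finally show ?thesis unfolding wsum_diffusion by (simp only: mult.assoc)
  qed
  show "AE s in lborel. 0 \<le> s \<longrightarrow> wsum (\<lambda>i. 1 / sqrt (\<nu> * jn2 i)) (G s) \<le> ennreal (1 / sqrt \<nu> * M)"
    using G_bound
  proof eventually_elim
    case (elim s)
    show ?case
    proof
      assume "0 \<le> s"
      then have "wsum (\<lambda>i. 1 / sqrt (\<nu> * jn2 i)) (G s) \<le> ennreal (1 / sqrt \<nu>) * ennreal M"
        unfolding wsum_inverse_sqrt using elim wsum_G_weighted[of s] by (intro mult_left_mono) (auto intro: order_trans[OF wsum_G_weighted])
      then show "wsum (\<lambda>i. 1 / sqrt (\<nu> * jn2 i)) (G s) \<le> ennreal (1 / sqrt \<nu> * M)"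
        using nu M_nonneg by (subst ennreal_mult) auto
    qed
  qed
  show "wsum (\<lambda>k. \<nu> * jn2 k) x0 < \<infinity>" using x0_V wsum_diffusion_finite by blast
qed (use nu M_nonneg diffusion_pos G_measurable in simp_all)

section \<open>Uniqueness for the original system\<close>

lemma solves_mono: "solves T \<kappa> x \<Longrightarrow> S \<le> T \<Longrightarrow> solves S \<kappa> x"
  unfolding solves_def by (meson atLeastAtMost_iff order_trans)

text \<open>Both solutions are bounded in V on \<open>{0..T}\<close>. For \<open>R\<close> above
  both bounds the cutoff equals 1 along them, so they are fixed points of one and the same
  \<open>duh\<close>, to which the abstract uniqueness applies.\<close>

lemma solves_uniqueness:
  assumes T: "0 \<le> T" and x: "solves T (\<lambda>_. 1) x" and y: "solves T (\<lambda>_. 1) y" and t: "t \<in> {0..T}"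
  shows "x t = y t"
proof
  fix k
  obtain Kx Ky where Kx: "\<And>s. s \<in> {0..T} \<Longrightarrow> wsum jn2 (x s) \<le> ennreal Kx" and Ky: "\<And>s. s \<in> {0..T} \<Longrightarrow> wsum jn2 (y s) \<le> ennreal Ky"
    using x y unfolding solves_def by metis
  \<comment> \<open>The summand 1 keeps \<open>R\<close> positive if both bounds are 0.\<close>
  define R where "R = sqrt (max \<bar>Kx\<bar> \<bar>Ky\<bar>) + 1"
  have R: "0 < R" by (simp add: R_def add_nonneg_pos)
  have RK: "max \<bar>Kx\<bar> \<bar>Ky\<bar> \<le> R\<^sup>2"
  proof -
    have "m \<le> (sqrt m + 1)\<^sup>2" if "0 \<le> m" for m using that by (simp add: power2_sum)
    from this[of "max \<bar>Kx\<bar> \<bar>Ky\<bar>"] show ?thesis unfolding R_def by linarith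
  qed
  interpret S: semilinear "\<lambda>k. \<nu> * jn2 k" "cut_nonlin N \<theta>1 \<theta>2 R" "sqrt (576 * Bop_const * R\<^sup>2 / (\<nu> * sqrt \<nu>))" G "1 / sqrt \<nu> * M" x0
    by (rule semilinear_cut_nonlin[OF R])
  have *: "S.admissible T z \<and> (\<forall>t\<in>{0..T}. \<forall>k. z t k = S.duh z t k)"
    if z: "solves T (\<lambda>_. 1) z" and bd: "\<And>s. s \<in> {0..T} \<Longrightarrow> wsum jn2 (z s) \<le> ennreal (R\<^sup>2)" for z
  proof (intro conjI ballI allI)
    show "S.admissible T z"
      unfolding S.admissible_def
    proof (intro conjI allI exI ballI)
      show "(\<lambda>s. z s i) \<in> borel_measurable borel" for i by (rule x_measurable[OF z T])
      show "wsum (\<lambda>k. \<nu> * jn2 k) (z s) \<le> ennreal (\<nu> * R\<^sup>2)" if "s \<in> {0..T}" for s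
        unfolding wsum_diffusion using bd[OF that] nu by (simp add: ennreal_mult mult_left_mono)
    qed
    fix t k assume t: "t \<in> {0..T}"
    have n: "cut_nonlin N \<theta>1 \<theta>2 R (z s) k = mix N \<theta>1 \<theta>2 k (PB (z s) (z s) k)" if "s \<in> {0..T}" for s
      using x_V[OF z T that] cut_eq_1[OF R wnrm_le[OF bd[OF that]]] R by (simp add: cut_nonlin_def)
    have "z t k = exp (- (\<nu> * jn2 k) * t) *\<^sub>R x0 k + (LINT s:{0..t}|lborel. exp (- (\<nu> * jn2 k) * (t - s)) *\<^sub>R force (\<lambda>_. 1) z s k)"
      using z t unfolding solves_def by blast
    also have "(LINT s:{0..t}|lborel. exp (- (\<nu> * jn2 k) * (t - s)) *\<^sub>R force (\<lambda>_. 1) z s k) =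
       (LINT s:{0..t}|lborel. exp (- (\<nu> * jn2 k) * (t - s)) *\<^sub>R (cut_nonlin N \<theta>1 \<theta>2 R (z s) k + G s k))"
      using n t by (intro set_lebesgue_integral_cong) (auto simp: force_def)
    finally show "z t k = S.duh z t k" unfolding S.duh_def .
  qed
  have bx: "wsum jn2 (x s) \<le> ennreal (R\<^sup>2)" if "s \<in> {0..T}" for s
    by (rule order_trans[OF Kx[OF that] ennreal_leI]) (use RK in auto)
  have byy: "wsum jn2 (y s) \<le> ennreal (R\<^sup>2)" if "s \<in> {0..T}" for s
    by (rule order_trans[OF Ky[OF that] ennreal_leI]) (use RK in auto)
  show "x t k = y t k"
    using *[OF x bx] *[OF y byy] t by (intro S.uniqueness[of T x y]) auto
qed

end

section \<open>Reality, incompressibility and global existence\<close>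

lemma bounded_linear_wdot: "bounded_linear (wdot k)"
  unfolding wdot_def[abs_def]
  by (intro bounded_linear_add bounded_linear_const_mult bounded_linear_fst bounded_linear_snd)

text \<open>Combined with \<open>k\<close> replaced by \<open>- k\<close>, this is
  \<open>refl_fld\<close> for pairs of fields.\<close>

definition conj2 :: "cvec \<times> cvec \<Rightarrow> cvec \<times> cvec" where "conj2 z = (cconj (fst z), cconj (snd z))"

lemma bounded_linear_conj2: "bounded_linear conj2"
  unfolding conj2_def[abs_def]
  by (intro bounded_linear_Pair bounded_linear_compose[OF bounded_linear_cconj] bounded_linear_fst bounded_linear_snd)

lemma norm_conj2[simp]: "norm (conj2 z) = norm z" by (simp add: conj2_def norm_Pair norm_prod_def[of z])

lemma jn2_uminus[simp]: "jn2 (- k) = jn2 k" by (simp add: jn2_def)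
lemma low_uminus[simp]: "low N (- k) = low N k" by (cases k) (simp add: low_def wnorm2_def)

lemma wsum_conj2: "wsum jn2 (\<lambda>k. conj2 (z (- k))) = wsum jn2 z"
  using nsum_reindex[OF bij_uminus_pair, of "\<lambda>k. ennreal (jn2 k * (norm (z k))\<^sup>2)"] by (simp add: wsum_def)

lemma cut_nonlin_conj2: "cut_nonlin N \<theta>1 \<theta>2 R (\<lambda>k. conj2 (z (- k))) k = conj2 (cut_nonlin N \<theta>1 \<theta>2 R z (- k))"
proof (cases "wsum jn2 z < \<infinity>")
  case True
  interpret C: bounded_linear conj2 by (rule bounded_linear_conj2)
  have c: "cut jn2 R (\<lambda>k. conj2 (z (- k))) = cut jn2 R z" by (simp add: cut_def wnrm_def wsum_conj2)
  have V: "Vfin (\<lambda>k. fst (z k))" "Vfin (\<lambda>k. snd (z k))" using Vfin_components[OF True] .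
  have "Bop (\<lambda>k. fst (conj2 (z (- k)))) (\<lambda>k. fst (conj2 (z (- k)))) k = cconj (Bop (\<lambda>k. fst (z k)) (\<lambda>k. fst (z k)) (- k))"
    "Bop (\<lambda>k. snd (conj2 (z (- k)))) (\<lambda>k. snd (conj2 (z (- k)))) k = cconj (Bop (\<lambda>k. snd (z k)) (\<lambda>k. snd (z k)) (- k))"
    using Bop_refl_fld[OF V(1) V(1), of k] Bop_refl_fld[OF V(2) V(2), of k] by (simp_all add: refl_fld_def[abs_def] conj2_def)
  then show ?thesis unfolding cut_nonlin_def c wsum_conj2 using True
    by (simp add: mix_def PB_def conj2_def cconj_diff cconj_scaleR)
next
  case False
  then show ?thesis unfolding cut_nonlin_def wsum_conj2 by (simp add: conj2_def prod_eq_iff)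
qed

text \<open>Adds what is needed to derive \<open>solenoidal_pair\<close>, which the a priori bounds
  take as a hypothesis.\<close>

locale sync_system = sync_data +
  assumes G_solenoidal: "AE s in lborel. 0 \<le> s \<longrightarrow> solenoidal (\<lambda>k. fst (G s k)) \<and> solenoidal (\<lambda>k. snd (G s k))"
    and x0_solenoidal: "solenoidal (\<lambda>k. fst (x0 k))" "solenoidal (\<lambda>k. snd (x0 k))"
begin

text \<open>Duhamel's formula is linear in datum and force, so a linear condition on a single mode
  passes from both to the solution. It is applied to the zero mode and to the divergence.\<close>

lemma linear_constraint:
  fixes p :: "cvec \<times> cvec \<Rightarrow> 'f::euclidean_space"
  assumes sol: "solves T \<kappa> x" and T: "0 \<le> T" and p: "bounded_linear p" and p0: "p (x0 k) = 0"
    and f: "AE s in lborel. 0 \<le> s \<longrightarrow> p (force \<kappa> x s k) = 0" and t: "t \<in> {0..T}"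
  shows "p (x t k) = 0"
proof -
  interpret p: bounded_linear p by (rule p)
  let ?a = "\<nu> * jn2 k"
  have "x t k = exp (- ?a * t) *\<^sub>R x0 k + (LINT s:{0..t}|lborel. exp (- ?a * (t - s)) *\<^sub>R force \<kappa> x s k)"
    using sol t unfolding solves_def by blast
  then have "p (x t k) = exp (- ?a * t) *\<^sub>R p (x0 k) + p (LINT s:{0..t}|lborel. exp (- ?a * (t - s)) *\<^sub>R force \<kappa> x s k)"
    by (simp only: p.add p.scaleR)
  also have "p (LINT s:{0..t}|lborel. exp (- ?a * (t - s)) *\<^sub>R force \<kappa> x s k) = (LINT s:{0..t}|lborel. p (exp (- ?a * (t - s)) *\<^sub>R force \<kappa> x s k))"
    by (rule set_integral_bounded_linear(2)[OF p set_integrable_duhamel[OF force_integrable[OF sol T t]], symmetric])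
  also have "\<dots> = 0"
    unfolding set_lebesgue_integral_def
    by (rule integral_eq_zero_AE) (use f in \<open>eventually_elim, auto simp: indicator_def p.scaleR\<close>)
  finally show ?thesis by (simp add: p0)
qed

text \<open>Zero mean and incompressibility are linear constraints which the force satisfies
  whatever \<open>x\<close> is. Reality is different, since B(x,x) is known to be real only for real
  \<open>x\<close>. Instead, the conjugated path solves the same cutoff equation, because the cutoff
  depends on the norm only, and uniqueness identifies it with \<open>x\<close>.\<close>

lemma cutoff_solution:
  assumes R: "0 < R"
  shows "\<exists>x \<kappa>. (\<forall>T\<ge>0. solves T \<kappa> x \<and> solenoidal_pair T x) \<and> (\<forall>s. wsum jn2 (x s) \<le> ennreal (R\<^sup>2) \<longrightarrow> \<kappa> s = 1)"
proof -
  interpret S: semilinear "\<lambda>k. \<nu> * jn2 k" "cut_nonlin N \<theta>1 \<theta>2 R" "sqrt (576 * Bop_const * R\<^sup>2 / (\<nu> * sqrt \<nu>))" G "1 / sqrt \<nu> * M" x0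
    by (rule semilinear_cut_nonlin[OF R])
  obtain x where adm: "\<And>T. S.admissible T x" and eq: "\<And>t k. 0 \<le> t \<Longrightarrow> x t k = S.duh x t k"
    using S.existence by blast
  have [measurable]: "(\<lambda>s. x s k) \<in> borel_measurable borel" for k using adm[of 0] unfolding S.admissible_def by blast
  \<comment> \<open>The squared cutoff read along the solution; with this factor
    \<open>force\<close> is the cutoff nonlinearity plus \<open>G\<close>.\<close>
  define \<kappa> where "\<kappa> s = (if wsum jn2 (x s) < \<infinity> then (cut jn2 R (x s))\<^sup>2 else 0)" for s
  have f: "force \<kappa> x s k = cut_nonlin N \<theta>1 \<theta>2 R (x s) k + G s k" for s k by (simp add: force_def \<kappa>_def cut_nonlin_def)
  have sol: "solves T \<kappa> x" if T: "0 \<le> T" for T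
    unfolding solves_def
  proof (intro conjI allI ballI)
    show "\<kappa> \<in> borel_measurable borel" unfolding \<kappa>_def cut_def wnrm_def by measurable
    show "0 \<le> \<kappa> s" "\<kappa> s \<le> 1" for s using cut_bounds[OF R, of jn2 "x s"] by (auto simp: \<kappa>_def power_le_one)
    show "(\<lambda>s. x s k) \<in> borel_measurable borel" for k by measurable
    obtain K where K: "\<And>s. s \<in> {0..T} \<Longrightarrow> wsum (\<lambda>k. \<nu> * jn2 k) (x s) \<le> ennreal K" using adm[of T] unfolding S.admissible_def by metis
    have "wsum jn2 (x s) \<le> ennreal (1 / \<nu>) * ennreal K" if "s \<in> {0..T}" for s
    proof -
      have "wsum jn2 (x s) = ennreal (1 / \<nu>) * wsum (\<lambda>k. \<nu> * jn2 k) (x s)"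
        unfolding wsum_diffusion using nu by (simp add: mult.assoc[symmetric] ennreal_mult[symmetric])
      also have "\<dots> \<le> ennreal (1 / \<nu>) * ennreal K" by (intro mult_left_mono K that) auto
      finally show ?thesis .
    qed
    then show "\<exists>K. \<forall>s\<in>{0..T}. wsum jn2 (x s) \<le> ennreal K" using nu by (metis ennreal_mult' less_imp_le zero_le_divide_1_iff)
    fix t k assume "t \<in> {0..T}"
    then show "x t k = exp (- (\<nu> * jn2 k) * t) *\<^sub>R x0 k + (LINT s:{0..t}|lborel. exp (- (\<nu> * jn2 k) * (t - s)) *\<^sub>R force \<kappa> x s k)"
      using eq[of t k] unfolding f S.duh_def by simp
  qed
  interpret C: bounded_linear conj2 by (rule bounded_linear_conj2)
  let ?y = "\<lambda>s k. conj2 (x s (- k))"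
  have adm_y: "S.admissible T ?y" for T
    unfolding S.admissible_def
  proof (intro conjI allI)
    show "(\<lambda>s. conj2 (x s (- i))) \<in> borel_measurable borel" for i
      by (rule borel_measurable_continuous_on[OF linear_continuous_on[OF bounded_linear_conj2]]) measurable
    show "\<exists>K. \<forall>s\<in>{0..T}. wsum (\<lambda>k. \<nu> * jn2 k) (?y s) \<le> ennreal K"
      using adm[of T] unfolding S.admissible_def wsum_diffusion wsum_conj2 by blast
  qed
  have y_eq: "?y t k = S.duh ?y t k" if t: "0 \<le> t" for t k
  proof -
    have tt: "t \<in> {0..t}" using t by auto
    let ?a = "\<nu> * jn2 k"
    have "fst (x0 (- k)) = cconj (fst (x0 k))" "snd (x0 (- k)) = cconj (snd (x0 k))"
      using x0_solenoidal unfolding solenoidal_def by blast+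
    then have x0c: "conj2 (x0 (- k)) = x0 k" by (simp add: conj2_def)
    have "x t (- k) = exp (- ?a * t) *\<^sub>R x0 (- k) + (LINT s:{0..t}|lborel. exp (- ?a * (t - s)) *\<^sub>R (cut_nonlin N \<theta>1 \<theta>2 R (x s) (- k) + G s (- k)))"
      using eq[OF t, of "- k"] unfolding S.duh_def jn2_uminus .
    then have "?y t k = exp (- ?a * t) *\<^sub>R x0 k + conj2 (LINT s:{0..t}|lborel. exp (- ?a * (t - s)) *\<^sub>R (cut_nonlin N \<theta>1 \<theta>2 R (x s) (- k) + G s (- k)))"
      by (simp only: C.add C.scaleR x0c)
    also have "conj2 (LINT s:{0..t}|lborel. exp (- ?a * (t - s)) *\<^sub>R (cut_nonlin N \<theta>1 \<theta>2 R (x s) (- k) + G s (- k))) =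
       (LINT s:{0..t}|lborel. conj2 (exp (- ?a * (t - s)) *\<^sub>R (cut_nonlin N \<theta>1 \<theta>2 R (x s) (- k) + G s (- k))))"
      by (rule set_integral_bounded_linear(2)[OF bounded_linear_conj2 set_integrable_duhamel[OF S.force_integrable[OF adm tt]], symmetric])
    also have "\<dots> = (LINT s:{0..t}|lborel. exp (- ?a * (t - s)) *\<^sub>R (cut_nonlin N \<theta>1 \<theta>2 R (?y s) k + G s k))"
      unfolding set_lebesgue_integral_def
    proof (rule integral_cong_AE)
      have m: "(\<lambda>s. cut_nonlin N \<theta>1 \<theta>2 R (x s) (- k) + G s (- k)) \<in> borel_measurable borel" "(\<lambda>s. cut_nonlin N \<theta>1 \<theta>2 R (?y s) k + G s k) \<in> borel_measurable borel"
        using S.force_measurable[OF adm] S.force_measurable[OF adm_y] by blast+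
      have mc: "(\<lambda>s. conj2 (exp (- ?a * (t - s)) *\<^sub>R (cut_nonlin N \<theta>1 \<theta>2 R (x s) (- k) + G s (- k)))) \<in> borel_measurable borel"
        by (rule borel_measurable_continuous_on[OF linear_continuous_on[OF bounded_linear_conj2]]) (use m(1) in measurable)
      show "(\<lambda>s. indicator {0..t} s *\<^sub>R conj2 (exp (- ?a * (t - s)) *\<^sub>R (cut_nonlin N \<theta>1 \<theta>2 R (x s) (- k) + G s (- k)))) \<in> borel_measurable lborel"
        using mc by measurable
      show "(\<lambda>s. indicator {0..t} s *\<^sub>R exp (- ?a * (t - s)) *\<^sub>R (cut_nonlin N \<theta>1 \<theta>2 R (?y s) k + G s k)) \<in> borel_measurable lborel"
        using m(2) by measurable
      show "AE s in lborel. indicator {0..t} s *\<^sub>R conj2 (exp (- ?a * (t - s)) *\<^sub>R (cut_nonlin N \<theta>1 \<theta>2 R (x s) (- k) + G s (- k))) =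
         indicator {0..t} s *\<^sub>R exp (- ?a * (t - s)) *\<^sub>R (cut_nonlin N \<theta>1 \<theta>2 R (?y s) k + G s k)"
        using G_solenoidal
      proof eventually_elim
        case (elim s)
        show ?case
        proof (cases "s \<in> {0..t}")
          case True
          then have "fst (G s (- k)) = cconj (fst (G s k))" "snd (G s (- k)) = cconj (snd (G s k))"
            using elim \<open>s \<in> {0..t}\<close> unfolding solenoidal_def by (metis atLeastAtMost_iff)+
          then have "conj2 (G s (- k)) = G s k" by (simp add: conj2_def)
          then show ?thesis by (simp add: C.scaleR C.add cut_nonlin_conj2)
        qed simp
      qed
    qed
    finally show ?thesis unfolding S.duh_def .
  qed
  have sym: "x t k = ?y t k" if "0 \<le> t" for t k
    by (rule S.uniqueness[OF adm adm_y, of t t k]) (use eq y_eq that in auto)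
  have solenoidal: "solenoidal_pair T x" if T: "0 \<le> T" for T
    unfolding solenoidal_pair_def
  proof (intro ballI)
    fix t assume t: "t \<in> {0..T}"
    have f0: "force \<kappa> x s 0 = G s 0" for s by (simp add: force_def mix_def PB_def zero_prod_def[symmetric])
    have df: "wdot k (fst (force \<kappa> x s k)) = wdot k (fst (G s k))" "wdot k (snd (force \<kappa> x s k)) = wdot k (snd (G s k))" for s k
      by (simp_all add: force_def mix_def PB_def wdot_add wdot_diff wdot_scaleR wdot_Bop)
    have mode0: "AE s in lborel. 0 \<le> s \<longrightarrow> fst (force \<kappa> x s 0) = 0" "AE s in lborel. 0 \<le> s \<longrightarrow> snd (force \<kappa> x s 0) = 0"
      using G_solenoidal by (eventually_elim, unfold f0 solenoidal_def, blast)+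
    have div: "AE s in lborel. 0 \<le> s \<longrightarrow> wdot k (fst (force \<kappa> x s k)) = 0" "AE s in lborel. 0 \<le> s \<longrightarrow> wdot k (snd (force \<kappa> x s k)) = 0" for k
      using G_solenoidal by (eventually_elim, unfold df solenoidal_def, blast)+
    have z: "fst (x t 0) = 0" "snd (x t 0) = 0"
      using x0_solenoidal by (auto intro!: linear_constraint[OF sol[OF T] T _ _ _ t] bounded_linear_fst bounded_linear_snd mode0 simp: solenoidal_def)
    have d: "wdot k (fst (x t k)) = 0" "wdot k (snd (x t k)) = 0" for k
      using linear_constraint[OF sol[OF T] T bounded_linear_compose[OF bounded_linear_wdot bounded_linear_fst] _ div(1) t]
        linear_constraint[OF sol[OF T] T bounded_linear_compose[OF bounded_linear_wdot bounded_linear_snd] _ div(2) t] x0_solenoidal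
      unfolding solenoidal_def by blast+
    have r: "fst (x t (- k)) = cconj (fst (x t k))" "snd (x t (- k)) = cconj (snd (x t k))" for k
      using sym[of t "- k"] t by (simp_all add: conj2_def)
    show "solenoidal (\<lambda>k. fst (x t k)) \<and> solenoidal (\<lambda>k. snd (x t k))" unfolding solenoidal_def using z d r by blast
  qed
  have "\<kappa> s = 1" if "wsum jn2 (x s) \<le> ennreal (R\<^sup>2)" for s
    using that cut_eq_1[OF R wnrm_le[OF that]] R by (auto simp: \<kappa>_def le_less_trans)
  with sol solenoidal show ?thesis by blast
qed

lemma solution_on_interval:
  assumes T: "0 \<le> T" shows "\<exists>x. solves T (\<lambda>_. 1) x \<and> solenoidal_pair T x"
proof -
  obtain K where K: "\<And>\<kappa> x t. solves T \<kappa> x \<Longrightarrow> solenoidal_pair T x \<Longrightarrow> t \<in> {0..T} \<Longrightarrow> wsum jn2 (x t) \<le> ennreal K"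
    using a_priori[OF T] by blast
  \<comment> \<open>\<open>K\<close> does not depend on the cutoff, so the radius can be taken from
    it; as \<open>K \<le> R^2\<close>, the cutoff is inactive on \<open>{0..T}\<close>.\<close>
  define R where "R = sqrt \<bar>K\<bar> + 1"
  have R: "0 < R" by (simp add: R_def add_nonneg_pos)
  have RK: "K \<le> R\<^sup>2" unfolding R_def by (simp add: power2_sum add_increasing2)
  obtain x \<kappa> where x: "\<And>T. T \<ge> 0 \<Longrightarrow> solves T \<kappa> x" "\<And>T. T \<ge> 0 \<Longrightarrow> solenoidal_pair T x" and k: "\<And>s. wsum jn2 (x s) \<le> ennreal (R\<^sup>2) \<Longrightarrow> \<kappa> s = 1"
    using cutoff_solution[OF R] by blast
  have k1: "\<kappa> s = 1" if "s \<in> {0..T}" for s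
    by (rule k, rule order_trans[OF K[OF x(1)[OF T] x(2)[OF T] that] ennreal_leI[OF RK]])
  have "solves T (\<lambda>_. 1) x"
    unfolding solves_def
  proof (intro conjI allI ballI)
    show "(\<lambda>s. x s k) \<in> borel_measurable borel" for k by (rule x_measurable[OF x(1)[OF T] T])
    show "\<exists>K. \<forall>s\<in>{0..T}. wsum jn2 (x s) \<le> ennreal K" using x(1)[OF T] unfolding solves_def by blast
    fix t k assume t: "t \<in> {0..T}"
    have "x t k = exp (- (\<nu> * jn2 k) * t) *\<^sub>R x0 k + (LINT s:{0..t}|lborel. exp (- (\<nu> * jn2 k) * (t - s)) *\<^sub>R force \<kappa> x s k)"
      using x(1)[OF T] t unfolding solves_def by blast
    also have "(LINT s:{0..t}|lborel. exp (- (\<nu> * jn2 k) * (t - s)) *\<^sub>R force \<kappa> x s k) = (LINT s:{0..t}|lborel. exp (- (\<nu> * jn2 k) * (t - s)) *\<^sub>R force (\<lambda>_. 1) x s k)"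
      using k1 t by (intro set_lebesgue_integral_cong) (auto simp: force_def)
    finally show "x t k = exp (- (\<nu> * jn2 k) * t) *\<^sub>R x0 k + (LINT s:{0..t}|lborel. exp (- (\<nu> * jn2 k) * (t - s)) *\<^sub>R force (\<lambda>_. 1) x s k)" .
  qed auto
  with x(2)[OF T] show ?thesis by blast
qed

theorem global_solution: "\<exists>x. \<forall>T\<ge>0. solves T (\<lambda>_. 1) x \<and> solenoidal_pair T x"
proof -
  have "\<forall>n. \<exists>x. solves (real n) (\<lambda>_. 1) x \<and> solenoidal_pair (real n) x" using solution_on_interval by simp
  then obtain X where X: "\<And>n. solves (real n) (\<lambda>_. 1) (X n)" "\<And>n. solenoidal_pair (real n) (X n)" by metis
  \<comment> \<open>By uniqueness every \<open>X n\<close> with \<open>t \<le> n\<close> gives the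
    same value. The chosen index takes countably many values and depends measurably on
    \<open>t\<close>, so measurability survives the gluing.\<close>
  define x where "x t = X (nat \<lceil>t\<rceil>) t" for t
  have xe: "x t = X n t" if "0 \<le> t" "t \<le> real n" for t n
  proof -
    have m: "t \<le> real (nat \<lceil>t\<rceil>)" "real (nat \<lceil>t\<rceil>) \<le> real n"
      using that ceiling_le_iff[of t "int n"] by (linarith, simp)
    show ?thesis unfolding x_def
      by (rule solves_uniqueness[OF _ X(1) solves_mono[OF X(1) m(2)]]) (use that m in auto)
  qed
  have xm: "(\<lambda>s. x s k) \<in> borel_measurable borel" for k
    unfolding x_def
  proof (rule measurable_compose_countable[where f="\<lambda>n s. X n s k" and g="\<lambda>s. nat \<lceil>s\<rceil>"])
    show "(\<lambda>s. X n s k) \<in> borel_measurable borel" for n by (rule x_measurable[OF X(1)]) simp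
  qed measurable
  have "solves T (\<lambda>_. 1) x \<and> solenoidal_pair T x" if T: "0 \<le> T" for T
  proof
    obtain n where n: "T \<le> real n" using real_arch_simple by blast
    have e: "x s = X n s" if "s \<in> {0..T}" for s using xe that n by auto
    show "solenoidal_pair T x" using X(2)[of n] e n unfolding solenoidal_pair_def by auto
    have Xn: "solves T (\<lambda>_. 1) (X n)" by (rule solves_mono[OF X(1) n])
    show "solves T (\<lambda>_. 1) x"
      unfolding solves_def
    proof (intro conjI allI ballI xm)
      show "\<exists>K. \<forall>s\<in>{0..T}. wsum jn2 (x s) \<le> ennreal K" using Xn e unfolding solves_def by simp
      fix t k assume t: "t \<in> {0..T}"
      have "X n t k = exp (- (\<nu> * jn2 k) * t) *\<^sub>R x0 k + (LINT s:{0..t}|lborel. exp (- (\<nu> * jn2 k) * (t - s)) *\<^sub>R force (\<lambda>_. 1) (X n) s k)"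
        using Xn t unfolding solves_def by blast
      also have "(LINT s:{0..t}|lborel. exp (- (\<nu> * jn2 k) * (t - s)) *\<^sub>R force (\<lambda>_. 1) (X n) s k) = (LINT s:{0..t}|lborel. exp (- (\<nu> * jn2 k) * (t - s)) *\<^sub>R force (\<lambda>_. 1) x s k)"
        using e t by (intro set_lebesgue_integral_cong) (auto simp: force_def)
      finally show "x t k = exp (- (\<nu> * jn2 k) * t) *\<^sub>R x0 k + (LINT s:{0..t}|lborel. exp (- (\<nu> * jn2 k) * (t - s)) *\<^sub>R force (\<lambda>_. 1) x s k)"
        using e[OF t] by simp
    qed auto
  qed
  then show ?thesis by blast
qed

end

section \<open>Strong solutions\<close>


lemma solenoidal_iff:
  "solenoidal u \<longleftrightarrow> u (0, 0) = (0, 0) \<and> (\<forall>k. wdot k (u k) = 0) \<and> (\<forall>k. u (- fst k, - snd k) = cconj (u k))"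
  by (simp add: solenoidal_def zero_prod_def uminus_prod_def)

lemma inH_iff: "inH u \<longleftrightarrow> solenoidal u \<and> wsum (\<lambda>_. 1) u < \<infinity>"
  using nsum_real_iff[of "\<lambda>k. cnorm2 (u k)"]
  by (auto simp: inH_def solenoidal_iff wsum_def norm_cvec_sq cnorm2_def)

lemma jn2_eq: "k \<noteq> 0 \<Longrightarrow> jn2 k = wnorm2 k"
  unfolding jn2_def by (rule jn_sq)

lemma solenoidal_weight: "solenoidal u \<Longrightarrow> jn2 k * (norm (u k))\<^sup>2 = wnorm2 k * cnorm2 (u k)"
  unfolding norm_cvec_sq by (cases "k = 0") (auto simp: solenoidal_def jn2_eq cnorm2_def)

lemma solenoidal_weight4: "solenoidal u \<Longrightarrow> jn k ^ 4 * (norm (u k))\<^sup>2 = (wnorm2 k)\<^sup>2 * cnorm2 (u k)"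
  unfolding norm_cvec_sq jn4 by (cases "k = 0") (auto simp: solenoidal_def jn2_eq cnorm2_def)

lemma cnorm2_nonneg: "0 \<le> cnorm2 v" by (simp add: cnorm2_def)

lemma wsum_jn2_eq: "solenoidal u \<Longrightarrow> wsum jn2 u = nsum (\<lambda>k. ennreal (wnorm2 k * cnorm2 (u k)))"
  by (simp add: wsum_def solenoidal_weight)

lemma wsum_jn4_eq: "solenoidal u \<Longrightarrow> wsum (\<lambda>k. jn k ^ 4) u = nsum (\<lambda>k. ennreal ((wnorm2 k)\<^sup>2 * cnorm2 (u k)))"
  by (simp add: wsum_def solenoidal_weight4)

lemma inV_iff: "inV u \<longleftrightarrow> solenoidal u \<and> wsum jn2 u < \<infinity>"
proof
  assume "inV u"
  then show "solenoidal u \<and> wsum jn2 u < \<infinity>"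
    using nsum_real_iff[of "\<lambda>k. wnorm2 k * cnorm2 (u k)"] by (auto simp: inV_def inH_iff wsum_jn2_eq wnorm2_nonneg cnorm2_nonneg)
next
  assume u: "solenoidal u \<and> wsum jn2 u < \<infinity>"
  then have "wsum (\<lambda>_. 1) u < \<infinity>" using le_less_trans[OF wsum_one_le_jn2] by blast
  then show "inV u"
    using u nsum_real_iff[of "\<lambda>k. wnorm2 k * cnorm2 (u k)"] by (auto simp: inV_def inH_iff wsum_jn2_eq wnorm2_nonneg cnorm2_nonneg)
qed

lemma inDA_I: assumes "solenoidal u" "wsum (\<lambda>k. jn k ^ 4) u < \<infinity>" shows "inDA u"
proof -
  have "wsum (\<lambda>_. 1) u < \<infinity>" using wsum_one_le_jn4 assms(2) by (rule le_less_trans)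
  then show ?thesis
    using assms nsum_real_iff[of "\<lambda>k. (wnorm2 k)\<^sup>2 * cnorm2 (u k)"]
    by (auto simp: inDA_def inH_iff wsum_jn4_eq cnorm2_nonneg)
qed

lemma Vnorm2_eq: assumes "solenoidal u" "wsum jn2 u < \<infinity>" shows "Vnorm2 u = (2 * pi)\<^sup>2 * (wnrm jn2 u)\<^sup>2"
proof -
  have s: "(\<lambda>k. wnorm2 k * cnorm2 (u k)) summable_on UNIV"
    using assms by (intro nsum_finite_summable) (auto simp: wsum_jn2_eq wnorm2_nonneg cnorm2_nonneg)
  have "ennreal ((wnrm jn2 u)\<^sup>2) = ennreal (infsum (\<lambda>k. wnorm2 k * cnorm2 (u k)) UNIV)"
    using assms s by (simp add: wsum_eq_wnrm[symmetric] wsum_jn2_eq nsum_eq_infsum_real[OF _ s] wnorm2_nonneg cnorm2_nonneg)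
  then have "(wnrm jn2 u)\<^sup>2 = infsum (\<lambda>k. wnorm2 k * cnorm2 (u k)) UNIV"
    by (subst (asm) ennreal_inj) (auto intro!: infsum_nonneg simp: wnorm2_nonneg cnorm2_nonneg)
  then show ?thesis by (simp add: Vnorm2_def)
qed

lemma solenoidal_diff: "solenoidal u \<Longrightarrow> solenoidal v \<Longrightarrow> solenoidal (\<lambda>k. u k - v k)"
  unfolding solenoidal_def by (auto simp: wdot_diff cconj_diff) 

lemma stokesA_eq: assumes "solenoidal u" shows "stokesA u k = jn2 k *\<^sub>R u k"
proof -
  have "stokesA u k = wnorm2 k *\<^sub>R u k"
  proof -
    have "wdot k (u k) = 0" "u 0 = 0" using assms unfolding solenoidal_def by blast+
    then show ?thesis unfolding stokesA_def lap_def by (subst leray_divfree) (auto simp: wdot_scaleR)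
  qed
  then show ?thesis using assms by (cases "k = 0") (auto simp: solenoidal_def jn2_eq)
qed

lemma PN_eq: "PN N w k = low N k *\<^sub>R w k"
  by (auto simp: PN_def low_def zero_prod_def)

lemma rhsF_eq:
  assumes "solenoidal (v s)"
  shows "rhsF \<nu> N \<theta> g v w s k =
    ((\<theta> * low N k) *\<^sub>R (Bop (v s) (v s) k - Bop (w s) (w s) k) - Bop (v s) (v s) k + g s k) - (\<nu> * jn2 k) *\<^sub>R v s k"
  unfolding rhsF_def stokesA_eq[OF assms] PN_eq by (simp add: algebra_simps)

section \<open>Data and strong solutions in the abstract setting\<close>

lemma Linf_H_measurable:
  assumes "Linf_H g" shows "(\<lambda>s. if 0 \<le> s then g s k else 0) \<in> borel_measurable borel"
proof -
  have "(\<lambda>s. g s k) \<in> borel_measurable (restrict_space lborel {0..})" using assms unfolding Linf_H_def by blast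
  then have "(\<lambda>s. indicator {0..} s *\<^sub>R g s k) \<in> borel_measurable lborel"
    by (subst (asm) borel_measurable_restrict_space_iff) auto
  moreover have "(\<lambda>s. indicator {0..} s *\<^sub>R g s k) = (\<lambda>s. if 0 \<le> s then g s k else 0)" by (auto simp: indicator_def)
  ultimately show ?thesis by simp
qed

lemma Linf_H_bound:
  assumes "Linf_H g"
  obtains M where "0 \<le> M" "AE s in lborel. 0 \<le> s \<longrightarrow> solenoidal (g s) \<and> wsum (\<lambda>_. 1) (g s) \<le> ennreal M"
proof -
  obtain M where M: "AE s in lborel. s \<ge> 0 \<longrightarrow> inH (g s) \<and> Hnorm2 (g s) \<le> M" using assms unfolding Linf_H_def by blast
  have "AE s in lborel. 0 \<le> s \<longrightarrow> solenoidal (g s) \<and> wsum (\<lambda>_. 1) (g s) \<le> ennreal \<bar>M / (2 * pi)\<^sup>2\<bar>"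
    using M
  proof eventually_elim
    case (elim s)
    show ?case
    proof
      assume "0 \<le> s"
      then have i: "inH (g s)" and h: "Hnorm2 (g s) \<le> M" using elim by auto
      have "wsum (\<lambda>_. 1) (g s) = ennreal (sqsum (g s))" using i by (intro wsum_eq_sqsum) (simp add: inH_iff)
      also have "sqsum (g s) = Hnorm2 (g s) / (2 * pi)\<^sup>2" by (simp add: sqsum_def Hnorm2_def norm_cvec_sq)
      also have "ennreal \<dots> \<le> ennreal \<bar>M / (2 * pi)\<^sup>2\<bar>"
        by (rule ennreal_leI[OF order_trans[OF divide_right_mono[OF h zero_le_power2] abs_ge_self]])
      finally show "solenoidal (g s) \<and> wsum (\<lambda>_. 1) (g s) \<le> ennreal \<bar>M / (2 * pi)\<^sup>2\<bar>" using i by (simp add: inH_iff)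
    qed
  qed
  then show thesis using that[of "\<bar>M / (2 * pi)\<^sup>2\<bar>"] by simp
qed

text \<open>By the reverse triangle inequality the V norm is continuous on the compact interval.
  This supplies the bound which \<open>solves\<close> asks for and \<open>strong_sol\<close>
  contains only implicitly.\<close>

lemma CV_wnrm_bounded:
  assumes "CV T w" shows "\<exists>K. \<forall>t\<in>{0..T}. wsum jn2 (w t) \<le> ennreal K"
proof -
  have V: "solenoidal (w t)" "wsum jn2 (w t) < \<infinity>" if "t \<in> {0..T}" for t
    using assms that by (auto simp: CV_def inV_iff)
  have "continuous_on {0..T} (\<lambda>t. wnrm jn2 (w t))"
    unfolding continuous_on_iff
  proof (intro ballI allI impI)
    fix t e :: real assume t: "t \<in> {0..T}" and e: "0 < e"
    have "0 < (2 * pi)\<^sup>2 * e\<^sup>2" using e by simp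
    then obtain d where d: "0 < d" "\<And>s. s \<in> {0..T} \<Longrightarrow> \<bar>s - t\<bar> < d \<Longrightarrow> Vnorm2 (\<lambda>k. w s k - w t k) < (2 * pi)\<^sup>2 * e\<^sup>2"
      using assms t unfolding CV_def by meson
    have "dist (wnrm jn2 (w s)) (wnrm jn2 (w t)) < e" if s: "s \<in> {0..T}" "dist s t < d" for s
    proof -
      have "(2 * pi)\<^sup>2 * (wnrm jn2 (\<lambda>k. w s k - w t k))\<^sup>2 < (2 * pi)\<^sup>2 * e\<^sup>2"
        using d(2)[OF s(1)] s(2)
          Vnorm2_eq[OF solenoidal_diff[OF V(1)[OF s(1)] V(1)[OF t]] wsum_diff_finite[where w=jn2, OF jn2_nonneg V(2)[OF s(1)] V(2)[OF t]]]
        by (simp add: dist_real_def)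
      then have "(wnrm jn2 (\<lambda>k. w s k - w t k))\<^sup>2 < e\<^sup>2" by simp
      then have "wnrm jn2 (\<lambda>k. w s k - w t k) < e" using e by (simp add: power_less_imp_less_base)
      then show ?thesis
        using wnrm_diff_abs_le[where w=jn2, OF jn2_nonneg V(2)[OF s(1)] V(2)[OF t]] by (simp add: dist_real_def)
    qed
    then show "\<exists>d>0. \<forall>s\<in>{0..T}. dist s t < d \<longrightarrow> dist (wnrm jn2 (w s)) (wnrm jn2 (w t)) < e" using d(1) by blast
  qed
  then have "bounded ((\<lambda>t. wnrm jn2 (w t)) ` {0..T})" by (intro compact_imp_bounded compact_continuous_image) auto
  then obtain B where B: "\<And>t. t \<in> {0..T} \<Longrightarrow> norm (wnrm jn2 (w t)) \<le> B" unfolding bounded_iff by blast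
  have "wsum jn2 (w t) \<le> ennreal (B\<^sup>2)" if "t \<in> {0..T}" for t
    unfolding wsum_eq_wnrm[OF V(2)[OF that]] using B[OF that] wnrm_nonneg[of jn2 "w t"] by (intro ennreal_leI power_mono) auto
  then show ?thesis by blast
qed

lemma set_integral_Pair:
  fixes f :: "real \<Rightarrow> 'a::euclidean_space" and h :: "real \<Rightarrow> 'b::euclidean_space"
  assumes "set_integrable lborel A f" "set_integrable lborel A h"
  shows "set_integrable lborel A (\<lambda>s. (f s, h s))" "(LINT s:A|lborel. (f s, h s)) = (LINT s:A|lborel. f s, LINT s:A|lborel. h s)"
proof -
  have l: "bounded_linear (\<lambda>z::'a. (z, 0::'b))" "bounded_linear (\<lambda>z::'b. (0::'a, z))"
    by (intro bounded_linear_Pair bounded_linear_ident bounded_linear_zero)+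
  note i = set_integral_bounded_linear[OF l(1) assms(1)] set_integral_bounded_linear[OF l(2) assms(2)]
  have e: "(\<lambda>s. (f s, h s)) = (\<lambda>s. (f s, 0) + (0, h s))" by simp
  show "set_integrable lborel A (\<lambda>s. (f s, h s))" unfolding e by (rule set_integral_add(1)[OF i(1) i(3)])
  show "(LINT s:A|lborel. (f s, h s)) = (LINT s:A|lborel. f s, LINT s:A|lborel. h s)"
    unfolding e set_integral_add(2)[OF i(1) i(3)] i by simp
qed

context sync_system
begin

text \<open>\<open>p\<close> and \<open>q\<close> are the two projections, in either order. The
  regularity is already established for the pair; here it is carried over to one component and to
  norms written with \<open>infsum\<close> and \<open>summable_on\<close>.\<close>

lemma strong_sol_component:
  fixes p q :: "cvec \<times> cvec \<Rightarrow> cvec"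
  assumes x: "\<And>T. 0 \<le> T \<Longrightarrow> solves T (\<lambda>_. 1) x" and p: "bounded_linear p" and pn: "\<And>z. norm (p z) \<le> norm z"
    and gp: "\<And>t. 0 \<le> t \<Longrightarrow> solenoidal (\<lambda>k. p (x t k))"
    and f: "\<And>s k. p (force (\<lambda>_. 1) x s k) = (\<theta> * low N k) *\<^sub>R (Bp p (x s) k - Bp q (x s) k) - Bp p (x s) k + p (G s k)"
    and g: "\<And>s k. 0 \<le> s \<Longrightarrow> p (G s k) = g s k"
  shows "strong_sol \<nu> N \<theta> g (\<lambda>t k. p (x t k)) (\<lambda>t k. q (x t k)) (\<lambda>k. p (x0 k))"
proof -
  interpret p: bounded_linear p by (rule p)
  have V: "wsum jn2 (\<lambda>k. p (x t k)) < \<infinity>" if "0 \<le> t" for t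
    using le_less_trans[OF wsum_component_le[where w=jn2, OF pn jn2_nonneg] x_V[OF x[OF that] that, of t]] that by simp
  have p0: "p (x 0 k) = p (x0 k)" for k
    using integral_equation(2)[OF x[of 0], of 0 k] by (simp only: set_integral_at_0) simp
  have rhs: "p (force (\<lambda>_. 1) x s k) - (\<nu> * jn2 k) *\<^sub>R p (x s k) = rhsF \<nu> N \<theta> g (\<lambda>t k. p (x t k)) (\<lambda>t k. q (x t k)) s k" if "0 \<le> s" for s k
    unfolding f g[OF that] rhsF_eq[where v="\<lambda>t k. p (x t k)", OF gp[OF that]] ..
  show ?thesis
    unfolding strong_sol_def
  proof (intro conjI allI impI)
    show "(\<lambda>k. p (x 0 k)) = (\<lambda>k. p (x0 k))" using p0 by blast
  next
    fix T :: real assume "0 < T"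
    then have T: "0 \<le> T" by simp
    show "CV T (\<lambda>t k. p (x t k))"
      unfolding CV_def
    proof (intro conjI ballI allI impI)
      show "inV (\<lambda>k. p (x t k))" if "t \<in> {0..T}" for t using gp V that by (simp add: inV_iff)
      fix t e :: real assume t: "t \<in> {0..T}" and e: "0 < e"
      have e': "0 < e / (2 * pi)\<^sup>2" using e by simp
      obtain d where d: "0 < d" "\<And>s. s \<in> {0..T} \<Longrightarrow> \<bar>s - t\<bar> < d \<Longrightarrow> wsum jn2 (\<lambda>k. x s k - x t k) < ennreal (e / (2 * pi)\<^sup>2)"
        using x_continuous_V[OF x[OF T] T t e'] by blast
      have "Vnorm2 (\<lambda>k. p (x s k) - p (x t k)) < e" if s: "s \<in> {0..T}" "\<bar>s - t\<bar> < d" for s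
      proof -
        let ?u = "\<lambda>k. p (x s k) - p (x t k)"
        have fin: "wsum jn2 ?u < \<infinity>" using V s t by (intro wsum_diff_finite jn2_nonneg) auto
        have "wsum jn2 ?u \<le> wsum jn2 (\<lambda>k. x s k - x t k)"
          using wsum_component_le[where w=jn2 and p=p and z="\<lambda>k. x s k - x t k", OF pn jn2_nonneg] by (simp add: p.diff)
        also have "\<dots> < ennreal (e / (2 * pi)\<^sup>2)" by (rule d(2)[OF s])
        finally have "(wnrm jn2 ?u)\<^sup>2 < e / (2 * pi)\<^sup>2" unfolding wsum_eq_wnrm[OF fin] by (simp add: ennreal_less_iff)
        then have "(2 * pi)\<^sup>2 * (wnrm jn2 ?u)\<^sup>2 < e" by (simp add: field_simps)
        then show ?thesis using Vnorm2_eq[OF solenoidal_diff[OF gp gp] fin] s t by simp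
      qed
      then show "\<exists>d>0. \<forall>s\<in>{0..T}. \<bar>s - t\<bar> < d \<longrightarrow> Vnorm2 (\<lambda>k. p (x s k) - p (x t k)) < e" using d(1) by blast
    qed
    have le4: "wsum (\<lambda>k. jn k ^ 4) (\<lambda>k. p (x t k)) \<le> wsum (\<lambda>k. jn k ^ 4) (x t)" for t
      by (rule wsum_component_le[OF pn]) (simp add: jn_nonneg)
    note [measurable] = x_measurable[OF x[OF T] T]
    have fin4: "AE t in lborel. wsum (\<lambda>k. jn k ^ 4) (x t) * indicator {0..T} t \<noteq> \<infinity>"
      using x_L2DA[OF x[OF T] T] by (intro nn_integral_PInf_AE) auto
    show "L2DA T (\<lambda>t k. p (x t k))"
      unfolding L2DA_def
    proof
      show "AE t in lborel. t \<in> {0..T} \<longrightarrow> inDA (\<lambda>k. p (x t k))"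
        using fin4
      proof eventually_elim
        case (elim t)
        then show ?case using le_less_trans[OF le4[of t]] by (auto intro!: inDA_I gp simp: less_top)
      qed
      have "(\<integral>\<^sup>+ t. indicator {0..T} t * (\<Sum>\<^sub>\<infinity>k. ennreal ((wnorm2 k)\<^sup>2 * cnorm2 (p (x t k)))) \<partial>lborel)
         \<le> (\<integral>\<^sup>+t\<in>{0..T}. wsum (\<lambda>k. jn k ^ 4) (x t) \<partial>lborel)"
      proof (intro nn_integral_mono)
        fix t
        show "indicator {0..T} t * (\<Sum>\<^sub>\<infinity>k. ennreal ((wnorm2 k)\<^sup>2 * cnorm2 (p (x t k)))) \<le> wsum (\<lambda>k. jn k ^ 4) (x t) * indicator {0..T} t"
          using le4[of t] nsum_eq_infsum[of "\<lambda>k. (wnorm2 k)\<^sup>2 * cnorm2 (p (x t k))"] wsum_jn4_eq[OF gp, of t]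
          by (cases "t \<in> {0..T}") (auto simp: cnorm2_nonneg)
      qed
      also have "\<dots> < \<infinity>" by (rule x_L2DA[OF x[OF T] T])
      finally show "(\<integral>\<^sup>+ t. indicator {0..T} t * (\<Sum>\<^sub>\<infinity>k. ennreal ((wnorm2 k)\<^sup>2 * cnorm2 (p (x t k)))) \<partial>lborel) < \<infinity>" .
    qed
  next
    fix t :: real and k assume t: "0 \<le> t"
    then have tt: "t \<in> {0..t}" by simp
    note I = component_integral_equation[OF x[OF t] t p tt, of k]
    show "set_integrable lborel {0..t} (\<lambda>s. rhsF \<nu> N \<theta> g (\<lambda>t k. p (x t k)) (\<lambda>t k. q (x t k)) s k)"
      by (rule set_integrable_cong[THEN iffD1, OF refl refl _ I(1)]) (simp add: rhs)
    have "(LINT s:{0..t}|lborel. p (force (\<lambda>_. 1) x s k) - (\<nu> * jn2 k) *\<^sub>R p (x s k)) =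
      (LINT s:{0..t}|lborel. rhsF \<nu> N \<theta> g (\<lambda>t k. p (x t k)) (\<lambda>t k. q (x t k)) s k)"
      by (intro set_lebesgue_integral_cong) (auto simp: rhs)
    then show "p (x t k) = p (x 0 k) + (LINT s:{0..t}|lborel. rhsF \<nu> N \<theta> g (\<lambda>t k. p (x t k)) (\<lambda>t k. q (x t k)) s k)"
      using I(2) p0 by simp
  qed
qed

text \<open>Brings an arbitrary competitor into mild form, so that \<open>solves_uniqueness\<close>
  applies to it. The path is set to 0 at negative times because \<open>solves\<close> demands
  measurability on the whole line and nothing is known of \<open>w1\<close> and \<open>w2\<close>
  there.\<close>

lemma strong_sol_solves:
  assumes w1: "strong_sol \<nu> N \<theta>1 g1 w1 w2 (\<lambda>k. fst (x0 k))" and w2: "strong_sol \<nu> N \<theta>2 g2 w2 w1 (\<lambda>k. snd (x0 k))"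
    and g: "\<And>s k. 0 \<le> s \<Longrightarrow> G s k = (g1 s k, g2 s k)" and T: "0 < T"
  shows "solves T (\<lambda>_. 1) (\<lambda>s k. if 0 \<le> s then (w1 s k, w2 s k) else 0)"
proof -
  let ?y = "\<lambda>s k. if 0 \<le> s then (w1 s k, w2 s k) else 0"
  have gw: "solenoidal (w1 s)" "solenoidal (w2 s)" if "0 \<le> s" for s
  proof -
    have "0 < s + 1" "s \<in> {0..s + 1}" using that by auto
    then show "solenoidal (w1 s)" "solenoidal (w2 s)" using w1 w2 unfolding strong_sol_def CV_def inV_iff by blast+
  qed
  have init: "w1 0 k = fst (x0 k)" "w2 0 k = snd (x0 k)" for k
    using w1 w2 unfolding strong_sol_def by simp_all
  have frc: "force (\<lambda>_. 1) ?y s k - (\<nu> * jn2 k) *\<^sub>R ?y s k = (rhsF \<nu> N \<theta>1 g1 w1 w2 s k, rhsF \<nu> N \<theta>2 g2 w2 w1 s k)" if s: "0 \<le> s" for s k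
    using s by (simp add: force_def mix_def PB_def g rhsF_eq gw prod_eq_iff)
  have I1: "set_integrable lborel {0..t} (\<lambda>s. rhsF \<nu> N \<theta>1 g1 w1 w2 s k)" "w1 t k = w1 0 k + (LINT s:{0..t}|lborel. rhsF \<nu> N \<theta>1 g1 w1 w2 s k)"
    and I2: "set_integrable lborel {0..t} (\<lambda>s. rhsF \<nu> N \<theta>2 g2 w2 w1 s k)" "w2 t k = w2 0 k + (LINT s:{0..t}|lborel. rhsF \<nu> N \<theta>2 g2 w2 w1 s k)"
    if "0 \<le> t" for t k
    using w1 w2 that unfolding strong_sol_def by blast+
  have int: "set_integrable lborel {0..t} (\<lambda>s. force (\<lambda>_. 1) ?y s k - (\<nu> * jn2 k) *\<^sub>R ?y s k)" if "0 \<le> t" for t k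
    by (rule set_integrable_cong[THEN iffD2, OF refl refl _ set_integral_Pair(1)[OF I1(1)[OF that] I2(1)[OF that]]]) (use frc in auto)
  have eq: "?y t k = x0 k + (LINT s:{0..t}|lborel. force (\<lambda>_. 1) ?y s k - (\<nu> * jn2 k) *\<^sub>R ?y s k)" if t: "0 \<le> t" for t k
  proof -
    have "(LINT s:{0..t}|lborel. force (\<lambda>_. 1) ?y s k - (\<nu> * jn2 k) *\<^sub>R ?y s k) =
       (LINT s:{0..t}|lborel. (rhsF \<nu> N \<theta>1 g1 w1 w2 s k, rhsF \<nu> N \<theta>2 g2 w2 w1 s k))"
      by (rule set_lebesgue_integral_cong) (use frc in auto)
    also have "\<dots> = (LINT s:{0..t}|lborel. rhsF \<nu> N \<theta>1 g1 w1 w2 s k, LINT s:{0..t}|lborel. rhsF \<nu> N \<theta>2 g2 w2 w1 s k)"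
      by (rule set_integral_Pair(2)[OF I1(1)[OF t] I2(1)[OF t]])
    finally show ?thesis using t I1(2)[OF t, of k] I2(2)[OF t, of k] init[of k] by (simp add: prod_eq_iff)
  qed
  \<comment> \<open>A competitor carries no measurability assumption. Its modes are continuous on
    each \<open>{0..real n}\<close> by the integral equation, and the path is the pointwise limit of
    its restrictions.\<close>
  have ym: "(\<lambda>s. ?y s k) \<in> borel_measurable borel" for k
  proof (rule borel_measurable_LIMSEQ_metric)
    show "(\<lambda>s. indicator {0..real n} s *\<^sub>R ?y s k) \<in> borel_measurable borel" for n
    proof (rule borel_measurable_continuous_on_indicator)
      show "continuous_on {0..real n} (\<lambda>s. ?y s k)"
        by (rule integral_equation_continuous[OF int eq]) auto
    qed simp
    show "(\<lambda>n. indicator {0..real n} s *\<^sub>R ?y s k) \<longlonglongrightarrow> ?y s k" for s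
    proof (rule tendsto_eventually)
      obtain m where "s \<le> real m" using real_arch_simple by blast
      then have "\<forall>n\<ge>m. indicator {0..real n} s *\<^sub>R ?y s k = ?y s k" by (auto simp: indicator_def)
      then show "\<forall>\<^sub>F n in sequentially. indicator {0..real n} s *\<^sub>R ?y s k = ?y s k" unfolding eventually_sequentially by blast
    qed
  qed
  show ?thesis
    unfolding solves_def
  proof (intro conjI allI ballI ym)
    have "CV T w1" "CV T w2" using w1 w2 T unfolding strong_sol_def by blast+
    then obtain K1 K2 where K: "\<And>t. t \<in> {0..T} \<Longrightarrow> wsum jn2 (w1 t) \<le> ennreal K1" "\<And>t. t \<in> {0..T} \<Longrightarrow> wsum jn2 (w2 t) \<le> ennreal K2"
      using CV_wnrm_bounded by metis
    have "wsum jn2 (?y t) \<le> ennreal (\<bar>K1\<bar> + \<bar>K2\<bar>)" if t: "t \<in> {0..T}" for t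
    proof -
      have "?y t = (\<lambda>k. (w1 t k, w2 t k))" using t by auto
      then have "wsum jn2 (?y t) = wsum jn2 (w1 t) + wsum jn2 (w2 t)" by (simp only: wsum_pair[where w=jn2, OF jn2_nonneg])
      also have "\<dots> \<le> ennreal \<bar>K1\<bar> + ennreal \<bar>K2\<bar>"
        by (intro add_mono order_trans[OF K(1)[OF t] ennreal_leI] order_trans[OF K(2)[OF t] ennreal_leI]) auto
      finally show ?thesis by simp
    qed
    then show "\<exists>K. \<forall>s\<in>{0..T}. wsum jn2 (?y s) \<le> ennreal K" by blast
    fix t k assume t: "t \<in> {0..T}"
    then have t0: "0 \<le> t" by simp
    show "?y t k = exp (- (\<nu> * jn2 k) * t) *\<^sub>R x0 k + (LINT s:{0..t}|lborel. exp (- (\<nu> * jn2 k) * (t - s)) *\<^sub>R force (\<lambda>_. 1) ?y s k)"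
      by (rule integral_equation_imp_duhamel[OF int[OF t0] t0 eq]) simp
  qed auto
qed

end

theorem theorem3p7:
  fixes \<nu> N \<theta>1 \<theta>2 :: real and g1 g2 :: "real \<Rightarrow> fld" and v01 v02 :: fld
  assumes "\<nu> > 0" and "0 \<le> \<theta>1" and "\<theta>1 \<le> 1" and "0 \<le> \<theta>2" and "\<theta>2 \<le> 1"
    and "\<theta>1 + \<theta>2 = 1" and "N > 0"
    and "Linf_H g1" and "Linf_H g2"
    and "inV v01" and "inV v02"
  shows "\<exists>v1 v2. sync_sol \<nu> N \<theta>1 \<theta>2 g1 g2 v01 v02 v1 v2 \<and>
           (\<forall>w1 w2. sync_sol \<nu> N \<theta>1 \<theta>2 g1 g2 v01 v02 w1 w2 \<longrightarrow>
              (\<forall>t\<ge>0. w1 t = v1 t \<and> w2 t = v2 t))"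
proof -
  \<comment> \<open>Extension by 0 to negative times, where \<open>Linf_H\<close> says nothing,
    makes the forcing Borel measurable on the whole line.\<close>
  define G :: "real \<Rightarrow> int \<times> int \<Rightarrow> cvec \<times> cvec" where "G s k = (if 0 \<le> s then (g1 s k, g2 s k) else 0)" for s k
  define x0 :: "int \<times> int \<Rightarrow> cvec \<times> cvec" where "x0 k = (v01 k, v02 k)" for k
  obtain M1 where M1: "0 \<le> M1" "AE s in lborel. 0 \<le> s \<longrightarrow> solenoidal (g1 s) \<and> wsum (\<lambda>_. 1) (g1 s) \<le> ennreal M1"
    using Linf_H_bound[OF \<open>Linf_H g1\<close>] by blast
  obtain M2 where M2: "0 \<le> M2" "AE s in lborel. 0 \<le> s \<longrightarrow> solenoidal (g2 s) \<and> wsum (\<lambda>_. 1) (g2 s) \<le> ennreal M2"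
    using Linf_H_bound[OF \<open>Linf_H g2\<close>] by blast
  interpret sync_system \<nu> N \<theta>1 \<theta>2 G "M1 + M2" x0
  proof
    have "G s k = (if 0 \<le> s then g1 s k else 0, if 0 \<le> s then g2 s k else 0)" for s k by (simp add: G_def zero_prod_def)
    then show "(\<lambda>s. G s k) \<in> borel_measurable borel" for k
      using Linf_H_measurable[OF \<open>Linf_H g1\<close>] Linf_H_measurable[OF \<open>Linf_H g2\<close>] by (simp only: borel_measurable_Pair)
    show "AE s in lborel. 0 \<le> s \<longrightarrow> wsum (\<lambda>_. 1) (G s) \<le> ennreal (M1 + M2)"
      using M1(2) M2(2)
    proof eventually_elim
      case (elim s)
      show ?case
      proof
        assume s: "0 \<le> s"
        then have "wsum (\<lambda>_. 1) (G s) = wsum (\<lambda>_. 1) (g1 s) + wsum (\<lambda>_. 1) (g2 s)"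
          unfolding G_def[abs_def] by (simp add: wsum_pair)
        also have "\<dots> \<le> ennreal M1 + ennreal M2" using elim s by (intro add_mono) auto
        finally show "wsum (\<lambda>_. 1) (G s) \<le> ennreal (M1 + M2)" using M1(1) M2(1) by simp
      qed
    qed
    show "AE s in lborel. 0 \<le> s \<longrightarrow> solenoidal (\<lambda>k. fst (G s k)) \<and> solenoidal (\<lambda>k. snd (G s k))"
      using M1(2) M2(2) by eventually_elim (simp add: G_def)
    show "wsum jn2 x0 < \<infinity>"
      using \<open>inV v01\<close> \<open>inV v02\<close> unfolding x0_def[abs_def] wsum_pair[where w=jn2, OF jn2_nonneg] inV_iff by simp
    show "solenoidal (\<lambda>k. fst (x0 k))" "solenoidal (\<lambda>k. snd (x0 k))"
      using \<open>inV v01\<close> \<open>inV v02\<close> by (simp_all add: x0_def inV_iff)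
  qed (use assms M1(1) M2(1) in auto)
  obtain x where x: "\<And>T. 0 \<le> T \<Longrightarrow> solves T (\<lambda>_. 1) x" "\<And>T. 0 \<le> T \<Longrightarrow> solenoidal_pair T x"
    using global_solution by blast
  let ?v1 = "\<lambda>t k. fst (x t k)" and ?v2 = "\<lambda>t k. snd (x t k)"
  have gx: "solenoidal (?v1 t)" "solenoidal (?v2 t)" if "0 \<le> t" for t using x(2)[OF that] that unfolding solenoidal_pair_def by auto
  have x0e: "(\<lambda>k. fst (x0 k)) = v01" "(\<lambda>k. snd (x0 k)) = v02" by (auto simp: x0_def)
  have "strong_sol \<nu> N \<theta>1 g1 ?v1 ?v2 (\<lambda>k. fst (x0 k))"
    by (rule strong_sol_component[OF x(1) bounded_linear_fst norm_fst_snd_le(1) gx(1)]) (auto simp: fst_force[OF x(1), of 0] G_def)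
  moreover have "strong_sol \<nu> N \<theta>2 g2 ?v2 ?v1 (\<lambda>k. snd (x0 k))"
    by (rule strong_sol_component[OF x(1) bounded_linear_snd norm_fst_snd_le(2) gx(2)]) (auto simp: snd_force[OF x(1), of 0] G_def)
  ultimately have sol: "sync_sol \<nu> N \<theta>1 \<theta>2 g1 g2 v01 v02 ?v1 ?v2" unfolding sync_sol_def x0e by blast
  have "w1 t = ?v1 t \<and> w2 t = ?v2 t" if w: "sync_sol \<nu> N \<theta>1 \<theta>2 g1 g2 v01 v02 w1 w2" and t: "0 \<le> t" for w1 w2 t
  proof -
    \<comment> \<open>\<open>strong_sol_solves\<close> requires an interval of positive length, and
      \<open>t\<close> may be 0.\<close>
    have T: "0 < t + 1" "0 \<le> t + 1" "t \<in> {0..t + 1}" using t by auto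
    let ?y = "\<lambda>s k. if 0 \<le> s then (w1 s k, w2 s k) else 0"
    have "solves (t + 1) (\<lambda>_. 1) ?y"
      using w unfolding sync_sol_def by (intro strong_sol_solves T) (auto simp: x0e G_def)
    from solves_uniqueness[OF T(2) this x(1)[OF T(2)] T(3)] have "x t = (\<lambda>k. (w1 t k, w2 t k))" using t by auto
    then show ?thesis by auto
  qed
  with sol show ?thesis by blast
qed

end
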